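(* Let $\mathbb{K}$ be a field, $R$ a $\mathbb{K}$-algebra, $\Lambda$ a non-empty finite set, $Q$ a finite quiver over $\Lambda$, and let $\mathbf{w}^{a,b}_{c,d}\in R$ for all $(a,b),(c,d)\in Q^{(2)}$. Suppose that for all $(a,b),(c,d)\in Q^{(2)}$: (i) $\mathbf{w}^{a,b}_{c,d}\in Z(R)$, where $Z(R)$ is the center of $R$; (ii) if $\mathfrak{s}(a)\neq\mathfrak{s}(c)$ or $\mathfrak{t}(b)\neq\mathfrak{t}(d)$, then $\mathbf{w}^{a,b}_{c,d}=0$. Then $\mathfrak{A}(w)$ is a left bialgebroid; namely, the sextuplet $(\mathfrak{A}(w),M_\Lambda(R),s_{M_\Lambda(R)},t_{M_\Lambda(R)},\Delta_{M_\Lambda(R)},\pi_{M_\Lambda(R)})$ is a left bialgebroid.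
   Context: Algebras are associative and unital, and algebra homomorphisms are unital unless only $\mathbb{K}$-linearity is mentioned. LEFT BIALGEBROIDS. A left bialgebroid is a sextuplet $(A,L,s_L,t_L,\Delta_L,\pi_L)$ where $A,L$ are $\mathbb{K}$-algebras, and: (1) $s_L\colon L\to A$ and $t_L\colon L^{op}\to A$ are $\mathbb{K}$-algebra homomorphisms with $s_L(l)t_L(l')=t_L(l')s_L(l)$ for all $l,l'\in L$; $A$ is made an $(L,L)$-bimodule by $l\cdot a=s_L(l)a$, $a\cdot l=t_L(l)a$ (so in $A\otimes_L A$ one has $t_L(l)a\otimes b=a\otimes s_L(l)b$, and $A\otimes_LA$ is a bimodule by $l\cdot(a\otimes b)\cdot l'=s_L(l)a\otimes t_L(l')b$). (2) $(A,\Delta_L\colon A\to A\otimes_LA,\pi_L\colon A\to L)$ is a comonoid in the monoidal category of $(L,L)$-bimodules (i.e. $\Delta_L,\pi_L$ are bimodule maps, $\Delta_L$ is coassociative, $\pi_L$ is a counit), such that, writing $\Delta_L(a)=a_{[1]}\otimes a_{[2]}$, for all $l\in L$, $a,b\in A$: $a_{[1]}t_L(l)\otimes a_{[2]}=a_{[1]}\otimes a_{[2]}s_L(l)$; $\Delta_L(1_A)=1_A\otimes1_A$; $\Delta_L(ab)=\Delta_L(a)\Delta_L(b)$ (componentwise product, well defined by the first condition); $\pi_L(1_A)=1_L$; $\pi_L(as_L(\pi_L(b)))=\pi_L(ab)=\pi_L(at_L(\pi_L(b)))$. NOTATION. $M_\Lambda(R)$ is the $\mathbb{K}$-algebra of all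 maps $\Lambda\to R$ with pointwise operations. For $r\in R$, $r_M\in M_\Lambda(R)$ is the constant map with value $r$; for $\lambda\in\Lambda$, $\delta_\lambda\in M_\Lambda(R)$ is $\delta_\lambda(\mu)=\delta_{\lambda,\mu}$ (Kronecker delta). QUIVERS. A quiver over $\Lambda$ is a set $Q$ with maps $\mathfrak{s},\mathfrak{t}\colon Q\to\Lambda$. Put $Q^{(0)}=\Lambda$ (with $\mathfrak{s}=\mathfrak{t}=\mathrm{id}$), $Q^{(1)}=Q$, and for $m>1$, $Q^{(m)}=\{(q_1,\dots,q_m)\in Q^m\mid \mathfrak{t}(q_i)=\mathfrak{s}(q_{i+1}),\ 1\le i\le m-1\}$ with $\mathfrak{s}(q)=\mathfrak{s}(q_1)$, $\mathfrak{t}(q)=\mathfrak{t}(q_m)$. For $p\in Q^{(m)},p'\in Q^{(n)}$ with $\mathfrak{t}(p)=\mathfrak{s}(p')$, $pp'\in Q^{(m+n)}$ is the concatenation (elements of $Q^{(0)}$ act as trivial paths). THE ALGEBRA $\mathfrak{A}(w)$. $\mathfrak{G}(Q)$ is the $\mathbb{K}$-vector space with basis the symbols $\mathbf{e}^{p}_{q}$, $p,q\in Q^{(m)}$, $m\in\mathbb{Z}_{\ge0}$, with product $\mathbf{e}^{p}_{q}\mathbf{e}^{p'}_{q'}=\delta_{\mathfrak{t}(p),\mathfrak{s}(p')}\delta_{\mathfrak{t}(q),\mathfrak{s}(q')}\mathbf{e}^{pp'}_{qq'}$ and unit $\sum_{\lambda,\mu\in\Lambda}\mathbf{e}^{\lambda}_{\mu}$.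 Let $\mathfrak{H}(Q)=R\otimes_{\mathbb{K}}R^{op}\otimes_{\mathbb{K}}\mathfrak{G}(Q)$. $\mathfrak{I}_{\mathbf{w}}$ is the two-sided ideal of $\mathfrak{H}(Q)$ generated by the elements $$\sum_{(x,y)\in Q^{(2)}}\mathbf{w}^{x,y}_{a,b}\otimes1_R\otimes\mathbf{e}^{x}_{c}\mathbf{e}^{y}_{d}-\sum_{(x,y)\in Q^{(2)}}1_R\otimes\mathbf{w}^{c,d}_{x,y}\otimes\mathbf{e}^{a}_{x}\mathbf{e}^{b}_{y}\qquad((a,b),(c,d)\in Q^{(2)}),$$ and $\mathfrak{A}(w)=\mathfrak{H}(Q)/\mathfrak{I}_{\mathbf{w}}$. STRUCTURE MAPS. $s_{M_\Lambda(R)}(f)=\sum_{\lambda,\mu\in\Lambda}f(\lambda)\otimes1_R\otimes\mathbf{e}^{\lambda}_{\mu}+\mathfrak{I}_{\mathbf{w}}$; $t_{M_\Lambda(R)}(f)=\sum_{\lambda,\mu\in\Lambda}1_R\otimes f(\lambda)\otimes\mathbf{e}^{\mu}_{\lambda}+\mathfrak{I}_{\mathbf{w}}$. $\Delta_{M_\Lambda(R)}\colon\mathfrak{A}(w)\to\mathfrak{A}(w)\otimes_{M_\Lambda(R)}\mathfrak{A}(w)$ is the $\mathbb{K}$-linear map induced by $$r\otimes r'\otimes\mathbf{e}^{p}_{q}\mapsto\sum_{u\in Q^{(m)}}(r\otimes1_R\otimes\mathbf{e}^{p}_{u}+\mathfrak{I}_{\mathbf{w}})\otimes(1_R\otimes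 r'\otimes\mathbf{e}^{u}_{q}+\mathfrak{I}_{\mathbf{w}})\quad(p,q\in Q^{(m)}).$$ $\pi_{M_\Lambda(R)}\colon\mathfrak{A}(w)\to M_\Lambda(R)$ is $\pi_{M_\Lambda(R)}(a)=\zeta(a)(1_{M_\Lambda(R)})$, where $\zeta\colon\mathfrak{A}(w)\to\mathrm{End}_{\mathbb{K}}(M_\Lambda(R))$ is the algebra homomorphism induced by $(r\otimes r'\otimes\mathbf{e}^{p}_{q})\mapsto\big(f\mapsto\delta_{p,q}(rf(\mathfrak{t}(q))r')_M\,\delta_{\mathfrak{s}(q)}\big)$. That these maps are well defined is part of the assertion. *)

theory Defs
  imports "HOL-Algebra.Algebra" "Graph_Theory.Digraph"
begin

section \<open>Algebras over a field\<close>

text \<open>Unlike the locale \<^locale>\<open>algebra\<close> of HOL-Algebra, the algebras here need not be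
  commutative. The zero algebra is allowed.\<close>

locale k_algebra = K?: field K + module K A + A?: ring A
  for K (structure) and A (structure) +
  assumes smult_mult_left:
      "\<lbrakk>k \<in> carrier K; x \<in> carrier A; y \<in> carrier A\<rbrakk>
        \<Longrightarrow> (k \<odot>\<^bsub>A\<^esub> x) \<otimes>\<^bsub>A\<^esub> y = k \<odot>\<^bsub>A\<^esub> (x \<otimes>\<^bsub>A\<^esub> y)"
    and smult_mult_right:
      "\<lbrakk>k \<in> carrier K; x \<in> carrier A; y \<in> carrier A\<rbrakk>
        \<Longrightarrow> x \<otimes>\<^bsub>A\<^esub> (k \<odot>\<^bsub>A\<^esub> y) = k \<odot>\<^bsub>A\<^esub> (x \<otimes>\<^bsub>A\<^esub> y)"

definition linear_hom ::
    "('k, 'm) ring_scheme \<Rightarrow> ('k, 'a, 'n) module_scheme \<Rightarrow> ('k, 'b, 'p) module_scheme \<Rightarrow> ('a \<Rightarrow> 'b) set"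
  where "linear_hom K M N =
    {f \<in> Pi (carrier M) (\<lambda>_. carrier N).
      (\<forall>x\<in>carrier M. \<forall>y\<in>carrier M. f (x \<oplus>\<^bsub>M\<^esub> y) = f x \<oplus>\<^bsub>N\<^esub> f y) \<and>
      (\<forall>k\<in>carrier K. \<forall>x\<in>carrier M. f (k \<odot>\<^bsub>M\<^esub> x) = k \<odot>\<^bsub>N\<^esub> f x)}"

definition algebra_hom ::
    "('k, 'm) ring_scheme \<Rightarrow> ('k, 'a, 'n) module_scheme \<Rightarrow> ('k, 'b, 'p) module_scheme \<Rightarrow> ('a \<Rightarrow> 'b) set"
  where "algebra_hom K A B = ring_hom A B \<inter> linear_hom K A B"

definition op_algebra :: "('k, 'a, 'n) module_scheme \<Rightarrow> ('k, 'a, 'n) module_scheme"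
  where "op_algebra A = A\<lparr>monoid.mult := (\<lambda>x y. y \<otimes>\<^bsub>A\<^esub> x)\<rparr>"

definition algebra_center :: "('a, 'n) ring_scheme \<Rightarrow> 'a set"
  where "algebra_center A = {z \<in> carrier A. \<forall>x\<in>carrier A. z \<otimes>\<^bsub>A\<^esub> x = x \<otimes>\<^bsub>A\<^esub> z}"

text \<open>The quotient ring \<^term>\<open>A Quot I\<close>, with scalar multiplication on cosets
  defined in the same manner as \<^const>\<open>rcoset_mult\<close>.\<close>

definition quotient_algebra :: "('k, 'a, 'n) module_scheme \<Rightarrow> 'a set \<Rightarrow> ('k, 'a set) module"
  where "quotient_algebra A I =
    ring.extend (A Quot I) (module.fields (\<lambda>k C. \<Union>x\<in>C. I +>\<^bsub>A\<^esub> (k \<odot>\<^bsub>A\<^esub> x)))"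

definition fun_algebra :: "'l set \<Rightarrow> ('k, 'a, 'n) module_scheme \<Rightarrow> ('k, 'l \<Rightarrow> 'a) module"
  where "fun_algebra S R =
    \<lparr>carrier = S \<rightarrow>\<^sub>E carrier R,
     monoid.mult = (\<lambda>f g. \<lambda>x\<in>S. f x \<otimes>\<^bsub>R\<^esub> g x),
     monoid.one = (\<lambda>x\<in>S. \<one>\<^bsub>R\<^esub>),
     ring.zero = (\<lambda>x\<in>S. \<zero>\<^bsub>R\<^esub>),
     ring.add = (\<lambda>f g. \<lambda>x\<in>S. f x \<oplus>\<^bsub>R\<^esub> g x),
     module.smult = (\<lambda>k f. \<lambda>x\<in>S. k \<odot>\<^bsub>R\<^esub> f x)\<rparr>"

definition end_algebra ::
    "('k, 'm) ring_scheme \<Rightarrow> ('k, 'v, 'n) module_scheme \<Rightarrow> ('k, 'v \<Rightarrow> 'v) module"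
  where "end_algebra K V =
    \<lparr>carrier = linear_hom K V V \<inter> extensional (carrier V),
     monoid.mult = compose (carrier V),
     monoid.one = (\<lambda>x\<in>carrier V. x),
     ring.zero = (\<lambda>x\<in>carrier V. \<zero>\<^bsub>V\<^esub>),
     ring.add = (\<lambda>\<phi> \<psi>. \<lambda>x\<in>carrier V. \<phi> x \<oplus>\<^bsub>V\<^esub> \<psi> x),
     module.smult = (\<lambda>k \<phi>. \<lambda>x\<in>carrier V. k \<odot>\<^bsub>V\<^esub> \<phi> x)\<rparr>"

text \<open>The free module on \<open>B\<close>: finitely supported functions, vanishing outside \<open>B\<close>.
  As usual for records that extend \<^typ>\<open>'a ring\<close>, a bare module has no meaningful
  \<^const>\<open>monoid.mult\<close> and \<^const>\<open>monoid.one\<close>.\<close>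

definition supp :: "('k, 'm) ring_scheme \<Rightarrow> ('b \<Rightarrow> 'k) \<Rightarrow> 'b set"
  where "supp K f = {b. f b \<noteq> \<zero>\<^bsub>K\<^esub>}"

definition free_module :: "('k, 'm) ring_scheme \<Rightarrow> 'b set \<Rightarrow> ('k, 'b \<Rightarrow> 'k) module"
  where "free_module K B =
    \<lparr>carrier = {f. (\<forall>b. f b \<in> carrier K) \<and> finite (supp K f) \<and> supp K f \<subseteq> B},
     monoid.mult = undefined,
     monoid.one = undefined,
     ring.zero = (\<lambda>b. \<zero>\<^bsub>K\<^esub>),
     ring.add = (\<lambda>f g b. f b \<oplus>\<^bsub>K\<^esub> g b),
     module.smult = (\<lambda>k f b. k \<otimes>\<^bsub>K\<^esub> f b)\<rparr>"

definition basis_vec :: "('k, 'm) ring_scheme \<Rightarrow> 'b \<Rightarrow> 'b \<Rightarrow> 'k"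
  where "basis_vec K b = (\<lambda>x. if x = b then \<one>\<^bsub>K\<^esub> else \<zero>\<^bsub>K\<^esub>)"


section \<open>Bimodules and their tensor product\<close>

record ('k, 'l, 'a) bimodule = "('k, 'a) module" +
  lact :: "'l \<Rightarrow> 'a \<Rightarrow> 'a"
  ract :: "'a \<Rightarrow> 'l \<Rightarrow> 'a"

locale bimodule = L?: k_algebra K L + M?: module K M
  for K :: "('k, 'm) ring_scheme" (structure) and L :: "('k, 'l) module" (structure)
    and M :: "('k, 'l, 'a) bimodule" (structure) +
  assumes lact_closed: "\<lbrakk>l \<in> carrier L; x \<in> carrier M\<rbrakk> \<Longrightarrow> lact M l x \<in> carrier M"
    and lact_add_left: "\<lbrakk>l \<in> carrier L; l' \<in> carrier L; x \<in> carrier M\<rbrakk>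
      \<Longrightarrow> lact M (l \<oplus>\<^bsub>L\<^esub> l') x = lact M l x \<oplus>\<^bsub>M\<^esub> lact M l' x"
    and lact_add_right: "\<lbrakk>l \<in> carrier L; x \<in> carrier M; y \<in> carrier M\<rbrakk>
      \<Longrightarrow> lact M l (x \<oplus>\<^bsub>M\<^esub> y) = lact M l x \<oplus>\<^bsub>M\<^esub> lact M l y"
    and lact_lact: "\<lbrakk>l \<in> carrier L; l' \<in> carrier L; x \<in> carrier M\<rbrakk>
      \<Longrightarrow> lact M (l \<otimes>\<^bsub>L\<^esub> l') x = lact M l (lact M l' x)"
    and lact_scalar: "\<lbrakk>k \<in> carrier K; x \<in> carrier M\<rbrakk>
      \<Longrightarrow> lact M (k \<odot>\<^bsub>L\<^esub> \<one>\<^bsub>L\<^esub>) x = k \<odot>\<^bsub>M\<^esub> x"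
    and ract_closed: "\<lbrakk>x \<in> carrier M; l \<in> carrier L\<rbrakk> \<Longrightarrow> ract M x l \<in> carrier M"
    and ract_add_right: "\<lbrakk>x \<in> carrier M; l \<in> carrier L; l' \<in> carrier L\<rbrakk>
      \<Longrightarrow> ract M x (l \<oplus>\<^bsub>L\<^esub> l') = ract M x l \<oplus>\<^bsub>M\<^esub> ract M x l'"
    and ract_add_left: "\<lbrakk>x \<in> carrier M; y \<in> carrier M; l \<in> carrier L\<rbrakk>
      \<Longrightarrow> ract M (x \<oplus>\<^bsub>M\<^esub> y) l = ract M x l \<oplus>\<^bsub>M\<^esub> ract M y l"
    and ract_ract: "\<lbrakk>x \<in> carrier M; l \<in> carrier L; l' \<in> carrier L\<rbrakk>
      \<Longrightarrow> ract M x (l \<otimes>\<^bsub>L\<^esub> l') = ract M (ract M x l) l'"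
    and ract_scalar: "\<lbrakk>k \<in> carrier K; x \<in> carrier M\<rbrakk>
      \<Longrightarrow> ract M x (k \<odot>\<^bsub>L\<^esub> \<one>\<^bsub>L\<^esub>) = k \<odot>\<^bsub>M\<^esub> x"
    and lact_ract: "\<lbrakk>l \<in> carrier L; x \<in> carrier M; l' \<in> carrier L\<rbrakk>
      \<Longrightarrow> ract M (lact M l x) l' = lact M l (ract M x l')"

definition bimodule_hom ::
    "('k, 'm) ring_scheme \<Rightarrow> ('l, 'p) ring_scheme \<Rightarrow> ('k, 'l, 'a, 'n) bimodule_scheme
      \<Rightarrow> ('k, 'l, 'b, 'q) bimodule_scheme \<Rightarrow> ('a \<Rightarrow> 'b) set"
  where "bimodule_hom K L M N =
    {f \<in> linear_hom K M N.
      (\<forall>l\<in>carrier L. \<forall>x\<in>carrier M. f (lact M l x) = lact N l (f x)) \<and>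
      (\<forall>l\<in>carrier L. \<forall>x\<in>carrier M. f (ract M x l) = ract N (f x) l)}"

definition regular_bimodule :: "('k, 'a) module \<Rightarrow> ('k, 'a, 'a) bimodule"
  where "regular_bimodule L = module.extend L (bimodule.fields (monoid.mult L) (monoid.mult L))"

text \<open>\<open>M \<otimes>\<^sub>L N\<close> is the free abelian group on pairs modulo the subgroup generated by the
  biadditivity and middle-linearity relations; its elements are cosets of formal
  \<open>\<int>\<close>-linear combinations of pairs.\<close>

definition tensor_rels ::
    "('l, 'p) ring_scheme \<Rightarrow> ('k, 'l, 'a, 'n) bimodule_scheme \<Rightarrow> ('k, 'l, 'b, 'q) bimodule_scheme
      \<Rightarrow> ('a \<times> 'b \<Rightarrow>\<^sub>0 int) set"
  where "tensor_rels L M N =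
    {frag_of (x \<oplus>\<^bsub>M\<^esub> x', y) - frag_of (x, y) - frag_of (x', y) | x x' y.
       x \<in> carrier M \<and> x' \<in> carrier M \<and> y \<in> carrier N} \<union>
    {frag_of (x, y \<oplus>\<^bsub>N\<^esub> y') - frag_of (x, y) - frag_of (x, y') | x y y'.
       x \<in> carrier M \<and> y \<in> carrier N \<and> y' \<in> carrier N} \<union>
    {frag_of (ract M x l, y) - frag_of (x, lact N l y) | x l y.
       x \<in> carrier M \<and> l \<in> carrier L \<and> y \<in> carrier N}"

definition tensor_null ::
    "('l, 'p) ring_scheme \<Rightarrow> ('k, 'l, 'a, 'n) bimodule_scheme \<Rightarrow> ('k, 'l, 'b, 'q) bimodule_scheme
      \<Rightarrow> ('a \<times> 'b \<Rightarrow>\<^sub>0 int) set"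
  where "tensor_null L M N =
    generate (free_Abelian_group (carrier M \<times> carrier N)) (tensor_rels L M N)"

definition tens ::
    "('l, 'p) ring_scheme \<Rightarrow> ('k, 'l, 'a, 'n) bimodule_scheme \<Rightarrow> ('k, 'l, 'b, 'q) bimodule_scheme
      \<Rightarrow> 'a \<Rightarrow> 'b \<Rightarrow> ('a \<times> 'b \<Rightarrow>\<^sub>0 int) set"
  where "tens L M N x y =
    tensor_null L M N #>\<^bsub>free_Abelian_group (carrier M \<times> carrier N)\<^esub> frag_of (x, y)"

definition tensor_ab ::
    "('l, 'p) ring_scheme \<Rightarrow> ('k, 'l, 'a, 'n) bimodule_scheme \<Rightarrow> ('k, 'l, 'b, 'q) bimodule_scheme
      \<Rightarrow> ('a \<times> 'b \<Rightarrow>\<^sub>0 int) set ring"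
  where "tensor_ab L M N =
    (let T = free_Abelian_group (carrier M \<times> carrier N) Mod tensor_null L M N in
     \<lparr>carrier = carrier T, monoid.mult = undefined, monoid.one = undefined,
      ring.zero = \<one>\<^bsub>T\<^esub>, ring.add = monoid.mult T\<rparr>)"

text \<open>The additive map out of a tensor product, into the abelian group \<open>Z\<close>, with
  \<open>x \<otimes> y \<mapsto> f x y\<close>. It evaluates a representing formal combination of pairs;
  \<^const>\<open>the_elem\<close> yields the value common to all representatives, which exists
  whenever \<open>f\<close> is biadditive and middle-linear.\<close>

definition tensor_lift ::
    "('c, 'm) ring_scheme \<Rightarrow> ('a \<Rightarrow> 'b \<Rightarrow> 'c) \<Rightarrow> ('a \<times> 'b \<Rightarrow>\<^sub>0 int) set \<Rightarrow> 'c"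
  where "tensor_lift Z f u =
    the_elem ((\<lambda>c. \<Oplus>\<^bsub>Z\<^esub>p\<in>Poly_Mapping.keys c.
                 add_pow Z (Poly_Mapping.lookup c p) (f (fst p) (snd p))) ` u)"

definition bimodule_tensor ::
    "('l, 'p) ring_scheme \<Rightarrow> ('k, 'l, 'a, 'n) bimodule_scheme \<Rightarrow> ('k, 'l, 'b, 'q) bimodule_scheme
      \<Rightarrow> ('k, 'l, ('a \<times> 'b \<Rightarrow>\<^sub>0 int) set) bimodule"
  where "bimodule_tensor L M N =
    (let T = tensor_ab L M N;
         V = ring.extend T
               (module.fields (\<lambda>k. tensor_lift T (\<lambda>x y. tens L M N (k \<odot>\<^bsub>M\<^esub> x) y)))
     in module.extend V (bimodule.fields
          (\<lambda>l. tensor_lift T (\<lambda>x y. tens L M N (lact M l x) y))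
          (\<lambda>u l. tensor_lift T (\<lambda>x y. tens L M N x (ract N y l)) u)))"

text \<open>\<open>f \<otimes> g : _ \<rightarrow> M \<otimes>\<^sub>L N\<close>, the associator
  \<open>(M \<otimes> N) \<otimes> P \<rightarrow> M \<otimes> (N \<otimes> P)\<close> and the unitors \<open>L \<otimes> M \<rightarrow> M\<close>, \<open>M \<otimes> L \<rightarrow> M\<close>.\<close>

definition tensor_map ::
    "('l, 'p) ring_scheme \<Rightarrow> ('k, 'l, 'a, 'n) bimodule_scheme \<Rightarrow> ('k, 'l, 'b, 'q) bimodule_scheme
      \<Rightarrow> ('c \<Rightarrow> 'a) \<Rightarrow> ('d \<Rightarrow> 'b) \<Rightarrow> ('c \<times> 'd \<Rightarrow>\<^sub>0 int) set \<Rightarrow> ('a \<times> 'b \<Rightarrow>\<^sub>0 int) set"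
  where "tensor_map L M N f g =
    tensor_lift (bimodule_tensor L M N) (\<lambda>x y. tens L M N (f x) (g y))"

definition associator ::
    "('l, 'p) ring_scheme \<Rightarrow> ('k, 'l, 'a, 'n) bimodule_scheme \<Rightarrow> ('k, 'l, 'b, 'q) bimodule_scheme
      \<Rightarrow> ('k, 'l, 'c, 'r) bimodule_scheme
      \<Rightarrow> (('a \<times> 'b \<Rightarrow>\<^sub>0 int) set \<times> 'c \<Rightarrow>\<^sub>0 int) set \<Rightarrow> ('a \<times> ('b \<times> 'c \<Rightarrow>\<^sub>0 int) set \<Rightarrow>\<^sub>0 int) set"
  where "associator L M N P =
    (let NP = bimodule_tensor L N P; T = bimodule_tensor L M NP in
     tensor_lift T (\<lambda>u z. tensor_lift T (\<lambda>x y. tens L M NP x (tens L N P y z)) u))"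

definition left_unitor ::
    "('k, 'l, 'a, 'n) bimodule_scheme \<Rightarrow> ('l \<times> 'a \<Rightarrow>\<^sub>0 int) set \<Rightarrow> 'a"
  where "left_unitor M = tensor_lift M (lact M)"

definition right_unitor ::
    "('k, 'l, 'a, 'n) bimodule_scheme \<Rightarrow> ('a \<times> 'l \<Rightarrow>\<^sub>0 int) set \<Rightarrow> 'a"
  where "right_unitor M = tensor_lift M (ract M)"

locale bimodule_comonoid = bimodule K L M
  for K :: "('k, 'm) ring_scheme" (structure) and L :: "('k, 'l) module" (structure)
    and M :: "('k, 'l, 'a) bimodule" (structure) +
  fixes \<Delta> :: "'a \<Rightarrow> ('a \<times> 'a \<Rightarrow>\<^sub>0 int) set" and \<epsilon> :: "'a \<Rightarrow> 'l"
  assumes comult_hom: "\<Delta> \<in> bimodule_hom K L M (bimodule_tensor L M M)"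
    and counit_hom: "\<epsilon> \<in> bimodule_hom K L M (regular_bimodule L)"
    and coassociative: "a \<in> carrier M \<Longrightarrow>
      associator L M M M (tensor_map L (bimodule_tensor L M M) M \<Delta> id (\<Delta> a))
        = tensor_map L M (bimodule_tensor L M M) id \<Delta> (\<Delta> a)"
    and counit_left: "a \<in> carrier M \<Longrightarrow>
      left_unitor M (tensor_map L (regular_bimodule L) M \<epsilon> id (\<Delta> a)) = a"
    and counit_right: "a \<in> carrier M \<Longrightarrow>
      right_unitor M (tensor_map L M (regular_bimodule L) id \<epsilon> (\<Delta> a)) = a"


section \<open>Tensor product of algebras over the ground field\<close>

definition scalar_bimodule :: "('k, 'a) module \<Rightarrow> ('k, 'k, 'a) bimodule"
  where "scalar_bimodule M =
    module.extend M (bimodule.fields (module.smult M) (\<lambda>x k. k \<odot>\<^bsub>M\<^esub> x))"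

definition ktens ::
    "('k, 'm) ring_scheme \<Rightarrow> ('k, 'a) module \<Rightarrow> ('k, 'b) module \<Rightarrow> 'a \<Rightarrow> 'b
      \<Rightarrow> ('a \<times> 'b \<Rightarrow>\<^sub>0 int) set"
  where "ktens K A B = tens K (scalar_bimodule A) (scalar_bimodule B)"

definition algebra_tensor ::
    "('k, 'm) ring_scheme \<Rightarrow> ('k, 'a) module \<Rightarrow> ('k, 'b) module
      \<Rightarrow> ('k, ('a \<times> 'b \<Rightarrow>\<^sub>0 int) set) module"
  where "algebra_tensor K A B =
    (let T = module.truncate (bimodule_tensor K (scalar_bimodule A) (scalar_bimodule B)) in
     T\<lparr>monoid.mult := (\<lambda>u v. tensor_lift T (\<lambda>a b. tensor_lift T (\<lambda>a' b'.
           ktens K A B (a \<otimes>\<^bsub>A\<^esub> a') (b \<otimes>\<^bsub>B\<^esub> b')) v) u),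
       monoid.one := ktens K A B \<one>\<^bsub>A\<^esub> \<one>\<^bsub>B\<^esub>\<rparr>)"


section \<open>Left bialgebroids\<close>

definition bialgebroid_bimodule ::
    "('k, 'a) module \<Rightarrow> ('l \<Rightarrow> 'a) \<Rightarrow> ('l \<Rightarrow> 'a) \<Rightarrow> ('k, 'l, 'a) bimodule"
  where "bialgebroid_bimodule A s t =
    module.extend A (bimodule.fields (\<lambda>l a. s l \<otimes>\<^bsub>A\<^esub> a) (\<lambda>a l. t l \<otimes>\<^bsub>A\<^esub> a))"

text \<open>The componentwise product \<open>u v\<close>, sending \<open>\<Sum>\<^sub>i a\<^sub>i \<otimes> b\<^sub>i\<close> and \<open>\<Sum>\<^sub>j x\<^sub>j \<otimes> y\<^sub>j\<close> to
  \<open>\<Sum>\<^sub>i\<^sub>j a\<^sub>i x\<^sub>j \<otimes> b\<^sub>i y\<^sub>j\<close>. Right multiplication by a fixed \<open>x \<otimes> y\<close> is always well defined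
  on \<open>A \<otimes>\<^sub>L A\<close>, and the outer lift is well defined for those \<open>u\<close> with
  \<open>u (t l \<otimes> 1) = u (1 \<otimes> s l)\<close> for all \<open>l\<close>.\<close>

definition componentwise_mult ::
    "('k, 'l) module \<Rightarrow> ('k, 'a) module \<Rightarrow> ('l \<Rightarrow> 'a) \<Rightarrow> ('l \<Rightarrow> 'a)
      \<Rightarrow> ('a \<times> 'a \<Rightarrow>\<^sub>0 int) set \<Rightarrow> ('a \<times> 'a \<Rightarrow>\<^sub>0 int) set \<Rightarrow> ('a \<times> 'a \<Rightarrow>\<^sub>0 int) set"
  where "componentwise_mult L A s t u v =
    (let M = bialgebroid_bimodule A s t in
     tensor_lift (bimodule_tensor L M M)
       (\<lambda>x y. tensor_map L M M (\<lambda>a. a \<otimes>\<^bsub>A\<^esub> x) (\<lambda>b. b \<otimes>\<^bsub>A\<^esub> y) u) v)"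

locale left_bialgebroid =
  fixes K :: "('k, 'm) ring_scheme"
    and A :: "('k, 'a) module"
    and L :: "('k, 'l) module"
    and s :: "'l \<Rightarrow> 'a"
    and t :: "'l \<Rightarrow> 'a"
    and \<Delta> :: "'a \<Rightarrow> ('a \<times> 'a \<Rightarrow>\<^sub>0 int) set"
    and \<pi> :: "'a \<Rightarrow> 'l"
  assumes algebra_A: "k_algebra K A"
    and algebra_L: "k_algebra K L"
    and source_hom: "s \<in> algebra_hom K L A"
    and target_hom: "t \<in> algebra_hom K (op_algebra L) A"
    and source_target_commute:
      "\<lbrakk>l \<in> carrier L; l' \<in> carrier L\<rbrakk> \<Longrightarrow> s l \<otimes>\<^bsub>A\<^esub> t l' = t l' \<otimes>\<^bsub>A\<^esub> s l"
    and comonoid: "bimodule_comonoid K L (bialgebroid_bimodule A s t) \<Delta> \<pi>"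
    and comult_takeuchi:
      "\<lbrakk>l \<in> carrier L; a \<in> carrier A\<rbrakk> \<Longrightarrow>
        tensor_map L (bialgebroid_bimodule A s t) (bialgebroid_bimodule A s t)
            (\<lambda>x. x \<otimes>\<^bsub>A\<^esub> t l) id (\<Delta> a)
          = tensor_map L (bialgebroid_bimodule A s t) (bialgebroid_bimodule A s t)
            id (\<lambda>y. y \<otimes>\<^bsub>A\<^esub> s l) (\<Delta> a)"
    and comult_one:
      "\<Delta> \<one>\<^bsub>A\<^esub> =
        tens L (bialgebroid_bimodule A s t) (bialgebroid_bimodule A s t) \<one>\<^bsub>A\<^esub> \<one>\<^bsub>A\<^esub>"
    and comult_mult:
      "\<lbrakk>a \<in> carrier A; b \<in> carrier A\<rbrakk> \<Longrightarrow>
        \<Delta> (a \<otimes>\<^bsub>A\<^esub> b) = componentwise_mult L A s t (\<Delta> a) (\<Delta> b)"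
    and counit_one: "\<pi> \<one>\<^bsub>A\<^esub> = \<one>\<^bsub>L\<^esub>"
    and counit_source:
      "\<lbrakk>a \<in> carrier A; b \<in> carrier A\<rbrakk> \<Longrightarrow> \<pi> (a \<otimes>\<^bsub>A\<^esub> s (\<pi> b)) = \<pi> (a \<otimes>\<^bsub>A\<^esub> b)"
    and counit_target:
      "\<lbrakk>a \<in> carrier A; b \<in> carrier A\<rbrakk> \<Longrightarrow> \<pi> (a \<otimes>\<^bsub>A\<^esub> t (\<pi> b)) = \<pi> (a \<otimes>\<^bsub>A\<^esub> b)"


section \<open>Quivers\<close>

text \<open>A quiver \<open>Q\<close> over \<open>\<Lambda>\<close> is a digraph with \<open>verts Q = \<Lambda>\<close>, arrow set \<open>arcs Q\<close>, and source
  and target maps \<open>tail Q\<close> and \<open>head Q\<close>; loops and parallel arrows are allowed.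
  The constructor \<open>Arrows\<close> is only used with non-empty lists.\<close>

datatype ('l, 'q) qpath = Triv 'l | Arrows "'q list"

definition qpaths :: "('l, 'q) pre_digraph \<Rightarrow> nat \<Rightarrow> ('l, 'q) qpath set"
  where "qpaths Q m =
    (if m = 0 then Triv ` verts Q
     else Arrows ` {qs. length qs = m \<and> set qs \<subseteq> arcs Q \<and>
            (\<forall>i. Suc i < m \<longrightarrow> head Q (qs ! i) = tail Q (qs ! Suc i))})"

fun qsource :: "('l, 'q) pre_digraph \<Rightarrow> ('l, 'q) qpath \<Rightarrow> 'l" where
  "qsource Q (Triv l) = l"
| "qsource Q (Arrows qs) = tail Q (hd qs)"

fun qtarget :: "('l, 'q) pre_digraph \<Rightarrow> ('l, 'q) qpath \<Rightarrow> 'l" where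
  "qtarget Q (Triv l) = l"
| "qtarget Q (Arrows qs) = head Q (last qs)"

fun qconcat :: "('l, 'q) qpath \<Rightarrow> ('l, 'q) qpath \<Rightarrow> ('l, 'q) qpath" where
  "qconcat (Triv l) p = p"
| "qconcat (Arrows qs) (Triv l) = Arrows qs"
| "qconcat (Arrows qs) (Arrows qs') = Arrows (qs @ qs')"

text \<open>The set \<open>Q\<^sup>(\<^sup>2\<^sup>)\<close>, as pairs.\<close>

definition arrow_pairs :: "('l, 'q) pre_digraph \<Rightarrow> ('q \<times> 'q) set"
  where "arrow_pairs Q = {(a, b). a \<in> arcs Q \<and> b \<in> arcs Q \<and> head Q a = tail Q b}"


section \<open>The algebra \<open>\<AA>(w)\<close>\<close>

type_synonym ('k, 'l, 'q) G_elt = "('l, 'q) qpath \<times> ('l, 'q) qpath \<Rightarrow> 'k"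

type_synonym ('k, 'r, 'l, 'q) H_elt =
  "(('r \<times> 'r \<Rightarrow>\<^sub>0 int) set \<times> ('k, 'l, 'q) G_elt \<Rightarrow>\<^sub>0 int) set"

definition ee :: "'k ring \<Rightarrow> ('l, 'q) qpath \<Rightarrow> ('l, 'q) qpath \<Rightarrow> ('k, 'l, 'q) G_elt"
  where "ee K p q = basis_vec K (p, q)"

definition ee_mult ::
    "'k ring \<Rightarrow> ('l, 'q) pre_digraph \<Rightarrow> ('l, 'q) qpath \<times> ('l, 'q) qpath
      \<Rightarrow> ('l, 'q) qpath \<times> ('l, 'q) qpath \<Rightarrow> ('k, 'l, 'q) G_elt"
  where "ee_mult K Q = (\<lambda>(p, q) (p', q').
    if qtarget Q p = qsource Q p' \<and> qtarget Q q = qsource Q q'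
    then ee K (qconcat p p') (qconcat q q') else (\<lambda>_. \<zero>\<^bsub>K\<^esub>))"

definition G_alg :: "'k ring \<Rightarrow> ('l, 'q) pre_digraph \<Rightarrow> ('k, ('k, 'l, 'q) G_elt) module"
  where "G_alg K Q =
    (let V = free_module K (\<Union>m. qpaths Q m \<times> qpaths Q m) in
     V\<lparr>monoid.mult := (\<lambda>f g. \<Oplus>\<^bsub>V\<^esub>i\<in>supp K f. \<Oplus>\<^bsub>V\<^esub>j\<in>supp K g.
                  (f i \<otimes>\<^bsub>K\<^esub> g j) \<odot>\<^bsub>V\<^esub> ee_mult K Q i j),
       monoid.one := \<Oplus>\<^bsub>V\<^esub>i\<in>verts Q \<times> verts Q. ee K (Triv (fst i)) (Triv (snd i))\<rparr>)"

text \<open>The triple tensor product is bracketed as \<open>(R \<otimes> R\<^sup>o\<^sup>p) \<otimes> \<GG>(Q)\<close>.\<close>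

definition H_alg ::
    "'k ring \<Rightarrow> ('k, 'r) module \<Rightarrow> ('l, 'q) pre_digraph \<Rightarrow> ('k, ('k, 'r, 'l, 'q) H_elt) module"
  where "H_alg K R Q = algebra_tensor K (algebra_tensor K R (op_algebra R)) (G_alg K Q)"

definition H_tens ::
    "'k ring \<Rightarrow> ('k, 'r) module \<Rightarrow> ('l, 'q) pre_digraph \<Rightarrow> 'r \<Rightarrow> 'r \<Rightarrow> ('k, 'l, 'q) G_elt
      \<Rightarrow> ('k, 'r, 'l, 'q) H_elt"
  where "H_tens K R Q r r' g =
    ktens K (algebra_tensor K R (op_algebra R)) (G_alg K Q) (ktens K R (op_algebra R) r r') g"

text \<open>\<open>w a b c d\<close> is the element of \<open>R\<close> with upper indices \<open>a, b\<close> and lower indices \<open>c, d\<close>.\<close>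

definition w_relation ::
    "'k ring \<Rightarrow> ('k, 'r) module \<Rightarrow> ('l, 'q) pre_digraph \<Rightarrow> ('q \<Rightarrow> 'q \<Rightarrow> 'q \<Rightarrow> 'q \<Rightarrow> 'r)
      \<Rightarrow> 'q \<Rightarrow> 'q \<Rightarrow> 'q \<Rightarrow> 'q \<Rightarrow> ('k, 'r, 'l, 'q) H_elt"
  where "w_relation K R Q w a b c d =
    (let H = H_alg K R Q; G = G_alg K Q; E = (\<lambda>x y. ee K (Arrows [x]) (Arrows [y])) in
     (\<Oplus>\<^bsub>H\<^esub>i\<in>arrow_pairs Q. case i of (x, y) \<Rightarrow>
        H_tens K R Q (w x y a b) \<one>\<^bsub>R\<^esub> (E x c \<otimes>\<^bsub>G\<^esub> E y d)) \<ominus>\<^bsub>H\<^esub>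
     (\<Oplus>\<^bsub>H\<^esub>i\<in>arrow_pairs Q. case i of (x, y) \<Rightarrow>
        H_tens K R Q \<one>\<^bsub>R\<^esub> (w c d x y) (E a x \<otimes>\<^bsub>G\<^esub> E b y)))"

definition w_ideal ::
    "'k ring \<Rightarrow> ('k, 'r) module \<Rightarrow> ('l, 'q) pre_digraph \<Rightarrow> ('q \<Rightarrow> 'q \<Rightarrow> 'q \<Rightarrow> 'q \<Rightarrow> 'r)
      \<Rightarrow> ('k, 'r, 'l, 'q) H_elt set"
  where "w_ideal K R Q w =
    genideal (H_alg K R Q)
      {w_relation K R Q w a b c d | a b c d. (a, b) \<in> arrow_pairs Q \<and> (c, d) \<in> arrow_pairs Q}"

definition Aw ::
    "'k ring \<Rightarrow> ('k, 'r) module \<Rightarrow> ('l, 'q) pre_digraph \<Rightarrow> ('q \<Rightarrow> 'q \<Rightarrow> 'q \<Rightarrow> 'q \<Rightarrow> 'r)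
      \<Rightarrow> ('k, ('k, 'r, 'l, 'q) H_elt set) module"
  where "Aw K R Q w = quotient_algebra (H_alg K R Q) (w_ideal K R Q w)"

definition Aw_class ::
    "'k ring \<Rightarrow> ('k, 'r) module \<Rightarrow> ('l, 'q) pre_digraph \<Rightarrow> ('q \<Rightarrow> 'q \<Rightarrow> 'q \<Rightarrow> 'q \<Rightarrow> 'r)
      \<Rightarrow> ('k, 'r, 'l, 'q) H_elt \<Rightarrow> ('k, 'r, 'l, 'q) H_elt set"
  where "Aw_class K R Q w h = w_ideal K R Q w +>\<^bsub>H_alg K R Q\<^esub> h"


section \<open>The structure maps\<close>

definition M_alg :: "('k, 'r) module \<Rightarrow> ('l, 'q) pre_digraph \<Rightarrow> ('k, 'l \<Rightarrow> 'r) module"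
  where "M_alg R Q = fun_algebra (verts Q) R"

definition const_M :: "('l, 'q) pre_digraph \<Rightarrow> 'r \<Rightarrow> 'l \<Rightarrow> 'r"
  where "const_M Q r = (\<lambda>_\<in>verts Q. r)"

definition delta_M :: "('k, 'r) module \<Rightarrow> ('l, 'q) pre_digraph \<Rightarrow> 'l \<Rightarrow> 'l \<Rightarrow> 'r"
  where "delta_M R Q l = (\<lambda>\<mu>\<in>verts Q. if l = \<mu> then \<one>\<^bsub>R\<^esub> else \<zero>\<^bsub>R\<^esub>)"

definition source_map ::
    "'k ring \<Rightarrow> ('k, 'r) module \<Rightarrow> ('l, 'q) pre_digraph \<Rightarrow> ('q \<Rightarrow> 'q \<Rightarrow> 'q \<Rightarrow> 'q \<Rightarrow> 'r)
      \<Rightarrow> ('l \<Rightarrow> 'r) \<Rightarrow> ('k, 'r, 'l, 'q) H_elt set"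
  where "source_map K R Q w f =
    Aw_class K R Q w (\<Oplus>\<^bsub>H_alg K R Q\<^esub>i\<in>verts Q \<times> verts Q. case i of (l, \<mu>) \<Rightarrow>
      H_tens K R Q (f l) \<one>\<^bsub>R\<^esub> (ee K (Triv l) (Triv \<mu>)))"

definition target_map ::
    "'k ring \<Rightarrow> ('k, 'r) module \<Rightarrow> ('l, 'q) pre_digraph \<Rightarrow> ('q \<Rightarrow> 'q \<Rightarrow> 'q \<Rightarrow> 'q \<Rightarrow> 'r)
      \<Rightarrow> ('l \<Rightarrow> 'r) \<Rightarrow> ('k, 'r, 'l, 'q) H_elt set"
  where "target_map K R Q w f =
    Aw_class K R Q w (\<Oplus>\<^bsub>H_alg K R Q\<^esub>i\<in>verts Q \<times> verts Q. case i of (l, \<mu>) \<Rightarrow>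
      H_tens K R Q \<one>\<^bsub>R\<^esub> (f l) (ee K (Triv \<mu>) (Triv l)))"

definition Aw_bimodule ::
    "'k ring \<Rightarrow> ('k, 'r) module \<Rightarrow> ('l, 'q) pre_digraph \<Rightarrow> ('q \<Rightarrow> 'q \<Rightarrow> 'q \<Rightarrow> 'q \<Rightarrow> 'r)
      \<Rightarrow> ('k, 'l \<Rightarrow> 'r, ('k, 'r, 'l, 'q) H_elt set) bimodule"
  where "Aw_bimodule K R Q w =
    bialgebroid_bimodule (Aw K R Q w) (source_map K R Q w) (target_map K R Q w)"

text \<open>The maps \<open>\<Delta>\<close> and \<open>\<zeta>\<close> are characterised by their values on the spanning elements.
  Extensionality only fixes the irrelevant values outside the carrier, so that a map
  with the stated property is unique as a HOL function.\<close>

definition is_comult ::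
    "'k ring \<Rightarrow> ('k, 'r) module \<Rightarrow> ('l, 'q) pre_digraph \<Rightarrow> ('q \<Rightarrow> 'q \<Rightarrow> 'q \<Rightarrow> 'q \<Rightarrow> 'r)
      \<Rightarrow> (('k, 'r, 'l, 'q) H_elt set
            \<Rightarrow> (('k, 'r, 'l, 'q) H_elt set \<times> ('k, 'r, 'l, 'q) H_elt set \<Rightarrow>\<^sub>0 int) set) \<Rightarrow> bool"
  where "is_comult K R Q w \<Delta> \<longleftrightarrow>
    (let A = Aw K R Q w; M = Aw_bimodule K R Q w; L = M_alg R Q; T = bimodule_tensor L M M;
         cl = (\<lambda>r r' p q. Aw_class K R Q w (H_tens K R Q r r' (ee K p q))) in
     \<Delta> \<in> linear_hom K A T \<inter> extensional (carrier A) \<and>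
     (\<forall>m. \<forall>p\<in>qpaths Q m. \<forall>q\<in>qpaths Q m. \<forall>r\<in>carrier R. \<forall>r'\<in>carrier R.
        \<Delta> (cl r r' p q) =
          (\<Oplus>\<^bsub>T\<^esub>u\<in>qpaths Q m. tens L M M (cl r \<one>\<^bsub>R\<^esub> p u) (cl \<one>\<^bsub>R\<^esub> r' u q))))"

definition is_zeta ::
    "'k ring \<Rightarrow> ('k, 'r) module \<Rightarrow> ('l, 'q) pre_digraph \<Rightarrow> ('q \<Rightarrow> 'q \<Rightarrow> 'q \<Rightarrow> 'q \<Rightarrow> 'r)
      \<Rightarrow> (('k, 'r, 'l, 'q) H_elt set \<Rightarrow> ('l \<Rightarrow> 'r) \<Rightarrow> ('l \<Rightarrow> 'r)) \<Rightarrow> bool"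
  where "is_zeta K R Q w \<zeta> \<longleftrightarrow>
    (let A = Aw K R Q w; L = M_alg R Q in
     \<zeta> \<in> algebra_hom K A (end_algebra K L) \<inter> extensional (carrier A) \<and>
     (\<forall>m. \<forall>p\<in>qpaths Q m. \<forall>q\<in>qpaths Q m. \<forall>r\<in>carrier R. \<forall>r'\<in>carrier R. \<forall>f\<in>carrier L.
        \<zeta> (Aw_class K R Q w (H_tens K R Q r r' (ee K p q))) f =
          (if p = q
           then const_M Q (r \<otimes>\<^bsub>R\<^esub> f (qtarget Q q) \<otimes>\<^bsub>R\<^esub> r') \<otimes>\<^bsub>L\<^esub> delta_M R Q (qsource Q q)
           else \<zero>\<^bsub>L\<^esub>)))"

definition comult_map ::
    "'k ring \<Rightarrow> ('k, 'r) module \<Rightarrow> ('l, 'q) pre_digraph \<Rightarrow> ('q \<Rightarrow> 'q \<Rightarrow> 'q \<Rightarrow> 'q \<Rightarrow> 'r)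
      \<Rightarrow> ('k, 'r, 'l, 'q) H_elt set
      \<Rightarrow> (('k, 'r, 'l, 'q) H_elt set \<times> ('k, 'r, 'l, 'q) H_elt set \<Rightarrow>\<^sub>0 int) set"
  where "comult_map K R Q w = (THE \<Delta>. is_comult K R Q w \<Delta>)"

definition zeta_map ::
    "'k ring \<Rightarrow> ('k, 'r) module \<Rightarrow> ('l, 'q) pre_digraph \<Rightarrow> ('q \<Rightarrow> 'q \<Rightarrow> 'q \<Rightarrow> 'q \<Rightarrow> 'r)
      \<Rightarrow> ('k, 'r, 'l, 'q) H_elt set \<Rightarrow> ('l \<Rightarrow> 'r) \<Rightarrow> ('l \<Rightarrow> 'r)"
  where "zeta_map K R Q w = (THE \<zeta>. is_zeta K R Q w \<zeta>)"

definition counit_map ::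
    "'k ring \<Rightarrow> ('k, 'r) module \<Rightarrow> ('l, 'q) pre_digraph \<Rightarrow> ('q \<Rightarrow> 'q \<Rightarrow> 'q \<Rightarrow> 'q \<Rightarrow> 'r)
      \<Rightarrow> ('k, 'r, 'l, 'q) H_elt set \<Rightarrow> 'l \<Rightarrow> 'r"
  where "counit_map K R Q w a = zeta_map K R Q w a \<one>\<^bsub>M_alg R Q\<^esub>"

end

theory Submission
  imports Defs
begin

text \<open>
  The modules and algebras involved are tensor products and quotients, whose elements have no normal
  form; what can be controlled are the additive maps out of them. All arguments therefore have the
  same shape: a map is obtained from a universal property (\<open>tensor_lift_hom\<close>, \<open>lin_ext_hom\<close>,
  \<open>quot_lift\<close>), and two additive maps are equal once they agree on an additive spanning set
  (\<open>add_hom_eq_on_span\<close>). The algebra \<open>\<AA>(w)\<close> is spanned by the classes of \<open>r \<otimes> r' \<otimes> e\<^sup>p\<^sub>q\<close>,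
  written \<open>cl r r' p q\<close> below. A product of two of them is another one or zero (\<open>cl_mult\<close>), and
  multiplying by \<open>s f\<close> or \<open>t f\<close> multiplies \<open>r\<close> or \<open>r'\<close> by the value of \<open>f\<close> at an end of \<open>p\<close> or \<open>q\<close>
  (\<open>s_left\<close>, \<open>t_left\<close>, \<open>s_right\<close>, \<open>t_right\<close>).

  A map on \<open>\<AA>(w)\<close> prescribed on these classes exists as soon as it respects the relations and
  multiplication by a class on either side corresponds to some additive operator on the target:
  then the kernel on \<open>R \<otimes> R\<^sup>o\<^sup>p \<otimes> \<GG>(Q)\<close> is an ideal (\<open>A_lift\<close>). For \<open>\<Delta>\<close> the operators are left and
  right multiplication by \<open>\<Sum>\<^sub>u e\<^sup>p\<^sub>u \<otimes> e\<^sup>u\<^sub>q\<close> on the tensor square. They are compatible with \<open>\<Delta>\<close>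
  because a path of length \<open>m + n\<close> splits uniquely at \<open>m\<close> (\<open>comult_val_product\<close>). The relations
  are respected because constant functions carry scalars of \<open>R\<close> across the tensor sign
  (\<open>tt_move\<close>): the relation is applied in the left factor, which moves \<open>w\<close> to its \<open>R\<^sup>o\<^sup>p\<close>-side,
  \<open>w\<close> crosses to the \<open>R\<close>-side of the right factor, and the relation is applied there
  (\<open>comult_val_relation\<close>). The bialgebroid axioms for \<open>\<Delta>\<close> are then checked on these classes, where
  both sides are sums of the same terms.

  For \<open>\<zeta>\<close> the target is an algebra, and the operators are its own multiplications. Each side of a
  relation is sent to a single term: \<open>w f(\<tt>(d))\<close> at the vertex \<open>\<ss>(c)\<close>, respectively \<open>f(\<tt>(b)) w\<close> at
  \<open>\<ss>(a)\<close>, where \<open>w\<close> has upper indices \<open>c, d\<close> and lower indices \<open>a, b\<close>. These agree because \<open>w\<close> is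
  central, and zero unless the ends match (\<open>zeta_op_relation\<close>). Finally \<open>\<zeta> (s g)\<close> and \<open>\<zeta> (t g)\<close>
  are left and right multiplication by \<open>g\<close>, and \<open>\<pi> (a b) = \<zeta> a (\<pi> b)\<close>; the identities for \<open>\<pi>\<close>
  follow from this. In the counit axioms only the summand \<open>u = p\<close>, respectively \<open>u = q\<close>, of \<open>\<Delta>\<close>
  survives.
\<close>

section \<open>Additive maps and additive spanning sets\<close>

text \<open>Additive rather than linear maps are the basic notion: the tensor products are defined by additive
  relations alone, and scalars can be absorbed into generators.\<close>

definition add_hom :: "('a, 'm) ring_scheme \<Rightarrow> ('b, 'n) ring_scheme \<Rightarrow> ('a \<Rightarrow> 'b) set"
  where "add_hom M N = {f \<in> carrier M \<rightarrow> carrier N.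
    \<forall>x\<in>carrier M. \<forall>y\<in>carrier M. f (x \<oplus>\<^bsub>M\<^esub> y) = f x \<oplus>\<^bsub>N\<^esub> f y}"

lemma add_homI:
  assumes "\<And>x. x \<in> carrier M \<Longrightarrow> f x \<in> carrier N"
    and "\<And>x y. x \<in> carrier M \<Longrightarrow> y \<in> carrier M \<Longrightarrow> f (x \<oplus>\<^bsub>M\<^esub> y) = f x \<oplus>\<^bsub>N\<^esub> f y"
  shows "f \<in> add_hom M N"
  using assms by (auto simp: add_hom_def)

lemma add_hom_closed: "f \<in> add_hom M N \<Longrightarrow> x \<in> carrier M \<Longrightarrow> f x \<in> carrier N"
  by (auto simp: add_hom_def)

lemma add_hom_add:
  "f \<in> add_hom M N \<Longrightarrow> x \<in> carrier M \<Longrightarrow> y \<in> carrier M \<Longrightarrow> f (x \<oplus>\<^bsub>M\<^esub> y) = f x \<oplus>\<^bsub>N\<^esub> f y"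
  by (auto simp: add_hom_def)

lemma add_hom_compose:
  "f \<in> add_hom M N \<Longrightarrow> g \<in> add_hom N P \<Longrightarrow> (\<lambda>x. g (f x)) \<in> add_hom M P"
  by (auto simp: add_hom_def Pi_def)

lemma id_add_hom: "id \<in> add_hom M M" "(\<lambda>x. x) \<in> add_hom M M"
  by (auto simp: add_hom_def)

lemma add_hom_zero:
  assumes "f \<in> add_hom M N" "abelian_group M" "abelian_group N"
  shows "f \<zero>\<^bsub>M\<^esub> = \<zero>\<^bsub>N\<^esub>"
proof -
  interpret M: abelian_group M by fact
  interpret N: abelian_group N by fact
  have "f \<zero>\<^bsub>M\<^esub> \<oplus>\<^bsub>N\<^esub> f \<zero>\<^bsub>M\<^esub> = f \<zero>\<^bsub>M\<^esub>"
    using add_hom_add[OF assms(1), of "\<zero>\<^bsub>M\<^esub>" "\<zero>\<^bsub>M\<^esub>"] by simp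
  thus ?thesis using add_hom_closed[OF assms(1), of "\<zero>\<^bsub>M\<^esub>"] by (simp add: N.add.l_cancel_one)
qed

lemma add_hom_neg:
  assumes "f \<in> add_hom M N" "abelian_group M" "abelian_group N" "x \<in> carrier M"
  shows "f (\<ominus>\<^bsub>M\<^esub> x) = \<ominus>\<^bsub>N\<^esub> f x"
proof -
  interpret M: abelian_group M by fact
  interpret N: abelian_group N by fact
  have "f (\<ominus>\<^bsub>M\<^esub> x) \<oplus>\<^bsub>N\<^esub> f x = \<zero>\<^bsub>N\<^esub>"
    using add_hom_add[OF assms(1), of "\<ominus>\<^bsub>M\<^esub> x" x] add_hom_zero[OF assms(1-3)] assms(4)
    by (simp add: M.l_neg)
  thus ?thesis using add_hom_closed[OF assms(1)] assms(4) by (metis M.a_inv_closed N.minus_equality)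
qed

lemma add_hom_minus:
  assumes "f \<in> add_hom M N" "abelian_group M" "abelian_group N" "x \<in> carrier M" "y \<in> carrier M"
  shows "f (x \<ominus>\<^bsub>M\<^esub> y) = f x \<ominus>\<^bsub>N\<^esub> f y"
proof -
  interpret M: abelian_group M by fact
  show ?thesis using assms by (simp add: a_minus_def add_hom_add add_hom_neg)
qed

lemma add_hom_finsum:
  assumes "f \<in> add_hom M N" "abelian_group M" "abelian_group N" "\<And>i. i \<in> A \<Longrightarrow> g i \<in> carrier M"
  shows "f (\<Oplus>\<^bsub>M\<^esub>i\<in>A. g i) = (\<Oplus>\<^bsub>N\<^esub>i\<in>A. f (g i))"
proof -
  interpret M: abelian_group M by fact
  interpret N: abelian_group N by fact
  note [simp] = add_hom_zero[OF assms(1-3)]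
  show ?thesis using assms(4)
  proof (induction A rule: infinite_finite_induct)
    case (insert x F)
    have "(\<Oplus>\<^bsub>M\<^esub>i\<in>F. g i) \<in> carrier M" using insert by (intro M.finsum_closed) auto
    with insert show ?case
      by (subst M.finsum_insert, auto simp: add_hom_add[OF assms(1)] add_hom_closed[OF assms(1)])
  qed simp_all
qed

text \<open>Only sums are formed, no negatives, so that an induction over a span has a single step. Negatives
  need not be adjoined because \<open>- (x \<otimes> y) = (- x) \<otimes> y\<close> moves a sign into a factor.\<close>

inductive_set add_span :: "('a, 'm) ring_scheme \<Rightarrow> 'a set \<Rightarrow> 'a set" for M S where
  zero: "\<zero>\<^bsub>M\<^esub> \<in> add_span M S"
| add: "x \<in> S \<Longrightarrow> y \<in> add_span M S \<Longrightarrow> x \<oplus>\<^bsub>M\<^esub> y \<in> add_span M S"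

definition add_spans :: "'a set \<Rightarrow> ('a, 'm) ring_scheme \<Rightarrow> bool"
  where "add_spans S M \<longleftrightarrow> S \<subseteq> carrier M \<and> carrier M \<subseteq> add_span M S"

lemma add_spans_induct [consumes 2, case_names zero add]:
  assumes "add_spans S M" "x \<in> carrier M" "P \<zero>\<^bsub>M\<^esub>" "abelian_group M"
    and "\<And>x y. x \<in> S \<Longrightarrow> x \<in> carrier M \<Longrightarrow> y \<in> carrier M \<Longrightarrow> P y \<Longrightarrow> P (x \<oplus>\<^bsub>M\<^esub> y)"
  shows "P x"
proof -
  interpret M: abelian_group M by fact
  have "x \<in> add_span M S" using assms by (auto simp: add_spans_def)
  hence "x \<in> carrier M \<and> P x"
    by induction (use assms in \<open>auto simp: add_spans_def\<close>)
  thus ?thesis by blast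
qed

lemma (in abelian_group) add_span_plus:
  assumes "S \<subseteq> carrier G" "x \<in> add_span G S" "y \<in> add_span G S"
  shows "x \<oplus> y \<in> add_span G S"
proof -
  have *: "z \<in> carrier G" if "z \<in> add_span G S" for z
    using that by induction (use assms in auto)
  show ?thesis using assms(2)
  proof induction
    case zero thus ?case using assms(3) * by simp
  next
    case (add u v)
    hence "u \<oplus> v \<oplus> y = u \<oplus> (v \<oplus> y)" using * assms by (intro a_assoc) auto
    thus ?case using add by (auto intro: add_span.add)
  qed
qed

lemma (in abelian_group) add_span_base:
  assumes "S \<subseteq> carrier G" "x \<in> S"
  shows "x \<in> add_span G S"
  using add_span.add[OF assms(2) add_span.zero, of G] assms by (auto simp: subset_iff)

lemma (in abelian_group) add_span_finsum:
  assumes "S \<subseteq> carrier G" "\<And>i. i \<in> A \<Longrightarrow> f i \<in> add_span G S"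
  shows "(\<Oplus>i\<in>A. f i) \<in> add_span G S"
proof -
  have *: "z \<in> carrier G" if "z \<in> add_span G S" for z
    using that by induction (use assms in auto)
  show ?thesis using assms(2)
  proof (induction A rule: infinite_finite_induct)
    case (insert x F)
    thus ?case using add_span_plus[OF assms(1)] *
      by (subst finsum_insert) (auto simp: Pi_def)
  qed (auto intro: add_span.zero)
qed

text \<open>Elements of iterated tensor products and quotients cannot be compared directly; this is how every
  identity between them is reduced to generators.\<close>

lemma add_hom_eq_on_span:
  assumes "f \<in> add_hom M N" "g \<in> add_hom M N" "abelian_group M" "abelian_group N" "add_spans S M"
    and "\<And>x. x \<in> S \<Longrightarrow> f x = g x" and "x \<in> carrier M"
  shows "f x = g x"
  using assms(5,7)
proof (induction rule: add_spans_induct)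
  show "abelian_group M" by fact
qed (use assms in \<open>auto simp: add_hom_zero add_hom_add\<close>)

lemma add_spans_image:
  assumes "f \<in> add_hom M N" "abelian_group M" "abelian_group N" "add_spans S M" "f ` carrier M = carrier N"
  shows "add_spans (f ` S) N"
proof -
  have "f x \<in> add_span N (f ` S)" if "x \<in> carrier M" for x
    using assms(4) that
  proof (induction rule: add_spans_induct)
    show "abelian_group M" by fact
  qed (auto simp: add_hom_zero[OF assms(1-3)] add_hom_add[OF assms(1)] intro: add_span.intros)
  hence "carrier N \<subseteq> add_span N (f ` S)" unfolding assms(5)[symmetric] by blast
  thus ?thesis using assms(4,5) unfolding add_spans_def by blast
qed

definition biadditive ::
    "('a, 'm) ring_scheme \<Rightarrow> ('b, 'n) ring_scheme \<Rightarrow> ('c, 'p) ring_scheme \<Rightarrow> ('a \<Rightarrow> 'b \<Rightarrow> 'c) \<Rightarrow> bool"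
  where "biadditive M N Z f \<longleftrightarrow>
    (\<forall>x\<in>carrier M. f x \<in> add_hom N Z) \<and> (\<forall>y\<in>carrier N. (\<lambda>x. f x y) \<in> add_hom M Z)"

lemma biadditiveI:
  assumes "\<And>x y. x \<in> carrier M \<Longrightarrow> y \<in> carrier N \<Longrightarrow> f x y \<in> carrier Z"
    and "\<And>x x' y. x \<in> carrier M \<Longrightarrow> x' \<in> carrier M \<Longrightarrow> y \<in> carrier N
          \<Longrightarrow> f (x \<oplus>\<^bsub>M\<^esub> x') y = f x y \<oplus>\<^bsub>Z\<^esub> f x' y"
    and "\<And>x y y'. x \<in> carrier M \<Longrightarrow> y \<in> carrier N \<Longrightarrow> y' \<in> carrier N
          \<Longrightarrow> f x (y \<oplus>\<^bsub>N\<^esub> y') = f x y \<oplus>\<^bsub>Z\<^esub> f x y'"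
  shows "biadditive M N Z f"
  using assms by (auto simp: biadditive_def intro!: add_homI)

lemma biadditiveD:
  assumes "biadditive M N Z f"
  shows "x \<in> carrier M \<Longrightarrow> f x \<in> add_hom N Z" "y \<in> carrier N \<Longrightarrow> (\<lambda>x. f x y) \<in> add_hom M Z"
    and "x \<in> carrier M \<Longrightarrow> y \<in> carrier N \<Longrightarrow> f x y \<in> carrier Z"
    and "x \<in> carrier M \<Longrightarrow> x' \<in> carrier M \<Longrightarrow> y \<in> carrier N
          \<Longrightarrow> f (x \<oplus>\<^bsub>M\<^esub> x') y = f x y \<oplus>\<^bsub>Z\<^esub> f x' y"
    and "x \<in> carrier M \<Longrightarrow> y \<in> carrier N \<Longrightarrow> y' \<in> carrier N
          \<Longrightarrow> f x (y \<oplus>\<^bsub>N\<^esub> y') = f x y \<oplus>\<^bsub>Z\<^esub> f x y'"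
  using assms by (auto simp: biadditive_def add_hom_def)

lemma biadditive_eq_on_span:
  assumes "biadditive M N Z f" "biadditive M N Z g"
    and "abelian_group M" "abelian_group N" "abelian_group Z" "add_spans S M" "add_spans S' N"
    and "\<And>x y. x \<in> S \<Longrightarrow> y \<in> S' \<Longrightarrow> f x y = g x y" and "x \<in> carrier M" "y \<in> carrier N"
  shows "f x y = g x y"
proof -
  have "f x y = g x y" if "x \<in> S" for x
    using that assms(6) add_hom_eq_on_span[OF biadditiveD(1)[OF assms(1)] biadditiveD(1)[OF assms(2)]
       assms(4,5,7) assms(8) assms(10)] by (auto simp: add_spans_def)
  from add_hom_eq_on_span[OF biadditiveD(2)[OF assms(1,10)] biadditiveD(2)[OF assms(2,10)]
       assms(3,5,6) this assms(9)]
  show ?thesis by simp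
qed

lemma add_span_mono: "x \<in> add_span M C \<Longrightarrow> C \<subseteq> D \<Longrightarrow> x \<in> add_span M D"
  by (induction rule: add_span.induct) (auto intro: add_span.intros)

lemma add_hom_plus:
  assumes "f \<in> add_hom M N" "g \<in> add_hom M N" "abelian_group M" "abelian_group N"
  shows "(\<lambda>x. f x \<oplus>\<^bsub>N\<^esub> g x) \<in> add_hom M N"
proof -
  interpret M: abelian_group M by fact
  interpret N: abelian_group N by fact
  show ?thesis
    by (rule add_homI)
       (simp_all add: add_hom_closed[OF assms(1)] add_hom_closed[OF assms(2)]
          add_hom_add[OF assms(1)] add_hom_add[OF assms(2)] N.a_ac)
qed

section \<open>Records with the same operations\<close>

lemma add_hom_target_cong:
  "carrier N = carrier N' \<Longrightarrow> ring.add N = ring.add N' \<Longrightarrow> add_hom M N = add_hom M N'"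
  by (simp add: add_hom_def)

lemma add_hom_source_cong:
  "carrier M = carrier M' \<Longrightarrow> ring.add M = ring.add M' \<Longrightarrow> add_hom M N = add_hom M' N"
  by (simp add: add_hom_def)

text \<open>The records for modules, algebras and bimodules on the same set are different types, and facts
  about the additive structure have to be carried from one to another.\<close>

lemma add_spans_cong:
  assumes "add_spans S A" "carrier B = carrier A" "ring.zero B = ring.zero A" "ring.add B = ring.add A"
  shows "add_spans S B"
proof -
  have "x \<in> add_span A S \<Longrightarrow> x \<in> add_span B S" for x
    by (induction rule: add_span.induct) (simp_all add: assms(3,4)[symmetric] add_span.intros)
  thus ?thesis using assms by (auto simp: add_spans_def)
qed

lemma abelian_group_cong:
  assumes "abelian_group A" "carrier B = carrier A" "ring.zero B = ring.zero A" "ring.add B = ring.add A"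
  shows "abelian_group B"
proof -
  interpret abelian_group A by fact
  have inv: "\<exists>y\<in>carrier A. y \<oplus>\<^bsub>A\<^esub> x = \<zero>\<^bsub>A\<^esub>" if "x \<in> carrier A" for x
    using that l_neg by (intro bexI[of _ "\<ominus>\<^bsub>A\<^esub> x"]) auto
  show ?thesis
    by (rule abelian_groupI, unfold assms(2-4))
       (auto simp: a_assoc intro: a_comm inv)
qed

lemma module_cong:
  assumes "module K A" "carrier B = carrier A" "ring.zero B = ring.zero A" "ring.add B = ring.add A" "smult B = smult A"
  shows "module K B"
proof -
  interpret module K A by fact
  show ?thesis
    by (rule moduleI)
       (simp_all only: is_cring assms, rule abelian_group_cong[OF abelian_group_axioms],
        simp_all add: assms smult_l_distr smult_r_distr smult_assoc1)
qed

lemma ring_cong: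
  assumes "ring A" "carrier B = carrier A" "ring.zero B = ring.zero A" "ring.add B = ring.add A"
    "monoid.mult B = monoid.mult A" "monoid.one B = monoid.one A"
  shows "ring B"
proof -
  interpret ring A by fact
  show ?thesis
    by (rule ringI, rule abelian_group_cong[OF is_abelian_group], simp_all add: assms)
       (rule monoidI, simp_all add: assms m_assoc l_distr r_distr)
qed

lemma finsum_cong_record:
  assumes "carrier B = carrier A" "ring.zero B = ring.zero A" "ring.add B = ring.add A"
  shows "finsum B f I = finsum A f I"
  by (simp add: finsum_def finprod_def assms)

section \<open>Finite sums\<close>

context abelian_group
begin

lemma finsum_single:
  assumes "finite A" "i \<in> A" "\<And>j. j \<in> A \<Longrightarrow> j \<noteq> i \<Longrightarrow> f j = \<zero>" "f i \<in> carrier G"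
  shows "(\<Oplus>j\<in>A. f j) = f i"
proof -
  have "f j \<in> carrier G" if "j \<in> A" for j by (cases "j = i") (use that assms in auto)
  hence "(\<Oplus>j\<in>A. f j) = (\<Oplus>j\<in>{i}. f j)"
    by (intro add.finprod_mono_neutral_cong_right) (use assms in auto)
  thus ?thesis using assms by simp
qed

lemma finsum_swap:
  assumes "finite I" "finite J" "\<And>i j. i \<in> I \<Longrightarrow> j \<in> J \<Longrightarrow> f i j \<in> carrier G"
  shows "(\<Oplus>i\<in>I. \<Oplus>j\<in>J. f i j) = (\<Oplus>j\<in>J. \<Oplus>i\<in>I. f i j)"
  using assms(1,3)
proof (induction I rule: finite_induct)
  case empty thus ?case by simp
next
  case (insert i I)
  have "(\<Oplus>i\<in>insert i I. \<Oplus>j\<in>J. f i j) = (\<Oplus>j\<in>J. f i j) \<oplus> (\<Oplus>i\<in>I. \<Oplus>j\<in>J. f i j)"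
    using insert by (intro finsum_insert) (auto intro!: finsum_closed)
  also have "\<dots> = (\<Oplus>j\<in>J. f i j) \<oplus> (\<Oplus>j\<in>J. \<Oplus>i\<in>I. f i j)"
    using insert by simp
  also have "\<dots> = (\<Oplus>j\<in>J. f i j \<oplus> (\<Oplus>i\<in>I. f i j))"
    using insert by (intro finsum_addf[symmetric]) (auto intro!: finsum_closed)
  also have "\<dots> = (\<Oplus>j\<in>J. \<Oplus>i\<in>insert i I. f i j)"
    using insert by (intro finsum_cong'[OF refl]) (auto intro!: finsum_closed)
  finally show ?case .
qed

lemma finsum_add_eq:
  assumes "\<And>i. i \<in> I \<Longrightarrow> f i \<in> carrier G" "\<And>i. i \<in> I \<Longrightarrow> g i \<in> carrier G"
    "\<And>i. i \<in> I \<Longrightarrow> h i = f i \<oplus> g i"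
  shows "(\<Oplus>i\<in>I. h i) = (\<Oplus>i\<in>I. f i) \<oplus> (\<Oplus>i\<in>I. g i)"
proof -
  have "(\<Oplus>i\<in>I. h i) = (\<Oplus>i\<in>I. f i \<oplus> g i)"
    by (rule finsum_cong'[OF refl]) (use assms in auto)
  also have "\<dots> = (\<Oplus>i\<in>I. f i) \<oplus> (\<Oplus>i\<in>I. g i)"
    by (rule finsum_addf) (use assms in auto)
  finally show ?thesis .
qed

lemma finsum_cartesian:
  assumes "finite I" "finite J" "\<And>i j. i \<in> I \<Longrightarrow> j \<in> J \<Longrightarrow> f i j \<in> carrier G"
  shows "(\<Oplus>x\<in>I \<times> J. f (fst x) (snd x)) = (\<Oplus>i\<in>I. \<Oplus>j\<in>J. f i j)"
  using assms(1,3)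
proof (induction I rule: finite_induct)
  case empty thus ?case by simp
next
  case (insert i I)
  have e: "insert i I \<times> J = Pair i ` J \<union> I \<times> J" by auto
  have "(\<Oplus>x\<in>insert i I \<times> J. f (fst x) (snd x)) =
      (\<Oplus>x\<in>Pair i ` J. f (fst x) (snd x)) \<oplus> (\<Oplus>x\<in>I \<times> J. f (fst x) (snd x))"
    unfolding e using insert assms(2) by (intro finsum_Un_disjoint) auto
  also have "(\<Oplus>x\<in>Pair i ` J. f (fst x) (snd x)) = (\<Oplus>j\<in>J. f i j)"
    using insert by (subst finsum_reindex) (auto simp: inj_on_def)
  also have "(\<Oplus>x\<in>I \<times> J. f (fst x) (snd x)) = (\<Oplus>i\<in>I. \<Oplus>j\<in>J. f i j)"
    using insert by simp
  also have "(\<Oplus>j\<in>J. f i j) \<oplus> \<dots> = (\<Oplus>i\<in>insert i I. \<Oplus>j\<in>J. f i j)"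
    using insert by (intro finsum_insert[symmetric]) (auto intro!: finsum_closed)
  finally show ?case .
qed

end

section \<open>The universal property of the tensor product\<close>

definition balanced ::
    "('l, 'p) ring_scheme \<Rightarrow> ('k, 'l, 'a, 'n) bimodule_scheme \<Rightarrow> ('k, 'l, 'b, 'q) bimodule_scheme
      \<Rightarrow> ('c, 'm) ring_scheme \<Rightarrow> ('a \<Rightarrow> 'b \<Rightarrow> 'c) \<Rightarrow> bool"
  where "balanced L M N Z f \<longleftrightarrow> biadditive M N Z f \<and>
    (\<forall>x\<in>carrier M. \<forall>l\<in>carrier L. \<forall>y\<in>carrier N. f (ract M x l) y = f x (lact N l y))"

lemma balancedI:
  assumes "\<And>x y. x \<in> carrier M \<Longrightarrow> y \<in> carrier N \<Longrightarrow> f x y \<in> carrier Z"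
    and "\<And>x x' y. x \<in> carrier M \<Longrightarrow> x' \<in> carrier M \<Longrightarrow> y \<in> carrier N
          \<Longrightarrow> f (x \<oplus>\<^bsub>M\<^esub> x') y = f x y \<oplus>\<^bsub>Z\<^esub> f x' y"
    and "\<And>x y y'. x \<in> carrier M \<Longrightarrow> y \<in> carrier N \<Longrightarrow> y' \<in> carrier N
          \<Longrightarrow> f x (y \<oplus>\<^bsub>N\<^esub> y') = f x y \<oplus>\<^bsub>Z\<^esub> f x y'"
    and "\<And>x l y. x \<in> carrier M \<Longrightarrow> l \<in> carrier L \<Longrightarrow> y \<in> carrier N \<Longrightarrow> f (ract M x l) y = f x (lact N l y)"
  shows "balanced L M N Z f"
  unfolding balanced_def using assms by (auto intro!: biadditiveI)

text \<open>The integer-linear extension of \<open>f\<close> to formal combinations, which is what \<^const>\<open>tensor_lift\<close> applies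
  to a representative of a coset.\<close>

definition frag_eval :: "('c, 'm) ring_scheme \<Rightarrow> ('a \<Rightarrow> 'c) \<Rightarrow> ('a \<Rightarrow>\<^sub>0 int) \<Rightarrow> 'c"
  where "frag_eval Z f c =
    (\<Oplus>\<^bsub>Z\<^esub>p\<in>Poly_Mapping.keys c. add_pow Z (Poly_Mapping.lookup c p) (f p))"

context abelian_group
begin

lemma frag_eval_superset:
  assumes "finite B" "Poly_Mapping.keys c \<subseteq> B" "B \<subseteq> S" "f \<in> S \<rightarrow> carrier G"
  shows "frag_eval G f c = (\<Oplus>p\<in>B. add_pow G (Poly_Mapping.lookup c p) (f p))"
proof -
  have "add_pow G (0::int) x = \<zero>" for x by (simp add: add_pow_def)
  with assms show ?thesis unfolding frag_eval_def
    by (intro add.finprod_mono_neutral_cong_left) (auto simp: in_keys_iff Pi_def subset_iff)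
qed

lemma frag_eval_closed:
  "Poly_Mapping.keys c \<subseteq> S \<Longrightarrow> f \<in> S \<rightarrow> carrier G \<Longrightarrow> frag_eval G f c \<in> carrier G"
  unfolding frag_eval_def by (rule finsum_closed) auto

lemma frag_eval_add:
  assumes "Poly_Mapping.keys c \<subseteq> S" "Poly_Mapping.keys d \<subseteq> S" "f \<in> S \<rightarrow> carrier G"
  shows "frag_eval G f (c + d) = frag_eval G f c \<oplus> frag_eval G f d"
proof -
  let ?B = "Poly_Mapping.keys c \<union> Poly_Mapping.keys d"
  have fp: "f p \<in> carrier G" if "p \<in> ?B" for p using that assms by auto
  have "frag_eval G f (c + d) = (\<Oplus>p\<in>?B. add_pow G (Poly_Mapping.lookup (c + d) p) (f p))"
    by (rule frag_eval_superset[where S=S]) (use assms keys_add[of c d] in auto)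
  also have "\<dots> = (\<Oplus>p\<in>?B. add_pow G (Poly_Mapping.lookup c p) (f p) \<oplus> add_pow G (Poly_Mapping.lookup d p) (f p))"
    by (rule finsum_cong') (auto simp: lookup_add add.int_pow_mult fp)
  also have "\<dots> = (\<Oplus>p\<in>?B. add_pow G (Poly_Mapping.lookup c p) (f p)) \<oplus> (\<Oplus>p\<in>?B. add_pow G (Poly_Mapping.lookup d p) (f p))"
    by (rule finsum_addf) (auto simp: fp)
  also have "\<dots> = frag_eval G f c \<oplus> frag_eval G f d"
    using assms by (subst (1 2) frag_eval_superset[where S=S and B = ?B]) auto
  finally show ?thesis .
qed

lemma frag_eval_of:
  "f p \<in> carrier G \<Longrightarrow> frag_eval G f (frag_of p) = f p"
  unfolding frag_eval_def by (simp add: keys_frag_of)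

lemma frag_eval_0: "frag_eval G f 0 = \<zero>"
  unfolding frag_eval_def by simp

lemma frag_eval_diff:
  assumes "Poly_Mapping.keys c \<subseteq> S" "Poly_Mapping.keys d \<subseteq> S" "f \<in> S \<rightarrow> carrier G"
  shows "frag_eval G f (c - d) = frag_eval G f c \<ominus> frag_eval G f d"
proof -
  have "frag_eval G f c = frag_eval G f (c - d) \<oplus> frag_eval G f d"
    using frag_eval_add[of "c - d" S d f] assms keys_diff[of c d] by auto
  moreover have "frag_eval G f (c - d) \<in> carrier G" "frag_eval G f d \<in> carrier G"
    using frag_eval_closed[of "c - d" S f] frag_eval_closed[of d S f] assms keys_diff[of c d] by auto
  ultimately show ?thesis by (simp add: a_minus_def a_assoc r_neg)
qed

end

lemma generate_free_Abelian_induct [consumes 2, case_names zero incl inv add]: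
  assumes "x \<in> generate (free_Abelian_group S) R" "R \<subseteq> carrier (free_Abelian_group S)"
    and "P 0" "\<And>r. r \<in> R \<Longrightarrow> P r" "\<And>r. r \<in> R \<Longrightarrow> P (-r)"
    and "\<And>x y. Poly_Mapping.keys x \<subseteq> S \<Longrightarrow> Poly_Mapping.keys y \<subseteq> S \<Longrightarrow> P x \<Longrightarrow> P y \<Longrightarrow> P (x + y)"
  shows "P x"
proof -
  have "Poly_Mapping.keys x \<subseteq> S \<and> P x"
    using assms(1)
  proof induction
    case (inv h)
    hence "Poly_Mapping.keys h \<subseteq> S" using assms(2) by (metis carrier_free_Abelian_group_iff subsetD)
    thus ?case using inv assms(5) by (simp add: keys_minus)
  next
    case (eng h1 h2) thus ?case using assms(6) keys_add[of h1 h2] by auto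
  next
    case (incl h)
    hence "Poly_Mapping.keys h \<subseteq> S" using assms(2) by (metis carrier_free_Abelian_group_iff subsetD)
    thus ?case using incl assms(4) by simp
  qed (use assms(3) in auto)
  thus ?thesis ..
qed

text \<open>Only the operations that occur in the relations of \<open>M \<otimes>\<^sub>L N\<close> are required. This covers bimodules,
  vector spaces, and the case where a factor is itself a tensor product.\<close>

locale tensor_pair =
  fixes L :: "('l, 'p) ring_scheme" and M :: "('k, 'l, 'a, 'n) bimodule_scheme"
    and N :: "('k, 'l, 'b, 'q) bimodule_scheme"
  assumes abelian_left: "abelian_group M" and abelian_right: "abelian_group N"
    and ract_in: "\<And>x l. x \<in> carrier M \<Longrightarrow> l \<in> carrier L \<Longrightarrow> ract M x l \<in> carrier M"
    and lact_in: "\<And>l y. l \<in> carrier L \<Longrightarrow> y \<in> carrier N \<Longrightarrow> lact N l y \<in> carrier N"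
begin

sublocale left: abelian_group M by (rule abelian_left)
sublocale right: abelian_group N by (rule abelian_right)

abbreviation "FF \<equiv> free_Abelian_group (carrier M \<times> carrier N)"
abbreviation "null \<equiv> tensor_null L M N"
abbreviation "T \<equiv> bimodule_tensor L M N"

lemma rels_in: "tensor_rels L M N \<subseteq> carrier FF"
  unfolding tensor_rels_def
  by (auto dest!: subsetD[OF keys_diff] simp: keys_frag_of ract_in lact_in)

lemma null_normal: "normal null FF"
  unfolding tensor_null_def
  by (intro comm_group.subgroup_imp_normal abelian_free_Abelian_group group.generate_is_subgroup rels_in)
    auto

sublocale null: normal null FF by (rule null_normal)

lemma tensor_simps:
  "carrier T = rcosets\<^bsub>FF\<^esub> null" "ring.zero T = null" "ring.add T = set_mult FF"
  by (simp_all add: bimodule_tensor_def tensor_ab_def Let_def FactGroup_def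
      module.extend_def ring.extend_def module.defs ring.defs)

lemma abelian_T: "abelian_group T"
proof -
  have c: "comm_group (FF Mod null)"
    using abelian_free_Abelian_group by (rule comm_group.abelian_FactGroup) (rule normal_imp_subgroup[OF null_normal])
  interpret Q: comm_group "FF Mod null" by (rule c)
  have *: "carrier T = carrier (FF Mod null)" "ring.zero T = \<one>\<^bsub>FF Mod null\<^esub>" "ring.add T = monoid.mult (FF Mod null)"
    by (simp_all add: tensor_simps FactGroup_def)
  have inv: "\<exists>y\<in>carrier T. y \<oplus>\<^bsub>T\<^esub> x = \<zero>\<^bsub>T\<^esub>" if "x \<in> carrier T" for x
    using that by (intro bexI[of _ "inv\<^bsub>FF Mod null\<^esub> x"]) (simp_all only: Q.l_inv Q.inv_closed \<open>carrier T = _\<close> \<open>ring.zero T = _\<close> \<open>ring.add T = _\<close>)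
  show ?thesis
    by (rule abelian_groupI)
       (simp_all only: inv, simp_all only: \<open>carrier T = _\<close> \<open>ring.zero T = _\<close> \<open>ring.add T = _\<close> Q.m_closed Q.one_closed Q.m_assoc Q.l_one,
        (rule Q.m_comm; assumption)?)
qed

lemma coset_eq:
  assumes "Poly_Mapping.keys c \<subseteq> carrier M \<times> carrier N" "Poly_Mapping.keys d \<subseteq> carrier M \<times> carrier N"
    "c - d \<in> null"
  shows "null #>\<^bsub>FF\<^esub> c = null #>\<^bsub>FF\<^esub> d"
proof -
  have "null #>\<^bsub>FF\<^esub> c = null #>\<^bsub>FF\<^esub> ((c - d) \<otimes>\<^bsub>FF\<^esub> d)" by simp
  also have "\<dots> = (null #>\<^bsub>FF\<^esub> (c - d)) #>\<^bsub>FF\<^esub> d"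
    using assms null.subset null.mem_carrier[OF assms(3)] by (subst null.coset_mult_assoc) auto
  also have "\<dots> = null #>\<^bsub>FF\<^esub> d" using assms null.rcos_const[OF null.is_group] by simp
  finally show ?thesis .
qed

lemma rel_null: "r \<in> tensor_rels L M N \<Longrightarrow> r \<in> null"
  unfolding tensor_null_def by (rule generate.incl)

lemma coset_add:
  assumes "Poly_Mapping.keys c \<subseteq> carrier M \<times> carrier N" "Poly_Mapping.keys d \<subseteq> carrier M \<times> carrier N"
  shows "(null #>\<^bsub>FF\<^esub> c) \<oplus>\<^bsub>T\<^esub> (null #>\<^bsub>FF\<^esub> d) = null #>\<^bsub>FF\<^esub> (c + d)"
  using null.rcos_sum[of c d] assms by (simp add: tensor_simps)

lemma rels:
  "x \<in> carrier M \<Longrightarrow> x' \<in> carrier M \<Longrightarrow> y \<in> carrier N \<Longrightarrow>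
    frag_of (x \<oplus>\<^bsub>M\<^esub> x', y) - frag_of (x, y) - frag_of (x', y) \<in> tensor_rels L M N"
  "x \<in> carrier M \<Longrightarrow> y \<in> carrier N \<Longrightarrow> y' \<in> carrier N \<Longrightarrow>
    frag_of (x, y \<oplus>\<^bsub>N\<^esub> y') - frag_of (x, y) - frag_of (x, y') \<in> tensor_rels L M N"
  unfolding tensor_rels_def by blast+

lemma tens_in: "x \<in> carrier M \<Longrightarrow> y \<in> carrier N \<Longrightarrow> tens L M N x y \<in> carrier T"
  unfolding tens_def tensor_simps by (rule null.rcosetsI) (use null.subset in \<open>auto simp: keys_frag_of\<close>)

lemma tens_biadditive: "biadditive M N T (tens L M N)"
proof (rule biadditiveI)
  fix x x' y assume xy: "x \<in> carrier M" "x' \<in> carrier M" "y \<in> carrier N"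
  show "tens L M N (x \<oplus>\<^bsub>M\<^esub> x') y = tens L M N x y \<oplus>\<^bsub>T\<^esub> tens L M N x' y"
    unfolding tens_def using xy
    by (subst coset_add, simp_all add: keys_frag_of)
       (rule coset_eq, auto simp: keys_frag_of diff_diff_eq[symmetric] intro!: rel_null rels dest!: subsetD[OF keys_add])
next
  fix x y y' assume xy: "x \<in> carrier M" "y \<in> carrier N" "y' \<in> carrier N"
  show "tens L M N x (y \<oplus>\<^bsub>N\<^esub> y') = tens L M N x y \<oplus>\<^bsub>T\<^esub> tens L M N x y'"
    unfolding tens_def using xy
    by (subst coset_add, simp_all add: keys_frag_of)
       (rule coset_eq, auto simp: keys_frag_of diff_diff_eq[symmetric] intro!: rel_null rels dest!: subsetD[OF keys_add])
qed (rule tens_in)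

lemma tens_middle:
  "x \<in> carrier M \<Longrightarrow> l \<in> carrier L \<Longrightarrow> y \<in> carrier N \<Longrightarrow>
    tens L M N (ract M x l) y = tens L M N x (lact N l y)"
  unfolding tens_def
  by (rule coset_eq) (auto simp: keys_frag_of tensor_rels_def ract_in lact_in intro!: rel_null)

text \<open>The point that needs care is a formal combination with negative coefficients: its class is still a
  sum of pure tensors, since the class of \<open>- (x, y)\<close> is \<open>(- x) \<otimes> y\<close>.\<close>

lemma tens_spans:
  assumes "add_spans S M" "add_spans S' N"
  shows "add_spans {tens L M N x y | x y. x \<in> S \<and> y \<in> S'} T"
    (is "add_spans ?G T")
proof -
  interpret T: abelian_group T by (rule abelian_T)
  have SM: "S \<subseteq> carrier M" "S' \<subseteq> carrier N" using assms by (auto simp: add_spans_def)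
  have G: "?G \<subseteq> carrier T" using SM by (auto intro!: tens_in)
  note tb = biadditiveD[OF tens_biadditive]
  have t: "tens L M N x y \<in> add_span T ?G" if x: "x \<in> carrier M" and y: "y \<in> carrier N" for x y
    using assms(1) x
  proof (induction rule: add_spans_induct)
    show "abelian_group M" by (rule abelian_left)
    show "tens L M N \<zero>\<^bsub>M\<^esub> y \<in> add_span T ?G"
      using add_hom_zero[OF tb(2)[OF y] abelian_left abelian_T] by (simp add: add_span.zero)
  next
    fix x x' assume x: "x \<in> S" "x \<in> carrier M" "x' \<in> carrier M" "tens L M N x' y \<in> add_span T ?G"
    have "tens L M N x y \<in> add_span T ?G"
      using assms(2) y
    proof (induction rule: add_spans_induct)
      show "abelian_group N" by (rule abelian_right)
      show "tens L M N x \<zero>\<^bsub>N\<^esub> \<in> add_span T ?G"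
        using add_hom_zero[OF tb(1)[OF x(2)] abelian_right abelian_T] by (simp add: add_span.zero)
    qed (use x in \<open>auto simp: tb intro!: add_span.add\<close>)
    with x show "tens L M N (x \<oplus>\<^bsub>M\<^esub> x') y \<in> add_span T ?G"
      by (simp add: tb y) (rule T.add_span_plus[OF G])
  qed
  have m: "tens L M N x y \<oplus>\<^bsub>T\<^esub> tens L M N (\<ominus>\<^bsub>M\<^esub> x) y = \<zero>\<^bsub>T\<^esub>" if "x \<in> carrier M" "y \<in> carrier N" for x y
    using add_hom_neg[OF tb(2)[OF that(2)] abelian_left abelian_T that(1)] tens_in[OF that] by (simp add: T.r_neg)
  have null0: "null #>\<^bsub>FF\<^esub> 0 = \<zero>\<^bsub>T\<^esub>"
    using null.rcos_const[OF null.is_group subgroup.one_closed[OF normal_imp_subgroup[OF null_normal]]] by (simp add: tensor_simps(2))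
  have "null #>\<^bsub>FF\<^esub> c \<in> add_span T ?G \<and> null #>\<^bsub>FF\<^esub> (-c) \<in> add_span T ?G"
    if "Poly_Mapping.keys c \<subseteq> carrier M \<times> carrier N" for c
    using that
  proof (induction rule: free_Abelian_group_induct[consumes 1, case_names zero diff of])
    case zero
    show ?case by (simp add: null0 add_span.zero)
  next
    case (diff x y)
    have "null #>\<^bsub>FF\<^esub> (x - y) = (null #>\<^bsub>FF\<^esub> x) \<oplus>\<^bsub>T\<^esub> (null #>\<^bsub>FF\<^esub> -y)"
      "null #>\<^bsub>FF\<^esub> -(x - y) = (null #>\<^bsub>FF\<^esub> -x) \<oplus>\<^bsub>T\<^esub> (null #>\<^bsub>FF\<^esub> y)"
      using diff by (simp_all add: coset_add keys_minus)
    thus ?case using T.add_span_plus[OF G] diff by simp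
  next
    case (of a)
    then obtain x y where a: "a = (x, y)" "x \<in> carrier M" "y \<in> carrier N" by auto
    let ?n = "null #>\<^bsub>FF\<^esub> - frag_of (x, y)"
    have k: "Poly_Mapping.keys (frag_of (x, y)) \<subseteq> carrier M \<times> carrier N" using a by (simp add: keys_frag_of)
    have n: "?n \<in> carrier T"
      unfolding tensor_simps using k by (intro null.rcosetsI null.subset) (simp add: keys_minus)
    have tx: "tens L M N x y \<in> carrier T" "tens L M N (\<ominus>\<^bsub>M\<^esub> x) y \<in> carrier T" using a by (simp_all add: tens_in)
    have "tens L M N x y \<oplus>\<^bsub>T\<^esub> ?n = null #>\<^bsub>FF\<^esub> 0"
      unfolding tens_def using k by (subst coset_add) (simp_all add: keys_minus)
    hence "tens L M N x y \<oplus>\<^bsub>T\<^esub> ?n = \<zero>\<^bsub>T\<^esub>" by (simp only: null0)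
    hence "?n = tens L M N (\<ominus>\<^bsub>M\<^esub> x) y"
      using m[OF a(2,3)] n tx by (metis T.add.inv_unique T.a_comm)
    thus ?case using t[of x y] t[of "\<ominus>\<^bsub>M\<^esub> x" y] a by (simp add: tens_def)
  qed
  thus ?thesis using G unfolding add_spans_def tensor_simps(1) RCOSETS_def by auto
qed

lemma carrier_spans: "add_spans (carrier M) M" "add_spans (carrier N) N"
  by (auto simp: add_spans_def intro: left.add_span_base right.add_span_base)

text \<open>The value is independent of the representative because evaluation of formal combinations is
  additive and vanishes on each of the three kinds of relations.\<close>

lemma tensor_lift_coset:
  assumes "abelian_group Z" "balanced L M N Z f" "Poly_Mapping.keys c \<subseteq> carrier M \<times> carrier N"
  shows "tensor_lift Z f (null #>\<^bsub>FF\<^esub> c) = frag_eval Z (case_prod f) c"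
proof -
  interpret Z: abelian_group Z by fact
  let ?S = "carrier M \<times> carrier N" and ?f = "case_prod f"
  note fb = biadditiveD[OF assms(2)[unfolded balanced_def, THEN conjunct1]]
  have fc: "?f \<in> ?S \<rightarrow> carrier Z" using fb(3) by auto
  have fr: "frag_eval Z ?f r = \<zero>\<^bsub>Z\<^esub>" if "r \<in> tensor_rels L M N" for r
  proof -
    have [simp]: "frag_eval Z ?f (frag_of (x, y)) = f x y" if "x \<in> carrier M" "y \<in> carrier N" for x y
      using that fb(3) by (subst Z.frag_eval_of) auto
    have k: "Poly_Mapping.keys (frag_of (x, y)) \<subseteq> ?S \<longleftrightarrow> x \<in> carrier M \<and> y \<in> carrier N" for x y
      by (simp add: keys_frag_of)
    have k2: "Poly_Mapping.keys (frag_of p - frag_of q) \<subseteq> ?S" if "p \<in> ?S" "q \<in> ?S" for p q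
      using that keys_diff[of "frag_of p" "frag_of q"] by (auto simp: keys_frag_of)
    from that consider
        (l) x x' y where "r = frag_of (x \<oplus>\<^bsub>M\<^esub> x', y) - frag_of (x, y) - frag_of (x', y)"
          "x \<in> carrier M" "x' \<in> carrier M" "y \<in> carrier N"
      | (r) x y y' where "r = frag_of (x, y \<oplus>\<^bsub>N\<^esub> y') - frag_of (x, y) - frag_of (x, y')"
          "x \<in> carrier M" "y \<in> carrier N" "y' \<in> carrier N"
      | (m) x l y where "r = frag_of (ract M x l, y) - frag_of (x, lact N l y)"
          "x \<in> carrier M" "l \<in> carrier L" "y \<in> carrier N"
      unfolding tensor_rels_def by blast
    thus ?thesis
    proof cases
      case l
      thus ?thesis using fb(3)[of x y] fb(3)[of x' y] fb(3)[of "x \<oplus>\<^bsub>M\<^esub> x'" y] fb(4)[of x x' y]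
        by (simp add: Z.frag_eval_diff[OF _ _ fc] k k2)
           (simp add: a_minus_def Z.a_assoc Z.r_neg Z.a_lcomm[of "f x' y" "\<ominus>\<^bsub>Z\<^esub> f x y"])
    next
      case r
      thus ?thesis using fb(3)[of x y] fb(3)[of x y'] fb(3)[of x "y \<oplus>\<^bsub>N\<^esub> y'"] fb(5)[of x y y']
        by (simp add: Z.frag_eval_diff[OF _ _ fc] k k2)
           (simp add: a_minus_def Z.a_assoc Z.r_neg Z.a_lcomm[of "f x y'" "\<ominus>\<^bsub>Z\<^esub> f x y"])
    next
      case m
      moreover have "f (ract M x l) y = f x (lact N l y)" using m assms(2) by (simp add: balanced_def)
      ultimately show ?thesis using fb(3)[of x "lact N l y"]
        by (simp add: Z.frag_eval_diff[OF _ _ fc] k ract_in lact_in)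
           (simp add: a_minus_def Z.r_neg)
    qed
  qed
  have fn: "frag_eval Z ?f h = \<zero>\<^bsub>Z\<^esub>" if "h \<in> null" for h
    using that[unfolded tensor_null_def] rels_in
  proof (induction rule: generate_free_Abelian_induct)
    case zero show ?case by (rule Z.frag_eval_0)
  next
    case (inv r)
    have "Poly_Mapping.keys r \<subseteq> ?S" using subsetD[OF rels_in inv] by simp
    thus ?case using Z.frag_eval_diff[OF _ _ fc, of 0 r] fr[OF inv] by (simp add: Z.frag_eval_0 a_minus_def)
  next
    case (incl r) thus ?case by (rule fr)
  next
    case (add x y)
    show ?case using Z.frag_eval_add[OF add(1,2) fc] add(3,4) by simp
  qed
  have "frag_eval Z ?f d = frag_eval Z ?f c" if "d \<in> null #>\<^bsub>FF\<^esub> c" for d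
  proof -
    from that obtain h where h: "h \<in> null" "d = h + c" by (auto simp: r_coset_def)
    have "Poly_Mapping.keys h \<subseteq> ?S" using null.mem_carrier[OF h(1)] by simp
    thus ?thesis using Z.frag_eval_add[OF _ assms(3) fc, of h] fn[OF h(1)] Z.frag_eval_closed[OF assms(3) fc]
      unfolding h(2) by simp
  qed
  moreover have "c \<in> null #>\<^bsub>FF\<^esub> c" using assms(3) null.rcos_self[OF _ normal_imp_subgroup[OF null_normal], of c] by simp
  ultimately have "frag_eval Z ?f ` (null #>\<^bsub>FF\<^esub> c) = {frag_eval Z ?f c}" by blast
  thus ?thesis unfolding tensor_lift_def frag_eval_def by (simp add: case_prod_beta)
qed

text \<open>The existence half of the universal property; uniqueness is \<open>tens_spans\<close> with
  \<open>add_hom_eq_on_span\<close>.\<close>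

lemma
  assumes "abelian_group Z" "balanced L M N Z f"
  shows tensor_lift_hom: "tensor_lift Z f \<in> add_hom T Z"
    and tensor_lift_tens: "x \<in> carrier M \<Longrightarrow> y \<in> carrier N \<Longrightarrow> tensor_lift Z f (tens L M N x y) = f x y"
proof -
  interpret Z: abelian_group Z by fact
  let ?S = "carrier M \<times> carrier N" and ?f = "case_prod f"
  note fb = biadditiveD[OF assms(2)[unfolded balanced_def, THEN conjunct1]]
  have fc: "?f \<in> ?S \<rightarrow> carrier Z" using fb(3) by auto
  note tl = tensor_lift_coset[OF assms]
  show "tensor_lift Z f \<in> add_hom T Z"
  proof (rule add_homI)
    show "tensor_lift Z f u \<in> carrier Z" if "u \<in> carrier T" for u
      using that Z.frag_eval_closed[OF _ fc] by (auto simp: tensor_simps RCOSETS_def tl)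
    show "tensor_lift Z f (u \<oplus>\<^bsub>T\<^esub> v) = tensor_lift Z f u \<oplus>\<^bsub>Z\<^esub> tensor_lift Z f v"
      if uv: "u \<in> carrier T" "v \<in> carrier T" for u v
    proof -
      from uv obtain c d where cd: "Poly_Mapping.keys c \<subseteq> ?S" "u = null #>\<^bsub>FF\<^esub> c"
          "Poly_Mapping.keys d \<subseteq> ?S" "v = null #>\<^bsub>FF\<^esub> d"
        by (auto simp: tensor_simps RCOSETS_def)
      moreover have "Poly_Mapping.keys (c + d) \<subseteq> ?S" using cd keys_add[of c d] by blast
      ultimately show ?thesis by (simp add: coset_add tl Z.frag_eval_add[OF _ _ fc])
    qed
  qed
  show "tensor_lift Z f (tens L M N x y) = f x y" if "x \<in> carrier M" "y \<in> carrier N"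
    unfolding tens_def using that fb(3)[OF that] by (subst tl) (auto simp: keys_frag_of Z.frag_eval_of)
qed

end

lemma bimodule_tensor_ops:
  "smult (bimodule_tensor L M N) k = tensor_lift (tensor_ab L M N) (\<lambda>x y. tens L M N (k \<odot>\<^bsub>M\<^esub> x) y)"
  "lact (bimodule_tensor L M N) l = tensor_lift (tensor_ab L M N) (\<lambda>x y. tens L M N (lact M l x) y)"
  "ract (bimodule_tensor L M N) u l = tensor_lift (tensor_ab L M N) (\<lambda>x y. tens L M N x (ract N y l)) u"
  by (simp_all add: bimodule_tensor_def Let_def module.extend_def ring.extend_def module.defs ring.defs bimodule.defs)

lemma tensor_ab_simps:
  "carrier (tensor_ab L M N) = carrier (bimodule_tensor L M N)"
  "ring.zero (tensor_ab L M N) = ring.zero (bimodule_tensor L M N)"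
  "ring.add (tensor_ab L M N) = ring.add (bimodule_tensor L M N)"
  by (simp_all add: bimodule_tensor_def tensor_ab_def Let_def
      module.extend_def ring.extend_def)

context tensor_pair
begin

text \<open>The operations of a tensor product are lifts into a record that has the additive structure only,
  as the full record is not yet available when they are defined. As a target for lifts it is as
  good as the tensor product itself.\<close>

lemma
  assumes b: "balanced L M N T f"
  shows tensor_ab_lift_hom: "tensor_lift (tensor_ab L M N) f \<in> add_hom T T"
    and tensor_ab_lift_tens: "x \<in> carrier M \<Longrightarrow> y \<in> carrier N \<Longrightarrow> tensor_lift (tensor_ab L M N) f (tens L M N x y) = f x y"
proof -
  have ab: "abelian_group (tensor_ab L M N)" by (rule abelian_group_cong[OF abelian_T]) (simp_all add: tensor_ab_simps)
  have h: "add_hom P (tensor_ab L M N) = add_hom P T" for P :: "('c, 'd) ring_scheme"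
    by (rule add_hom_target_cong) (simp_all add: tensor_ab_simps)
  have b': "balanced L M N (tensor_ab L M N) f"
    using b unfolding balanced_def biadditive_def add_hom_def tensor_ab_simps .
  show "tensor_lift (tensor_ab L M N) f \<in> add_hom T T" using tensor_lift_hom[OF ab b'] by (simp add: h)
  show "x \<in> carrier M \<Longrightarrow> y \<in> carrier N \<Longrightarrow> tensor_lift (tensor_ab L M N) f (tens L M N x y) = f x y"
    by (rule tensor_lift_tens[OF ab b'])
qed

lemma balanced_tens_left:
  assumes "f \<in> add_hom M M" "\<And>x l. x \<in> carrier M \<Longrightarrow> l \<in> carrier L \<Longrightarrow> f (ract M x l) = ract M (f x) l"
  shows "balanced L M N T (\<lambda>x y. tens L M N (f x) y)"
  using assms(2) biadditiveD[OF tens_biadditive]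
  by (auto simp: balanced_def ract_in lact_in tens_middle add_hom_closed[OF assms(1)] add_hom_add[OF assms(1)] intro!: biadditiveI)

lemma balanced_tens_right:
  assumes "f \<in> add_hom N N" "\<And>y l. y \<in> carrier N \<Longrightarrow> l \<in> carrier L \<Longrightarrow> f (lact N l y) = lact N l (f y)"
  shows "balanced L M N T (\<lambda>x y. tens L M N x (f y))"
  using assms(2) biadditiveD[OF tens_biadditive]
  by (auto simp: balanced_def ract_in lact_in tens_middle add_hom_closed[OF assms(1)] add_hom_add[OF assms(1)] intro!: biadditiveI)

lemma
  assumes "smult M k \<in> add_hom M M" "\<And>x l. x \<in> carrier M \<Longrightarrow> l \<in> carrier L \<Longrightarrow> smult M k (ract M x l) = ract M (smult M k x) l"
  shows T_smult_hom: "smult T k \<in> add_hom T T"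
    and T_smult_tens: "x \<in> carrier M \<Longrightarrow> y \<in> carrier N \<Longrightarrow> k \<odot>\<^bsub>T\<^esub> tens L M N x y = tens L M N (k \<odot>\<^bsub>M\<^esub> x) y"
  unfolding bimodule_tensor_ops using balanced_tens_left[OF assms]
  by (simp_all add: tensor_ab_lift_hom tensor_ab_lift_tens)

lemma
  assumes "lact M k \<in> add_hom M M" "\<And>x l. x \<in> carrier M \<Longrightarrow> l \<in> carrier L \<Longrightarrow> lact M k (ract M x l) = ract M (lact M k x) l"
  shows T_lact_hom: "lact T k \<in> add_hom T T"
    and T_lact_tens: "x \<in> carrier M \<Longrightarrow> y \<in> carrier N \<Longrightarrow> lact T k (tens L M N x y) = tens L M N (lact M k x) y"
  unfolding bimodule_tensor_ops using balanced_tens_left[OF assms]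
  by (simp_all add: tensor_ab_lift_hom tensor_ab_lift_tens)

lemma
  assumes "(\<lambda>y. ract N y k) \<in> add_hom N N" "\<And>y l. y \<in> carrier N \<Longrightarrow> l \<in> carrier L \<Longrightarrow> ract N (lact N l y) k = lact N l (ract N y k)"
  shows T_ract_hom: "(\<lambda>u. ract T u k) \<in> add_hom T T"
    and T_ract_tens: "x \<in> carrier M \<Longrightarrow> y \<in> carrier N \<Longrightarrow> ract T (tens L M N x y) k = tens L M N x (ract N y k)"
  unfolding bimodule_tensor_ops using balanced_tens_right[OF assms]
  by (simp_all add: tensor_ab_lift_hom tensor_ab_lift_tens)

end

lemma
  assumes TP: "tensor_pair L M N" and TP': "tensor_pair L M' N'"
    and f: "f \<in> add_hom M M'" and g: "g \<in> add_hom N N'"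
    and mid: "\<And>x l y. x \<in> carrier M \<Longrightarrow> l \<in> carrier L \<Longrightarrow> y \<in> carrier N \<Longrightarrow>
      tens L M' N' (f (ract M x l)) (g y) = tens L M' N' (f x) (g (lact N l y))"
  shows tensor_map_hom: "tensor_map L M' N' f g \<in> add_hom (bimodule_tensor L M N) (bimodule_tensor L M' N')"
    and tensor_map_tens: "\<And>x y. x \<in> carrier M \<Longrightarrow> y \<in> carrier N \<Longrightarrow>
      tensor_map L M' N' f g (tens L M N x y) = tens L M' N' (f x) (g y)"
proof -
  note tb = biadditiveD(3-5)[OF tensor_pair.tens_biadditive[OF TP']]
  have b: "balanced L M N (bimodule_tensor L M' N') (\<lambda>x y. tens L M' N' (f x) (g y))"
    by (rule balancedI)
       (simp_all add: tb mid add_hom_closed[OF f] add_hom_closed[OF g] add_hom_add[OF f] add_hom_add[OF g])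
  note T' = tensor_pair.abelian_T[OF TP']
  show "tensor_map L M' N' f g \<in> add_hom (bimodule_tensor L M N) (bimodule_tensor L M' N')"
    unfolding tensor_map_def by (rule tensor_pair.tensor_lift_hom[OF TP T' b])
  show "\<And>x y. x \<in> carrier M \<Longrightarrow> y \<in> carrier N \<Longrightarrow>
      tensor_map L M' N' f g (tens L M N x y) = tens L M' N' (f x) (g y)"
    unfolding tensor_map_def by (rule tensor_pair.tensor_lift_tens[OF TP T' b])
qed

section \<open>Algebras given on an additive spanning set\<close>

text \<open>Both sides of each ring axiom are additive in every variable. Checking them on a spanning set
  replaces calculations with sums by calculations with single terms.\<close>

lemma ring_on_span:
  assumes ab: "abelian_group S" and ba: "biadditive S S S (monoid.mult S)" and one: "\<one>\<^bsub>S\<^esub> \<in> carrier S"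
    and sp: "add_spans G S"
    and assoc: "\<And>x y z. x \<in> G \<Longrightarrow> y \<in> G \<Longrightarrow> z \<in> G \<Longrightarrow> (x \<otimes>\<^bsub>S\<^esub> y) \<otimes>\<^bsub>S\<^esub> z = x \<otimes>\<^bsub>S\<^esub> (y \<otimes>\<^bsub>S\<^esub> z)"
    and unit: "\<And>x. x \<in> G \<Longrightarrow> \<one>\<^bsub>S\<^esub> \<otimes>\<^bsub>S\<^esub> x = x" "\<And>x. x \<in> G \<Longrightarrow> x \<otimes>\<^bsub>S\<^esub> \<one>\<^bsub>S\<^esub> = x"
  shows "ring S"
proof (rule ringI[OF ab])
  interpret abelian_group S by fact
  note ba = biadditiveD[OF ba]
  have G: "x \<in> carrier S" if "x \<in> G" for x using sp that by (auto simp: add_spans_def)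
  have L: "(\<lambda>x. x \<otimes>\<^bsub>S\<^esub> y) \<in> add_hom S S" and R: "(\<lambda>x. y \<otimes>\<^bsub>S\<^esub> x) \<in> add_hom S S" if "y \<in> carrier S" for y
    using ba(1,2)[OF that] by simp_all
  note eq = add_hom_eq_on_span[OF _ _ ab ab sp]
  show "Group.monoid S"
  proof (rule monoidI)
    fix x y z assume c: "x \<in> carrier S" "y \<in> carrier S" "z \<in> carrier S"
    have 1: "(x \<otimes>\<^bsub>S\<^esub> y) \<otimes>\<^bsub>S\<^esub> z = x \<otimes>\<^bsub>S\<^esub> (y \<otimes>\<^bsub>S\<^esub> z)" if "x \<in> G" "y \<in> G" for x y
      by (rule eq[OF R add_hom_compose[OF R R]]) (use that c in \<open>simp_all add: assoc G ba(3)\<close>)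
    have 2: "(x \<otimes>\<^bsub>S\<^esub> y) \<otimes>\<^bsub>S\<^esub> z = x \<otimes>\<^bsub>S\<^esub> (y \<otimes>\<^bsub>S\<^esub> z)" if "x \<in> G" for x
      by (rule eq[OF add_hom_compose[OF R L] add_hom_compose[OF L R]]) (use that c in \<open>simp_all add: 1 G ba(3)\<close>)
    show "(x \<otimes>\<^bsub>S\<^esub> y) \<otimes>\<^bsub>S\<^esub> z = x \<otimes>\<^bsub>S\<^esub> (y \<otimes>\<^bsub>S\<^esub> z)"
      by (rule eq[OF add_hom_compose[OF L L] L]) (use c in \<open>simp_all add: 2 G ba(3)\<close>)
  next
    fix x assume "x \<in> carrier S"
    show "\<one>\<^bsub>S\<^esub> \<otimes>\<^bsub>S\<^esub> x = x"
      by (rule eq[OF R[OF one] id_add_hom(2) unit(1)]) (auto intro: \<open>x \<in> carrier S\<close>)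
    show "x \<otimes>\<^bsub>S\<^esub> \<one>\<^bsub>S\<^esub> = x"
      by (rule eq[OF L[OF one] id_add_hom(2) unit(2)]) (auto intro: \<open>x \<in> carrier S\<close>)
  qed (use one ba(3) in auto)
qed (use biadditiveD(4,5)[OF ba] in auto)

lemma k_algebra_on_span:
  assumes F: "field K" and M: "module K S"
    and ba: "biadditive S S S (monoid.mult S)" and one: "\<one>\<^bsub>S\<^esub> \<in> carrier S"
    and sp: "add_spans G S"
    and assoc: "\<And>x y z. x \<in> G \<Longrightarrow> y \<in> G \<Longrightarrow> z \<in> G \<Longrightarrow> (x \<otimes>\<^bsub>S\<^esub> y) \<otimes>\<^bsub>S\<^esub> z = x \<otimes>\<^bsub>S\<^esub> (y \<otimes>\<^bsub>S\<^esub> z)"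
    and unit: "\<And>x. x \<in> G \<Longrightarrow> \<one>\<^bsub>S\<^esub> \<otimes>\<^bsub>S\<^esub> x = x" "\<And>x. x \<in> G \<Longrightarrow> x \<otimes>\<^bsub>S\<^esub> \<one>\<^bsub>S\<^esub> = x"
    and sm: "\<And>k x y. k \<in> carrier K \<Longrightarrow> x \<in> G \<Longrightarrow> y \<in> G \<Longrightarrow> (k \<odot>\<^bsub>S\<^esub> x) \<otimes>\<^bsub>S\<^esub> y = k \<odot>\<^bsub>S\<^esub> (x \<otimes>\<^bsub>S\<^esub> y)"
      "\<And>k x y. k \<in> carrier K \<Longrightarrow> x \<in> G \<Longrightarrow> y \<in> G \<Longrightarrow> x \<otimes>\<^bsub>S\<^esub> (k \<odot>\<^bsub>S\<^esub> y) = k \<odot>\<^bsub>S\<^esub> (x \<otimes>\<^bsub>S\<^esub> y)"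
  shows "k_algebra K S"
proof -
  interpret module K S by fact
  have ab: "abelian_group S" by unfold_locales
  note ba' = biadditiveD[OF ba]
  have s: "(\<lambda>x. k \<odot>\<^bsub>S\<^esub> x) \<in> add_hom S S" if "k \<in> carrier K" for k
    using that by (intro add_homI) (auto simp: smult_r_distr)
  have b1: "biadditive S S S (\<lambda>x y. (k \<odot>\<^bsub>S\<^esub> x) \<otimes>\<^bsub>S\<^esub> y)"
    "biadditive S S S (\<lambda>x y. x \<otimes>\<^bsub>S\<^esub> (k \<odot>\<^bsub>S\<^esub> y))" "biadditive S S S (\<lambda>x y. k \<odot>\<^bsub>S\<^esub> (x \<otimes>\<^bsub>S\<^esub> y))"
    if "k \<in> carrier K" for k
    using that by (auto intro!: biadditiveI simp: ba'(3-5) smult_r_distr)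
  show ?thesis
  proof (intro k_algebra.intro F M ring_on_span[OF ab ba one sp] k_algebra_axioms.intro)
    fix k x y assume c: "k \<in> carrier K" "x \<in> carrier S" "y \<in> carrier S"
    show "(k \<odot>\<^bsub>S\<^esub> x) \<otimes>\<^bsub>S\<^esub> y = k \<odot>\<^bsub>S\<^esub> (x \<otimes>\<^bsub>S\<^esub> y)"
      by (rule biadditive_eq_on_span[OF b1(1,3) ab ab ab sp sp sm(1)]) (use c in auto)
    show "x \<otimes>\<^bsub>S\<^esub> (k \<odot>\<^bsub>S\<^esub> y) = k \<odot>\<^bsub>S\<^esub> (x \<otimes>\<^bsub>S\<^esub> y)"
      by (rule biadditive_eq_on_span[OF b1(2,3) ab ab ab sp sp sm(2)]) (use c in auto)
  qed (use assoc unit in auto)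
qed

section \<open>Tensor products of algebras\<close>

lemma scalar_bimodule_simps [simp]:
  "carrier (scalar_bimodule A) = carrier A" "ring.zero (scalar_bimodule A) = ring.zero A"
  "ring.add (scalar_bimodule A) = ring.add A" "smult (scalar_bimodule A) = smult A"
  "lact (scalar_bimodule A) = smult A" "ract (scalar_bimodule A) = (\<lambda>x k. smult A k x)"
  by (simp_all add: scalar_bimodule_def module.extend_def bimodule.defs)

lemma algebra_tensor_simps:
  fixes K :: "('k, 'm) ring_scheme" and A :: "('k, 'a) module" and B :: "('k, 'b) module"
  defines "T \<equiv> bimodule_tensor K (scalar_bimodule A) (scalar_bimodule B)"
  shows "carrier (algebra_tensor K A B) = carrier T" "ring.zero (algebra_tensor K A B) = ring.zero T"
    "ring.add (algebra_tensor K A B) = ring.add T" "smult (algebra_tensor K A B) = smult T"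
    "monoid.one (algebra_tensor K A B) = ktens K A B \<one>\<^bsub>A\<^esub> \<one>\<^bsub>B\<^esub>"
    "monoid.mult (algebra_tensor K A B) u v =
       tensor_lift (module.truncate T) (\<lambda>a b. tensor_lift (module.truncate T) (\<lambda>a' b'.
           ktens K A B (a \<otimes>\<^bsub>A\<^esub> a') (b \<otimes>\<^bsub>B\<^esub> b')) v) u"
  by (simp_all add: algebra_tensor_def T_def Let_def module.truncate_def)

locale ktensor =
  fixes K :: "('k, 'm) ring_scheme" and A :: "('k, 'a) module" and B :: "('k, 'b) module"
  assumes algA: "k_algebra K A" and algB: "k_algebra K B"
begin

sublocale A: k_algebra K A by (rule algA)
sublocale B: k_algebra K B by (rule algB)

abbreviation "S \<equiv> algebra_tensor K A B"
abbreviation "tn \<equiv> ktens K A B"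

sublocale tp: tensor_pair K "scalar_bimodule A" "scalar_bimodule B"
proof (rule tensor_pair.intro)
  show "abelian_group (scalar_bimodule A)" by (rule abelian_group_cong[OF A.is_abelian_group]) simp_all
  show "abelian_group (scalar_bimodule B)" by (rule abelian_group_cong[OF B.is_abelian_group]) simp_all
qed simp_all

lemmas S_simps = algebra_tensor_simps[of K A B]

lemma abelian_S: "abelian_group S"
  by (rule abelian_group_cong[OF tp.abelian_T]) (simp_all add: S_simps)

sublocale S: abelian_group S by (rule abelian_S)

lemma hom_S: "add_hom S Z = add_hom tp.T Z" "add_hom Z' S = add_hom Z' tp.T"
  by (simp_all add: add_hom_def S_simps)

lemma spans_S: "add_spans U S = add_spans U tp.T"
proof
  assume "add_spans U S"
  thus "add_spans U tp.T" by (rule add_spans_cong) (simp_all add: S_simps)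
next
  assume "add_spans U tp.T"
  thus "add_spans U S" by (rule add_spans_cong) (simp_all add: S_simps)
qed

lemma tn_biadditive: "biadditive A B S tn"
  using tp.tens_biadditive unfolding biadditive_def ktens_def add_hom_def S_simps by simp

lemmas tn_add = biadditiveD(4,5)[OF tn_biadditive] and tn_in = biadditiveD(3)[OF tn_biadditive]

lemma tn_middle: "x \<in> carrier A \<Longrightarrow> k \<in> carrier K \<Longrightarrow> y \<in> carrier B \<Longrightarrow>
    tn (k \<odot>\<^bsub>A\<^esub> x) y = tn x (k \<odot>\<^bsub>B\<^esub> y)"
  using tp.tens_middle[of x k y] by (simp add: ktens_def)

lemma tn_spans:
  assumes "add_spans U A" "add_spans V B"
  shows "add_spans {tn x y | x y. x \<in> U \<and> y \<in> V} S"
proof -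
  have "add_spans U (scalar_bimodule A)" by (rule add_spans_cong[OF assms(1)]) simp_all
  moreover have "add_spans V (scalar_bimodule B)" by (rule add_spans_cong[OF assms(2)]) simp_all
  ultimately show ?thesis using tp.tens_spans unfolding spans_S ktens_def by blast
qed

abbreviation "G \<equiv> {tn x y | x y. x \<in> carrier A \<and> y \<in> carrier B}"

lemma S_spans: "add_spans G S"
  by (rule tn_spans) (auto simp: add_spans_def intro: A.add_span_base B.add_span_base)

lemma
  assumes "abelian_group Z" "biadditive A B Z f"
    "\<And>x k y. x \<in> carrier A \<Longrightarrow> k \<in> carrier K \<Longrightarrow> y \<in> carrier B \<Longrightarrow> f (k \<odot>\<^bsub>A\<^esub> x) y = f x (k \<odot>\<^bsub>B\<^esub> y)"
  shows S_lift_hom: "tensor_lift Z f \<in> add_hom S Z"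
    and S_lift_tn: "x \<in> carrier A \<Longrightarrow> y \<in> carrier B \<Longrightarrow> tensor_lift Z f (tn x y) = f x y"
proof -
  have b: "balanced K (scalar_bimodule A) (scalar_bimodule B) Z f"
    using assms(2,3) by (auto simp: balanced_def biadditive_def add_hom_def)
  show "tensor_lift Z f \<in> add_hom S Z" using tp.tensor_lift_hom[OF assms(1) b] by (simp add: hom_S)
  show "x \<in> carrier A \<Longrightarrow> y \<in> carrier B \<Longrightarrow> tensor_lift Z f (tn x y) = f x y"
    using tp.tensor_lift_tens[OF assms(1) b] by (simp add: ktens_def)
qed

lemma S_smult_hom: "k \<in> carrier K \<Longrightarrow> smult S k \<in> add_hom S S"
  and S_smult_tn: "k \<in> carrier K \<Longrightarrow> x \<in> carrier A \<Longrightarrow> y \<in> carrier B \<Longrightarrow> k \<odot>\<^bsub>S\<^esub> tn x y = tn (k \<odot>\<^bsub>A\<^esub> x) y"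
proof -
  assume k: "k \<in> carrier K"
  have 1: "smult (scalar_bimodule A) k \<in> add_hom (scalar_bimodule A) (scalar_bimodule A)"
    using k by (auto simp: add_hom_def A.smult_r_distr)
  have 2: "smult (scalar_bimodule A) k (ract (scalar_bimodule A) x l) = ract (scalar_bimodule A) (smult (scalar_bimodule A) k x) l"
    if "x \<in> carrier (scalar_bimodule A)" "l \<in> carrier K" for x l
    using k that by (simp add: A.smult_assoc1[symmetric] A.K.m_comm)
  show "smult S k \<in> add_hom S S" using tp.T_smult_hom[OF 1 2] by (simp add: hom_S S_simps)
  assume "x \<in> carrier A" "y \<in> carrier B"
  thus "k \<odot>\<^bsub>S\<^esub> tn x y = tn (k \<odot>\<^bsub>A\<^esub> x) y" using tp.T_smult_tens[OF 1 2, of x y] by (simp add: S_simps ktens_def)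
qed

lemma S_module: "module K S"
proof (rule moduleI)
  show "cring K" by (rule A.K.is_cring)
  show "abelian_group S" by (rule abelian_S)
  note eq = add_hom_eq_on_span[OF _ _ abelian_S abelian_S S_spans]
  note sm = S_smult_hom
  fix a b x y assume c: "a \<in> carrier K" "b \<in> carrier K" "x \<in> carrier S" "y \<in> carrier S"
  show "a \<odot>\<^bsub>S\<^esub> x \<in> carrier S" using add_hom_closed[OF sm] c by simp
  show "a \<odot>\<^bsub>S\<^esub> (x \<oplus>\<^bsub>S\<^esub> y) = a \<odot>\<^bsub>S\<^esub> x \<oplus>\<^bsub>S\<^esub> a \<odot>\<^bsub>S\<^esub> y" using add_hom_add[OF sm] c by simp
  show "(a \<oplus>\<^bsub>K\<^esub> b) \<odot>\<^bsub>S\<^esub> x = a \<odot>\<^bsub>S\<^esub> x \<oplus>\<^bsub>S\<^esub> b \<odot>\<^bsub>S\<^esub> x"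
    by (rule eq[OF sm add_hom_plus[OF sm sm]])
       (use c in \<open>auto simp: S_smult_tn A.smult_l_distr tn_add abelian_S\<close>)
  show "(a \<otimes>\<^bsub>K\<^esub> b) \<odot>\<^bsub>S\<^esub> x = a \<odot>\<^bsub>S\<^esub> (b \<odot>\<^bsub>S\<^esub> x)"
    by (rule eq[OF sm add_hom_compose[OF sm sm]])
       (use c in \<open>auto simp: S_smult_tn A.smult_assoc1 tn_add\<close>)
next
  fix x assume c: "x \<in> carrier S"
  show "\<one>\<^bsub>K\<^esub> \<odot>\<^bsub>S\<^esub> x = x"
    by (rule add_hom_eq_on_span[OF _ _ abelian_S abelian_S S_spans, OF S_smult_hom id_add_hom(2)])
       (use c in \<open>auto simp: S_smult_tn\<close>)
qed

text \<open>The product is a lift of a lift. The inner one exists for each pure tensor \<open>a \<otimes> b\<close> on the left;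
  that its value at a fixed \<open>v\<close> is balanced in \<open>a\<close> and \<open>b\<close> is checked on pure tensors \<open>v\<close>.\<close>

lemma
  shows S_mult_biadditive: "biadditive S S S (monoid.mult S)"
    and S_mult_tn: "\<lbrakk>a \<in> carrier A; b \<in> carrier B; a' \<in> carrier A; b' \<in> carrier B\<rbrakk> \<Longrightarrow>
      tn a b \<otimes>\<^bsub>S\<^esub> tn a' b' = tn (a \<otimes>\<^bsub>A\<^esub> a') (b \<otimes>\<^bsub>B\<^esub> b')"
proof -
  let ?Z = "module.truncate tp.T"
  have Zs: "carrier ?Z = carrier S" "ring.add ?Z = ring.add S" "ring.zero ?Z = ring.zero S"
    by (simp_all add: module.truncate_def S_simps)
  have abZ: "abelian_group ?Z" by (rule abelian_group_cong[OF abelian_S]) (simp_all add: Zs)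
  have hZ: "add_hom P ?Z = add_hom P S" for P :: "('c, 'd) ring_scheme" by (simp add: add_hom_def Zs)
  define inner where "inner a b = tensor_lift ?Z (\<lambda>a' b'. tn (a \<otimes>\<^bsub>A\<^esub> a') (b \<otimes>\<^bsub>B\<^esub> b'))" for a b
  have in_hom: "inner a b \<in> add_hom S S"
    and in_tn: "\<And>a' b'. a' \<in> carrier A \<Longrightarrow> b' \<in> carrier B \<Longrightarrow> inner a b (tn a' b') = tn (a \<otimes>\<^bsub>A\<^esub> a') (b \<otimes>\<^bsub>B\<^esub> b')"
    if ab: "a \<in> carrier A" "b \<in> carrier B" for a b
  proof -
    have 1: "biadditive A B ?Z (\<lambda>a' b'. tn (a \<otimes>\<^bsub>A\<^esub> a') (b \<otimes>\<^bsub>B\<^esub> b'))"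
      using ab by (intro biadditiveI) (auto simp: tn_in tn_add Zs A.r_distr B.r_distr)
    have 2: "tn (a \<otimes>\<^bsub>A\<^esub> (k \<odot>\<^bsub>A\<^esub> x)) (b \<otimes>\<^bsub>B\<^esub> y) = tn (a \<otimes>\<^bsub>A\<^esub> x) (b \<otimes>\<^bsub>B\<^esub> (k \<odot>\<^bsub>B\<^esub> y))"
      if "x \<in> carrier A" "k \<in> carrier K" "y \<in> carrier B" for x k y
      using ab that by (simp add: A.smult_mult_right B.smult_mult_right tn_middle)
    show "inner a b \<in> add_hom S S" using S_lift_hom[OF abZ 1 2] by (simp add: hZ inner_def)
    show "\<And>a' b'. a' \<in> carrier A \<Longrightarrow> b' \<in> carrier B \<Longrightarrow> inner a b (tn a' b') = tn (a \<otimes>\<^bsub>A\<^esub> a') (b \<otimes>\<^bsub>B\<^esub> b')"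
      using S_lift_tn[OF abZ 1 2] by (simp add: inner_def)
  qed
  have m: "u \<otimes>\<^bsub>S\<^esub> v = tensor_lift ?Z (\<lambda>a b. inner a b v) u" for u v
    by (simp add: S_simps(6) inner_def)
  note eq = add_hom_eq_on_span[OF _ _ abelian_S abelian_S S_spans]
  have o1: "biadditive A B ?Z (\<lambda>a b. inner a b v)" if v: "v \<in> carrier S" for v
  proof (rule biadditiveI)
    fix x x' y assume c: "x \<in> carrier A" "x' \<in> carrier A" "y \<in> carrier B"
    have "inner (x \<oplus>\<^bsub>A\<^esub> x') y v = inner x y v \<oplus>\<^bsub>S\<^esub> inner x' y v"
      by (rule eq[OF in_hom add_hom_plus[OF in_hom in_hom]])
         (use c v in \<open>auto simp: in_tn tn_add A.l_distr abelian_S\<close>)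
    thus "inner (x \<oplus>\<^bsub>A\<^esub> x') y v = inner x y v \<oplus>\<^bsub>?Z\<^esub> inner x' y v" by (simp add: Zs)
  next
    fix x y y' assume c: "x \<in> carrier A" "y \<in> carrier B" "y' \<in> carrier B"
    have "inner x (y \<oplus>\<^bsub>B\<^esub> y') v = inner x y v \<oplus>\<^bsub>S\<^esub> inner x y' v"
      by (rule eq[OF in_hom add_hom_plus[OF in_hom in_hom]])
         (use c v in \<open>auto simp: in_tn tn_add B.l_distr abelian_S\<close>)
    thus "inner x (y \<oplus>\<^bsub>B\<^esub> y') v = inner x y v \<oplus>\<^bsub>?Z\<^esub> inner x y' v" by (simp add: Zs)
  next
    fix x y assume "x \<in> carrier A" "y \<in> carrier B"
    thus "inner x y v \<in> carrier ?Z" using add_hom_closed[OF in_hom v] by (simp add: Zs)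
  qed
  have o2: "inner (k \<odot>\<^bsub>A\<^esub> x) y v = inner x (k \<odot>\<^bsub>B\<^esub> y) v"
      if "x \<in> carrier A" "k \<in> carrier K" "y \<in> carrier B" "v \<in> carrier S" for x k y v
    by (rule eq[OF in_hom in_hom])
       (use that in \<open>auto simp: in_tn A.smult_mult_left B.smult_mult_left tn_middle\<close>)
  have mh: "(\<lambda>u. u \<otimes>\<^bsub>S\<^esub> v) \<in> add_hom S S"
    and mt: "\<And>a b. a \<in> carrier A \<Longrightarrow> b \<in> carrier B \<Longrightarrow> tn a b \<otimes>\<^bsub>S\<^esub> v = inner a b v"
    if v: "v \<in> carrier S" for v
    using S_lift_hom[OF abZ o1[OF v] o2[OF _ _ _ v]] S_lift_tn[OF abZ o1[OF v] o2[OF _ _ _ v]] by (simp_all add: m hZ)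
  show "\<lbrakk>a \<in> carrier A; b \<in> carrier B; a' \<in> carrier A; b' \<in> carrier B\<rbrakk> \<Longrightarrow>
      tn a b \<otimes>\<^bsub>S\<^esub> tn a' b' = tn (a \<otimes>\<^bsub>A\<^esub> a') (b \<otimes>\<^bsub>B\<^esub> b')" by (simp add: mt tn_in in_tn)
  show "biadditive S S S (monoid.mult S)"
  proof (rule biadditiveI)
    fix u v w assume c: "u \<in> carrier S" "v \<in> carrier S" "w \<in> carrier S"
    show "u \<otimes>\<^bsub>S\<^esub> v \<in> carrier S" using add_hom_closed[OF mh[OF c(2)] c(1)] .
    show "(u \<oplus>\<^bsub>S\<^esub> v) \<otimes>\<^bsub>S\<^esub> w = u \<otimes>\<^bsub>S\<^esub> w \<oplus>\<^bsub>S\<^esub> v \<otimes>\<^bsub>S\<^esub> w" using add_hom_add[OF mh] c by simp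
    show "u \<otimes>\<^bsub>S\<^esub> (v \<oplus>\<^bsub>S\<^esub> w) = u \<otimes>\<^bsub>S\<^esub> v \<oplus>\<^bsub>S\<^esub> u \<otimes>\<^bsub>S\<^esub> w"
      by (rule eq[OF mh add_hom_plus[OF mh mh]])
         (use c in \<open>auto simp: mt add_hom_add[OF in_hom] abelian_S\<close>)
  qed
qed

lemma S_algebra: "k_algebra K S"
proof (rule k_algebra_on_span[OF _ S_module S_mult_biadditive _ S_spans])
  show "field K" by (rule A.K.field_axioms)
  show "\<one>\<^bsub>S\<^esub> \<in> carrier S" by (simp add: S_simps(5) tn_in)
qed (auto simp: S_mult_tn S_simps(5) A.m_assoc B.m_assoc S_smult_tn A.smult_mult_left A.smult_mult_right)

end

lemma op_algebra_simps [simp]: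
  "carrier (op_algebra A) = carrier A" "ring.zero (op_algebra A) = ring.zero A"
  "ring.add (op_algebra A) = ring.add A" "smult (op_algebra A) = smult A"
  "\<one>\<^bsub>op_algebra A\<^esub> = \<one>\<^bsub>A\<^esub>" "x \<otimes>\<^bsub>op_algebra A\<^esub> y = y \<otimes>\<^bsub>A\<^esub> x"
  by (simp_all add: op_algebra_def)

lemma op_algebra_algebra:
  assumes "k_algebra K A" shows "k_algebra K (op_algebra A)"
proof -
  interpret A: k_algebra K A by fact
  have ab: "abelian_group (op_algebra A)" by (rule abelian_group_cong[OF A.is_abelian_group]) simp_all
  show ?thesis
  proof (intro k_algebra.intro moduleI ringI monoidI k_algebra_axioms.intro)
    show "field K" by (rule A.K.field_axioms)
  qed (auto simp: ab A.K.is_cring A.smult_l_distr A.smult_r_distr A.smult_assoc1 A.m_assoc A.l_distr A.r_distr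
     A.smult_mult_left A.smult_mult_right)
qed

section \<open>Free modules\<close>

lemma free_module_simps:
  "carrier (free_module K B) = {f. (\<forall>b. f b \<in> carrier K) \<and> finite (supp K f) \<and> supp K f \<subseteq> B}"
  "ring.zero (free_module K B) = (\<lambda>b. \<zero>\<^bsub>K\<^esub>)"
  "ring.add (free_module K B) = (\<lambda>f g b. f b \<oplus>\<^bsub>K\<^esub> g b)"
  "smult (free_module K B) = (\<lambda>k f b. k \<otimes>\<^bsub>K\<^esub> f b)"
  by (simp_all add: free_module_def)

lemma free_module_module:
  assumes "cring K"
  shows "module K (free_module K B)"
proof -
  interpret cring K by fact
  let ?V = "free_module K B"
  have sup: "supp K (\<lambda>b. f b \<oplus>\<^bsub>K\<^esub> g b) \<subseteq> supp K f \<union> supp K g"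
      if "\<forall>b. f b \<in> carrier K" "\<forall>b. g b \<in> carrier K" for f g
    using that by (auto simp: supp_def)
  have plus: "f \<oplus>\<^bsub>?V\<^esub> g \<in> carrier ?V" if "f \<in> carrier ?V" "g \<in> carrier ?V" for f g
    using that sup[of f g] by (auto simp: free_module_simps intro: finite_subset)
  have sm: "k \<odot>\<^bsub>?V\<^esub> f \<in> carrier ?V" if "f \<in> carrier ?V" "k \<in> carrier K" for f k
  proof -
    have "supp K (\<lambda>b. k \<otimes>\<^bsub>K\<^esub> f b) \<subseteq> supp K f" using that by (auto simp: supp_def)
    thus ?thesis using that by (auto simp: free_module_simps intro: finite_subset)
  qed
  have zero: "\<zero>\<^bsub>?V\<^esub> \<in> carrier ?V" by (simp add: free_module_simps supp_def)
  have pt: "f b \<in> carrier K" if "f \<in> carrier ?V" for f b using that by (simp add: free_module_simps)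
  note op = free_module_simps(2-4)
  have ab: "abelian_group ?V"
  proof (rule abelian_groupI)
    show "\<exists>g\<in>carrier ?V. g \<oplus>\<^bsub>?V\<^esub> f = \<zero>\<^bsub>?V\<^esub>" if f: "f \<in> carrier ?V" for f
    proof (rule bexI)
      show "(\<ominus>\<^bsub>K\<^esub> \<one>\<^bsub>K\<^esub>) \<odot>\<^bsub>?V\<^esub> f \<in> carrier ?V" using f by (rule sm) simp
      show "(\<ominus>\<^bsub>K\<^esub> \<one>\<^bsub>K\<^esub>) \<odot>\<^bsub>?V\<^esub> f \<oplus>\<^bsub>?V\<^esub> f = \<zero>\<^bsub>?V\<^esub>"
        using pt[OF f] by (simp add: op l_minus l_neg)
    qed
  qed (simp_all only: plus zero, simp_all add: op pt a_ac)
  show ?thesis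
    by (rule moduleI)
       (simp_all only: assms ab sm, simp_all add: op pt l_distr r_distr m_assoc)
qed

text \<open>The extension is only additive: \<open>\<phi> i\<close> is any additive map on the line spanned by the basis vector
  \<open>i\<close>, so that targets without scalars are allowed.\<close>

definition lin_ext :: "('k, 'm) ring_scheme \<Rightarrow> ('c, 'p) ring_scheme \<Rightarrow> ('b \<Rightarrow> 'k \<Rightarrow> 'c) \<Rightarrow> ('b \<Rightarrow> 'k) \<Rightarrow> 'c"
  where "lin_ext K Z \<phi> f = (\<Oplus>\<^bsub>Z\<^esub>i\<in>supp K f. \<phi> i (f i))"

locale free_mod =
  fixes K :: "('k, 'm) ring_scheme" and B :: "'b set"
  assumes cringK: "cring K"
begin

sublocale K: cring K by (rule cringK)

abbreviation "V \<equiv> free_module K B"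

sublocale V: module K V by (rule free_module_module[OF cringK])

abbreviation bv :: "'k \<Rightarrow> 'b \<Rightarrow> 'b \<Rightarrow> 'k" where "bv k i \<equiv> k \<odot>\<^bsub>V\<^esub> basis_vec K i"

lemma bv_eq: "k \<in> carrier K \<Longrightarrow> bv k i = (\<lambda>j. if j = i then k else \<zero>\<^bsub>K\<^esub>)"
  by (auto simp: free_module_simps basis_vec_def)

lemma basis_vec_in: "i \<in> B \<Longrightarrow> basis_vec K i \<in> carrier V"
proof -
  assume "i \<in> B"
  moreover have "supp K (basis_vec K i) \<subseteq> {i}" by (auto simp: supp_def basis_vec_def)
  ultimately show ?thesis using finite_subset[of "supp K (basis_vec K i)" "{i}"] unfolding free_module_simps by (auto simp: basis_vec_def)
qed

lemma bv_in: "k \<in> carrier K \<Longrightarrow> i \<in> B \<Longrightarrow> bv k i \<in> carrier V"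
  by (intro V.smult_closed basis_vec_in)

lemma V_spans: "add_spans {bv k i | k i. k \<in> carrier K \<and> i \<in> B} V"
proof -
  let ?S = "{bv k i | k i. k \<in> carrier K \<and> i \<in> B}"
  have "f \<in> add_span V ?S" if "finite F" "f \<in> carrier V" "supp K f \<subseteq> F" for F f
    using that
  proof (induction F arbitrary: f rule: finite_induct)
    case empty
    hence "f = \<zero>\<^bsub>V\<^esub>" by (auto simp: free_module_simps supp_def fun_eq_iff)
    thus ?case by (simp only: add_span.zero)
  next
    case (insert i F)
    have fi: "f j \<in> carrier K" for j using insert.prems by (simp add: free_module_simps)
    show ?case
    proof (cases "f i = \<zero>\<^bsub>K\<^esub>")
      case True
      hence "supp K f \<subseteq> F" using insert.prems by (auto simp: supp_def)
      thus ?thesis using insert by auto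
    next
      case False
      hence iB: "i \<in> B" using insert.prems by (auto simp: free_module_simps supp_def)
      let ?g = "f(i := \<zero>\<^bsub>K\<^esub>)"
      have sg: "supp K ?g \<subseteq> supp K f" "supp K ?g \<subseteq> F" using insert.prems by (auto simp: supp_def)
      have "?g \<in> carrier V" using insert.prems sg(1) by (auto simp: free_module_simps intro: finite_subset)
      hence g: "?g \<in> add_span V ?S" using insert sg by auto
      have eq: "f = bv (f i) i \<oplus>\<^bsub>V\<^esub> ?g" unfolding bv_eq[OF fi] using fi by (auto simp: free_module_simps(3) fun_eq_iff)
      moreover have "bv (f i) i \<in> ?S" using iB fi by blast
      ultimately show ?thesis by (subst eq) (rule add_span.add[OF _ g])
    qed
  qed
  moreover have "finite (supp K f)" if "f \<in> carrier V" for f using that by (simp add: free_module_simps)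
  ultimately have "carrier V \<subseteq> add_span V ?S" by blast
  moreover have "?S \<subseteq> carrier V" using bv_in by auto
  ultimately show ?thesis by (simp add: add_spans_def)
qed

lemma
  assumes Z: "abelian_group Z" and \<phi>: "\<And>i. i \<in> B \<Longrightarrow> \<phi> i \<in> add_hom K Z"
  shows lin_ext_hom: "lin_ext K Z \<phi> \<in> add_hom V Z"
    and lin_ext_bv: "i \<in> B \<Longrightarrow> k \<in> carrier K \<Longrightarrow> lin_ext K Z \<phi> (bv k i) = \<phi> i k"
proof -
  interpret Z: abelian_group Z by fact
  have Kab: "abelian_group K" by (rule K.is_abelian_group)
  have p0: "\<phi> i \<zero>\<^bsub>K\<^esub> = \<zero>\<^bsub>Z\<^esub>" if "i \<in> B" for i by (rule add_hom_zero[OF \<phi>[OF that] Kab Z])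
  have pc: "\<phi> i k \<in> carrier Z" if "i \<in> B" "k \<in> carrier K" for i k using add_hom_closed[OF \<phi>] that by blast
  have super: "lin_ext K Z \<phi> f = (\<Oplus>\<^bsub>Z\<^esub>i\<in>F. \<phi> i (f i))"
    if "finite F" "supp K f \<subseteq> F" "F \<subseteq> B" "\<forall>b. f b \<in> carrier K" for f F
    unfolding lin_ext_def
    by (rule Z.add.finprod_mono_neutral_cong_left) (use that pc p0 in \<open>auto simp: supp_def\<close>)
  show "lin_ext K Z \<phi> \<in> add_hom V Z"
  proof (rule add_homI)
    fix f g assume fg: "f \<in> carrier V" "g \<in> carrier V"
    let ?F = "supp K f \<union> supp K g"
    have c: "f b \<in> carrier K" "g b \<in> carrier K" for b using fg by (auto simp: free_module_simps)
    have F: "finite ?F" "?F \<subseteq> B" using fg by (auto simp: free_module_simps)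
    have s: "supp K (f \<oplus>\<^bsub>V\<^esub> g) \<subseteq> ?F" using c by (auto simp: supp_def free_module_simps(3))
    have "lin_ext K Z \<phi> (f \<oplus>\<^bsub>V\<^esub> g) = (\<Oplus>\<^bsub>Z\<^esub>i\<in>?F. \<phi> i ((f \<oplus>\<^bsub>V\<^esub> g) i))"
      by (rule super) (use F s c in \<open>auto simp: free_module_simps(3)\<close>)
    also have "\<dots> = (\<Oplus>\<^bsub>Z\<^esub>i\<in>?F. \<phi> i (f i) \<oplus>\<^bsub>Z\<^esub> \<phi> i (g i))"
      by (rule Z.finsum_cong') (use F c pc in \<open>auto simp: free_module_simps(3) add_hom_add[OF \<phi>]\<close>)
    also have "\<dots> = (\<Oplus>\<^bsub>Z\<^esub>i\<in>?F. \<phi> i (f i)) \<oplus>\<^bsub>Z\<^esub> (\<Oplus>\<^bsub>Z\<^esub>i\<in>?F. \<phi> i (g i))"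
      by (rule Z.finsum_addf) (use F c pc in auto)
    also have "\<dots> = lin_ext K Z \<phi> f \<oplus>\<^bsub>Z\<^esub> lin_ext K Z \<phi> g"
      using F c by (subst (1 2) super[of ?F]) auto
    finally show "lin_ext K Z \<phi> (f \<oplus>\<^bsub>V\<^esub> g) = lin_ext K Z \<phi> f \<oplus>\<^bsub>Z\<^esub> lin_ext K Z \<phi> g" .
  next
    fix f assume "f \<in> carrier V"
    thus "lin_ext K Z \<phi> f \<in> carrier Z" unfolding lin_ext_def
      by (intro Z.finsum_closed) (auto simp: free_module_simps intro!: pc)
  qed
  assume ik: "i \<in> B" "k \<in> carrier K"
  have "lin_ext K Z \<phi> (bv k i) = (\<Oplus>\<^bsub>Z\<^esub>j\<in>{i}. \<phi> j (bv k i j))"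
    unfolding bv_eq[OF ik(2)] by (rule super) (use ik in \<open>auto simp: supp_def\<close>)
  also have "\<dots> = \<phi> i k" unfolding bv_eq[OF ik(2)] using ik pc by simp
  finally show "lin_ext K Z \<phi> (bv k i) = \<phi> i k" .
qed

end

section \<open>Paths\<close>

lemma qpaths_cases:
  assumes "p \<in> qpaths Q m"
  obtains (Triv) l where "m = 0" "p = Triv l" "l \<in> verts Q"
  | (Arrows) qs where "m > 0" "p = Arrows qs" "length qs = m" "qs \<noteq> []" "set qs \<subseteq> arcs Q"
      "\<And>i. Suc i < m \<Longrightarrow> head Q (qs ! i) = tail Q (qs ! Suc i)"
  using assms unfolding qpaths_def by (cases "m = 0") auto

lemma qpaths_0: "qpaths Q 0 = Triv ` verts Q" by (simp add: qpaths_def)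

lemma Arrows_in_qpaths: "Arrows qs \<in> qpaths Q m \<longleftrightarrow> qs \<noteq> [] \<and> length qs = m \<and> set qs \<subseteq> arcs Q \<and>
    (\<forall>i. Suc i < m \<longrightarrow> head Q (qs ! i) = tail Q (qs ! Suc i))"
  unfolding qpaths_def by auto

lemma qconcat_in_qpaths:
  assumes "p \<in> qpaths Q m" "p' \<in> qpaths Q n" "qtarget Q p = qsource Q p'"
  shows "qconcat p p' \<in> qpaths Q (m + n)"
  using assms(1)
proof (cases rule: qpaths_cases)
  case (Triv l) thus ?thesis using assms by simp
next
  case p: (Arrows qs)
  show ?thesis using assms(2)
  proof (cases rule: qpaths_cases)
    case (Triv l) thus ?thesis using assms p by simp
  next
    case p': (Arrows qs')
    have "head Q ((qs @ qs') ! i) = tail Q ((qs @ qs') ! Suc i)" if "Suc i < m + n" for i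
    proof -
      consider "Suc i < m" | "Suc i = m" | "i \<ge> m" by linarith
      thus ?thesis
      proof cases
        case 2
        thus ?thesis using assms(3) p p' by (auto simp: nth_append last_conv_nth hd_conv_nth)
      next
        case 3
        hence "Suc (i - m) < n" using that by simp
        from p'(6)[OF this] show ?thesis using 3 p by (simp add: nth_append Suc_diff_le)
      qed (use p in \<open>auto simp: nth_append\<close>)
    qed
    thus ?thesis using p p' by (auto simp: Arrows_in_qpaths)
  qed
qed

lemma qsource_qconcat:
  "p \<in> qpaths Q m \<Longrightarrow> p' \<in> qpaths Q n \<Longrightarrow> qtarget Q p = qsource Q p' \<Longrightarrow> qsource Q (qconcat p p') = qsource Q p"
  by (auto elim!: qpaths_cases)

lemma qtarget_qconcat:
  "p \<in> qpaths Q m \<Longrightarrow> p' \<in> qpaths Q n \<Longrightarrow> qtarget Q p = qsource Q p' \<Longrightarrow> qtarget Q (qconcat p p') = qtarget Q p'"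
  by (auto elim!: qpaths_cases)

lemma qconcat_assoc: "qconcat (qconcat p q) r = qconcat p (qconcat q r)"
  by (cases p; cases q; cases r) auto

lemma qconcat_Triv: "qconcat p (Triv (qtarget Q p)) = p"
  by (cases p) auto

text \<open>Recovers \<open>m\<close> from a path in \<open>Q\<^sup>(\<^sup>m\<^sup>)\<close>, so that sums over paths of the same length can be written
  as functions of the path alone.\<close>

definition qlength :: "('l, 'q) qpath \<Rightarrow> nat"
  where "qlength p = (case p of Triv _ \<Rightarrow> 0 | Arrows qs \<Rightarrow> length qs)"

lemma qlength_eq: "p \<in> qpaths Q m \<Longrightarrow> qlength p = m"
  by (auto simp: qlength_def elim!: qpaths_cases)

lemma qsource_in: "wf_digraph Q \<Longrightarrow> p \<in> qpaths Q m \<Longrightarrow> qsource Q p \<in> verts Q"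
  by (auto elim!: qpaths_cases simp: wf_digraph.tail_in_verts subset_iff)

lemma qtarget_in: "wf_digraph Q \<Longrightarrow> p \<in> qpaths Q m \<Longrightarrow> qtarget Q p \<in> verts Q"
  by (auto elim!: qpaths_cases simp: wf_digraph.head_in_verts subset_iff)

lemma finite_qpaths: "fin_digraph Q \<Longrightarrow> finite (qpaths Q m)"
proof -
  assume "fin_digraph Q"
  then interpret fin_digraph Q .
  have "finite {qs. set qs \<subseteq> arcs Q \<and> length qs = m}" by (rule finite_lists_length_eq) simp
  hence "finite (Arrows ` {qs. set qs \<subseteq> arcs Q \<and> length qs = m} :: ('a, 'b) qpath set)" by (rule finite_imageI)
  hence "finite (Triv ` verts Q \<union> Arrows ` {qs. set qs \<subseteq> arcs Q \<and> length qs = m})" by simp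
  moreover have "qpaths Q m \<subseteq> Triv ` verts Q \<union> Arrows ` {qs. set qs \<subseteq> arcs Q \<and> length qs = m}"
    by (auto simp: qpaths_def)
  ultimately show ?thesis by (rule finite_subset[rotated])
qed

lemma qconcat_inj:
  assumes "u \<in> qpaths Q m" "u' \<in> qpaths Q m" "v \<in> qpaths Q n" "v' \<in> qpaths Q n"
    "qtarget Q u = qsource Q v" "qtarget Q u' = qsource Q v'" "qconcat u v = qconcat u' v'"
  shows "u = u' \<and> v = v'"
proof (cases "m = 0")
  case True
  then obtain l l' where "u = Triv l" "u' = Triv l'" using assms(1,2) by (auto simp: qpaths_0)
  thus ?thesis using assms(5-7) by simp
next
  case m: False
  then obtain us us' where u: "u = Arrows us" "length us = m" "u' = Arrows us'" "length us' = m"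
    using assms(1,2) by (metis less_numeral_extra(3) qpaths_cases)
  show ?thesis
  proof (cases "n = 0")
    case True
    then obtain l l' where "v = Triv l" "v' = Triv l'" using assms(3,4) by (auto simp: qpaths_0)
    thus ?thesis using assms(5-7) u by auto
  next
    case False
    then obtain vs vs' where "v = Arrows vs" "v' = Arrows vs'"
      using assms(3,4) by (metis less_numeral_extra(3) qpaths_cases)
    thus ?thesis using assms(7) u by simp
  qed
qed

text \<open>This unique splitting of a path at a given length is what makes the comultiplication
  multiplicative.\<close>

lemma qconcat_bij:
  assumes "wf_digraph Q"
  shows "bij_betw (\<lambda>(u, v). qconcat u v)
    {(u, v). u \<in> qpaths Q m \<and> v \<in> qpaths Q n \<and> qtarget Q u = qsource Q v} (qpaths Q (m + n))"
  unfolding bij_betw_def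
proof (intro conjI subset_antisym subsetI)
  show "inj_on (\<lambda>(u, v). qconcat u v) {(u, v). u \<in> qpaths Q m \<and> v \<in> qpaths Q n \<and> qtarget Q u = qsource Q v}"
  proof (rule inj_onI)
    fix x y
    assume xy: "x \<in> {(u, v). u \<in> qpaths Q m \<and> v \<in> qpaths Q n \<and> qtarget Q u = qsource Q v}"
      "y \<in> {(u, v). u \<in> qpaths Q m \<and> v \<in> qpaths Q n \<and> qtarget Q u = qsource Q v}"
      "(case x of (u, v) \<Rightarrow> qconcat u v) = (case y of (u, v) \<Rightarrow> qconcat u v)"
    thus "x = y" using qconcat_inj[of "fst x" Q m "fst y" "snd x" n "snd y"] by (simp add: case_prod_beta prod_eq_iff)
  qed
next
  fix p assume p: "p \<in> qpaths Q (m + n)"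
  have "\<exists>u v. u \<in> qpaths Q m \<and> v \<in> qpaths Q n \<and> qtarget Q u = qsource Q v \<and> p = qconcat u v"
  proof (cases "m = 0 \<or> n = 0")
    case True
    thus ?thesis
    proof
      assume "m = 0"
      moreover have "qconcat (Triv (qsource Q p)) p = p" by simp
      ultimately show ?thesis using p qsource_in[OF assms p]
        by (intro exI[of _ "Triv (qsource Q p)"] exI[of _ p]) (auto simp: qpaths_0)
    next
      assume "n = 0"
      thus ?thesis using p qtarget_in[OF assms p]
        by (intro exI[of _ p] exI[of _ "Triv (qtarget Q p)"]) (auto simp: qpaths_0 qconcat_Triv)
    qed
  next
    case False
    from p False obtain qs where qs: "p = Arrows qs" "length qs = m + n" "set qs \<subseteq> arcs Q"
      "\<And>i. Suc i < m + n \<Longrightarrow> head Q (qs ! i) = tail Q (qs ! Suc i)"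
      by (auto elim!: qpaths_cases)
    have "take m qs \<noteq> []" "drop m qs \<noteq> []" using False qs by auto
    moreover have "Arrows (take m qs) \<in> qpaths Q m" "Arrows (drop m qs) \<in> qpaths Q n"
      using False qs set_take_subset[of m qs] set_drop_subset[of m qs] by (auto simp: Arrows_in_qpaths simp del: set_take_subset)
    moreover have "head Q (last (take m qs)) = tail Q (hd (drop m qs))"
    proof -
      have "last (take m qs) = qs ! (m - 1)"
        using False qs(2) by (subst last_conv_nth) auto
      thus ?thesis using False qs(2) qs(4)[of "m - 1"] by (simp add: hd_drop_conv_nth)
    qed
    ultimately show ?thesis using qs(1)
      by (intro exI[of _ "Arrows (take m qs)"] exI[of _ "Arrows (drop m qs)"]) auto
  qed
  thus "p \<in> (\<lambda>(u, v). qconcat u v) ` {(u, v). u \<in> qpaths Q m \<and> v \<in> qpaths Q n \<and> qtarget Q u = qsource Q v}"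
    by auto
qed (auto intro: qconcat_in_qpaths)

section \<open>The algebra of pairs of paths\<close>

locale weighted_quiver =
  fixes K :: "'k ring" and R :: "('k, 'r) module" (structure) and Q :: "('l, 'q) pre_digraph"
    and w :: "'q \<Rightarrow> 'q \<Rightarrow> 'q \<Rightarrow> 'q \<Rightarrow> 'r"
  assumes fieldK: "field K"
    and algR: "k_algebra K R"
    and finQ: "fin_digraph Q"
    and w_in: "\<And>a b c d. \<lbrakk>(a, b) \<in> arrow_pairs Q; (c, d) \<in> arrow_pairs Q\<rbrakk> \<Longrightarrow> w a b c d \<in> carrier R"
begin

sublocale R: k_algebra K R by (rule algR)

lemma wfQ: "wf_digraph Q"
  using finQ by (simp add: fin_digraph_def)

lemma finV: "finite (verts Q)" by (rule fin_digraph.finite_verts[OF finQ])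

abbreviation "Bs \<equiv> (\<Union>m. qpaths Q m \<times> qpaths Q m)"

sublocale fm: free_mod K Bs by (rule free_mod.intro) (rule R.K.is_cring)

abbreviation "G \<equiv> G_alg K Q"

lemma G_simps:
  "carrier G = carrier fm.V" "ring.zero G = ring.zero fm.V" "ring.add G = ring.add fm.V" "smult G = smult fm.V"
  "f \<otimes>\<^bsub>G\<^esub> g = lin_ext K fm.V (\<lambda>i k. lin_ext K fm.V (\<lambda>j k'. (k \<otimes>\<^bsub>K\<^esub> k') \<odot>\<^bsub>fm.V\<^esub> ee_mult K Q i j) g) f"
  "\<one>\<^bsub>G\<^esub> = (\<Oplus>\<^bsub>fm.V\<^esub>i\<in>verts Q \<times> verts Q. ee K (Triv (fst i)) (Triv (snd i)))"
  by (simp_all add: G_alg_def Let_def lin_ext_def)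

lemma Vab: "abelian_group fm.V" by (rule fm.V.abelian_group_axioms)
lemma Gab: "abelian_group G" by (rule abelian_group_cong[OF Vab]) (simp_all add: G_simps)
lemma Kab: "abelian_group K" by (rule R.K.is_abelian_group)

abbreviation gv where "gv k p q \<equiv> k \<odot>\<^bsub>G\<^esub> ee K p q"

lemma gv_bv: "gv k p q = fm.bv k (p, q)" by (simp add: G_simps ee_def)

lemma gv_in: "\<lbrakk>k \<in> carrier K; p \<in> qpaths Q m; q \<in> qpaths Q m\<rbrakk> \<Longrightarrow> gv k p q \<in> carrier G"
  unfolding gv_bv G_simps(1) by (rule fm.bv_in) auto

lemma ee_in: "\<lbrakk>p \<in> qpaths Q m; q \<in> qpaths Q m\<rbrakk> \<Longrightarrow> ee K p q \<in> carrier G"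
  unfolding ee_def G_simps(1) by (rule fm.basis_vec_in) auto

lemma G_module: "module K G"
  by (rule module_cong[OF fm.V.module_axioms]) (simp_all add: G_simps)

lemma ee_gv: "\<lbrakk>p \<in> qpaths Q m; q \<in> qpaths Q m\<rbrakk> \<Longrightarrow> ee K p q = gv \<one>\<^bsub>K\<^esub> p q"
  using module.smult_one[OF G_module ee_in] by simp

abbreviation "Gspan \<equiv> {gv k p q | k p q m. k \<in> carrier K \<and> p \<in> qpaths Q m \<and> q \<in> qpaths Q m}"

lemma G_spans: "add_spans Gspan G"
proof -
  have "Gspan = {fm.bv k i | k i. k \<in> carrier K \<and> i \<in> Bs}"
    unfolding gv_bv by blast
  thus ?thesis by (simp only:) (rule add_spans_cong[OF fm.V_spans], simp_all add: G_simps)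
qed

lemma ee_mult_in:
  assumes "i \<in> Bs" "j \<in> Bs" shows "ee_mult K Q i j \<in> carrier fm.V"
proof -
  obtain p q m p' q' n where i: "i = (p, q)" "p \<in> qpaths Q m" "q \<in> qpaths Q m"
    and j: "j = (p', q')" "p' \<in> qpaths Q n" "q' \<in> qpaths Q n" using assms by auto
  have "(\<lambda>_. \<zero>\<^bsub>K\<^esub>) \<in> carrier fm.V" using fm.V.zero_closed by (simp only: free_module_simps(2))
  thus ?thesis using i j ee_in[of "qconcat p p'" "m + n" "qconcat q q'"]
    by (simp add: ee_mult_def qconcat_in_qpaths G_simps)
qed

text \<open>The double sum that defines the product is a linear extension of a linear extension.\<close>

lemma
  shows G_mult_biadditive: "biadditive G G G (monoid.mult G)"
    and G_mult_bv: "\<lbrakk>k \<in> carrier K; k' \<in> carrier K; i \<in> Bs; j \<in> Bs\<rbrakk> \<Longrightarrow>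
      fm.bv k i \<otimes>\<^bsub>G\<^esub> fm.bv k' j = (k \<otimes>\<^bsub>K\<^esub> k') \<odot>\<^bsub>G\<^esub> ee_mult K Q i j"
proof -
  define inner where "inner i k = lin_ext K fm.V (\<lambda>j k'. (k \<otimes>\<^bsub>K\<^esub> k') \<odot>\<^bsub>fm.V\<^esub> ee_mult K Q i j)" for i k
  have ps: "(\<lambda>k'. (k \<otimes>\<^bsub>K\<^esub> k') \<odot>\<^bsub>fm.V\<^esub> ee_mult K Q i j) \<in> add_hom K fm.V" if "k \<in> carrier K" "i \<in> Bs" "j \<in> Bs" for i j k
    using that ee_mult_in[OF that(2,3)]
    by (intro add_homI) (simp_all add: R.K.r_distr fm.V.smult_l_distr)
  have ih: "inner i k \<in> add_hom fm.V fm.V" if "k \<in> carrier K" "i \<in> Bs" for i k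
    unfolding inner_def by (rule fm.lin_ext_hom[OF Vab]) (use ps that in blast)
  have ib: "inner i k (fm.bv k' j) = (k \<otimes>\<^bsub>K\<^esub> k') \<odot>\<^bsub>fm.V\<^esub> ee_mult K Q i j"
    if "k \<in> carrier K" "i \<in> Bs" "j \<in> Bs" "k' \<in> carrier K" for i j k k'
    unfolding inner_def by (rule fm.lin_ext_bv[OF Vab]) (use ps that in blast)+
  note eq = add_hom_eq_on_span[OF _ _ Vab Vab fm.V_spans]
  have ik: "(\<lambda>k. inner i k g) \<in> add_hom K fm.V" if g: "g \<in> carrier fm.V" and i: "i \<in> Bs" for i g
  proof (rule add_homI)
    fix k k' assume k: "k \<in> carrier K" "k' \<in> carrier K"
    have kk: "k \<oplus>\<^bsub>K\<^esub> k' \<in> carrier K" using k by simp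
    show "inner i (k \<oplus>\<^bsub>K\<^esub> k') g = inner i k g \<oplus>\<^bsub>fm.V\<^esub> inner i k' g"
    proof (rule eq[OF ih[OF kk i] add_hom_plus[OF ih[OF k(1) i] ih[OF k(2) i] Vab Vab] _ g])
      fix x assume "x \<in> {fm.bv k i |k i. k \<in> carrier K \<and> i \<in> Bs}"
      then obtain c j where x: "x = fm.bv c j" "c \<in> carrier K" "j \<in> Bs" by blast
      show "inner i (k \<oplus>\<^bsub>K\<^esub> k') x = inner i k x \<oplus>\<^bsub>fm.V\<^esub> inner i k' x"
        unfolding x(1) using ee_mult_in[OF i x(3)] k i x
        by (simp only: ib kk R.K.l_distr fm.V.smult_l_distr R.K.m_closed)
    qed
  qed (rule add_hom_closed[OF ih[OF _ i] g])
  have m: "f \<otimes>\<^bsub>G\<^esub> g = lin_ext K fm.V (\<lambda>i k. inner i k g) f" for f g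
    unfolding inner_def by (rule G_simps)
  have mh: "(\<lambda>f. f \<otimes>\<^bsub>G\<^esub> g) \<in> add_hom fm.V fm.V" if "g \<in> carrier fm.V" for g
    unfolding m by (rule fm.lin_ext_hom[OF Vab ik[OF that]])
  have mb: "fm.bv k i \<otimes>\<^bsub>G\<^esub> g = inner i k g" if "g \<in> carrier fm.V" "i \<in> Bs" "k \<in> carrier K" for g i k
    unfolding m by (rule fm.lin_ext_bv[OF Vab ik[OF that(1)] that(2,3)])
  show "\<lbrakk>k \<in> carrier K; k' \<in> carrier K; i \<in> Bs; j \<in> Bs\<rbrakk> \<Longrightarrow>
      fm.bv k i \<otimes>\<^bsub>G\<^esub> fm.bv k' j = (k \<otimes>\<^bsub>K\<^esub> k') \<odot>\<^bsub>G\<^esub> ee_mult K Q i j"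
    by (simp only: mb fm.bv_in ib G_simps(4))
  show "biadditive G G G (monoid.mult G)"
  proof (rule biadditiveI; unfold G_simps(1,3))
    fix f g h assume c: "f \<in> carrier fm.V" "g \<in> carrier fm.V" "h \<in> carrier fm.V"
    have gh: "g \<oplus>\<^bsub>fm.V\<^esub> h \<in> carrier fm.V" using c by simp
    show "(f \<oplus>\<^bsub>fm.V\<^esub> g) \<otimes>\<^bsub>G\<^esub> h = f \<otimes>\<^bsub>G\<^esub> h \<oplus>\<^bsub>fm.V\<^esub> g \<otimes>\<^bsub>G\<^esub> h"
      by (rule add_hom_add[OF mh[OF c(3)] c(1,2)])
    show "f \<otimes>\<^bsub>G\<^esub> (g \<oplus>\<^bsub>fm.V\<^esub> h) = f \<otimes>\<^bsub>G\<^esub> g \<oplus>\<^bsub>fm.V\<^esub> f \<otimes>\<^bsub>G\<^esub> h"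
    proof (rule eq[OF mh[OF gh] add_hom_plus[OF mh[OF c(2)] mh[OF c(3)] Vab Vab] _ c(1)])
      fix x assume "x \<in> {fm.bv k i |k i. k \<in> carrier K \<and> i \<in> Bs}"
      then obtain k j where x: "x = fm.bv k j" "k \<in> carrier K" "j \<in> Bs" by blast
      show "x \<otimes>\<^bsub>G\<^esub> (g \<oplus>\<^bsub>fm.V\<^esub> h) = x \<otimes>\<^bsub>G\<^esub> g \<oplus>\<^bsub>fm.V\<^esub> x \<otimes>\<^bsub>G\<^esub> h"
        unfolding x(1) by (simp only: mb gh c x add_hom_add[OF ih[OF x(2,3)]])
    qed
  next
    fix f g assume "f \<in> carrier fm.V" "g \<in> carrier fm.V"
    thus "f \<otimes>\<^bsub>G\<^esub> g \<in> carrier fm.V" using add_hom_closed[OF mh] by blast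
  qed
qed

abbreviation composable where
  "composable p q p' q' \<equiv> qtarget Q p = qsource Q p' \<and> qtarget Q q = qsource Q q'"

lemma gv_mult:
  assumes "k \<in> carrier K" "k' \<in> carrier K" "p \<in> qpaths Q m" "q \<in> qpaths Q m" "p' \<in> qpaths Q n" "q' \<in> qpaths Q n"
  shows "gv k p q \<otimes>\<^bsub>G\<^esub> gv k' p' q' =
    (if composable p q p' q' then gv (k \<otimes>\<^bsub>K\<^esub> k') (qconcat p p') (qconcat q q') else \<zero>\<^bsub>G\<^esub>)"
proof -
  have B: "(p, q) \<in> Bs" "(p', q') \<in> Bs" using assms by auto
  have "gv k p q \<otimes>\<^bsub>G\<^esub> gv k' p' q' = (k \<otimes>\<^bsub>K\<^esub> k') \<odot>\<^bsub>G\<^esub> ee_mult K Q (p, q) (p', q')"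
    unfolding gv_bv by (rule G_mult_bv[OF assms(1,2) B])
  also have "\<dots> = (if composable p q p' q' then gv (k \<otimes>\<^bsub>K\<^esub> k') (qconcat p p') (qconcat q q') else \<zero>\<^bsub>G\<^esub>)"
    using assms(1,2) by (simp add: ee_mult_def G_simps free_module_simps)
  finally show ?thesis .
qed

lemma G_mult_zero: "x \<in> carrier G \<Longrightarrow> \<zero>\<^bsub>G\<^esub> \<otimes>\<^bsub>G\<^esub> x = \<zero>\<^bsub>G\<^esub>" "x \<in> carrier G \<Longrightarrow> x \<otimes>\<^bsub>G\<^esub> \<zero>\<^bsub>G\<^esub> = \<zero>\<^bsub>G\<^esub>"
  using add_hom_zero[OF biadditiveD(2)[OF G_mult_biadditive] Gab Gab]
    add_hom_zero[OF biadditiveD(1)[OF G_mult_biadditive] Gab Gab] by simp_all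

lemma Triv_in: "l \<in> verts Q \<Longrightarrow> Triv l \<in> qpaths Q 0" by (simp add: qpaths_0)

lemma G_one: "\<one>\<^bsub>G\<^esub> = (\<Oplus>\<^bsub>G\<^esub>i\<in>verts Q \<times> verts Q. ee K (Triv (fst i)) (Triv (snd i)))"
  unfolding G_simps(6) by (rule finsum_cong_record[symmetric]) (simp_all add: G_simps)

text \<open>The product of basis elements is concatenation or zero, so associativity is that of concatenation
  once it is known which products vanish. The unit acts trivially since exactly one \<open>e\<^sup>\<lambda>\<^sub>\<mu>\<close>
  composes with a given \<open>e\<^sup>p\<^sub>q\<close>.\<close>

lemma G_algebra: "k_algebra K G"
proof (rule k_algebra_on_span[OF fieldK G_module G_mult_biadditive _ G_spans])
  interpret GM: module K G by (rule G_module)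
  note mul = biadditiveD(3)[OF G_mult_biadditive]
  have one: "\<one>\<^bsub>G\<^esub> \<in> carrier G"
    unfolding G_one by (rule GM.finsum_closed) (auto intro: ee_in[OF Triv_in Triv_in])
  thus "\<one>\<^bsub>G\<^esub> \<in> carrier G" .
  {
    fix x y z assume "x \<in> Gspan" "y \<in> Gspan" "z \<in> Gspan"
    then obtain k p q m k' p' q' n k'' p'' q'' l where
      x: "x = gv k p q" "k \<in> carrier K" "p \<in> qpaths Q m" "q \<in> qpaths Q m" and
      y: "y = gv k' p' q'" "k' \<in> carrier K" "p' \<in> qpaths Q n" "q' \<in> qpaths Q n" and
      z: "z = gv k'' p'' q''" "k'' \<in> carrier K" "p'' \<in> qpaths Q l" "q'' \<in> qpaths Q l" by blast
    have in': "x \<in> carrier G" "y \<in> carrier G" "z \<in> carrier G" using x y z gv_in by auto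
    note mz = G_mult_zero[OF in'(1)] G_mult_zero[OF in'(2)] G_mult_zero[OF in'(3)]
    show "(x \<otimes>\<^bsub>G\<^esub> y) \<otimes>\<^bsub>G\<^esub> z = x \<otimes>\<^bsub>G\<^esub> (y \<otimes>\<^bsub>G\<^esub> z)"
    proof (cases "composable p q p' q'")
      case c: True
      hence pc: "qconcat p p' \<in> qpaths Q (m + n)" "qconcat q q' \<in> qpaths Q (m + n)"
        and tc: "qtarget Q (qconcat p p') = qtarget Q p'" "qtarget Q (qconcat q q') = qtarget Q q'"
        using x y by (auto intro: qconcat_in_qpaths qtarget_qconcat)
      have xy: "x \<otimes>\<^bsub>G\<^esub> y = gv (k \<otimes>\<^bsub>K\<^esub> k') (qconcat p p') (qconcat q q')"
        using c gv_mult[OF x(2) y(2) x(3,4) y(3,4)] x y by simp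
      show ?thesis
      proof (cases "composable p' q' p'' q''")
        case d: True
        hence pd: "qconcat p' p'' \<in> qpaths Q (n + l)" "qconcat q' q'' \<in> qpaths Q (n + l)"
          and sd: "qsource Q (qconcat p' p'') = qsource Q p'" "qsource Q (qconcat q' q'') = qsource Q q'"
          using y z by (auto intro: qconcat_in_qpaths qsource_qconcat)
        have yz: "y \<otimes>\<^bsub>G\<^esub> z = gv (k' \<otimes>\<^bsub>K\<^esub> k'') (qconcat p' p'') (qconcat q' q'')"
          using d gv_mult[OF y(2) z(2) y(3,4) z(3,4)] y z by simp
        show ?thesis unfolding xy yz unfolding x(1) z(1)
          using gv_mult[OF R.K.m_closed[OF x(2) y(2)] z(2) pc z(3,4)] gv_mult[OF x(2) R.K.m_closed[OF y(2) z(2)] x(3,4) pd]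
            c d tc sd x(2) y(2) z(2) by (simp add: qconcat_assoc R.K.m_assoc)
      next
        case d: False
        have yz: "y \<otimes>\<^bsub>G\<^esub> z = \<zero>\<^bsub>G\<^esub>"
          using d gv_mult[OF y(2) z(2) y(3,4) z(3,4)] y z by auto
        show ?thesis unfolding yz mz unfolding xy z(1)
          using gv_mult[OF R.K.m_closed[OF x(2) y(2)] z(2) pc z(3,4)] d tc by auto
      qed
    next
      case c: False
      hence xy: "x \<otimes>\<^bsub>G\<^esub> y = \<zero>\<^bsub>G\<^esub>" using gv_mult[OF x(2) y(2) x(3,4) y(3,4)] x y by auto
      show ?thesis
      proof (cases "composable p' q' p'' q''")
        case d: True
        hence pd: "qconcat p' p'' \<in> qpaths Q (n + l)" "qconcat q' q'' \<in> qpaths Q (n + l)"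
          and sd: "qsource Q (qconcat p' p'') = qsource Q p'" "qsource Q (qconcat q' q'') = qsource Q q'"
          using y z by (auto intro: qconcat_in_qpaths qsource_qconcat)
        have yz: "y \<otimes>\<^bsub>G\<^esub> z = gv (k' \<otimes>\<^bsub>K\<^esub> k'') (qconcat p' p'') (qconcat q' q'')"
          using d gv_mult[OF y(2) z(2) y(3,4) z(3,4)] y z by simp
        show ?thesis unfolding xy mz unfolding yz x(1)
          using gv_mult[OF x(2) R.K.m_closed[OF y(2) z(2)] x(3,4) pd] c sd by auto
      next
        case d: False
        have yz: "y \<otimes>\<^bsub>G\<^esub> z = \<zero>\<^bsub>G\<^esub>"
          using d gv_mult[OF y(2) z(2) y(3,4) z(3,4)] y z by auto
        show ?thesis unfolding xy yz mz ..
      qed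
    qed
  next
    fix x assume "x \<in> Gspan"
    then obtain k p q m where x: "x = gv k p q" "k \<in> carrier K" "p \<in> qpaths Q m" "q \<in> qpaths Q m" by blast
    have xG: "x \<in> carrier G" using x gv_in by auto
    have fin: "finite (verts Q \<times> verts Q)" using finV by simp
    have ein: "ee K (Triv (fst i)) (Triv (snd i)) \<in> carrier G" if "i \<in> verts Q \<times> verts Q" for i
      using that by (intro ee_in[OF Triv_in Triv_in]) auto
    have L: "ee K (Triv (fst i)) (Triv (snd i)) \<otimes>\<^bsub>G\<^esub> x = (if i = (qsource Q p, qsource Q q) then x else \<zero>\<^bsub>G\<^esub>)"
      if "i \<in> verts Q \<times> verts Q" for i
      using gv_mult[OF R.K.one_closed x(2) Triv_in[of "fst i"] Triv_in[of "snd i"] x(3,4)] that x(1,2)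
      by (subst ee_gv[OF Triv_in Triv_in]) (auto simp: prod_eq_iff)
    have R: "x \<otimes>\<^bsub>G\<^esub> ee K (Triv (fst i)) (Triv (snd i)) = (if i = (qtarget Q p, qtarget Q q) then x else \<zero>\<^bsub>G\<^esub>)"
      if "i \<in> verts Q \<times> verts Q" for i
      using gv_mult[OF x(2) R.K.one_closed x(3,4) Triv_in[of "fst i"] Triv_in[of "snd i"]] that x(1,2)
      by (subst ee_gv[OF Triv_in Triv_in]) (auto simp: prod_eq_iff qconcat_Triv)
    have "\<one>\<^bsub>G\<^esub> \<otimes>\<^bsub>G\<^esub> x = (\<Oplus>\<^bsub>G\<^esub>i\<in>verts Q \<times> verts Q. ee K (Triv (fst i)) (Triv (snd i)) \<otimes>\<^bsub>G\<^esub> x)"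
      unfolding G_one by (rule add_hom_finsum[OF biadditiveD(2)[OF G_mult_biadditive xG] Gab Gab ein])
    also have "\<dots> = ee K (Triv (fst (qsource Q p, qsource Q q))) (Triv (snd (qsource Q p, qsource Q q))) \<otimes>\<^bsub>G\<^esub> x"
      by (rule GM.finsum_single[OF fin]) (use qsource_in[OF wfQ x(3)] qsource_in[OF wfQ x(4)] L xG in auto)
    also have "\<dots> = x" using L[of "(qsource Q p, qsource Q q)"] qsource_in[OF wfQ x(3)] qsource_in[OF wfQ x(4)] by simp
    finally show "\<one>\<^bsub>G\<^esub> \<otimes>\<^bsub>G\<^esub> x = x" .
    have "x \<otimes>\<^bsub>G\<^esub> \<one>\<^bsub>G\<^esub> = (\<Oplus>\<^bsub>G\<^esub>i\<in>verts Q \<times> verts Q. x \<otimes>\<^bsub>G\<^esub> ee K (Triv (fst i)) (Triv (snd i)))"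
      unfolding G_one by (rule add_hom_finsum[OF biadditiveD(1)[OF G_mult_biadditive xG] Gab Gab ein])
    also have "\<dots> = x \<otimes>\<^bsub>G\<^esub> ee K (Triv (fst (qtarget Q p, qtarget Q q))) (Triv (snd (qtarget Q p, qtarget Q q)))"
      by (rule GM.finsum_single[OF fin]) (use qtarget_in[OF wfQ x(3)] qtarget_in[OF wfQ x(4)] R xG in auto)
    also have "\<dots> = x" using R[of "(qtarget Q p, qtarget Q q)"] qtarget_in[OF wfQ x(3)] qtarget_in[OF wfQ x(4)] by simp
    finally show "x \<otimes>\<^bsub>G\<^esub> \<one>\<^bsub>G\<^esub> = x" .
  next
    fix c x y assume c: "c \<in> carrier K" and "x \<in> Gspan" "y \<in> Gspan"
    then obtain k p q m k' p' q' n where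
      x: "x = gv k p q" "k \<in> carrier K" "p \<in> qpaths Q m" "q \<in> qpaths Q m" and
      y: "y = gv k' p' q'" "k' \<in> carrier K" "p' \<in> qpaths Q n" "q' \<in> qpaths Q n" by blast
    have cx: "c \<odot>\<^bsub>G\<^esub> x = gv (c \<otimes>\<^bsub>K\<^esub> k) p q" and cy: "c \<odot>\<^bsub>G\<^esub> y = gv (c \<otimes>\<^bsub>K\<^esub> k') p' q'"
      using c x y GM.smult_assoc1 ee_in by auto
    have cxy: "c \<odot>\<^bsub>G\<^esub> (x \<otimes>\<^bsub>G\<^esub> y) = (if composable p q p' q' then gv (c \<otimes>\<^bsub>K\<^esub> (k \<otimes>\<^bsub>K\<^esub> k')) (qconcat p p') (qconcat q q') else \<zero>\<^bsub>G\<^esub>)"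
      unfolding x(1) y(1) gv_mult[OF x(2) y(2) x(3,4) y(3,4)]
      using c x y GM.smult_assoc1[OF c R.K.m_closed[OF x(2) y(2)], of "ee K (qconcat p p') (qconcat q q')"]
        ee_in[of "qconcat p p'" "m + n" "qconcat q q'"] by (auto simp: qconcat_in_qpaths)
    show "(c \<odot>\<^bsub>G\<^esub> x) \<otimes>\<^bsub>G\<^esub> y = c \<odot>\<^bsub>G\<^esub> (x \<otimes>\<^bsub>G\<^esub> y)"
      unfolding cxy unfolding cx y(1) using gv_mult[OF R.K.m_closed[OF c x(2)] y(2) x(3,4) y(3,4)] c x(2) y(2)
      by (simp add: R.K.m_assoc)
    show "x \<otimes>\<^bsub>G\<^esub> (c \<odot>\<^bsub>G\<^esub> y) = c \<odot>\<^bsub>G\<^esub> (x \<otimes>\<^bsub>G\<^esub> y)"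
      unfolding cxy unfolding cy x(1) using gv_mult[OF x(2) R.K.m_closed[OF c y(2)] x(3,4) y(3,4)] c x(2) y(2)
      by (simp add: R.K.m_lcomm)
  }
qed

end

section \<open>Quotient algebras\<close>

lemma quotient_algebra_simps:
  "carrier (quotient_algebra A I) = carrier (A Quot I)"
  "ring.zero (quotient_algebra A I) = ring.zero (A Quot I)"
  "ring.add (quotient_algebra A I) = ring.add (A Quot I)"
  "monoid.mult (quotient_algebra A I) = monoid.mult (A Quot I)"
  "monoid.one (quotient_algebra A I) = monoid.one (A Quot I)"
  "smult (quotient_algebra A I) = (\<lambda>k C. \<Union>x\<in>C. I +>\<^bsub>A\<^esub> (k \<odot>\<^bsub>A\<^esub> x))"
  by (simp_all add: quotient_algebra_def ring.extend_def module.defs)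

locale algebra_ideal = A: k_algebra K A + I: ideal I A for K (structure) and A (structure) and I
begin

abbreviation "AI \<equiv> quotient_algebra A I"
abbreviation coset where "coset x \<equiv> I +>\<^bsub>A\<^esub> x"

lemma quot_ring: "ring AI"
  by (rule ring_cong[OF I.quotient_is_ring]) (simp_all add: quotient_algebra_simps)

lemma coset_hom: "coset \<in> ring_hom A AI"
  using I.rcos_ring_hom by (simp add: ring_hom_def quotient_algebra_simps)

lemma coset_surj: "carrier AI = coset ` carrier A"
  by (auto simp: quotient_algebra_simps FactRing_def A_RCOSETS_def')

lemma coset_add_hom: "coset \<in> add_hom A AI"
  using coset_hom by (auto simp: ring_hom_def add_hom_def)

text \<open>Since \<open>k i = (k 1) i\<close>, an ideal of the ring is a subspace.\<close>

lemma I_smult: "k \<in> carrier K \<Longrightarrow> i \<in> I \<Longrightarrow> k \<odot>\<^bsub>A\<^esub> i \<in> I"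
proof -
  assume k: "k \<in> carrier K" and i: "i \<in> I"
  have iA: "i \<in> carrier A" using i by (rule I.a_Hcarr)
  have "(k \<odot>\<^bsub>A\<^esub> \<one>\<^bsub>A\<^esub>) \<otimes>\<^bsub>A\<^esub> i \<in> I" using i k by (intro I.I_l_closed) auto
  moreover have "(k \<odot>\<^bsub>A\<^esub> \<one>\<^bsub>A\<^esub>) \<otimes>\<^bsub>A\<^esub> i = k \<odot>\<^bsub>A\<^esub> i" using k iA by (simp add: A.smult_mult_left)
  ultimately show ?thesis by simp
qed

lemma coset_eqI: "x \<in> carrier A \<Longrightarrow> i \<in> I \<Longrightarrow> coset (i \<oplus>\<^bsub>A\<^esub> x) = coset x"
proof -
  assume x: "x \<in> carrier A" and i: "i \<in> I"
  have "i \<oplus>\<^bsub>A\<^esub> x \<in> coset x" using i by (auto simp: a_r_coset_def')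
  thus ?thesis using A.a_repr_independence[OF _ x I.a_subgroup] by simp
qed

lemma coset_rep: "x \<in> carrier A \<Longrightarrow> y \<in> coset x \<Longrightarrow> \<exists>i\<in>I. y = i \<oplus>\<^bsub>A\<^esub> x"
  by (auto simp: a_r_coset_def')

lemma coset_smult: "k \<in> carrier K \<Longrightarrow> x \<in> carrier A \<Longrightarrow> k \<odot>\<^bsub>AI\<^esub> coset x = coset (k \<odot>\<^bsub>A\<^esub> x)"
proof -
  assume k: "k \<in> carrier K" and x: "x \<in> carrier A"
  have "coset (k \<odot>\<^bsub>A\<^esub> y) = coset (k \<odot>\<^bsub>A\<^esub> x)" if yx: "y \<in> coset x" for y
  proof -
    obtain i where i: "i \<in> I" "y = i \<oplus>\<^bsub>A\<^esub> x" using coset_rep[OF x yx] by blast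
    have iA: "i \<in> carrier A" using i(1) by (rule I.a_Hcarr)
    show ?thesis unfolding i(2) A.smult_r_distr[OF k iA x]
      by (rule coset_eqI) (use k x I_smult[OF k i(1)] in auto)
  qed
  moreover have "x \<in> coset x" using I.a_rcos_self[OF x] by simp
  ultimately have "(\<Union>y\<in>coset x. coset (k \<odot>\<^bsub>A\<^esub> y)) = coset (k \<odot>\<^bsub>A\<^esub> x)" by blast
  thus ?thesis by (simp add: quotient_algebra_simps)
qed

lemma quot_algebra: "k_algebra K AI"
proof -
  interpret AI: ring AI by (rule quot_ring)
  have ch: "\<And>x. x \<in> carrier A \<Longrightarrow> coset x \<in> carrier AI"
    "\<And>x y. x \<in> carrier A \<Longrightarrow> y \<in> carrier A \<Longrightarrow> coset x \<oplus>\<^bsub>AI\<^esub> coset y = coset (x \<oplus>\<^bsub>A\<^esub> y)"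
    "\<And>x y. x \<in> carrier A \<Longrightarrow> y \<in> carrier A \<Longrightarrow> coset x \<otimes>\<^bsub>AI\<^esub> coset y = coset (x \<otimes>\<^bsub>A\<^esub> y)"
    using coset_hom by (auto simp: ring_hom_def)
  show ?thesis
  proof (intro k_algebra.intro moduleI k_algebra_axioms.intro)
    show "field K" by (rule A.K.field_axioms)
    show "cring K" by (rule A.K.is_cring)
    show "abelian_group AI" by (rule AI.is_abelian_group)
    show "ring AI" by (rule quot_ring)
  qed (auto simp: coset_surj coset_smult ch A.smult_l_distr A.smult_r_distr A.smult_assoc1 A.smult_mult_left A.smult_mult_right)
qed

lemma quot_lift:
  assumes "abelian_group Z" "f \<in> add_hom A Z" "\<And>i. i \<in> I \<Longrightarrow> f i = \<zero>\<^bsub>Z\<^esub>"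
  shows "\<exists>g\<in>add_hom AI Z. \<forall>x\<in>carrier A. g (coset x) = f x"
proof -
  interpret Z: abelian_group Z by fact
  let ?g = "\<lambda>C. f (SOME x. x \<in> C)"
  have gc: "?g (coset x) = f x" if x: "x \<in> carrier A" for x
  proof -
    have "(SOME y. y \<in> coset x) \<in> coset x" using I.a_rcos_self[OF x] by (metis someI)
    then obtain i where i: "i \<in> I" "(SOME y. y \<in> coset x) = i \<oplus>\<^bsub>A\<^esub> x" using coset_rep[OF x] by blast
    have iA: "i \<in> carrier A" using i(1) by (rule I.a_Hcarr)
    show ?thesis unfolding i(2) add_hom_add[OF assms(2) iA x] assms(3)[OF i(1)]
      using add_hom_closed[OF assms(2) x] by simp
  qed
  have "?g \<in> add_hom AI Z"
  proof (rule add_homI)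
    fix C assume "C \<in> carrier AI"
    thus "?g C \<in> carrier Z" using gc add_hom_closed[OF assms(2)] by (auto simp: coset_surj)
  next
    fix C D assume "C \<in> carrier AI" "D \<in> carrier AI"
    then obtain x y where xy: "C = coset x" "D = coset y" "x \<in> carrier A" "y \<in> carrier A" by (auto simp: coset_surj)
    show "?g (C \<oplus>\<^bsub>AI\<^esub> D) = ?g C \<oplus>\<^bsub>Z\<^esub> ?g D"
      unfolding xy(1,2) add_hom_add[OF coset_add_hom xy(3,4), symmetric]
      using gc xy add_hom_add[OF assms(2)] by simp
  qed
  thus ?thesis using gc by (intro bexI[of _ ?g]) auto
qed

end

section \<open>The algebra before dividing by the relations\<close>

context weighted_quiver
begin

abbreviation "Rop \<equiv> op_algebra R"
abbreviation "RR \<equiv> algebra_tensor K R Rop"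
abbreviation "H \<equiv> H_alg K R Q"

lemma ktensor_RR: "ktensor K R Rop"
  by (intro ktensor.intro algR op_algebra_algebra)

lemma RR_algebra: "k_algebra K RR" by (rule ktensor.S_algebra[OF ktensor_RR])

lemma ktensor_H: "ktensor K RR G"
  by (intro ktensor.intro RR_algebra G_algebra)

lemma H_eq: "H = algebra_tensor K RR G" by (simp add: H_alg_def)

lemma H_algebra: "k_algebra K H" unfolding H_eq by (rule ktensor.S_algebra[OF ktensor_H])

lemma H_ring: "ring H" by (rule k_algebra.axioms(3)[OF H_algebra])

lemma Hab: "abelian_group H" unfolding H_eq by (rule ktensor.abelian_S[OF ktensor_H])

lemma Rab: "abelian_group R" by (rule R.is_abelian_group)
abbreviation "tr \<equiv> ktens K R Rop"
abbreviation "Ht \<equiv> H_tens K R Q"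
abbreviation "hh r r' p q \<equiv> Ht r r' (ee K p q)"

lemma tr_facts:
  "r \<in> carrier R \<Longrightarrow> r' \<in> carrier R \<Longrightarrow> tr r r' \<in> carrier RR"
  "r \<in> carrier R \<Longrightarrow> s \<in> carrier R \<Longrightarrow> r' \<in> carrier R \<Longrightarrow> tr (r \<oplus> s) r' = tr r r' \<oplus>\<^bsub>RR\<^esub> tr s r'"
  "r \<in> carrier R \<Longrightarrow> r' \<in> carrier R \<Longrightarrow> s' \<in> carrier R \<Longrightarrow> tr r (r' \<oplus> s') = tr r r' \<oplus>\<^bsub>RR\<^esub> tr r s'"
  "k \<in> carrier K \<Longrightarrow> r \<in> carrier R \<Longrightarrow> r' \<in> carrier R \<Longrightarrow> k \<odot>\<^bsub>RR\<^esub> tr r r' = tr (k \<odot> r) r'"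
  "k \<in> carrier K \<Longrightarrow> r \<in> carrier R \<Longrightarrow> r' \<in> carrier R \<Longrightarrow> tr (k \<odot> r) r' = tr r (k \<odot> r')"
  "r \<in> carrier R \<Longrightarrow> r' \<in> carrier R \<Longrightarrow> s \<in> carrier R \<Longrightarrow> s' \<in> carrier R \<Longrightarrow>
     tr r r' \<otimes>\<^bsub>RR\<^esub> tr s s' = tr (r \<otimes> s) (s' \<otimes> r')"
  "\<one>\<^bsub>RR\<^esub> = tr \<one> \<one>"
  using ktensor.tn_in[OF ktensor_RR, of r r'] ktensor.tn_add(1)[OF ktensor_RR, of r s r'] ktensor.tn_add(2)[OF ktensor_RR, of r r' s']
    ktensor.S_smult_tn[OF ktensor_RR, of k r r'] ktensor.tn_middle[OF ktensor_RR, of r k r'] ktensor.S_mult_tn[OF ktensor_RR, of r r' s s']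
    ktensor.S_simps(5)[OF ktensor_RR] by simp_all

lemma RR_spans: "add_spans {tr r r' | r r'. r \<in> carrier R \<and> r' \<in> carrier R} RR"
  using ktensor.S_spans[OF ktensor_RR] by simp

lemma Ht_eq: "Ht r r' g = ktens K RR G (tr r r') g" by (simp add: H_tens_def)

lemma Ht_facts:
  "r \<in> carrier R \<Longrightarrow> r' \<in> carrier R \<Longrightarrow> g \<in> carrier G \<Longrightarrow> Ht r r' g \<in> carrier H"
  "r \<in> carrier R \<Longrightarrow> s \<in> carrier R \<Longrightarrow> r' \<in> carrier R \<Longrightarrow> g \<in> carrier G \<Longrightarrow> Ht (r \<oplus> s) r' g = Ht r r' g \<oplus>\<^bsub>H\<^esub> Ht s r' g"
  "r \<in> carrier R \<Longrightarrow> r' \<in> carrier R \<Longrightarrow> s' \<in> carrier R \<Longrightarrow> g \<in> carrier G \<Longrightarrow> Ht r (r' \<oplus> s') g = Ht r r' g \<oplus>\<^bsub>H\<^esub> Ht r s' g"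
  "k \<in> carrier K \<Longrightarrow> r \<in> carrier R \<Longrightarrow> r' \<in> carrier R \<Longrightarrow> g \<in> carrier G \<Longrightarrow> k \<odot>\<^bsub>H\<^esub> Ht r r' g = Ht (k \<odot> r) r' g"
  "k \<in> carrier K \<Longrightarrow> r \<in> carrier R \<Longrightarrow> r' \<in> carrier R \<Longrightarrow> g \<in> carrier G \<Longrightarrow> Ht (k \<odot> r) r' g = Ht r (k \<odot> r') g"
  "k \<in> carrier K \<Longrightarrow> r \<in> carrier R \<Longrightarrow> r' \<in> carrier R \<Longrightarrow> g \<in> carrier G \<Longrightarrow> Ht r r' (k \<odot>\<^bsub>G\<^esub> g) = Ht (k \<odot> r) r' g"
  "r \<in> carrier R \<Longrightarrow> r' \<in> carrier R \<Longrightarrow> s \<in> carrier R \<Longrightarrow> s' \<in> carrier R \<Longrightarrow> g \<in> carrier G \<Longrightarrow> g' \<in> carrier G \<Longrightarrow>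
     Ht r r' g \<otimes>\<^bsub>H\<^esub> Ht s s' g' = Ht (r \<otimes> s) (s' \<otimes> r') (g \<otimes>\<^bsub>G\<^esub> g')"
  "\<one>\<^bsub>H\<^esub> = Ht \<one> \<one> \<one>\<^bsub>G\<^esub>"
  unfolding Ht_eq H_eq
  by (simp_all add: ktensor.tn_in[OF ktensor_H] ktensor.tn_add[OF ktensor_H] tr_facts(1-3,6) ktensor.S_smult_tn[OF ktensor_H]
      tr_facts(4) ktensor.S_mult_tn[OF ktensor_H] ktensor.S_simps(5)[OF ktensor_H] tr_facts(7) tr_facts(5)[symmetric]
      ktensor.tn_middle[OF ktensor_H, symmetric])

lemma Ht_hom: "r \<in> carrier R \<Longrightarrow> r' \<in> carrier R \<Longrightarrow> Ht r r' \<in> add_hom G H"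
  unfolding H_eq using biadditiveD(1)[OF ktensor.tn_biadditive[OF ktensor_H] tr_facts(1)] by (simp add: Ht_eq[abs_def])

lemma Ht_zero: "r \<in> carrier R \<Longrightarrow> r' \<in> carrier R \<Longrightarrow> Ht r r' \<zero>\<^bsub>G\<^esub> = \<zero>\<^bsub>H\<^esub>"
  by (rule add_hom_zero[OF Ht_hom Gab Hab])

lemma ee_mult_G:
  assumes "p \<in> qpaths Q m" "q \<in> qpaths Q m" "p' \<in> qpaths Q n" "q' \<in> qpaths Q n"
  shows "ee K p q \<otimes>\<^bsub>G\<^esub> ee K p' q' = (if composable p q p' q' then ee K (qconcat p p') (qconcat q q') else \<zero>\<^bsub>G\<^esub>)"
proof (cases "composable p q p' q'")
  case True
  hence "qconcat p p' \<in> qpaths Q (m + n)" "qconcat q q' \<in> qpaths Q (m + n)"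
    using assms by (auto intro: qconcat_in_qpaths)
  from ee_gv[OF this] ee_gv[OF assms(1,2)] ee_gv[OF assms(3,4)] show ?thesis
    using gv_mult[OF R.K.one_closed R.K.one_closed assms] True by simp
next
  case False
  thus ?thesis using gv_mult[OF R.K.one_closed R.K.one_closed assms]
    ee_gv[OF assms(1,2)] ee_gv[OF assms(3,4)] by auto
qed

lemma hh_mult:
  assumes "r \<in> carrier R" "r' \<in> carrier R" "s \<in> carrier R" "s' \<in> carrier R"
    "p \<in> qpaths Q m" "q \<in> qpaths Q m" "p' \<in> qpaths Q n" "q' \<in> qpaths Q n"
  shows "hh r r' p q \<otimes>\<^bsub>H\<^esub> hh s s' p' q' =
    (if composable p q p' q' then hh (r \<otimes> s) (s' \<otimes> r') (qconcat p p') (qconcat q q') else \<zero>\<^bsub>H\<^esub>)"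
  using assms by (simp add: Ht_facts(7) ee_in ee_mult_G[OF assms(5-8)] Ht_zero)

abbreviation "Hspan \<equiv> {hh r r' p q | r r' p q m. r \<in> carrier R \<and> r' \<in> carrier R \<and> p \<in> qpaths Q m \<and> q \<in> qpaths Q m}"

lemma H_spans: "add_spans Hspan H"
proof -
  let ?S = "{ktens K RR G x y | x y. x \<in> {tr r r' | r r'. r \<in> carrier R \<and> r' \<in> carrier R} \<and> y \<in> Gspan}"
  have 1: "?S \<subseteq> Hspan"
  proof
    fix x assume "x \<in> ?S"
    then obtain r r' k p q m where x: "x = ktens K RR G (tr r r') (gv k p q)"
      and a: "r \<in> carrier R" "r' \<in> carrier R" "k \<in> carrier K" "p \<in> qpaths Q m" "q \<in> qpaths Q m" by auto
    have "x = hh (k \<odot> r) r' p q"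
      unfolding x using Ht_facts(6)[OF a(3,1,2) ee_in[OF a(4,5)]] by (simp add: Ht_eq)
    moreover have "k \<odot> r \<in> carrier R" using a by simp
    ultimately show "x \<in> Hspan" using a by blast
  qed
  have "add_spans ?S H"
    unfolding H_eq by (rule ktensor.tn_spans[OF ktensor_H RR_spans G_spans])
  hence "carrier H \<subseteq> add_span H Hspan" using add_span_mono[OF _ 1] by (auto simp only: add_spans_def)
  moreover have "Hspan \<subseteq> carrier H" using Ht_facts(1) ee_in by auto
  ultimately show ?thesis unfolding add_spans_def by simp
qed

text \<open>Three universal properties in a row: on \<open>R \<otimes> R\<^sup>o\<^sup>p\<close> for each pair of paths, then linear extension
  over the basis of \<open>\<GG>(Q)\<close>, then the outer tensor product. The target is an abelian group because
  the tensor square in which \<open>\<Delta>\<close> takes values has no product.\<close>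

lemma H_lift:
  assumes Z: "abelian_group Z"
    and cl: "\<And>r r' p q m. \<lbrakk>r \<in> carrier R; r' \<in> carrier R; p \<in> qpaths Q m; q \<in> qpaths Q m\<rbrakk> \<Longrightarrow> \<phi> r r' p q \<in> carrier Z"
    and add1: "\<And>r s r' p q m. \<lbrakk>r \<in> carrier R; s \<in> carrier R; r' \<in> carrier R; p \<in> qpaths Q m; q \<in> qpaths Q m\<rbrakk> \<Longrightarrow>
       \<phi> (r \<oplus> s) r' p q = \<phi> r r' p q \<oplus>\<^bsub>Z\<^esub> \<phi> s r' p q"
    and add2: "\<And>r s r' p q m. \<lbrakk>r \<in> carrier R; s \<in> carrier R; r' \<in> carrier R; p \<in> qpaths Q m; q \<in> qpaths Q m\<rbrakk> \<Longrightarrow>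
       \<phi> r (r' \<oplus> s) p q = \<phi> r r' p q \<oplus>\<^bsub>Z\<^esub> \<phi> r s p q"
    and mid: "\<And>k r r' p q m. \<lbrakk>k \<in> carrier K; r \<in> carrier R; r' \<in> carrier R; p \<in> qpaths Q m; q \<in> qpaths Q m\<rbrakk> \<Longrightarrow>
       \<phi> (k \<odot> r) r' p q = \<phi> r (k \<odot> r') p q"
  shows "\<exists>\<Phi>\<in>add_hom H Z. \<forall>m. \<forall>r\<in>carrier R. \<forall>r'\<in>carrier R. \<forall>p\<in>qpaths Q m. \<forall>q\<in>qpaths Q m. \<Phi> (hh r r' p q) = \<phi> r r' p q"
proof -
  interpret Z: abelian_group Z by fact
  interpret RRm: k_algebra K RR by (rule RR_algebra)
  interpret Gm: k_algebra K G by (rule G_algebra)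
  define lf where "lf = (\<lambda>(p, q). tensor_lift Z (\<lambda>r r'. \<phi> r r' p q))"
  have ba: "biadditive R Rop Z (\<lambda>r r'. \<phi> r r' p q)" if "(p, q) \<in> Bs" for p q
    using that by (intro biadditiveI) (auto intro!: cl add1 add2)
  have lfh: "lf i \<in> add_hom RR Z" and lft: "\<And>r r'. r \<in> carrier R \<Longrightarrow> r' \<in> carrier R \<Longrightarrow> lf i (tr r r') = \<phi> r r' (fst i) (snd i)"
    if i: "i \<in> Bs" for i
  proof -
    obtain p q m where pq: "i = (p, q)" "p \<in> qpaths Q m" "q \<in> qpaths Q m" using i by auto
    have mid': "\<phi> (k \<odot> x) y p q = \<phi> x (k \<odot>\<^bsub>Rop\<^esub> y) p q"
      if "x \<in> carrier R" "k \<in> carrier K" "y \<in> carrier Rop" for x k y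
      using mid[OF that(2,1) _ pq(2,3)] that by simp
    show "lf i \<in> add_hom RR Z" using ktensor.S_lift_hom[OF ktensor_RR Z ba mid'] i by (simp add: lf_def pq(1))
    show "\<And>r r'. r \<in> carrier R \<Longrightarrow> r' \<in> carrier R \<Longrightarrow> lf i (tr r r') = \<phi> r r' (fst i) (snd i)"
      using ktensor.S_lift_tn[OF ktensor_RR Z ba mid'] i by (simp add: lf_def pq(1))
  qed
  define F where "F u = lin_ext K Z (\<lambda>i k. lf i (k \<odot>\<^bsub>RR\<^esub> u))" for u
  have ps: "(\<lambda>k. lf i (k \<odot>\<^bsub>RR\<^esub> u)) \<in> add_hom K Z" if "i \<in> Bs" "u \<in> carrier RR" for i u
    using that by (intro add_homI) (simp_all add: add_hom_closed[OF lfh] add_hom_add[OF lfh] RRm.smult_l_distr)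
  have hG: "add_hom fm.V Z = add_hom G Z" by (rule add_hom_source_cong) (simp_all add: G_simps)
  have Fh: "F u \<in> add_hom G Z" if "u \<in> carrier RR" for u
    unfolding F_def hG[symmetric] by (rule fm.lin_ext_hom[OF Z]) (use ps that in blast)
  have Fg: "F u (gv k p q) = lf (p, q) (k \<odot>\<^bsub>RR\<^esub> u)" if "u \<in> carrier RR" "k \<in> carrier K" "(p, q) \<in> Bs" for u k p q
    unfolding F_def gv_bv by (rule fm.lin_ext_bv[OF Z]) (use ps that in blast)+
  note eq = add_hom_eq_on_span[OF _ _ Gab Z G_spans]
  have FB: "biadditive RR G Z F"
  proof (rule biadditiveI)
    fix u v g assume c: "u \<in> carrier RR" "v \<in> carrier RR" "g \<in> carrier G"
    have uv: "u \<oplus>\<^bsub>RR\<^esub> v \<in> carrier RR" using c by simp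
    show "F (u \<oplus>\<^bsub>RR\<^esub> v) g = F u g \<oplus>\<^bsub>Z\<^esub> F v g"
    proof (rule eq[OF Fh[OF uv] add_hom_plus[OF Fh[OF c(1)] Fh[OF c(2)] Gab Z] _ c(3)])
      fix x assume "x \<in> Gspan"
      then obtain k p q where x: "x = gv k p q" "k \<in> carrier K" "(p, q) \<in> Bs" by blast
      show "F (u \<oplus>\<^bsub>RR\<^esub> v) x = F u x \<oplus>\<^bsub>Z\<^esub> F v x"
        unfolding x(1) Fg[OF uv x(2,3)] Fg[OF c(1) x(2,3)] Fg[OF c(2) x(2,3)] RRm.smult_r_distr[OF x(2) c(1,2)]
        by (rule add_hom_add[OF lfh[OF x(3)]]) (use c x in auto)
    qed
  next
    fix u g h assume "u \<in> carrier RR" "g \<in> carrier G" "h \<in> carrier G"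
    thus "F u (g \<oplus>\<^bsub>G\<^esub> h) = F u g \<oplus>\<^bsub>Z\<^esub> F u h" using add_hom_add[OF Fh] by blast
  next
    fix u g assume "u \<in> carrier RR" "g \<in> carrier G"
    thus "F u g \<in> carrier Z" using add_hom_closed[OF Fh] by blast
  qed
  have FM: "F (k \<odot>\<^bsub>RR\<^esub> u) g = F u (k \<odot>\<^bsub>G\<^esub> g)" if c: "u \<in> carrier RR" "k \<in> carrier K" "g \<in> carrier G" for u k g
  proof -
    have ku: "k \<odot>\<^bsub>RR\<^esub> u \<in> carrier RR" using c by simp
    have sm: "smult G k \<in> add_hom G G" using c(2) by (intro add_homI) (auto simp: Gm.smult_r_distr)
    show ?thesis
    proof (rule eq[OF Fh[OF ku] add_hom_compose[OF sm Fh[OF c(1)]] _ c(3)])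
      fix x assume "x \<in> Gspan"
      then obtain k' p q m where x: "x = gv k' p q" "k' \<in> carrier K" "p \<in> qpaths Q m" "q \<in> qpaths Q m" by blast
      hence B: "(p, q) \<in> Bs" by auto
      have "k \<odot>\<^bsub>G\<^esub> x = gv (k' \<otimes>\<^bsub>K\<^esub> k) p q" using x c ee_in by (simp add: Gm.smult_assoc1[symmetric] R.K.m_comm)
      moreover have "k' \<otimes>\<^bsub>K\<^esub> k \<in> carrier K" using x c by simp
      ultimately show "F (k \<odot>\<^bsub>RR\<^esub> u) x = F u (k \<odot>\<^bsub>G\<^esub> x)"
        using Fg[OF ku x(2) B] Fg[OF c(1) _ B, of "k' \<otimes>\<^bsub>K\<^esub> k"] x(1) RRm.smult_assoc1[OF x(2) c(2,1)] by simp
    qed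
  qed
  have 1: "tensor_lift Z F \<in> add_hom H Z" unfolding H_eq
      by (rule ktensor.S_lift_hom[OF ktensor_H Z FB]) (rule FM)
  have 2: "tensor_lift Z F (hh r r' p q) = \<phi> r r' p q"
    if a: "r \<in> carrier R" "r' \<in> carrier R" "p \<in> qpaths Q m" "q \<in> qpaths Q m" for r r' p q m
  proof -
    have "tensor_lift Z F (hh r r' p q) = F (tr r r') (gv \<one>\<^bsub>K\<^esub> p q)"
      unfolding Ht_eq ee_gv[OF a(3,4), symmetric]
      by (rule ktensor.S_lift_tn[OF ktensor_H Z FB _ tr_facts(1)[OF a(1,2)] ee_in[OF a(3,4)]]) (rule FM)
    also have "\<dots> = \<phi> r r' p q"
      using Fg[OF tr_facts(1)[OF a(1,2)] R.K.one_closed, of p q] lft[of "(p, q)" r r'] a tr_facts(1)[OF a(1,2)] by auto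
    finally show ?thesis .
  qed
  show ?thesis by (rule bexI[OF _ 1]) (use 2 in blast)
qed

section \<open>The algebra defined by the relations\<close>

abbreviation "wI \<equiv> w_ideal K R Q w"
abbreviation "A \<equiv> Aw K R Q w"
abbreviation "cls \<equiv> Aw_class K R Q w"
abbreviation "cl r r' p q \<equiv> cls (hh r r' p q)"
abbreviation "A2 a b \<equiv> Arrows [a, b]"

lemma A1_in: "a \<in> arcs Q \<Longrightarrow> Arrows [a] \<in> qpaths Q 1" by (simp add: Arrows_in_qpaths)

lemma A2_in: "(a, b) \<in> arrow_pairs Q \<Longrightarrow> A2 a b \<in> qpaths Q 2"
  by (auto simp: Arrows_in_qpaths arrow_pairs_def less_Suc_eq)

lemma ee_mult_arrows: "(a, b) \<in> arrow_pairs Q \<Longrightarrow> (c, d) \<in> arrow_pairs Q \<Longrightarrow>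
   ee K (Arrows [a]) (Arrows [c]) \<otimes>\<^bsub>G\<^esub> ee K (Arrows [b]) (Arrows [d]) = ee K (A2 a b) (A2 c d)"
  using ee_mult_G[OF A1_in A1_in A1_in A1_in, of a c b d] by (auto simp: arrow_pairs_def)

abbreviation "AP \<equiv> arrow_pairs Q"

lemma finAP: "finite AP"
  by (rule finite_subset[of _ "arcs Q \<times> arcs Q"]) (auto simp: arrow_pairs_def fin_digraph.finite_arcs[OF finQ])

lemma w_relation_eq:
  assumes "(a, b) \<in> AP" "(c, d) \<in> AP"
  shows "w_relation K R Q w a b c d =
    (\<Oplus>\<^bsub>H\<^esub>i\<in>AP. hh (w (fst i) (snd i) a b) \<one> (A2 (fst i) (snd i)) (A2 c d)) \<ominus>\<^bsub>H\<^esub>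
    (\<Oplus>\<^bsub>H\<^esub>i\<in>AP. hh \<one> (w c d (fst i) (snd i)) (A2 a b) (A2 (fst i) (snd i)))"
proof -
  interpret H: k_algebra K H by (rule H_algebra)
  have "(\<Oplus>\<^bsub>H\<^esub>i\<in>AP. case i of (x, y) \<Rightarrow> Ht (w x y a b) \<one> (ee K (Arrows [x]) (Arrows [c]) \<otimes>\<^bsub>G\<^esub> ee K (Arrows [y]) (Arrows [d])))
      = (\<Oplus>\<^bsub>H\<^esub>i\<in>AP. hh (w (fst i) (snd i) a b) \<one> (A2 (fst i) (snd i)) (A2 c d))"
    by (rule H.finsum_cong') (use assms in \<open>auto simp: ee_mult_arrows intro!: Ht_facts(1) w_in ee_in[OF A2_in A2_in]\<close>)
  moreover have "(\<Oplus>\<^bsub>H\<^esub>i\<in>AP. case i of (x, y) \<Rightarrow> Ht \<one> (w c d x y) (ee K (Arrows [a]) (Arrows [x]) \<otimes>\<^bsub>G\<^esub> ee K (Arrows [b]) (Arrows [y])))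
      = (\<Oplus>\<^bsub>H\<^esub>i\<in>AP. hh \<one> (w c d (fst i) (snd i)) (A2 a b) (A2 (fst i) (snd i)))"
    by (rule H.finsum_cong') (use assms in \<open>auto simp: ee_mult_arrows intro!: Ht_facts(1) w_in ee_in[OF A2_in A2_in]\<close>)
  ultimately show ?thesis by (simp add: w_relation_def Let_def)
qed

lemma rel_terms_in:
  assumes "(a, b) \<in> AP" "(c, d) \<in> AP" "i \<in> AP"
  shows "hh (w (fst i) (snd i) a b) \<one> (A2 (fst i) (snd i)) (A2 c d) \<in> carrier H"
    "hh \<one> (w c d (fst i) (snd i)) (A2 a b) (A2 (fst i) (snd i)) \<in> carrier H"
  using assms by (auto intro!: Ht_facts(1) w_in ee_in[OF A2_in A2_in])

abbreviation "wgens \<equiv> {w_relation K R Q w a b c d | a b c d. (a, b) \<in> AP \<and> (c, d) \<in> AP}"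

lemma wgens_in: "wgens \<subseteq> carrier H"
proof clarify
  interpret H: k_algebra K H by (rule H_algebra)
  fix a b c d assume ab: "(a, b) \<in> AP" "(c, d) \<in> AP"
  show "w_relation K R Q w a b c d \<in> carrier H"
    unfolding w_relation_eq[OF ab] by (intro H.minus_closed H.finsum_closed) (use rel_terms_in[OF ab] in auto)
qed

lemma wI_ideal: "ideal wI H"
proof -
  interpret H: k_algebra K H by (rule H_algebra)
  show ?thesis unfolding w_ideal_def by (rule ring.genideal_ideal[OF H_ring wgens_in])
qed

lemma AI: "algebra_ideal K H wI"
  by (intro algebra_ideal.intro H_algebra wI_ideal)

lemma A_eq: "A = quotient_algebra H wI" by (simp add: Aw_def)
lemma cls_eq: "cls = (\<lambda>h. wI +>\<^bsub>H\<^esub> h)" by (simp add: Aw_class_def fun_eq_iff)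

lemma A_algebra: "k_algebra K A" unfolding A_eq by (rule algebra_ideal.quot_algebra[OF AI])
lemma Aab: "abelian_group A" using A_algebra by (intro ring.is_abelian_group k_algebra.axioms)

lemma cls_hom: "cls \<in> add_hom H A" unfolding A_eq cls_eq by (rule algebra_ideal.coset_add_hom[OF AI])
lemma cls_ring_hom: "cls \<in> ring_hom H A" unfolding A_eq cls_eq by (rule algebra_ideal.coset_hom[OF AI])

abbreviation "Aspan \<equiv> {cl r r' p q | r r' p q m. r \<in> carrier R \<and> r' \<in> carrier R \<and> p \<in> qpaths Q m \<and> q \<in> qpaths Q m}"

lemma A_spans: "add_spans Aspan A"
proof -
  have "add_spans (cls ` Hspan) A"
    by (rule add_spans_image[OF cls_hom Hab Aab H_spans]) (simp add: A_eq cls_eq algebra_ideal.coset_surj[OF AI])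
  moreover have "cls ` Hspan = Aspan" by blast
  ultimately show ?thesis by simp
qed

lemma cl_in: "\<lbrakk>r \<in> carrier R; r' \<in> carrier R; p \<in> qpaths Q m; q \<in> qpaths Q m\<rbrakk> \<Longrightarrow> cl r r' p q \<in> carrier A"
  by (intro add_hom_closed[OF cls_hom] Ht_facts(1) ee_in)

lemma cl_add:
  "\<lbrakk>r \<in> carrier R; s \<in> carrier R; r' \<in> carrier R; p \<in> qpaths Q m; q \<in> qpaths Q m\<rbrakk> \<Longrightarrow>
       cl (r \<oplus> s) r' p q = cl r r' p q \<oplus>\<^bsub>A\<^esub> cl s r' p q"
  "\<lbrakk>r \<in> carrier R; r' \<in> carrier R; s \<in> carrier R; p \<in> qpaths Q m; q \<in> qpaths Q m\<rbrakk> \<Longrightarrow>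
       cl r (r' \<oplus> s) p q = cl r r' p q \<oplus>\<^bsub>A\<^esub> cl r s p q"
  using Ht_facts(1,2,3) ee_in by (simp_all add: add_hom_add[OF cls_hom])

lemma cl_smult: "\<lbrakk>k \<in> carrier K; r \<in> carrier R; r' \<in> carrier R; p \<in> qpaths Q m; q \<in> qpaths Q m\<rbrakk> \<Longrightarrow>
       k \<odot>\<^bsub>A\<^esub> cl r r' p q = cl (k \<odot> r) r' p q"
  unfolding A_eq cls_eq using algebra_ideal.coset_smult[OF AI] Ht_facts(1,4) ee_in by simp

lemma cl_mid: "\<lbrakk>k \<in> carrier K; r \<in> carrier R; r' \<in> carrier R; p \<in> qpaths Q m; q \<in> qpaths Q m\<rbrakk> \<Longrightarrow>
       cl (k \<odot> r) r' p q = cl r (k \<odot> r') p q"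
  using Ht_facts(5) ee_in by simp

lemma cl_mult:
  assumes "r \<in> carrier R" "r' \<in> carrier R" "s \<in> carrier R" "s' \<in> carrier R"
    "p \<in> qpaths Q m" "q \<in> qpaths Q m" "p' \<in> qpaths Q n" "q' \<in> qpaths Q n"
  shows "cl r r' p q \<otimes>\<^bsub>A\<^esub> cl s s' p' q' =
    (if composable p q p' q' then cl (r \<otimes> s) (s' \<otimes> r') (qconcat p p') (qconcat q q') else \<zero>\<^bsub>A\<^esub>)"
proof -
  have "cl r r' p q \<otimes>\<^bsub>A\<^esub> cl s s' p' q' = cls (hh r r' p q \<otimes>\<^bsub>H\<^esub> hh s s' p' q')"
    by (rule ring_hom_mult[OF cls_ring_hom, symmetric]) (use assms Ht_facts(1) ee_in in auto)
  thus ?thesis using add_hom_zero[OF cls_hom Hab Aab] by (simp add: hh_mult[OF assms])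
qed

abbreviation "VV \<equiv> verts Q \<times> verts Q"
lemma finVV: "finite VV" using finV by simp

lemma A_one: "\<one>\<^bsub>A\<^esub> = (\<Oplus>\<^bsub>A\<^esub>i\<in>VV. cl \<one> \<one> (Triv (fst i)) (Triv (snd i)))"
proof -
  have e: "ee K (Triv (fst i)) (Triv (snd i)) \<in> carrier G" if "i \<in> VV" for i
    using that by (intro ee_in[OF Triv_in Triv_in]) auto
  have "\<one>\<^bsub>A\<^esub> = cls \<one>\<^bsub>H\<^esub>" using ring_hom_one[OF cls_ring_hom] by simp
  also have "\<one>\<^bsub>H\<^esub> = (\<Oplus>\<^bsub>H\<^esub>i\<in>VV. hh \<one> \<one> (Triv (fst i)) (Triv (snd i)))"
    unfolding Ht_facts(8) G_one by (rule add_hom_finsum[OF Ht_hom Gab Hab e]) auto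
  also have "cls \<dots> = (\<Oplus>\<^bsub>A\<^esub>i\<in>VV. cl \<one> \<one> (Triv (fst i)) (Triv (snd i)))"
    by (rule add_hom_finsum[OF cls_hom Hab Aab]) (use e Ht_facts(1) in auto)
  finally show ?thesis .
qed

lemma cl_relation:
  assumes ab: "(a, b) \<in> AP" "(c, d) \<in> AP"
  shows "(\<Oplus>\<^bsub>A\<^esub>i\<in>AP. cl (w (fst i) (snd i) a b) \<one> (A2 (fst i) (snd i)) (A2 c d)) =
    (\<Oplus>\<^bsub>A\<^esub>i\<in>AP. cl \<one> (w c d (fst i) (snd i)) (A2 a b) (A2 (fst i) (snd i)))" (is "?l = ?r")
proof -
  interpret H: k_algebra K H by (rule H_algebra)
  interpret A: k_algebra K A by (rule A_algebra)
  let ?x = "\<Oplus>\<^bsub>H\<^esub>i\<in>AP. hh (w (fst i) (snd i) a b) \<one> (A2 (fst i) (snd i)) (A2 c d)"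
  let ?y = "\<Oplus>\<^bsub>H\<^esub>i\<in>AP. hh \<one> (w c d (fst i) (snd i)) (A2 a b) (A2 (fst i) (snd i))"
  have xy: "?x \<in> carrier H" "?y \<in> carrier H" using rel_terms_in[OF ab] by (auto intro!: H.finsum_closed)
  have "?x \<ominus>\<^bsub>H\<^esub> ?y \<in> wI"
    unfolding w_relation_eq[OF ab, symmetric] w_ideal_def using ring.genideal_self[OF H_ring wgens_in] ab by blast
  from algebra_ideal.coset_eqI[OF AI xy(2) this] have "cls (?x \<ominus>\<^bsub>H\<^esub> ?y \<oplus>\<^bsub>H\<^esub> ?y) = cls ?y" by (simp add: cls_eq)
  moreover have "?x \<ominus>\<^bsub>H\<^esub> ?y \<oplus>\<^bsub>H\<^esub> ?y = ?x" using xy by (simp add: a_minus_def H.a_assoc H.l_neg)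
  ultimately have "cls ?x = cls ?y" by simp
  moreover have "cls ?x = ?l" by (rule add_hom_finsum[OF cls_hom Hab Aab rel_terms_in(1)[OF ab]])
  moreover have "cls ?y = ?r" by (rule add_hom_finsum[OF cls_hom Hab Aab rel_terms_in(2)[OF ab]])
  ultimately show ?thesis by simp
qed

text \<open>The kernel of an additive map that kills the relations need not contain the ideal they generate.
  It does if it is an ideal, and this holds when multiplication by a spanning element, on either
  side, is carried to an additive operator on \<open>Z\<close>: \<open>lm\<close> and \<open>rm\<close> are these operators.\<close>

lemma A_lift:
  assumes Z: "abelian_group Z"
    and cl: "\<And>r r' p q m. \<lbrakk>r \<in> carrier R; r' \<in> carrier R; p \<in> qpaths Q m; q \<in> qpaths Q m\<rbrakk> \<Longrightarrow> \<phi> r r' p q \<in> carrier Z"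
    and add1: "\<And>r s r' p q m. \<lbrakk>r \<in> carrier R; s \<in> carrier R; r' \<in> carrier R; p \<in> qpaths Q m; q \<in> qpaths Q m\<rbrakk> \<Longrightarrow>
       \<phi> (r \<oplus> s) r' p q = \<phi> r r' p q \<oplus>\<^bsub>Z\<^esub> \<phi> s r' p q"
    and add2: "\<And>r s r' p q m. \<lbrakk>r \<in> carrier R; s \<in> carrier R; r' \<in> carrier R; p \<in> qpaths Q m; q \<in> qpaths Q m\<rbrakk> \<Longrightarrow>
       \<phi> r (r' \<oplus> s) p q = \<phi> r r' p q \<oplus>\<^bsub>Z\<^esub> \<phi> r s p q"
    and mid: "\<And>k r r' p q m. \<lbrakk>k \<in> carrier K; r \<in> carrier R; r' \<in> carrier R; p \<in> qpaths Q m; q \<in> qpaths Q m\<rbrakk> \<Longrightarrow>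
       \<phi> (k \<odot> r) r' p q = \<phi> r (k \<odot> r') p q"
    and lh: "\<And>r r' p q m. \<lbrakk>r \<in> carrier R; r' \<in> carrier R; p \<in> qpaths Q m; q \<in> qpaths Q m\<rbrakk> \<Longrightarrow> lm r r' p q \<in> add_hom Z Z"
    and rh: "\<And>r r' p q m. \<lbrakk>r \<in> carrier R; r' \<in> carrier R; p \<in> qpaths Q m; q \<in> qpaths Q m\<rbrakk> \<Longrightarrow> rm r r' p q \<in> add_hom Z Z"
    and lm: "\<And>r r' p q m s s' p' q' n. \<lbrakk>r \<in> carrier R; r' \<in> carrier R; p \<in> qpaths Q m; q \<in> qpaths Q m;
        s \<in> carrier R; s' \<in> carrier R; p' \<in> qpaths Q n; q' \<in> qpaths Q n\<rbrakk> \<Longrightarrow> lm r r' p q (\<phi> s s' p' q') =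
        (if composable p q p' q' then \<phi> (r \<otimes> s) (s' \<otimes> r') (qconcat p p') (qconcat q q') else \<zero>\<^bsub>Z\<^esub>)"
    and rm: "\<And>r r' p q m s s' p' q' n. \<lbrakk>r \<in> carrier R; r' \<in> carrier R; p \<in> qpaths Q m; q \<in> qpaths Q m;
        s \<in> carrier R; s' \<in> carrier R; p' \<in> qpaths Q n; q' \<in> qpaths Q n\<rbrakk> \<Longrightarrow> rm s s' p' q' (\<phi> r r' p q) =
        (if composable p q p' q' then \<phi> (r \<otimes> s) (s' \<otimes> r') (qconcat p p') (qconcat q q') else \<zero>\<^bsub>Z\<^esub>)"
    and rel: "\<And>a b c d. (a, b) \<in> AP \<Longrightarrow> (c, d) \<in> AP \<Longrightarrow>
      (\<Oplus>\<^bsub>Z\<^esub>i\<in>AP. \<phi> (w (fst i) (snd i) a b) \<one> (A2 (fst i) (snd i)) (A2 c d)) =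
      (\<Oplus>\<^bsub>Z\<^esub>i\<in>AP. \<phi> \<one> (w c d (fst i) (snd i)) (A2 a b) (A2 (fst i) (snd i)))"
  shows "\<exists>\<Phi>\<in>add_hom A Z. \<forall>m. \<forall>r\<in>carrier R. \<forall>r'\<in>carrier R. \<forall>p\<in>qpaths Q m. \<forall>q\<in>qpaths Q m. \<Phi> (cl r r' p q) = \<phi> r r' p q"
proof -
  interpret H: k_algebra K H by (rule H_algebra)
  interpret Z: abelian_group Z by fact
  have "\<exists>F\<in>add_hom H Z. \<forall>m. \<forall>r\<in>carrier R. \<forall>r'\<in>carrier R. \<forall>p\<in>qpaths Q m. \<forall>q\<in>qpaths Q m. F (hh r r' p q) = \<phi> r r' p q"
    by (rule H_lift[OF Z]) (fact cl add1 add2 mid)+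
  then obtain F where F: "F \<in> add_hom H Z"
    and Fh: "\<And>m r r' p q. \<lbrakk>r \<in> carrier R; r' \<in> carrier R; p \<in> qpaths Q m; q \<in> qpaths Q m\<rbrakk> \<Longrightarrow> F (hh r r' p q) = \<phi> r r' p q"
    by auto
  note F0 = add_hom_zero[OF F Hab Z]
  have hh_in: "hh r r' p q \<in> carrier H" if "r \<in> carrier R" "r' \<in> carrier R" "p \<in> qpaths Q m" "q \<in> qpaths Q m" for r r' p q m
    using that by (intro Ht_facts(1) ee_in)
  have Hm: "(\<lambda>x. x \<otimes>\<^bsub>H\<^esub> y) \<in> add_hom H H" "(\<lambda>x. y \<otimes>\<^bsub>H\<^esub> x) \<in> add_hom H H" if "y \<in> carrier H" for y
    using that by (auto intro!: add_homI simp: H.l_distr H.r_distr)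
  note eq = add_hom_eq_on_span[OF _ _ Hab Z H_spans]
  let ?J = "{h \<in> carrier H. F h = \<zero>\<^bsub>Z\<^esub>}"
  have left: "F (hh r r' p q \<otimes>\<^bsub>H\<^esub> x) = lm r r' p q (F x)" and right: "F (x \<otimes>\<^bsub>H\<^esub> hh r r' p q) = rm r r' p q (F x)"
    if a: "r \<in> carrier R" "r' \<in> carrier R" "p \<in> qpaths Q m" "q \<in> qpaths Q m" and x: "x \<in> carrier H" for r r' p q m x
  proof -
    show "F (hh r r' p q \<otimes>\<^bsub>H\<^esub> x) = lm r r' p q (F x)"
    proof (rule eq[OF add_hom_compose[OF Hm(2)[OF hh_in[OF a]] F] add_hom_compose[OF F lh[OF a]] _ x])
      fix y assume "y \<in> Hspan"
      then obtain s s' p' q' n where y: "y = hh s s' p' q'" "s \<in> carrier R" "s' \<in> carrier R" "p' \<in> qpaths Q n" "q' \<in> qpaths Q n" by blast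
      have c: "composable p q p' q' \<Longrightarrow> F (hh (r \<otimes> s) (s' \<otimes> r') (qconcat p p') (qconcat q q')) =
          \<phi> (r \<otimes> s) (s' \<otimes> r') (qconcat p p') (qconcat q q')"
        by (rule Fh[of _ _ _ "m + n"]) (use a y in \<open>auto intro: qconcat_in_qpaths\<close>)
      show "F (hh r r' p q \<otimes>\<^bsub>H\<^esub> y) = lm r r' p q (F y)"
        unfolding y(1) hh_mult[OF a(1,2) y(2,3) a(3,4) y(4,5)] Fh[OF y(2-5)] lm[OF a y(2-5)]
        using c F0 by simp
    qed
    show "F (x \<otimes>\<^bsub>H\<^esub> hh r r' p q) = rm r r' p q (F x)"
    proof (rule eq[OF add_hom_compose[OF Hm(1)[OF hh_in[OF a]] F] add_hom_compose[OF F rh[OF a]] _ x])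
      fix y assume "y \<in> Hspan"
      then obtain s s' p' q' n where y: "y = hh s s' p' q'" "s \<in> carrier R" "s' \<in> carrier R" "p' \<in> qpaths Q n" "q' \<in> qpaths Q n" by blast
      have c: "composable p' q' p q \<Longrightarrow> F (hh (s \<otimes> r) (r' \<otimes> s') (qconcat p' p) (qconcat q' q)) =
          \<phi> (s \<otimes> r) (r' \<otimes> s') (qconcat p' p) (qconcat q' q)"
        by (rule Fh[of _ _ _ "n + m"]) (use a y in \<open>auto intro: qconcat_in_qpaths\<close>)
      show "F (y \<otimes>\<^bsub>H\<^esub> hh r r' p q) = rm r r' p q (F y)"
        unfolding y(1) hh_mult[OF y(2,3) a(1,2) y(4,5) a(3,4)] Fh[OF y(2-5)] rm[OF y(2-5) a]
        using c F0 by simp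
    qed
  qed
  have z: "lm r r' p q \<zero>\<^bsub>Z\<^esub> = \<zero>\<^bsub>Z\<^esub>" "rm r r' p q \<zero>\<^bsub>Z\<^esub> = \<zero>\<^bsub>Z\<^esub>"
    if a: "r \<in> carrier R" "r' \<in> carrier R" "p \<in> qpaths Q m" "q \<in> qpaths Q m" for r r' p q m
    by (rule add_hom_zero[OF lh[OF a] Z Z], rule add_hom_zero[OF rh[OF a] Z Z])
  have J: "F (x \<otimes>\<^bsub>H\<^esub> a) = \<zero>\<^bsub>Z\<^esub> \<and> F (a \<otimes>\<^bsub>H\<^esub> x) = \<zero>\<^bsub>Z\<^esub>" if a: "a \<in> carrier H" "F a = \<zero>\<^bsub>Z\<^esub>" and x: "x \<in> carrier H" for x a
    using H_spans x
  proof (induction rule: add_spans_induct)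
    show "abelian_group H" by (rule Hab)
    show "F (\<zero>\<^bsub>H\<^esub> \<otimes>\<^bsub>H\<^esub> a) = \<zero>\<^bsub>Z\<^esub> \<and> F (a \<otimes>\<^bsub>H\<^esub> \<zero>\<^bsub>H\<^esub>) = \<zero>\<^bsub>Z\<^esub>" using a by (simp add: F0)
  next
    fix x y assume x: "x \<in> Hspan" "x \<in> carrier H" and y: "y \<in> carrier H" "F (y \<otimes>\<^bsub>H\<^esub> a) = \<zero>\<^bsub>Z\<^esub> \<and> F (a \<otimes>\<^bsub>H\<^esub> y) = \<zero>\<^bsub>Z\<^esub>"
    obtain s s' p' q' n where s: "x = hh s s' p' q'" "s \<in> carrier R" "s' \<in> carrier R" "p' \<in> qpaths Q n" "q' \<in> qpaths Q n"
      using x(1) by blast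
    have "F (x \<otimes>\<^bsub>H\<^esub> a) = \<zero>\<^bsub>Z\<^esub>" "F (a \<otimes>\<^bsub>H\<^esub> x) = \<zero>\<^bsub>Z\<^esub>"
      unfolding s(1) using left[OF s(2-5) a(1)] right[OF s(2-5) a(1)] a(2) z[OF s(2-5)] by simp_all
    thus "F ((x \<oplus>\<^bsub>H\<^esub> y) \<otimes>\<^bsub>H\<^esub> a) = \<zero>\<^bsub>Z\<^esub> \<and> F (a \<otimes>\<^bsub>H\<^esub> (x \<oplus>\<^bsub>H\<^esub> y)) = \<zero>\<^bsub>Z\<^esub>"
      using x(2) y a by (simp add: H.l_distr H.r_distr add_hom_add[OF F])
  qed
  have "ideal ?J H"
  proof (rule idealI)
    show "ring H" by (rule H_ring)
    show "subgroup ?J (add_monoid H)"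
    proof (rule subgroup.intro)
      fix x assume x: "x \<in> ?J"
      have "inv\<^bsub>add_monoid H\<^esub> x = \<ominus>\<^bsub>H\<^esub> x" by (simp add: a_inv_def)
      thus "inv\<^bsub>add_monoid H\<^esub> x \<in> ?J" using x add_hom_neg[OF F Hab Z] by simp
    qed (auto simp: F0 add_hom_add[OF F])
  qed (use J in auto)
  moreover have "wgens \<subseteq> ?J"
  proof clarify
    fix a b c d assume ab: "(a, b) \<in> AP" "(c, d) \<in> AP"
    let ?x = "\<Oplus>\<^bsub>H\<^esub>i\<in>AP. hh (w (fst i) (snd i) a b) \<one> (A2 (fst i) (snd i)) (A2 c d)"
    let ?y = "\<Oplus>\<^bsub>H\<^esub>i\<in>AP. hh \<one> (w c d (fst i) (snd i)) (A2 a b) (A2 (fst i) (snd i))"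
    have xy: "?x \<in> carrier H" "?y \<in> carrier H" using rel_terms_in[OF ab] by (auto intro!: H.finsum_closed)
    have "F ?x = (\<Oplus>\<^bsub>Z\<^esub>i\<in>AP. F (hh (w (fst i) (snd i) a b) \<one> (A2 (fst i) (snd i)) (A2 c d)))"
      by (rule add_hom_finsum[OF F Hab Z rel_terms_in(1)[OF ab]])
    also have "\<dots> = (\<Oplus>\<^bsub>Z\<^esub>i\<in>AP. \<phi> (w (fst i) (snd i) a b) \<one> (A2 (fst i) (snd i)) (A2 c d))"
      by (rule Z.finsum_cong') (use ab in \<open>auto intro!: cl Fh[of _ _ _ 2] w_in A2_in\<close>)
    also have "\<dots> = (\<Oplus>\<^bsub>Z\<^esub>i\<in>AP. \<phi> \<one> (w c d (fst i) (snd i)) (A2 a b) (A2 (fst i) (snd i)))"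
      by (rule rel[OF ab])
    also have "\<dots> = (\<Oplus>\<^bsub>Z\<^esub>i\<in>AP. F (hh \<one> (w c d (fst i) (snd i)) (A2 a b) (A2 (fst i) (snd i))))"
      by (rule Z.finsum_cong') (use ab add_hom_closed[OF F rel_terms_in(2)[OF ab]] in \<open>auto intro!: Fh[of _ _ _ 2, symmetric] w_in A2_in\<close>)
    also have "\<dots> = F ?y" by (rule add_hom_finsum[OF F Hab Z rel_terms_in(2)[OF ab], symmetric])
    finally have "F ?x = F ?y" .
    hence "F (?x \<ominus>\<^bsub>H\<^esub> ?y) = \<zero>\<^bsub>Z\<^esub>"
      using add_hom_minus[OF F Hab Z xy] add_hom_closed[OF F xy(2)] by (simp add: a_minus_def Z.r_neg)
    thus "w_relation K R Q w a b c d \<in> carrier H \<and> F (w_relation K R Q w a b c d) = \<zero>\<^bsub>Z\<^esub>"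
      unfolding w_relation_eq[OF ab] using xy by simp
  qed
  ultimately have "wI \<subseteq> ?J" unfolding w_ideal_def by (rule ring.genideal_minimal[OF H_ring])
  hence "\<And>i. i \<in> wI \<Longrightarrow> F i = \<zero>\<^bsub>Z\<^esub>" by auto
  hence "\<exists>g\<in>add_hom A Z. \<forall>x\<in>carrier H. g (cls x) = F x"
    unfolding A_eq cls_eq by (rule algebra_ideal.quot_lift[OF AI Z F])
  then obtain g where g: "g \<in> add_hom A Z" "\<And>x. x \<in> carrier H \<Longrightarrow> g (cls x) = F x" by auto
  have "g (cl r r' p q) = \<phi> r r' p q"
    if a: "r \<in> carrier R" "r' \<in> carrier R" "p \<in> qpaths Q m" "q \<in> qpaths Q m" for r r' p q m
    using g(2)[OF hh_in[OF a]] Fh[OF a] by simp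
  thus ?thesis by (intro bexI[OF _ g(1)]) blast
qed

end

section \<open>Tensor products of bimodules\<close>

lemma bimodule_smult_ract:
  assumes "bimodule K L M" "k \<in> carrier K" "l \<in> carrier L" "x \<in> carrier M"
  shows "k \<odot>\<^bsub>M\<^esub> ract M x l = ract M (k \<odot>\<^bsub>M\<^esub> x) l"
proof -
  interpret bimodule K L M by fact
  show ?thesis using assms(2-4) by (simp add: lact_scalar[symmetric] ract_closed lact_ract)
qed

lemma bimodule_abelian:
  assumes "bimodule K L M" shows "abelian_group M"
proof -
  interpret bimodule K L M by fact
  show ?thesis by (rule M.abelian_group_axioms)
qed

lemma bimodule_act_hom:
  assumes "bimodule K L M" "l \<in> carrier L"
  shows "lact M l \<in> add_hom M M" "(\<lambda>x. ract M x l) \<in> add_hom M M"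
proof -
  interpret bimodule K L M by fact
  show "lact M l \<in> add_hom M M" "(\<lambda>x. ract M x l) \<in> add_hom M M"
    using assms(2) by (auto intro!: add_homI simp: lact_closed ract_closed lact_add_right ract_add_left)
qed

lemma bimodule_smult_hom:
  assumes "bimodule K L M" "k \<in> carrier K"
  shows "smult M k \<in> add_hom M M"
proof -
  interpret bimodule K L M by fact
  show ?thesis using assms(2) by (auto intro!: add_homI simp: M.smult_r_distr)
qed

lemma bimodule_lact_ract:
  assumes "bimodule K L M" "l \<in> carrier L" "l' \<in> carrier L" "x \<in> carrier M"
  shows "ract M (lact M l x) l' = lact M l (ract M x l')"
  by (rule bimodule.lact_ract) fact+

lemma tensor_pairI:
  assumes "bimodule K L M" "bimodule K' L N"
  shows "tensor_pair L M N"
  using assms by (intro tensor_pair.intro bimodule_abelian bimodule.ract_closed bimodule.lact_closed)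

locale bimodule_pair =
  fixes K :: "('k, 'm) ring_scheme" and L :: "('k, 'l) module"
    and M :: "('k, 'l, 'a) bimodule" and N :: "('k, 'l, 'b) bimodule"
  assumes bimodM: "bimodule K L M" and bimodN: "bimodule K L N"
begin

sublocale tensor_pair L M N by (rule tensor_pairI[OF bimodM bimodN])

lemma T_ops_hom:
  "k \<in> carrier K \<Longrightarrow> smult T k \<in> add_hom T T"
  "l \<in> carrier L \<Longrightarrow> lact T l \<in> add_hom T T"
  "l \<in> carrier L \<Longrightarrow> (\<lambda>u. ract T u l) \<in> add_hom T T"
proof -
  show "k \<in> carrier K \<Longrightarrow> smult T k \<in> add_hom T T"
    by (rule T_smult_hom[OF bimodule_smult_hom[OF bimodM] bimodule_smult_ract[OF bimodM]])
  show "l \<in> carrier L \<Longrightarrow> lact T l \<in> add_hom T T"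
    by (rule T_lact_hom[OF bimodule_act_hom(1)[OF bimodM] bimodule_lact_ract[OF bimodM, symmetric]])
  show "l \<in> carrier L \<Longrightarrow> (\<lambda>u. ract T u l) \<in> add_hom T T"
    by (rule T_ract_hom[OF bimodule_act_hom(2)[OF bimodN] bimodule_lact_ract[OF bimodN]])
qed

lemma T_ops_tens:
  assumes "x \<in> carrier M" "y \<in> carrier N"
  shows "k \<in> carrier K \<Longrightarrow> k \<odot>\<^bsub>T\<^esub> tens L M N x y = tens L M N (k \<odot>\<^bsub>M\<^esub> x) y"
    "l \<in> carrier L \<Longrightarrow> lact T l (tens L M N x y) = tens L M N (lact M l x) y"
    "l \<in> carrier L \<Longrightarrow> ract T (tens L M N x y) l = tens L M N x (ract N y l)"
proof -
  show "k \<in> carrier K \<Longrightarrow> k \<odot>\<^bsub>T\<^esub> tens L M N x y = tens L M N (k \<odot>\<^bsub>M\<^esub> x) y"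
    by (rule T_smult_tens[OF bimodule_smult_hom[OF bimodM] bimodule_smult_ract[OF bimodM] assms])
  show "l \<in> carrier L \<Longrightarrow> lact T l (tens L M N x y) = tens L M N (lact M l x) y"
    by (rule T_lact_tens[OF bimodule_act_hom(1)[OF bimodM] bimodule_lact_ract[OF bimodM, symmetric] assms])
  show "l \<in> carrier L \<Longrightarrow> ract T (tens L M N x y) l = tens L M N x (ract N y l)"
    by (rule T_ract_tens[OF bimodule_act_hom(2)[OF bimodN] bimodule_lact_ract[OF bimodN] assms])
qed

end

lemma regular_bimodule_simps [simp]:
  "carrier (regular_bimodule L) = carrier L" "ring.zero (regular_bimodule L) = ring.zero L"
  "ring.add (regular_bimodule L) = ring.add L" "smult (regular_bimodule L) = smult L"
  "lact (regular_bimodule L) = monoid.mult L" "ract (regular_bimodule L) = monoid.mult L"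
  by (simp_all add: regular_bimodule_def module.extend_def bimodule.defs)

lemma bialgebroid_bimodule_simps [simp]:
  "carrier (bialgebroid_bimodule A s t) = carrier A" "ring.zero (bialgebroid_bimodule A s t) = ring.zero A"
  "ring.add (bialgebroid_bimodule A s t) = ring.add A" "smult (bialgebroid_bimodule A s t) = smult A"
  "lact (bialgebroid_bimodule A s t) = (\<lambda>l a. s l \<otimes>\<^bsub>A\<^esub> a)" "ract (bialgebroid_bimodule A s t) = (\<lambda>a l. t l \<otimes>\<^bsub>A\<^esub> a)"
  by (simp_all add: bialgebroid_bimodule_def module.extend_def bimodule.defs)

lemma bialgebroid_bimodule_bimodule:
  fixes K :: "('k, 'm) ring_scheme" and A :: "('k, 'a) module" and L :: "('k, 'l) module"
  assumes "k_algebra K A" "k_algebra K L" and s: "s \<in> algebra_hom K L A" and t: "t \<in> algebra_hom K (op_algebra L) A"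
    and st: "\<And>l l'. \<lbrakk>l \<in> carrier L; l' \<in> carrier L\<rbrakk> \<Longrightarrow> s l \<otimes>\<^bsub>A\<^esub> t l' = t l' \<otimes>\<^bsub>A\<^esub> s l"
  shows "bimodule K L (bialgebroid_bimodule A s t)"
proof -
  interpret A: k_algebra K A by fact
  interpret L: k_algebra K L by fact
  have sh: "s l \<in> carrier A" "s (l \<oplus>\<^bsub>L\<^esub> l') = s l \<oplus>\<^bsub>A\<^esub> s l'" "s (l \<otimes>\<^bsub>L\<^esub> l') = s l \<otimes>\<^bsub>A\<^esub> s l'"
      "k \<in> carrier K \<Longrightarrow> s (k \<odot>\<^bsub>L\<^esub> l) = k \<odot>\<^bsub>A\<^esub> s l" "s \<one>\<^bsub>L\<^esub> = \<one>\<^bsub>A\<^esub>"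
    if "l \<in> carrier L" "l' \<in> carrier L" for l l' k
    using s that by (auto simp: algebra_hom_def linear_hom_def ring_hom_def)
  have th: "t l \<in> carrier A" "t (l \<oplus>\<^bsub>L\<^esub> l') = t l \<oplus>\<^bsub>A\<^esub> t l'" "t (l \<otimes>\<^bsub>L\<^esub> l') = t l' \<otimes>\<^bsub>A\<^esub> t l"
      "k \<in> carrier K \<Longrightarrow> t (k \<odot>\<^bsub>L\<^esub> l) = k \<odot>\<^bsub>A\<^esub> t l" "t \<one>\<^bsub>L\<^esub> = \<one>\<^bsub>A\<^esub>"
    if "l \<in> carrier L" "l' \<in> carrier L" for l l' k
    using t that by (auto simp: algebra_hom_def linear_hom_def ring_hom_def)
  have lr: "t l' \<otimes>\<^bsub>A\<^esub> (s l \<otimes>\<^bsub>A\<^esub> x) = s l \<otimes>\<^bsub>A\<^esub> (t l' \<otimes>\<^bsub>A\<^esub> x)"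
    if "l \<in> carrier L" "l' \<in> carrier L" "x \<in> carrier A" for l l' x
    using that st[OF that(1,2)] by (simp add: A.m_assoc[symmetric] sh(1) th(1))
  show ?thesis
  proof (intro bimodule.intro bimodule_axioms.intro)
    show "k_algebra K L" by fact
    show "module K (bialgebroid_bimodule A s t)"
      by (rule module_cong[OF A.module_axioms]) simp_all
  qed (simp_all add: sh(1,2,3) th(1,2,3) A.l_distr A.r_distr A.m_assoc sh(4,5)[OF L.one_closed L.one_closed]
      th(4,5)[OF L.one_closed L.one_closed] A.smult_mult_left lr)
qed

section \<open>The base algebra and the source and target maps\<close>

context weighted_quiver
begin

abbreviation "L \<equiv> M_alg R Q"

lemma L_simps:
  "carrier L = verts Q \<rightarrow>\<^sub>E carrier R" "monoid.mult L = (\<lambda>f g. \<lambda>x\<in>verts Q. f x \<otimes> g x)"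
  "monoid.one L = (\<lambda>x\<in>verts Q. \<one>)" "ring.zero L = (\<lambda>x\<in>verts Q. \<zero>)"
  "ring.add L = (\<lambda>f g. \<lambda>x\<in>verts Q. f x \<oplus> g x)" "smult L = (\<lambda>k f. \<lambda>x\<in>verts Q. k \<odot> f x)"
  by (simp_all add: M_alg_def fun_algebra_def)

lemma L_eqI: "f \<in> carrier L \<Longrightarrow> g \<in> carrier L \<Longrightarrow> (\<And>x. x \<in> verts Q \<Longrightarrow> f x = g x) \<Longrightarrow> f = g"
  unfolding L_simps by (rule PiE_ext)

lemma L_val: "f \<in> carrier L \<Longrightarrow> x \<in> verts Q \<Longrightarrow> f x \<in> carrier R"
  by (auto simp: L_simps)

lemma L_in:
  "\<one>\<^bsub>L\<^esub> \<in> carrier L" "\<zero>\<^bsub>L\<^esub> \<in> carrier L"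
  "f \<in> carrier L \<Longrightarrow> g \<in> carrier L \<Longrightarrow> f \<otimes>\<^bsub>L\<^esub> g \<in> carrier L"
  "f \<in> carrier L \<Longrightarrow> g \<in> carrier L \<Longrightarrow> f \<oplus>\<^bsub>L\<^esub> g \<in> carrier L"
  "f \<in> carrier L \<Longrightarrow> k \<in> carrier K \<Longrightarrow> k \<odot>\<^bsub>L\<^esub> f \<in> carrier L"
  by (auto simp: L_simps intro!: restrict_PiE)

lemma L_at:
  assumes "x \<in> verts Q"
  shows "\<one>\<^bsub>L\<^esub> x = \<one>" "\<zero>\<^bsub>L\<^esub> x = \<zero>" "(f \<otimes>\<^bsub>L\<^esub> g) x = f x \<otimes> g x" "(f \<oplus>\<^bsub>L\<^esub> g) x = f x \<oplus> g x"
    "(k \<odot>\<^bsub>L\<^esub> f) x = k \<odot> f x"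
  using assms by (simp_all add: L_simps)

lemma L_algebra: "k_algebra K L"
proof -
  have ab: "abelian_group L"
  proof (rule abelian_groupI)
    show "\<exists>g\<in>carrier L. g \<oplus>\<^bsub>L\<^esub> f = \<zero>\<^bsub>L\<^esub>" if f: "f \<in> carrier L" for f
    proof (rule bexI)
      show g: "(\<lambda>x\<in>verts Q. \<ominus> f x) \<in> carrier L" using L_val[OF f] by (auto simp: L_simps(1) intro!: restrict_PiE)
      show "(\<lambda>x\<in>verts Q. \<ominus> f x) \<oplus>\<^bsub>L\<^esub> f = \<zero>\<^bsub>L\<^esub>"
        by (rule L_eqI) (use f g L_val[OF f] in \<open>simp_all add: L_in L_at R.l_neg\<close>)
    qed
    show "f \<oplus>\<^bsub>L\<^esub> g = g \<oplus>\<^bsub>L\<^esub> f" if "f \<in> carrier L" "g \<in> carrier L" for f g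
      by (rule L_eqI) (use that L_val in \<open>simp_all add: L_in L_at R.a_comm\<close>)
    show "f \<oplus>\<^bsub>L\<^esub> g \<oplus>\<^bsub>L\<^esub> h = f \<oplus>\<^bsub>L\<^esub> (g \<oplus>\<^bsub>L\<^esub> h)" if "f \<in> carrier L" "g \<in> carrier L" "h \<in> carrier L" for f g h
      by (rule L_eqI) (use that L_val in \<open>simp_all add: L_in L_at R.a_assoc\<close>)
    show "\<zero>\<^bsub>L\<^esub> \<oplus>\<^bsub>L\<^esub> f = f" if "f \<in> carrier L" for f
      by (rule L_eqI) (use that L_val in \<open>simp_all add: L_in L_at\<close>)
  qed (simp_all add: L_in)
  show ?thesis
  proof (intro k_algebra.intro moduleI ringI monoidI k_algebra_axioms.intro fieldK ab R.K.is_cring)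
  qed (simp_all only: L_in, (rule L_eqI; simp add: L_in L_at L_val R.m_assoc R.l_distr R.r_distr R.smult_l_distr R.smult_r_distr
        R.smult_assoc1 R.smult_mult_left R.smult_mult_right)+)
qed

abbreviation "s \<equiv> source_map K R Q w"
abbreviation "t \<equiv> target_map K R Q w"

lemma s_eq: "f \<in> carrier L \<Longrightarrow> s f = (\<Oplus>\<^bsub>A\<^esub>i\<in>VV. cl (f (fst i)) \<one> (Triv (fst i)) (Triv (snd i)))"
  unfolding source_map_def case_prod_beta
  by (rule add_hom_finsum[OF cls_hom Hab Aab]) (auto intro!: Ht_facts(1) ee_in[OF Triv_in Triv_in] L_val[of f])

lemma t_eq: "f \<in> carrier L \<Longrightarrow> t f = (\<Oplus>\<^bsub>A\<^esub>i\<in>VV. cl \<one> (f (fst i)) (Triv (snd i)) (Triv (fst i)))"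
  unfolding target_map_def case_prod_beta
  by (rule add_hom_finsum[OF cls_hom Hab Aab]) (auto intro!: Ht_facts(1) ee_in[OF Triv_in Triv_in] L_val[of f])

lemma A_mult_biadditive: "biadditive A A A (monoid.mult A)"
proof -
  interpret A: k_algebra K A by (rule A_algebra)
  show ?thesis by (auto intro!: biadditiveI simp: A.l_distr A.r_distr)
qed

lemmas A_mult_hom = biadditiveD(1,2)[OF A_mult_biadditive]
lemmas A_mult_in = biadditiveD(3)[OF A_mult_biadditive]

lemma s_in: "f \<in> carrier L \<Longrightarrow> s f \<in> carrier A" and t_in: "f \<in> carrier L \<Longrightarrow> t f \<in> carrier A"
proof -
  interpret A: abelian_group A by (rule Aab)
  show "f \<in> carrier L \<Longrightarrow> s f \<in> carrier A" "f \<in> carrier L \<Longrightarrow> t f \<in> carrier A"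
    by (auto simp: s_eq t_eq intro!: A.finsum_closed cl_in[OF _ _ Triv_in Triv_in] L_val[of f])
qed

text \<open>The sums that define \<open>s f\<close> and \<open>t f\<close> contain exactly one \<open>e\<^sup>\<lambda>\<^sub>\<mu>\<close> that composes with a given class
  on a given side, so multiplication by them picks out one value of \<open>f\<close>.\<close>

context
  fixes f r r' p q m
  assumes f: "f \<in> carrier L" and r: "r \<in> carrier R" "r' \<in> carrier R" and p: "p \<in> qpaths Q m" "q \<in> qpaths Q m"
begin

lemma fvals: "f (qsource Q p) \<in> carrier R" "f (qsource Q q) \<in> carrier R" "f (qtarget Q p) \<in> carrier R" "f (qtarget Q q) \<in> carrier R"
  using L_val[OF f] qsource_in[OF wfQ] qtarget_in[OF wfQ] p by auto

lemma s_left: "s f \<otimes>\<^bsub>A\<^esub> cl r r' p q = cl (f (qsource Q p) \<otimes> r) r' p q"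
proof -
  interpret A: abelian_group A by (rule Aab)
  have c: "cl (f (fst i)) \<one> (Triv (fst i)) (Triv (snd i)) \<otimes>\<^bsub>A\<^esub> cl r r' p q =
      (if i = (qsource Q p, qsource Q q) then cl (f (qsource Q p) \<otimes> r) r' p q else \<zero>\<^bsub>A\<^esub>)" if "i \<in> VV" for i
    using cl_mult[OF L_val[OF f] R.one_closed r Triv_in Triv_in p, of "fst i" "fst i" "snd i"] that r
    by (auto simp: prod_eq_iff)
  have "s f \<otimes>\<^bsub>A\<^esub> cl r r' p q = (\<Oplus>\<^bsub>A\<^esub>i\<in>VV. cl (f (fst i)) \<one> (Triv (fst i)) (Triv (snd i)) \<otimes>\<^bsub>A\<^esub> cl r r' p q)"
    unfolding s_eq[OF f]
    by (rule add_hom_finsum[OF A_mult_hom(2)[OF cl_in[OF r p]] Aab Aab]) (auto intro!: cl_in[OF _ _ Triv_in Triv_in] L_val[OF f])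
  also have "\<dots> = cl (f (fst (qsource Q p, qsource Q q))) \<one> (Triv (fst (qsource Q p, qsource Q q))) (Triv (snd (qsource Q p, qsource Q q))) \<otimes>\<^bsub>A\<^esub> cl r r' p q"
    by (rule A.finsum_single[OF finVV])
       (use qsource_in[OF wfQ p(1)] qsource_in[OF wfQ p(2)] c cl_in[OF R.m_closed[OF fvals(1) r(1)] r(2) p] in auto)
  also have "\<dots> = cl (f (qsource Q p) \<otimes> r) r' p q"
    using c[of "(qsource Q p, qsource Q q)"] qsource_in[OF wfQ p(1)] qsource_in[OF wfQ p(2)] by simp
  finally show ?thesis .
qed

lemma t_left: "t f \<otimes>\<^bsub>A\<^esub> cl r r' p q = cl r (r' \<otimes> f (qsource Q q)) p q"
proof -
  interpret A: abelian_group A by (rule Aab)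
  have c: "cl \<one> (f (fst i)) (Triv (snd i)) (Triv (fst i)) \<otimes>\<^bsub>A\<^esub> cl r r' p q =
      (if i = (qsource Q q, qsource Q p) then cl r (r' \<otimes> f (qsource Q q)) p q else \<zero>\<^bsub>A\<^esub>)" if "i \<in> VV" for i
    using cl_mult[OF R.one_closed L_val[OF f] r Triv_in Triv_in p, of "fst i" "snd i" "fst i"] that r
    by (auto simp: prod_eq_iff)
  have "t f \<otimes>\<^bsub>A\<^esub> cl r r' p q = (\<Oplus>\<^bsub>A\<^esub>i\<in>VV. cl \<one> (f (fst i)) (Triv (snd i)) (Triv (fst i)) \<otimes>\<^bsub>A\<^esub> cl r r' p q)"
    unfolding t_eq[OF f]
    by (rule add_hom_finsum[OF A_mult_hom(2)[OF cl_in[OF r p]] Aab Aab]) (auto intro!: cl_in[OF _ _ Triv_in Triv_in] L_val[OF f])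
  also have "\<dots> = cl \<one> (f (fst (qsource Q q, qsource Q p))) (Triv (snd (qsource Q q, qsource Q p))) (Triv (fst (qsource Q q, qsource Q p))) \<otimes>\<^bsub>A\<^esub> cl r r' p q"
    by (rule A.finsum_single[OF finVV])
       (use qsource_in[OF wfQ p(1)] qsource_in[OF wfQ p(2)] c cl_in[OF r(1) R.m_closed[OF r(2) fvals(2)] p] in auto)
  also have "\<dots> = cl r (r' \<otimes> f (qsource Q q)) p q"
    using c[of "(qsource Q q, qsource Q p)"] qsource_in[OF wfQ p(1)] qsource_in[OF wfQ p(2)] by simp
  finally show ?thesis .
qed

lemma s_right: "cl r r' p q \<otimes>\<^bsub>A\<^esub> s f = cl (r \<otimes> f (qtarget Q p)) r' p q"
proof -
  interpret A: abelian_group A by (rule Aab)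
  have c: "cl r r' p q \<otimes>\<^bsub>A\<^esub> cl (f (fst i)) \<one> (Triv (fst i)) (Triv (snd i)) =
      (if i = (qtarget Q p, qtarget Q q) then cl (r \<otimes> f (qtarget Q p)) r' p q else \<zero>\<^bsub>A\<^esub>)" if "i \<in> VV" for i
    using cl_mult[OF r L_val[OF f] R.one_closed p Triv_in Triv_in, of "fst i" "fst i" "snd i"] that r
    by (auto simp: prod_eq_iff qconcat_Triv)
  have "cl r r' p q \<otimes>\<^bsub>A\<^esub> s f = (\<Oplus>\<^bsub>A\<^esub>i\<in>VV. cl r r' p q \<otimes>\<^bsub>A\<^esub> cl (f (fst i)) \<one> (Triv (fst i)) (Triv (snd i)))"
    unfolding s_eq[OF f]
    by (rule add_hom_finsum[OF A_mult_hom(1)[OF cl_in[OF r p]] Aab Aab]) (auto intro!: cl_in[OF _ _ Triv_in Triv_in] L_val[OF f])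
  also have "\<dots> = cl r r' p q \<otimes>\<^bsub>A\<^esub> cl (f (fst (qtarget Q p, qtarget Q q))) \<one> (Triv (fst (qtarget Q p, qtarget Q q))) (Triv (snd (qtarget Q p, qtarget Q q)))"
    by (rule A.finsum_single[OF finVV])
       (use qtarget_in[OF wfQ p(1)] qtarget_in[OF wfQ p(2)] c cl_in[OF R.m_closed[OF r(1) fvals(3)] r(2) p] in auto)
  also have "\<dots> = cl (r \<otimes> f (qtarget Q p)) r' p q"
    using c[of "(qtarget Q p, qtarget Q q)"] qtarget_in[OF wfQ p(1)] qtarget_in[OF wfQ p(2)] by simp
  finally show ?thesis .
qed

lemma t_right: "cl r r' p q \<otimes>\<^bsub>A\<^esub> t f = cl r (f (qtarget Q q) \<otimes> r') p q"
proof -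
  interpret A: abelian_group A by (rule Aab)
  have c: "cl r r' p q \<otimes>\<^bsub>A\<^esub> cl \<one> (f (fst i)) (Triv (snd i)) (Triv (fst i)) =
      (if i = (qtarget Q q, qtarget Q p) then cl r (f (qtarget Q q) \<otimes> r') p q else \<zero>\<^bsub>A\<^esub>)" if "i \<in> VV" for i
    using cl_mult[OF r R.one_closed L_val[OF f] p Triv_in Triv_in, of "fst i" "snd i" "fst i"] that r
    by (auto simp: prod_eq_iff qconcat_Triv)
  have "cl r r' p q \<otimes>\<^bsub>A\<^esub> t f = (\<Oplus>\<^bsub>A\<^esub>i\<in>VV. cl r r' p q \<otimes>\<^bsub>A\<^esub> cl \<one> (f (fst i)) (Triv (snd i)) (Triv (fst i)))"
    unfolding t_eq[OF f]
    by (rule add_hom_finsum[OF A_mult_hom(1)[OF cl_in[OF r p]] Aab Aab]) (auto intro!: cl_in[OF _ _ Triv_in Triv_in] L_val[OF f])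
  also have "\<dots> = cl r r' p q \<otimes>\<^bsub>A\<^esub> cl \<one> (f (fst (qtarget Q q, qtarget Q p))) (Triv (snd (qtarget Q q, qtarget Q p))) (Triv (fst (qtarget Q q, qtarget Q p)))"
    by (rule A.finsum_single[OF finVV])
       (use qtarget_in[OF wfQ p(1)] qtarget_in[OF wfQ p(2)] c cl_in[OF r(1) R.m_closed[OF fvals(4) r(2)] p] in auto)
  also have "\<dots> = cl r (f (qtarget Q q) \<otimes> r') p q"
    using c[of "(qtarget Q q, qtarget Q p)"] qtarget_in[OF wfQ p(1)] qtarget_in[OF wfQ p(2)] by simp
  finally show ?thesis .
qed

end

text \<open>As \<open>\<AA>(w)\<close> is unital, an element is determined by how it multiplies classes. This reduces
  identities between \<open>s f\<close> and \<open>t g\<close> to \<open>s_left\<close> and \<open>t_left\<close>.\<close>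

lemma A_faithful:
  assumes "u \<in> carrier A" "v \<in> carrier A"
    and "\<And>r r' p q m. \<lbrakk>r \<in> carrier R; r' \<in> carrier R; p \<in> qpaths Q m; q \<in> qpaths Q m\<rbrakk> \<Longrightarrow>
      u \<otimes>\<^bsub>A\<^esub> cl r r' p q = v \<otimes>\<^bsub>A\<^esub> cl r r' p q"
  shows "u = v"
proof -
  interpret A: k_algebra K A by (rule A_algebra)
  have "u \<otimes>\<^bsub>A\<^esub> \<one>\<^bsub>A\<^esub> = v \<otimes>\<^bsub>A\<^esub> \<one>\<^bsub>A\<^esub>"
    by (rule add_hom_eq_on_span[OF A_mult_hom(1)[OF assms(1)] A_mult_hom(1)[OF assms(2)] Aab Aab A_spans])
       (use assms(3) in auto)
  thus ?thesis using assms by simp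
qed

lemma L_vals: "f \<in> carrier L \<Longrightarrow> p \<in> qpaths Q m \<Longrightarrow> f (qsource Q p) \<in> carrier R"
  "f \<in> carrier L \<Longrightarrow> p \<in> qpaths Q m \<Longrightarrow> f (qtarget Q p) \<in> carrier R"
  using L_val qsource_in[OF wfQ] qtarget_in[OF wfQ] by auto

lemma s_hom: "s \<in> algebra_hom K L A"
proof -
  interpret A: k_algebra K A by (rule A_algebra)
  have "s (f \<otimes>\<^bsub>L\<^esub> g) = s f \<otimes>\<^bsub>A\<^esub> s g" if "f \<in> carrier L" "g \<in> carrier L" for f g
    by (rule A_faithful)
       (use that in \<open>simp_all add: s_in L_in s_left L_vals A.m_assoc cl_in R.m_assoc L_at(3)[OF qsource_in[OF wfQ]]\<close>)
  moreover have "s (f \<oplus>\<^bsub>L\<^esub> g) = s f \<oplus>\<^bsub>A\<^esub> s g" if "f \<in> carrier L" "g \<in> carrier L" for f g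
    by (rule A_faithful)
       (use that in \<open>simp_all add: s_in L_in s_left L_vals A.l_distr cl_in cl_add R.l_distr L_at(4)[OF qsource_in[OF wfQ]]\<close>)
  moreover have "s \<one>\<^bsub>L\<^esub> = \<one>\<^bsub>A\<^esub>"
    by (rule A_faithful)
       (simp_all add: s_in L_in s_left cl_in L_at(1)[OF qsource_in[OF wfQ]])
  moreover have "s (k \<odot>\<^bsub>L\<^esub> f) = k \<odot>\<^bsub>A\<^esub> s f" if "k \<in> carrier K" "f \<in> carrier L" for f k
    by (rule A_faithful)
       (use that in \<open>simp_all add: s_in L_in s_left L_vals A.smult_mult_left cl_in cl_smult R.smult_mult_left L_at(5)[OF qsource_in[OF wfQ]]\<close>)
  ultimately show ?thesis by (auto simp: algebra_hom_def linear_hom_def ring_hom_def s_in)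
qed

lemma t_hom: "t \<in> algebra_hom K (op_algebra L) A"
proof -
  interpret A: k_algebra K A by (rule A_algebra)
  have "t (g \<otimes>\<^bsub>L\<^esub> f) = t f \<otimes>\<^bsub>A\<^esub> t g" if "f \<in> carrier L" "g \<in> carrier L" for f g
    by (rule A_faithful)
       (use that in \<open>simp_all add: t_in L_in t_left L_vals A.m_assoc cl_in R.m_assoc L_at(3)[OF qsource_in[OF wfQ]]\<close>)
  moreover have "t (f \<oplus>\<^bsub>L\<^esub> g) = t f \<oplus>\<^bsub>A\<^esub> t g" if "f \<in> carrier L" "g \<in> carrier L" for f g
    by (rule A_faithful)
       (use that in \<open>simp_all add: t_in L_in t_left L_vals A.l_distr cl_in cl_add R.r_distr L_at(4)[OF qsource_in[OF wfQ]]\<close>)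
  moreover have "t \<one>\<^bsub>L\<^esub> = \<one>\<^bsub>A\<^esub>"
    by (rule A_faithful)
       (simp_all add: t_in L_in t_left cl_in L_at(1)[OF qsource_in[OF wfQ]])
  moreover have "t (k \<odot>\<^bsub>L\<^esub> f) = k \<odot>\<^bsub>A\<^esub> t f" if "k \<in> carrier K" "f \<in> carrier L" for f k
    by (rule A_faithful)
       (use that in \<open>simp_all add: t_in L_in t_left L_vals A.smult_mult_left cl_in cl_smult R.smult_mult_right cl_mid L_at(5)[OF qsource_in[OF wfQ]]\<close>)
  ultimately show ?thesis by (auto simp: algebra_hom_def linear_hom_def ring_hom_def t_in)
qed

lemma s_t_commute: "f \<in> carrier L \<Longrightarrow> g \<in> carrier L \<Longrightarrow> s f \<otimes>\<^bsub>A\<^esub> t g = t g \<otimes>\<^bsub>A\<^esub> s f"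
proof -
  interpret A: k_algebra K A by (rule A_algebra)
  assume fg: "f \<in> carrier L" "g \<in> carrier L"
  show ?thesis
    by (rule A_faithful) (use fg in \<open>simp_all add: s_in t_in s_left t_left L_vals A.m_assoc cl_in\<close>)
qed

abbreviation "MM \<equiv> Aw_bimodule K R Q w"

lemma MM_eq: "MM = bialgebroid_bimodule A s t" by (simp add: Aw_bimodule_def)

lemma MM_simps [simp]:
  "carrier MM = carrier A" "ring.zero MM = ring.zero A"
  "ring.add MM = ring.add A" "smult MM = smult A"
  "lact MM = (\<lambda>l a. s l \<otimes>\<^bsub>A\<^esub> a)" "ract MM = (\<lambda>a l. t l \<otimes>\<^bsub>A\<^esub> a)"
  by (simp_all add: MM_eq)

lemma MM_bimodule: "bimodule K L MM"
  unfolding MM_eq by (rule bialgebroid_bimodule_bimodule[OF A_algebra L_algebra s_hom t_hom s_t_commute])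

section \<open>The comultiplication\<close>

abbreviation "TT \<equiv> bimodule_tensor L MM MM"
abbreviation "tt \<equiv> tens L MM MM"

lemma BP: "bimodule_pair K L MM MM" by (intro bimodule_pair.intro MM_bimodule)
lemma TP: "tensor_pair L MM MM" by (rule tensor_pairI[OF MM_bimodule MM_bimodule])
lemma Tab: "abelian_group TT" by (rule tensor_pair.abelian_T[OF TP])

lemma tt_facts:
  "a \<in> carrier A \<Longrightarrow> b \<in> carrier A \<Longrightarrow> tt a b \<in> carrier TT"
  "a \<in> carrier A \<Longrightarrow> a' \<in> carrier A \<Longrightarrow> b \<in> carrier A \<Longrightarrow> tt (a \<oplus>\<^bsub>A\<^esub> a') b = tt a b \<oplus>\<^bsub>TT\<^esub> tt a' b"
  "a \<in> carrier A \<Longrightarrow> b \<in> carrier A \<Longrightarrow> b' \<in> carrier A \<Longrightarrow> tt a (b \<oplus>\<^bsub>A\<^esub> b') = tt a b \<oplus>\<^bsub>TT\<^esub> tt a b'"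
  "a \<in> carrier A \<Longrightarrow> l \<in> carrier L \<Longrightarrow> b \<in> carrier A \<Longrightarrow> tt (t l \<otimes>\<^bsub>A\<^esub> a) b = tt a (s l \<otimes>\<^bsub>A\<^esub> b)"
  using biadditiveD(3)[OF tensor_pair.tens_biadditive[OF TP], of a b] biadditiveD(4)[OF tensor_pair.tens_biadditive[OF TP], of a a' b]
   biadditiveD(5)[OF tensor_pair.tens_biadditive[OF TP], of a b b'] tensor_pair.tens_middle[OF TP, of a l b] by simp_all

lemma tt_hom: "a \<in> carrier A \<Longrightarrow> tt a \<in> add_hom A TT" "b \<in> carrier A \<Longrightarrow> (\<lambda>a. tt a b) \<in> add_hom A TT"
  by (auto intro!: add_homI simp: tt_facts)

lemma tt_zero: "a \<in> carrier A \<Longrightarrow> tt a \<zero>\<^bsub>A\<^esub> = \<zero>\<^bsub>TT\<^esub>" "b \<in> carrier A \<Longrightarrow> tt \<zero>\<^bsub>A\<^esub> b = \<zero>\<^bsub>TT\<^esub>"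
  using add_hom_zero[OF tt_hom(1) Aab Tab] add_hom_zero[OF tt_hom(2) Aab Tab] by auto

lemma tt_ops:
  assumes "a \<in> carrier A" "b \<in> carrier A"
  shows "k \<in> carrier K \<Longrightarrow> k \<odot>\<^bsub>TT\<^esub> tt a b = tt (k \<odot>\<^bsub>A\<^esub> a) b"
    "l \<in> carrier L \<Longrightarrow> lact TT l (tt a b) = tt (s l \<otimes>\<^bsub>A\<^esub> a) b"
    "l \<in> carrier L \<Longrightarrow> ract TT (tt a b) l = tt a (t l \<otimes>\<^bsub>A\<^esub> b)"
  using bimodule_pair.T_ops_tens[OF BP, of a b] assms by simp_all

lemma TT_spans: "add_spans {tt a b | a b. a \<in> carrier A \<and> b \<in> carrier A} TT"
  using tensor_pair.tens_spans[OF TP tensor_pair.carrier_spans[OF TP]] by simp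

lemma TT_eq:
  assumes "abelian_group Z" "f \<in> add_hom TT Z" "g \<in> add_hom TT Z"
    "\<And>a b. a \<in> carrier A \<Longrightarrow> b \<in> carrier A \<Longrightarrow> f (tt a b) = g (tt a b)" "u \<in> carrier TT"
  shows "f u = g u"
  by (rule add_hom_eq_on_span[OF assms(2,3) Tab assms(1) TT_spans _ assms(5)]) (use assms(4) in auto)

lemma const_in: "x \<in> carrier R \<Longrightarrow> const_M Q x \<in> carrier L"
  by (auto simp: const_M_def L_simps(1))

lemma const_at: "v \<in> verts Q \<Longrightarrow> const_M Q x v = x" by (simp add: const_M_def)

lemma const_at_path: "p \<in> qpaths Q m \<Longrightarrow> const_M Q x (qsource Q p) = x"
  by (simp add: const_at qsource_in[OF wfQ])

text \<open>Scalars of \<open>R\<close> cross the tensor sign: this is middle linearity for constant functions. The second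
  form has further factors on the right, for use inside products.\<close>

lemma tt_move:
  assumes "r \<in> carrier R" "r' \<in> carrier R" "x \<in> carrier R" "y \<in> carrier R" "y' \<in> carrier R"
    "p \<in> qpaths Q m" "u \<in> qpaths Q m" "u' \<in> qpaths Q n" "q \<in> qpaths Q n"
    "a \<in> carrier A" "b \<in> carrier A"
  shows "tt (cl r (r' \<otimes> x) p u) (cl y y' u' q) = tt (cl r r' p u) (cl (x \<otimes> y) y' u' q)"
    "tt (cl r (r' \<otimes> x) p u \<otimes>\<^bsub>A\<^esub> a) (cl y y' u' q \<otimes>\<^bsub>A\<^esub> b) =
      tt (cl r r' p u \<otimes>\<^bsub>A\<^esub> a) (cl (x \<otimes> y) y' u' q \<otimes>\<^bsub>A\<^esub> b)"
proof -
  interpret A: k_algebra K A by (rule A_algebra)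
  have l: "t (const_M Q x) \<otimes>\<^bsub>A\<^esub> cl r r' p u = cl r (r' \<otimes> x) p u"
    using t_left[OF const_in[OF assms(3)] assms(1,2,6,7)] assms(7) by (simp add: const_at_path)
  have r: "s (const_M Q x) \<otimes>\<^bsub>A\<^esub> cl y y' u' q = cl (x \<otimes> y) y' u' q"
    using s_left[OF const_in[OF assms(3)] assms(4,5,8,9)] assms(8) by (simp add: const_at_path)
  note c = cl_in[OF assms(1,2,6,7)] cl_in[OF assms(4,5,8,9)]
  note st = s_in[OF const_in[OF assms(3)]] t_in[OF const_in[OF assms(3)]]
  show "tt (cl r (r' \<otimes> x) p u) (cl y y' u' q) = tt (cl r r' p u) (cl (x \<otimes> y) y' u' q)"
    unfolding l[symmetric] r[symmetric] by (rule tt_facts(4)[OF c(1) const_in[OF assms(3)] c(2)])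
  show "tt (cl r (r' \<otimes> x) p u \<otimes>\<^bsub>A\<^esub> a) (cl y y' u' q \<otimes>\<^bsub>A\<^esub> b) =
      tt (cl r r' p u \<otimes>\<^bsub>A\<^esub> a) (cl (x \<otimes> y) y' u' q \<otimes>\<^bsub>A\<^esub> b)"
    unfolding l[symmetric] r[symmetric]
    using tt_facts(4)[OF A.m_closed[OF c(1) assms(10)] const_in[OF assms(3)] A.m_closed[OF c(2) assms(11)]]
    by (simp add: A.m_assoc c st assms(10,11))
qed

abbreviation "comult_term r r' p q u \<equiv> tt (cl r \<one> p u) (cl \<one> r' u q)"

definition comult_val where "comult_val r r' p q = (\<Oplus>\<^bsub>TT\<^esub>u\<in>qpaths Q (qlength p). comult_term r r' p q u)"

lemma comult_val_eq: "p \<in> qpaths Q m \<Longrightarrow> comult_val r r' p q = (\<Oplus>\<^bsub>TT\<^esub>u\<in>qpaths Q m. comult_term r r' p q u)"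
  by (simp add: comult_val_def qlength_eq)

lemma comult_term_in: "\<lbrakk>r \<in> carrier R; r' \<in> carrier R; p \<in> qpaths Q m; q \<in> qpaths Q m; u \<in> qpaths Q m\<rbrakk> \<Longrightarrow> comult_term r r' p q u \<in> carrier TT"
  by (intro tt_facts(1) cl_in) auto

lemma finq: "finite (qpaths Q m)" by (rule finite_qpaths[OF finQ])

lemma comult_val_in: "\<lbrakk>r \<in> carrier R; r' \<in> carrier R; p \<in> qpaths Q m; q \<in> qpaths Q m\<rbrakk> \<Longrightarrow> comult_val r r' p q \<in> carrier TT"
proof -
  interpret T: abelian_group TT by (rule Tab)
  assume a: "r \<in> carrier R" "r' \<in> carrier R" "p \<in> qpaths Q m" "q \<in> qpaths Q m"
  show ?thesis unfolding comult_val_eq[OF a(3)] by (rule T.finsum_closed) (use comult_term_in[OF a] in auto)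
qed

text \<open>Multiplication by \<open>\<Delta> (r \<otimes> r' \<otimes> e\<^sup>p\<^sub>q)\<close> on the tensor square, from the left and from the right, on
  pure tensors. It takes the place of a product, which the tensor square does not have. The right
  version is balanced for formal reasons; the left one is balanced because \<open>\<Delta>\<close> takes values in the
  Takeuchi product.\<close>

definition left_term where "left_term r r' p q a b = (\<Oplus>\<^bsub>TT\<^esub>u\<in>qpaths Q (qlength p). tt (cl r \<one> p u \<otimes>\<^bsub>A\<^esub> a) (cl \<one> r' u q \<otimes>\<^bsub>A\<^esub> b))"

definition right_term where "right_term r r' p q a b = (\<Oplus>\<^bsub>TT\<^esub>u\<in>qpaths Q (qlength p). tt (a \<otimes>\<^bsub>A\<^esub> cl r \<one> p u) (b \<otimes>\<^bsub>A\<^esub> cl \<one> r' u q))"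

context
  fixes r r' p q m
  assumes r: "r \<in> carrier R" "r' \<in> carrier R" and p: "p \<in> qpaths Q m" "q \<in> qpaths Q m"
begin

lemma comult_factors_in: "u \<in> qpaths Q m \<Longrightarrow> cl r \<one> p u \<in> carrier A" "u \<in> qpaths Q m \<Longrightarrow> cl \<one> r' u q \<in> carrier A"
  using r p by (auto intro: cl_in)

text \<open>Multiplying \<open>e\<^sup>p\<^sub>u\<close> by \<open>t l\<close> on the right and multiplying \<open>e\<^sup>u\<^sub>q\<close> by \<open>s l\<close> on the right produce
  the same scalar, the value of \<open>l\<close> at the target of \<open>u\<close>, on the two sides of the tensor sign.\<close>

lemma takeuchi_term:
  assumes l: "l \<in> carrier L" and u: "u \<in> qpaths Q m" and ab: "a \<in> carrier A" "b \<in> carrier A"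
  shows "tt (cl r \<one> p u \<otimes>\<^bsub>A\<^esub> t l) (cl \<one> r' u q) = tt (cl r \<one> p u) (cl \<one> r' u q \<otimes>\<^bsub>A\<^esub> s l)"
    "tt (cl r \<one> p u \<otimes>\<^bsub>A\<^esub> (t l \<otimes>\<^bsub>A\<^esub> a)) (cl \<one> r' u q \<otimes>\<^bsub>A\<^esub> b) = tt (cl r \<one> p u \<otimes>\<^bsub>A\<^esub> a) (cl \<one> r' u q \<otimes>\<^bsub>A\<^esub> (s l \<otimes>\<^bsub>A\<^esub> b))"
proof -
  interpret A: k_algebra K A by (rule A_algebra)
  have lu: "l (qtarget Q u) \<in> carrier R" by (rule L_vals(2)[OF l u])
  have 1: "cl r \<one> p u \<otimes>\<^bsub>A\<^esub> t l = cl r (\<one> \<otimes> l (qtarget Q u)) p u"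
    using t_right[OF l r(1) R.one_closed p(1) u] lu by simp
  have 2: "cl \<one> r' u q \<otimes>\<^bsub>A\<^esub> s l = cl (l (qtarget Q u) \<otimes> \<one>) r' u q"
    using s_right[OF l R.one_closed r(2) u p(2)] lu by simp
  note mv = tt_move[OF r(1) R.one_closed lu R.one_closed r(2) p(1) u u p(2)]
  show "tt (cl r \<one> p u \<otimes>\<^bsub>A\<^esub> t l) (cl \<one> r' u q) = tt (cl r \<one> p u) (cl \<one> r' u q \<otimes>\<^bsub>A\<^esub> s l)"
    unfolding 1 2 by (rule mv(1)[OF ab])
  show "tt (cl r \<one> p u \<otimes>\<^bsub>A\<^esub> (t l \<otimes>\<^bsub>A\<^esub> a)) (cl \<one> r' u q \<otimes>\<^bsub>A\<^esub> b) = tt (cl r \<one> p u \<otimes>\<^bsub>A\<^esub> a) (cl \<one> r' u q \<otimes>\<^bsub>A\<^esub> (s l \<otimes>\<^bsub>A\<^esub> b))"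
    using mv(2)[OF ab] comult_factors_in[OF u] s_in[OF l] t_in[OF l] ab by (simp add: A.m_assoc[symmetric] 1 2)
qed

lemma left_term_balanced: "balanced L MM MM TT (left_term r r' p q)"
proof -
  interpret A: k_algebra K A by (rule A_algebra)
  interpret T: abelian_group TT by (rule Tab)
  have le: "left_term r r' p q a b = (\<Oplus>\<^bsub>TT\<^esub>u\<in>qpaths Q m. tt (cl r \<one> p u \<otimes>\<^bsub>A\<^esub> a) (cl \<one> r' u q \<otimes>\<^bsub>A\<^esub> b))" for a b
    by (simp add: left_term_def qlength_eq[OF p(1)])
  have cc: "tt (cl r \<one> p u \<otimes>\<^bsub>A\<^esub> a) (cl \<one> r' u q \<otimes>\<^bsub>A\<^esub> b) \<in> carrier TT"
    if "u \<in> qpaths Q m" "a \<in> carrier A" "b \<in> carrier A" for u a b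
    using that comult_factors_in by (intro tt_facts(1)) auto
  show ?thesis
  proof (rule balancedI; unfold MM_simps le)
    fix x x' y assume c: "x \<in> carrier A" "x' \<in> carrier A" "y \<in> carrier A"
    show "(\<Oplus>\<^bsub>TT\<^esub>u\<in>qpaths Q m. tt (cl r \<one> p u \<otimes>\<^bsub>A\<^esub> (x \<oplus>\<^bsub>A\<^esub> x')) (cl \<one> r' u q \<otimes>\<^bsub>A\<^esub> y)) =
      (\<Oplus>\<^bsub>TT\<^esub>u\<in>qpaths Q m. tt (cl r \<one> p u \<otimes>\<^bsub>A\<^esub> x) (cl \<one> r' u q \<otimes>\<^bsub>A\<^esub> y)) \<oplus>\<^bsub>TT\<^esub>
      (\<Oplus>\<^bsub>TT\<^esub>u\<in>qpaths Q m. tt (cl r \<one> p u \<otimes>\<^bsub>A\<^esub> x') (cl \<one> r' u q \<otimes>\<^bsub>A\<^esub> y))"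
      by (rule T.finsum_add_eq)
         (use c cc comult_factors_in in \<open>simp_all add: A.r_distr tt_facts(1,2)\<close>)
    show "(\<Oplus>\<^bsub>TT\<^esub>u\<in>qpaths Q m. tt (cl r \<one> p u \<otimes>\<^bsub>A\<^esub> y) (cl \<one> r' u q \<otimes>\<^bsub>A\<^esub> (x \<oplus>\<^bsub>A\<^esub> x'))) =
      (\<Oplus>\<^bsub>TT\<^esub>u\<in>qpaths Q m. tt (cl r \<one> p u \<otimes>\<^bsub>A\<^esub> y) (cl \<one> r' u q \<otimes>\<^bsub>A\<^esub> x)) \<oplus>\<^bsub>TT\<^esub>
      (\<Oplus>\<^bsub>TT\<^esub>u\<in>qpaths Q m. tt (cl r \<one> p u \<otimes>\<^bsub>A\<^esub> y) (cl \<one> r' u q \<otimes>\<^bsub>A\<^esub> x'))"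
      by (rule T.finsum_add_eq)
         (use c cc comult_factors_in in \<open>simp_all add: A.r_distr tt_facts(1,3)\<close>)
  next
    fix x y assume "x \<in> carrier A" "y \<in> carrier A"
    thus "(\<Oplus>\<^bsub>TT\<^esub>u\<in>qpaths Q m. tt (cl r \<one> p u \<otimes>\<^bsub>A\<^esub> x) (cl \<one> r' u q \<otimes>\<^bsub>A\<^esub> y)) \<in> carrier TT"
      using cc by (auto intro!: T.finsum_closed)
  next
    fix x l y assume c: "x \<in> carrier A" "l \<in> carrier L" "y \<in> carrier A"
    show "(\<Oplus>\<^bsub>TT\<^esub>u\<in>qpaths Q m. tt (cl r \<one> p u \<otimes>\<^bsub>A\<^esub> (t l \<otimes>\<^bsub>A\<^esub> x)) (cl \<one> r' u q \<otimes>\<^bsub>A\<^esub> y)) =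
      (\<Oplus>\<^bsub>TT\<^esub>u\<in>qpaths Q m. tt (cl r \<one> p u \<otimes>\<^bsub>A\<^esub> x) (cl \<one> r' u q \<otimes>\<^bsub>A\<^esub> (s l \<otimes>\<^bsub>A\<^esub> y)))"
      by (rule T.finsum_cong'[OF refl])
         (use c cc s_in[OF c(2)] takeuchi_term(2)[OF c(2) _ c(1,3)] in auto)
  qed
qed

lemma right_term_balanced: "balanced L MM MM TT (right_term r r' p q)"
proof -
  interpret A: k_algebra K A by (rule A_algebra)
  interpret T: abelian_group TT by (rule Tab)
  have le: "right_term r r' p q a b = (\<Oplus>\<^bsub>TT\<^esub>u\<in>qpaths Q m. tt (a \<otimes>\<^bsub>A\<^esub> cl r \<one> p u) (b \<otimes>\<^bsub>A\<^esub> cl \<one> r' u q))" for a b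
    by (simp add: right_term_def qlength_eq[OF p(1)])
  have cc: "tt (a \<otimes>\<^bsub>A\<^esub> cl r \<one> p u) (b \<otimes>\<^bsub>A\<^esub> cl \<one> r' u q) \<in> carrier TT"
    if "u \<in> qpaths Q m" "a \<in> carrier A" "b \<in> carrier A" for u a b
    using that comult_factors_in by (intro tt_facts(1)) auto
  show ?thesis
  proof (rule balancedI; unfold MM_simps le)
    fix x x' y assume c: "x \<in> carrier A" "x' \<in> carrier A" "y \<in> carrier A"
    show "(\<Oplus>\<^bsub>TT\<^esub>u\<in>qpaths Q m. tt ((x \<oplus>\<^bsub>A\<^esub> x') \<otimes>\<^bsub>A\<^esub> cl r \<one> p u) (y \<otimes>\<^bsub>A\<^esub> cl \<one> r' u q)) =
      (\<Oplus>\<^bsub>TT\<^esub>u\<in>qpaths Q m. tt (x \<otimes>\<^bsub>A\<^esub> cl r \<one> p u) (y \<otimes>\<^bsub>A\<^esub> cl \<one> r' u q)) \<oplus>\<^bsub>TT\<^esub>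
      (\<Oplus>\<^bsub>TT\<^esub>u\<in>qpaths Q m. tt (x' \<otimes>\<^bsub>A\<^esub> cl r \<one> p u) (y \<otimes>\<^bsub>A\<^esub> cl \<one> r' u q))"
      by (rule T.finsum_add_eq)
         (use c cc comult_factors_in in \<open>simp_all add: A.l_distr tt_facts(1,2)\<close>)
    show "(\<Oplus>\<^bsub>TT\<^esub>u\<in>qpaths Q m. tt (y \<otimes>\<^bsub>A\<^esub> cl r \<one> p u) ((x \<oplus>\<^bsub>A\<^esub> x') \<otimes>\<^bsub>A\<^esub> cl \<one> r' u q)) =
      (\<Oplus>\<^bsub>TT\<^esub>u\<in>qpaths Q m. tt (y \<otimes>\<^bsub>A\<^esub> cl r \<one> p u) (x \<otimes>\<^bsub>A\<^esub> cl \<one> r' u q)) \<oplus>\<^bsub>TT\<^esub>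
      (\<Oplus>\<^bsub>TT\<^esub>u\<in>qpaths Q m. tt (y \<otimes>\<^bsub>A\<^esub> cl r \<one> p u) (x' \<otimes>\<^bsub>A\<^esub> cl \<one> r' u q))"
      by (rule T.finsum_add_eq)
         (use c cc comult_factors_in in \<open>simp_all add: A.l_distr tt_facts(1,3)\<close>)
  next
    fix x y assume "x \<in> carrier A" "y \<in> carrier A"
    thus "(\<Oplus>\<^bsub>TT\<^esub>u\<in>qpaths Q m. tt (x \<otimes>\<^bsub>A\<^esub> cl r \<one> p u) (y \<otimes>\<^bsub>A\<^esub> cl \<one> r' u q)) \<in> carrier TT"
      using cc by (auto intro!: T.finsum_closed)
  next
    fix x l y assume c: "x \<in> carrier A" "l \<in> carrier L" "y \<in> carrier A"
    show "(\<Oplus>\<^bsub>TT\<^esub>u\<in>qpaths Q m. tt ((t l \<otimes>\<^bsub>A\<^esub> x) \<otimes>\<^bsub>A\<^esub> cl r \<one> p u) (y \<otimes>\<^bsub>A\<^esub> cl \<one> r' u q)) =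
      (\<Oplus>\<^bsub>TT\<^esub>u\<in>qpaths Q m. tt (x \<otimes>\<^bsub>A\<^esub> cl r \<one> p u) ((s l \<otimes>\<^bsub>A\<^esub> y) \<otimes>\<^bsub>A\<^esub> cl \<one> r' u q))"
      by (rule T.finsum_cong'[OF refl])
         (use c comult_factors_in s_in[OF c(2)] t_in[OF c(2)] in \<open>auto simp: A.m_assoc tt_facts(1,4)\<close>)
  qed
qed

abbreviation "left_mult \<equiv> tensor_lift TT (left_term r r' p q)"
abbreviation "right_mult \<equiv> tensor_lift TT (right_term r r' p q)"

lemma left_mult_hom: "left_mult \<in> add_hom TT TT" and right_mult_hom: "right_mult \<in> add_hom TT TT"
  by (rule tensor_pair.tensor_lift_hom[OF TP Tab left_term_balanced], rule tensor_pair.tensor_lift_hom[OF TP Tab right_term_balanced])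

lemma left_mult_tt: "a \<in> carrier A \<Longrightarrow> b \<in> carrier A \<Longrightarrow> left_mult (tt a b) = left_term r r' p q a b"
  and right_mult_tt: "a \<in> carrier A \<Longrightarrow> b \<in> carrier A \<Longrightarrow> right_mult (tt a b) = right_term r r' p q a b"
  using tensor_pair.tensor_lift_tens[OF TP Tab left_term_balanced, of a b] tensor_pair.tensor_lift_tens[OF TP Tab right_term_balanced, of a b]
  by simp_all

end

text \<open>The summand for \<open>u, v\<close> vanishes unless \<open>p, p'\<close> and \<open>q, q'\<close> and \<open>u, v\<close> are all composable, and the
  composable pairs \<open>u, v\<close> correspond to the paths of length \<open>m + n\<close>.\<close>

lemma comult_val_product:
  assumes r: "r \<in> carrier R" "r' \<in> carrier R" and p: "p \<in> qpaths Q m" "q \<in> qpaths Q m"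
    and s: "x \<in> carrier R" "x' \<in> carrier R" and p': "p' \<in> qpaths Q n" "q' \<in> qpaths Q n"
  shows "(\<Oplus>\<^bsub>TT\<^esub>u\<in>qpaths Q m. \<Oplus>\<^bsub>TT\<^esub>v\<in>qpaths Q n. tt (cl r \<one> p u \<otimes>\<^bsub>A\<^esub> cl x \<one> p' v) (cl \<one> r' u q \<otimes>\<^bsub>A\<^esub> cl \<one> x' v q')) =
    (if composable p q p' q' then comult_val (r \<otimes> x) (x' \<otimes> r') (qconcat p p') (qconcat q q') else \<zero>\<^bsub>TT\<^esub>)"
proof -
  interpret A: k_algebra K A by (rule A_algebra)
  interpret T: abelian_group TT by (rule Tab)
  let ?f = "\<lambda>u v. tt (cl r \<one> p u \<otimes>\<^bsub>A\<^esub> cl x \<one> p' v) (cl \<one> r' u q \<otimes>\<^bsub>A\<^esub> cl \<one> x' v q')"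
  let ?g = "\<lambda>w. comult_term (r \<otimes> x) (x' \<otimes> r') (qconcat p p') (qconcat q q') w"
  have f: "?f u v = (if composable p q p' q' \<and> qtarget Q u = qsource Q v then ?g (qconcat u v) else \<zero>\<^bsub>TT\<^esub>)"
    if uv: "u \<in> qpaths Q m" "v \<in> qpaths Q n" for u v
  proof -
    have 1: "cl r \<one> p u \<otimes>\<^bsub>A\<^esub> cl x \<one> p' v = (if composable p u p' v then cl (r \<otimes> x) \<one> (qconcat p p') (qconcat u v) else \<zero>\<^bsub>A\<^esub>)"
      using cl_mult[OF r(1) R.one_closed s(1) R.one_closed p(1) uv(1) p'(1) uv(2)] by simp
    have 2: "cl \<one> r' u q \<otimes>\<^bsub>A\<^esub> cl \<one> x' v q' = (if composable u q v q' then cl \<one> (x' \<otimes> r') (qconcat u v) (qconcat q q') else \<zero>\<^bsub>A\<^esub>)"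
      using cl_mult[OF R.one_closed r(2) R.one_closed s(2) uv(1) p(2) uv(2) p'(2)] by simp
    have i1: "cl (r \<otimes> x) \<one> (qconcat p p') (qconcat u v) \<in> carrier A" if "composable p u p' v"
      by (rule cl_in[of _ _ _ "m + n"]) (use that r s p p' uv in \<open>auto intro: qconcat_in_qpaths\<close>)
    have i2: "cl \<one> (x' \<otimes> r') (qconcat u v) (qconcat q q') \<in> carrier A" if "composable u q v q'"
      by (rule cl_in[of _ _ _ "m + n"]) (use that r s p p' uv in \<open>auto intro: qconcat_in_qpaths\<close>)
    show ?thesis unfolding 1 2 using i1 i2 tt_zero by auto
  qed
  show ?thesis
  proof (cases "composable p q p' q'")
    case False
    have "?f u v = \<zero>\<^bsub>TT\<^esub>" if "u \<in> qpaths Q m" "v \<in> qpaths Q n" for u v using f[OF that] False by auto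
    hence "(\<Oplus>\<^bsub>TT\<^esub>u\<in>qpaths Q m. \<Oplus>\<^bsub>TT\<^esub>v\<in>qpaths Q n. ?f u v) = (\<Oplus>\<^bsub>TT\<^esub>u\<in>qpaths Q m. \<Oplus>\<^bsub>TT\<^esub>v\<in>qpaths Q n. \<zero>\<^bsub>TT\<^esub>)"
      by (intro T.finsum_cong'[OF refl]) (auto simp: T.finsum_zero cong: T.finsum_cong)
    thus ?thesis using False by (auto simp: T.finsum_zero)
  next
    case True
    have pc: "qconcat p p' \<in> qpaths Q (m + n)" "qconcat q q' \<in> qpaths Q (m + n)"
      using True p p' by (auto intro: qconcat_in_qpaths)
    have gin: "?g w \<in> carrier TT" if "w \<in> qpaths Q (m + n)" for w
      by (rule comult_term_in[OF _ _ pc that]) (use r s in auto)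
    let ?P = "{(u, v). u \<in> qpaths Q m \<and> v \<in> qpaths Q n \<and> qtarget Q u = qsource Q v}"
    have fin: "?f u v \<in> carrier TT" if "u \<in> qpaths Q m" "v \<in> qpaths Q n" for u v
      using f[OF that] gin qconcat_in_qpaths[OF that] by auto
    have "(\<Oplus>\<^bsub>TT\<^esub>u\<in>qpaths Q m. \<Oplus>\<^bsub>TT\<^esub>v\<in>qpaths Q n. ?f u v) = (\<Oplus>\<^bsub>TT\<^esub>z\<in>qpaths Q m \<times> qpaths Q n. ?f (fst z) (snd z))"
      by (rule T.finsum_cartesian[OF finq finq fin, symmetric])
    also have "\<dots> = (\<Oplus>\<^bsub>TT\<^esub>z\<in>?P. ?g (case z of (u, v) \<Rightarrow> qconcat u v))"
    proof (rule T.add.finprod_mono_neutral_cong_right)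
      show "finite (qpaths Q m \<times> qpaths Q n)" using finq by simp
      show "?f (fst z) (snd z) = \<zero>\<^bsub>TT\<^esub>" if "z \<in> qpaths Q m \<times> qpaths Q n - ?P" for z
        by (cases z) (use that f in simp)
      show "?f (fst z) (snd z) = ?g (case z of (u, v) \<Rightarrow> qconcat u v)" if "z \<in> ?P" for z
        by (cases z) (use that f True in simp)
    qed (use fin in auto)
    also have "\<dots> = (\<Oplus>\<^bsub>TT\<^esub>w\<in>(\<lambda>(u, v). qconcat u v) ` ?P. ?g w)"
      by (rule T.finsum_reindex[symmetric])
         (use qconcat_bij[OF wfQ, of m n] gin in \<open>auto simp: bij_betw_def\<close>)
    also have "\<dots> = (\<Oplus>\<^bsub>TT\<^esub>w\<in>qpaths Q (m + n). ?g w)"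
      using qconcat_bij[OF wfQ, of m n] by (simp add: bij_betw_def)
    also have "\<dots> = comult_val (r \<otimes> x) (x' \<otimes> r') (qconcat p p') (qconcat q q')"
      by (rule comult_val_eq[OF pc(1), symmetric])
    finally show ?thesis using True by simp
  qed
qed

lemma
  assumes r: "r \<in> carrier R" "r' \<in> carrier R" and p: "p \<in> qpaths Q m" "q \<in> qpaths Q m"
    and s: "x \<in> carrier R" "x' \<in> carrier R" and p': "p' \<in> qpaths Q n" "q' \<in> qpaths Q n"
  shows left_mult_comult_val: "left_mult r r' p q (comult_val x x' p' q') =
      (if composable p q p' q' then comult_val (r \<otimes> x) (x' \<otimes> r') (qconcat p p') (qconcat q q') else \<zero>\<^bsub>TT\<^esub>)"
    and right_mult_comult_val: "right_mult x x' p' q' (comult_val r r' p q) =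
      (if composable p q p' q' then comult_val (r \<otimes> x) (x' \<otimes> r') (qconcat p p') (qconcat q q') else \<zero>\<^bsub>TT\<^esub>)"
proof -
  interpret A: k_algebra K A by (rule A_algebra)
  interpret T: abelian_group TT by (rule Tab)
  let ?f = "\<lambda>u v. tt (cl r \<one> p u \<otimes>\<^bsub>A\<^esub> cl x \<one> p' v) (cl \<one> r' u q \<otimes>\<^bsub>A\<^esub> cl \<one> x' v q')"
  have fin: "?f u v \<in> carrier TT" if "u \<in> qpaths Q m" "v \<in> qpaths Q n" for u v
    using comult_factors_in[OF r p that(1)] comult_factors_in[OF s p' that(2)] by (auto intro!: tt_facts(1))
  have "left_mult r r' p q (comult_val x x' p' q') = (\<Oplus>\<^bsub>TT\<^esub>v\<in>qpaths Q n. left_mult r r' p q (comult_term x x' p' q' v))"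
    unfolding comult_val_eq[OF p'(1)] by (rule add_hom_finsum[OF left_mult_hom[OF r p] Tab Tab comult_term_in[OF s p']])
  also have "\<dots> = (\<Oplus>\<^bsub>TT\<^esub>v\<in>qpaths Q n. \<Oplus>\<^bsub>TT\<^esub>u\<in>qpaths Q m. ?f u v)"
    by (rule T.finsum_cong'[OF refl])
       (use fin in \<open>auto intro!: T.finsum_closed simp: left_mult_tt[OF r p] comult_factors_in[OF s p'] left_term_def qlength_eq[OF p(1)]\<close>)
  also have "\<dots> = (\<Oplus>\<^bsub>TT\<^esub>u\<in>qpaths Q m. \<Oplus>\<^bsub>TT\<^esub>v\<in>qpaths Q n. ?f u v)"
    by (rule T.finsum_swap[OF finq finq]) (rule fin)
  finally show "left_mult r r' p q (comult_val x x' p' q') =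
      (if composable p q p' q' then comult_val (r \<otimes> x) (x' \<otimes> r') (qconcat p p') (qconcat q q') else \<zero>\<^bsub>TT\<^esub>)"
    unfolding comult_val_product[OF r p s p'] .
  have "right_mult x x' p' q' (comult_val r r' p q) = (\<Oplus>\<^bsub>TT\<^esub>u\<in>qpaths Q m. right_mult x x' p' q' (comult_term r r' p q u))"
    unfolding comult_val_eq[OF p(1)] by (rule add_hom_finsum[OF right_mult_hom[OF s p'] Tab Tab comult_term_in[OF r p]])
  also have "\<dots> = (\<Oplus>\<^bsub>TT\<^esub>u\<in>qpaths Q m. \<Oplus>\<^bsub>TT\<^esub>v\<in>qpaths Q n. ?f u v)"
    by (rule T.finsum_cong'[OF refl])
       (use fin in \<open>auto intro!: T.finsum_closed simp: right_mult_tt[OF s p'] comult_factors_in[OF r p] right_term_def qlength_eq[OF p'(1)]\<close>)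
  finally show "right_mult x x' p' q' (comult_val r r' p q) =
      (if composable p q p' q' then comult_val (r \<otimes> x) (x' \<otimes> r') (qconcat p p') (qconcat q q') else \<zero>\<^bsub>TT\<^esub>)"
    unfolding comult_val_product[OF r p s p'] .
qed

abbreviation "AA i \<equiv> A2 (fst i) (snd i)"

lemma AA_in: "i \<in> AP \<Longrightarrow> AA i \<in> qpaths Q 2"
  using A2_in[of "fst i" "snd i"] by simp

lemma finsum_paths2:
  assumes "abelian_group Z" "\<And>u. u \<in> qpaths Q 2 \<Longrightarrow> f u \<in> carrier Z"
  shows "(\<Oplus>\<^bsub>Z\<^esub>u\<in>qpaths Q 2. f u) = (\<Oplus>\<^bsub>Z\<^esub>i\<in>AP. f (AA i))"
proof -
  interpret Z: abelian_group Z by fact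
  have "u \<in> AA ` AP" if "u \<in> qpaths Q 2" for u
    using that
  proof (cases rule: qpaths_cases)
    case (Arrows qs)
    then obtain a b where ab: "qs = [a, b]" by (auto simp: numeral_2_eq_2 length_Suc_conv)
    have "(a, b) \<in> AP" using Arrows(5) Arrows(6)[of 0] by (simp add: ab arrow_pairs_def)
    thus ?thesis using Arrows(2) ab by (intro image_eqI[of _ _ "(a, b)"]) auto
  qed simp
  hence e: "qpaths Q 2 = AA ` AP" using AA_in by auto
  show ?thesis unfolding e
    by (rule Z.finsum_reindex) (use assms(2) e in \<open>auto simp: inj_on_def prod_eq_iff\<close>)
qed

lemma w_in': "i \<in> AP \<Longrightarrow> (c, d) \<in> AP \<Longrightarrow> w (fst i) (snd i) c d \<in> carrier R" "i \<in> AP \<Longrightarrow> (c, d) \<in> AP \<Longrightarrow> w c d (fst i) (snd i) \<in> carrier R"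
  "i \<in> AP \<Longrightarrow> j \<in> AP \<Longrightarrow> w (fst i) (snd i) (fst j) (snd j) \<in> carrier R"
  using w_in by auto

text \<open>In sum notation, with \<open>i, j\<close> ranging over \<open>Q\<^sup>(\<^sup>2\<^sup>)\<close>: the relation for \<open>(a, b)\<close> and \<open>j\<close> in the left
  factor turns the scalar \<open>w\<^sup>i\<^sub>a\<^sub>b\<close> on its \<open>R\<close>-side into \<open>w\<^sup>j\<^sub>i\<close> on its \<open>R\<^sup>o\<^sup>p\<close>-side, from where
  it crosses to the right factor; the relation for \<open>i\<close> and \<open>(c, d)\<close> then turns it into \<open>w\<^sup>c\<^sup>d\<^sub>j\<close>.\<close>

lemma comult_val_relation:
  assumes ab: "(a, b) \<in> AP" and cd: "(c, d) \<in> AP"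
  shows "(\<Oplus>\<^bsub>TT\<^esub>i\<in>AP. comult_val (w (fst i) (snd i) a b) \<one> (AA i) (A2 c d)) =
      (\<Oplus>\<^bsub>TT\<^esub>i\<in>AP. comult_val \<one> (w c d (fst i) (snd i)) (A2 a b) (AA i))"
proof -
  interpret T: abelian_group TT by (rule Tab)
  interpret A: k_algebra K A by (rule A_algebra)
  note q2 = A2_in[OF ab] A2_in[OF cd] AA_in
  have tin: "tt (cl r r' x u) (cl y y' v z) \<in> carrier TT"
    if "r \<in> carrier R" "r' \<in> carrier R" "y \<in> carrier R" "y' \<in> carrier R" "x \<in> qpaths Q 2" "u \<in> qpaths Q 2" "v \<in> qpaths Q 2" "z \<in> qpaths Q 2"
    for r r' y y' x u v z
    using that by (intro tt_facts(1) cl_in)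
  have "(\<Oplus>\<^bsub>TT\<^esub>i\<in>AP. comult_val (w (fst i) (snd i) a b) \<one> (AA i) (A2 c d)) =
     (\<Oplus>\<^bsub>TT\<^esub>i\<in>AP. \<Oplus>\<^bsub>TT\<^esub>j\<in>AP. tt (cl (w (fst i) (snd i) a b) \<one> (AA i) (AA j)) (cl \<one> \<one> (AA j) (A2 c d)))"
    by (rule T.finsum_cong'[OF refl])
       (use ab cd in \<open>auto simp: comult_val_eq[OF AA_in] finsum_paths2[OF Tab comult_term_in[OF w_in'(1) _ AA_in q2(2)]] intro!: T.finsum_closed tin q2 w_in w_in'\<close>)
  also have "\<dots> = (\<Oplus>\<^bsub>TT\<^esub>j\<in>AP. \<Oplus>\<^bsub>TT\<^esub>i\<in>AP. tt (cl (w (fst i) (snd i) a b) \<one> (AA i) (AA j)) (cl \<one> \<one> (AA j) (A2 c d)))"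
    by (rule T.finsum_swap[OF finAP finAP]) (use ab cd in \<open>auto intro!: tin q2 w_in'\<close>)
  also have "\<dots> = (\<Oplus>\<^bsub>TT\<^esub>j\<in>AP. \<Oplus>\<^bsub>TT\<^esub>i\<in>AP. tt (cl \<one> (w (fst j) (snd j) (fst i) (snd i)) (A2 a b) (AA i)) (cl \<one> \<one> (AA j) (A2 c d)))"
  proof (rule T.finsum_cong'[OF refl])
    fix j assume j: "j \<in> AP"
    have Y: "cl \<one> \<one> (AA j) (A2 c d) \<in> carrier A" by (intro cl_in[of _ _ _ 2] q2 j) auto
    note h = add_hom_finsum[OF tt_hom(2)[OF Y] Aab Tab, symmetric]
    have j': "(fst j, snd j) \<in> AP" using j by simp
    show "(\<Oplus>\<^bsub>TT\<^esub>i\<in>AP. tt (cl (w (fst i) (snd i) a b) \<one> (AA i) (AA j)) (cl \<one> \<one> (AA j) (A2 c d)))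
      = (\<Oplus>\<^bsub>TT\<^esub>i\<in>AP. tt (cl \<one> (w (fst j) (snd j) (fst i) (snd i)) (A2 a b) (AA i)) (cl \<one> \<one> (AA j) (A2 c d)))"
      by (subst (1 2) h) (use j ab in \<open>auto intro!: cl_in[of _ _ _ 2] q2 w_in' simp only: cl_relation[OF ab j']\<close>)
  qed (use ab cd in \<open>auto intro!: T.finsum_closed tin q2 w_in'\<close>)
  also have "\<dots> = (\<Oplus>\<^bsub>TT\<^esub>j\<in>AP. \<Oplus>\<^bsub>TT\<^esub>i\<in>AP. tt (cl \<one> \<one> (A2 a b) (AA i)) (cl (w (fst j) (snd j) (fst i) (snd i)) \<one> (AA j) (A2 c d)))"
  proof (intro T.finsum_cong'[OF refl])
    fix i j assume ij: "i \<in> AP" "j \<in> AP"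
    show "tt (cl \<one> (w (fst j) (snd j) (fst i) (snd i)) (A2 a b) (AA i)) (cl \<one> \<one> (AA j) (A2 c d)) =
       tt (cl \<one> \<one> (A2 a b) (AA i)) (cl (w (fst j) (snd j) (fst i) (snd i)) \<one> (AA j) (A2 c d))"
      using tt_move(1)[OF R.one_closed R.one_closed w_in'(3)[OF ij(2,1)] R.one_closed R.one_closed q2(1) AA_in[OF ij(1)] AA_in[OF ij(2)] q2(2) A.one_closed A.one_closed]
        w_in'(3)[OF ij(2,1)] by simp
  qed (use ab cd in \<open>auto intro!: T.finsum_closed tin q2 w_in'\<close>)
  also have "\<dots> = (\<Oplus>\<^bsub>TT\<^esub>i\<in>AP. \<Oplus>\<^bsub>TT\<^esub>j\<in>AP. tt (cl \<one> \<one> (A2 a b) (AA i)) (cl (w (fst j) (snd j) (fst i) (snd i)) \<one> (AA j) (A2 c d)))"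
    by (rule T.finsum_swap[OF finAP finAP]) (use ab cd in \<open>auto intro!: tin q2 w_in'\<close>)
  also have "\<dots> = (\<Oplus>\<^bsub>TT\<^esub>i\<in>AP. \<Oplus>\<^bsub>TT\<^esub>j\<in>AP. tt (cl \<one> \<one> (A2 a b) (AA i)) (cl \<one> (w c d (fst j) (snd j)) (AA i) (AA j)))"
  proof (rule T.finsum_cong'[OF refl])
    fix i assume i: "i \<in> AP"
    have Y: "cl \<one> \<one> (A2 a b) (AA i) \<in> carrier A" by (intro cl_in[of _ _ _ 2] q2 i) auto
    note h = add_hom_finsum[OF tt_hom(1)[OF Y] Aab Tab, symmetric]
    have i': "(fst i, snd i) \<in> AP" using i by simp
    show "(\<Oplus>\<^bsub>TT\<^esub>j\<in>AP. tt (cl \<one> \<one> (A2 a b) (AA i)) (cl (w (fst j) (snd j) (fst i) (snd i)) \<one> (AA j) (A2 c d)))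
      = (\<Oplus>\<^bsub>TT\<^esub>j\<in>AP. tt (cl \<one> \<one> (A2 a b) (AA i)) (cl \<one> (w c d (fst j) (snd j)) (AA i) (AA j)))"
      by (subst (1 2) h) (use i cd in \<open>auto intro!: cl_in[of _ _ _ 2] q2 w_in' simp only: cl_relation[OF i' cd]\<close>)
  qed (use ab cd in \<open>auto intro!: T.finsum_closed tin q2 w_in'\<close>)
  also have "\<dots> = (\<Oplus>\<^bsub>TT\<^esub>j\<in>AP. \<Oplus>\<^bsub>TT\<^esub>i\<in>AP. tt (cl \<one> \<one> (A2 a b) (AA i)) (cl \<one> (w c d (fst j) (snd j)) (AA i) (AA j)))"
    by (rule T.finsum_swap[OF finAP finAP]) (use ab cd in \<open>auto intro!: tin q2 w_in'\<close>)
  also have "\<dots> = (\<Oplus>\<^bsub>TT\<^esub>i\<in>AP. comult_val \<one> (w c d (fst i) (snd i)) (A2 a b) (AA i))"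
  proof (rule T.finsum_cong'[OF refl])
    fix j assume j: "j \<in> AP"
    show "(\<Oplus>\<^bsub>TT\<^esub>i\<in>AP. tt (cl \<one> \<one> (A2 a b) (AA i)) (cl \<one> (w c d (fst j) (snd j)) (AA i) (AA j))) =
      comult_val \<one> (w c d (fst j) (snd j)) (A2 a b) (AA j)"
      unfolding comult_val_eq[OF q2(1)]
      by (rule finsum_paths2[OF Tab, symmetric]) (rule comult_term_in[OF R.one_closed w_in'(2)[OF j cd] q2(1) AA_in[OF j]])
  qed (use ab cd in \<open>auto intro!: comult_val_in[of _ _ _ 2] q2 w_in'\<close>)
  finally show ?thesis .
qed

lemma comult_val_mid:
  assumes "k \<in> carrier K" "r \<in> carrier R" "r' \<in> carrier R" "p \<in> qpaths Q m" "q \<in> qpaths Q m"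
  shows "comult_val (k \<odot> r) r' p q = comult_val r (k \<odot> r') p q"
proof -
  interpret T: abelian_group TT by (rule Tab)
  interpret A: k_algebra K A by (rule A_algebra)
  have k1: "k \<odot> \<one> \<in> carrier R" using assms by simp
  have "comult_term (k \<odot> r) r' p q u = comult_term r (k \<odot> r') p q u" if u: "u \<in> qpaths Q m" for u
  proof -
    have "comult_term (k \<odot> r) r' p q u = tt (cl r (\<one> \<otimes> (k \<odot> \<one>)) p u) (cl \<one> r' u q)"
      using cl_mid[OF assms(1,2) R.one_closed assms(4) u] k1 by simp
    also have "\<dots> = tt (cl r \<one> p u) (cl ((k \<odot> \<one>) \<otimes> \<one>) r' u q)"
      by (rule tt_move(1)[OF assms(2) R.one_closed k1 R.one_closed assms(3,4) u u assms(5) A.one_closed A.one_closed])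
    also have "\<dots> = comult_term r (k \<odot> r') p q u"
      using cl_mid[OF assms(1) R.one_closed assms(3) u assms(5)] k1 by simp
    finally show ?thesis .
  qed
  thus ?thesis unfolding comult_val_eq[OF assms(4)]
    by (intro T.finsum_cong'[OF refl]) (use comult_term_in[OF assms(2) _ assms(4,5)] assms in auto)
qed

lemma comult_val_add:
  assumes "r \<in> carrier R" "x \<in> carrier R" "r' \<in> carrier R" "p \<in> qpaths Q m" "q \<in> qpaths Q m"
  shows "comult_val (r \<oplus> x) r' p q = comult_val r r' p q \<oplus>\<^bsub>TT\<^esub> comult_val x r' p q"
    "comult_val r (r' \<oplus> x) p q = comult_val r r' p q \<oplus>\<^bsub>TT\<^esub> comult_val r x p q"
proof -
  interpret T: abelian_group TT by (rule Tab)
  show "comult_val (r \<oplus> x) r' p q = comult_val r r' p q \<oplus>\<^bsub>TT\<^esub> comult_val x r' p q"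
    unfolding comult_val_eq[OF assms(4)]
    by (rule T.finsum_add_eq)
       (use assms in \<open>simp_all add: tt_facts(1) cl_add[OF _ _ _ assms(4)] tt_facts(2) cl_in[OF _ _ assms(4)] cl_in[OF _ _ _ assms(5)]\<close>)
  show "comult_val r (r' \<oplus> x) p q = comult_val r r' p q \<oplus>\<^bsub>TT\<^esub> comult_val r x p q"
    unfolding comult_val_eq[OF assms(4)]
    by (rule T.finsum_add_eq)
       (use assms in \<open>simp_all add: tt_facts(1) cl_add[OF _ _ _ _ assms(5)] tt_facts(3) cl_in[OF _ _ assms(4)] cl_in[OF _ _ _ assms(5)]\<close>)
qed

lemma comult_exists: "\<exists>D\<in>add_hom A TT. \<forall>m. \<forall>r\<in>carrier R. \<forall>r'\<in>carrier R. \<forall>p\<in>qpaths Q m. \<forall>q\<in>qpaths Q m. D (cl r r' p q) = comult_val r r' p q"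
proof (rule A_lift[OF Tab, where lm = left_mult and rm = right_mult])
qed (fact comult_val_in comult_val_add comult_val_mid left_mult_hom right_mult_hom left_mult_comult_val right_mult_comult_val comult_val_relation)+

section \<open>The comultiplication as a comonoid structure\<close>

abbreviation "D \<equiv> comult_map K R Q w"
abbreviation "isD \<equiv> is_comult K R Q w"

lemma isD_eq: "isD \<Delta> \<longleftrightarrow> \<Delta> \<in> linear_hom K A TT \<inter> extensional (carrier A) \<and>
    (\<forall>m. \<forall>p\<in>qpaths Q m. \<forall>q\<in>qpaths Q m. \<forall>r\<in>carrier R. \<forall>r'\<in>carrier R.
        \<Delta> (cl r r' p q) = (\<Oplus>\<^bsub>TT\<^esub>u\<in>qpaths Q m. comult_term r r' p q u))"
  by (simp add: is_comult_def Let_def)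

lemma smult_TT_hom: "k \<in> carrier K \<Longrightarrow> smult TT k \<in> add_hom TT TT"
  by (rule bimodule_pair.T_ops_hom(1)[OF BP])

lemma smult_A_hom: "k \<in> carrier K \<Longrightarrow> smult A k \<in> add_hom A A"
  using bimodule_smult_hom[OF MM_bimodule, of k] by (simp add: add_hom_def)

lemma comult_val_smult:
  assumes "k \<in> carrier K" "r \<in> carrier R" "r' \<in> carrier R" "p \<in> qpaths Q m" "q \<in> qpaths Q m"
  shows "k \<odot>\<^bsub>TT\<^esub> comult_val r r' p q = comult_val (k \<odot> r) r' p q"
proof -
  interpret T: abelian_group TT by (rule Tab)
  have "k \<odot>\<^bsub>TT\<^esub> comult_val r r' p q = (\<Oplus>\<^bsub>TT\<^esub>u\<in>qpaths Q m. k \<odot>\<^bsub>TT\<^esub> comult_term r r' p q u)"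
    unfolding comult_val_eq[OF assms(4)]
    by (rule add_hom_finsum[OF smult_TT_hom[OF assms(1)] Tab Tab comult_term_in[OF assms(2-5)]])
  also have "\<dots> = (\<Oplus>\<^bsub>TT\<^esub>u\<in>qpaths Q m. comult_term (k \<odot> r) r' p q u)"
  proof (rule T.finsum_cong'[OF refl])
    fix u assume u: "u \<in> qpaths Q m"
    show "k \<odot>\<^bsub>TT\<^esub> comult_term r r' p q u = comult_term (k \<odot> r) r' p q u"
      using assms u by (simp add: tt_ops(1) comult_factors_in cl_smult[OF _ _ _ assms(4)])
  qed (use assms in \<open>auto intro!: comult_term_in\<close>)
  finally show ?thesis by (simp add: comult_val_eq[OF assms(4)])
qed

lemma comult_ex1: "\<exists>!\<Delta>. isD \<Delta>"
proof -
  interpret A: k_algebra K A by (rule A_algebra)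
  obtain D0 where D0: "D0 \<in> add_hom A TT" and
    c: "\<And>m r r' p q. \<lbrakk>r \<in> carrier R; r' \<in> carrier R; p \<in> qpaths Q m; q \<in> qpaths Q m\<rbrakk> \<Longrightarrow> D0 (cl r r' p q) = comult_val r r' p q"
    using comult_exists by auto
  have sm: "D0 (k \<odot>\<^bsub>A\<^esub> x) = k \<odot>\<^bsub>TT\<^esub> D0 x" if k: "k \<in> carrier K" and x: "x \<in> carrier A" for k x
  proof (rule add_hom_eq_on_span[OF add_hom_compose[OF smult_A_hom[OF k] D0] add_hom_compose[OF D0 smult_TT_hom[OF k]] Aab Tab A_spans _ x])
    fix y assume "y \<in> Aspan"
    then obtain r r' p q m where y: "y = cl r r' p q" "r \<in> carrier R" "r' \<in> carrier R" "p \<in> qpaths Q m" "q \<in> qpaths Q m" by auto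
    have "k \<odot> r \<in> carrier R" using k y by simp
    thus "D0 (k \<odot>\<^bsub>A\<^esub> y) = k \<odot>\<^bsub>TT\<^esub> D0 y"
      unfolding y(1) cl_smult[OF k y(2-5)] c[OF y(2-5)] comult_val_smult[OF k y(2-5)] by (rule c[OF _ y(3-5)])
  qed
  have "isD (restrict D0 (carrier A))"
    unfolding isD_eq linear_hom_def
    using sm D0 c cl_in by (auto simp: add_hom_def comult_val_eq)
  moreover have "\<Delta> = \<Delta>'" if "isD \<Delta>" "isD \<Delta>'" for \<Delta> \<Delta>'
  proof (rule extensionalityI[of _ "carrier A"])
    have ah: "\<Delta> \<in> add_hom A TT" "\<Delta>' \<in> add_hom A TT" using that by (auto simp: isD_eq linear_hom_def add_hom_def)
    show "\<Delta> x = \<Delta>' x" if x: "x \<in> carrier A" for x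
      by (rule add_hom_eq_on_span[OF ah Aab Tab A_spans _ x])
         (use \<open>isD \<Delta>\<close> \<open>isD \<Delta>'\<close> in \<open>auto simp only: isD_eq\<close>)
  qed (use that in \<open>auto simp: isD_eq\<close>)
  ultimately show ?thesis by blast
qed

lemma D_isD: "isD D"
  unfolding comult_map_def by (rule theI'[OF comult_ex1])

lemma D_hom: "D \<in> add_hom A TT"
  using D_isD by (auto simp: isD_eq linear_hom_def add_hom_def)

lemma D_linear: "D \<in> linear_hom K A TT"
  using D_isD by (auto simp: isD_eq)

lemma D_cl: "\<lbrakk>r \<in> carrier R; r' \<in> carrier R; p \<in> qpaths Q m; q \<in> qpaths Q m\<rbrakk> \<Longrightarrow> D (cl r r' p q) = comult_val r r' p q"
  using D_isD by (simp add: isD_eq comult_val_eq)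

lemma D_in: "a \<in> carrier A \<Longrightarrow> D a \<in> carrier TT" by (rule add_hom_closed[OF D_hom])

lemma A_eq_on_span:
  assumes "abelian_group Z" "f \<in> add_hom A Z" "g \<in> add_hom A Z"
    "\<And>r r' p q m. \<lbrakk>r \<in> carrier R; r' \<in> carrier R; p \<in> qpaths Q m; q \<in> qpaths Q m\<rbrakk> \<Longrightarrow> f (cl r r' p q) = g (cl r r' p q)"
    "a \<in> carrier A"
  shows "f a = g a"
proof (rule add_hom_eq_on_span[OF assms(2,3) Aab assms(1) A_spans _ assms(5)])
  fix x assume "x \<in> Aspan"
  then obtain r r' p q m where y: "x = cl r r' p q" "r \<in> carrier R" "r' \<in> carrier R" "p \<in> qpaths Q m" "q \<in> qpaths Q m" by auto
  show "f x = g x" unfolding y(1) by (rule assms(4)[OF y(2-5)])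
qed

text \<open>Every identity for \<open>\<Delta>\<close> is read off from the summands in this way.\<close>

lemma finsum_comult_val:
  assumes "abelian_group Z" "f \<in> add_hom TT Z" "r \<in> carrier R" "r' \<in> carrier R" "p \<in> qpaths Q m" "q \<in> qpaths Q m"
    "\<And>u. u \<in> qpaths Q m \<Longrightarrow> f (comult_term r r' p q u) = g u"
  shows "f (D (cl r r' p q)) = (\<Oplus>\<^bsub>Z\<^esub>u\<in>qpaths Q m. g u)"
proof -
  interpret Z: abelian_group Z by fact
  have "f (D (cl r r' p q)) = (\<Oplus>\<^bsub>Z\<^esub>u\<in>qpaths Q m. f (comult_term r r' p q u))"
    unfolding D_cl[OF assms(3-6)] comult_val_eq[OF assms(5)]
    by (rule add_hom_finsum[OF assms(2) Tab assms(1) comult_term_in[OF assms(3-6)]])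
  also have "\<dots> = (\<Oplus>\<^bsub>Z\<^esub>u\<in>qpaths Q m. g u)"
    by (rule Z.finsum_cong'[OF refl])
       (use assms(7) add_hom_closed[OF assms(2) comult_term_in[OF assms(3-6)]] in auto)
  finally show ?thesis .
qed

lemma act_A_hom: "l \<in> carrier L \<Longrightarrow> (\<lambda>a. s l \<otimes>\<^bsub>A\<^esub> a) \<in> add_hom A A" "l \<in> carrier L \<Longrightarrow> (\<lambda>a. t l \<otimes>\<^bsub>A\<^esub> a) \<in> add_hom A A"
  by (rule A_mult_hom(1)[OF s_in], assumption, rule A_mult_hom(1)[OF t_in], assumption)

lemma act_TT_hom: "l \<in> carrier L \<Longrightarrow> lact TT l \<in> add_hom TT TT" "l \<in> carrier L \<Longrightarrow> (\<lambda>u. ract TT u l) \<in> add_hom TT TT"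
  by (rule bimodule_pair.T_ops_hom[OF BP], assumption)+

lemma D_lact: "l \<in> carrier L \<Longrightarrow> a \<in> carrier A \<Longrightarrow> D (s l \<otimes>\<^bsub>A\<^esub> a) = lact TT l (D a)"
  and D_ract: "l \<in> carrier L \<Longrightarrow> a \<in> carrier A \<Longrightarrow> D (t l \<otimes>\<^bsub>A\<^esub> a) = ract TT (D a) l"
proof -
  assume l: "l \<in> carrier L" and a: "a \<in> carrier A"
  show "D (s l \<otimes>\<^bsub>A\<^esub> a) = lact TT l (D a)"
  proof (rule A_eq_on_span[OF Tab add_hom_compose[OF act_A_hom(1)[OF l] D_hom] add_hom_compose[OF D_hom act_TT_hom(1)[OF l]] _ a])
    fix r r' p q m assume b: "r \<in> carrier R" "r' \<in> carrier R" "p \<in> qpaths Q m" "q \<in> qpaths Q m"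
    have lr: "l (qsource Q p) \<otimes> r \<in> carrier R" using L_vals(1)[OF l b(3)] b by simp
    have "lact TT l (D (cl r r' p q)) = (\<Oplus>\<^bsub>TT\<^esub>u\<in>qpaths Q m. comult_term (l (qsource Q p) \<otimes> r) r' p q u)"
      by (rule finsum_comult_val[OF Tab act_TT_hom(1)[OF l] b])
         (simp add: tt_ops(2) comult_factors_in[OF b] l s_left[OF l b(1) R.one_closed b(3)])
    thus "D (s l \<otimes>\<^bsub>A\<^esub> cl r r' p q) = lact TT l (D (cl r r' p q))"
      by (simp add: s_left[OF l b] D_cl[OF lr b(2-4)] comult_val_eq[OF b(3)])
  qed
  show "D (t l \<otimes>\<^bsub>A\<^esub> a) = ract TT (D a) l"
  proof (rule A_eq_on_span[OF Tab add_hom_compose[OF act_A_hom(2)[OF l] D_hom] add_hom_compose[OF D_hom act_TT_hom(2)[OF l]] _ a])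
    fix r r' p q m assume b: "r \<in> carrier R" "r' \<in> carrier R" "p \<in> qpaths Q m" "q \<in> qpaths Q m"
    have lr: "r' \<otimes> l (qsource Q q) \<in> carrier R" using L_vals(1)[OF l b(4)] b by simp
    have "ract TT (D (cl r r' p q)) l = (\<Oplus>\<^bsub>TT\<^esub>u\<in>qpaths Q m. comult_term r (r' \<otimes> l (qsource Q q)) p q u)"
      by (rule finsum_comult_val[OF Tab act_TT_hom(2)[OF l] b])
         (simp add: tt_ops(3) comult_factors_in[OF b] l t_left[OF l R.one_closed b(2) _ b(4)])
    thus "D (t l \<otimes>\<^bsub>A\<^esub> cl r r' p q) = ract TT (D (cl r r' p q)) l"
      by (simp add: t_left[OF l b] D_cl[OF b(1) lr b(3-4)] comult_val_eq[OF b(3)])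
  qed
qed

lemma D_bimodule_hom: "D \<in> bimodule_hom K L MM TT"
proof -
  have "D \<in> linear_hom K MM TT" using D_linear by (simp add: linear_hom_def)
  thus ?thesis by (simp add: bimodule_hom_def D_lact D_ract)
qed

lemma right_mult_tens_hom:
  assumes "x \<in> carrier A" "y \<in> carrier A"
  shows "tensor_map L MM MM (\<lambda>a. a \<otimes>\<^bsub>A\<^esub> x) (\<lambda>b. b \<otimes>\<^bsub>A\<^esub> y) \<in> add_hom TT TT"
    "\<And>a b. a \<in> carrier A \<Longrightarrow> b \<in> carrier A \<Longrightarrow>
      tensor_map L MM MM (\<lambda>a. a \<otimes>\<^bsub>A\<^esub> x) (\<lambda>b. b \<otimes>\<^bsub>A\<^esub> y) (tt a b) = tt (a \<otimes>\<^bsub>A\<^esub> x) (b \<otimes>\<^bsub>A\<^esub> y)"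
proof -
  interpret A: k_algebra K A by (rule A_algebra)
  have h: "(\<lambda>a. a \<otimes>\<^bsub>A\<^esub> z) \<in> add_hom MM MM" if "z \<in> carrier A" for z
    using A_mult_hom(2)[OF that] unfolding add_hom_def MM_simps .
  have mid: "tt (ract MM a l \<otimes>\<^bsub>A\<^esub> x) (b \<otimes>\<^bsub>A\<^esub> y) = tt (a \<otimes>\<^bsub>A\<^esub> x) (lact MM l b \<otimes>\<^bsub>A\<^esub> y)"
    if "a \<in> carrier MM" "l \<in> carrier L" "b \<in> carrier MM" for a l b
  proof -
    have c: "a \<in> carrier A" "b \<in> carrier A" using that by simp_all
    show ?thesis
      unfolding MM_simps A.m_assoc[OF t_in[OF that(2)] c(1) assms(1)] A.m_assoc[OF s_in[OF that(2)] c(2) assms(2)]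
      by (rule tt_facts(4)[OF A.m_closed[OF c(1) assms(1)] that(2) A.m_closed[OF c(2) assms(2)]])
  qed
  show "tensor_map L MM MM (\<lambda>a. a \<otimes>\<^bsub>A\<^esub> x) (\<lambda>b. b \<otimes>\<^bsub>A\<^esub> y) \<in> add_hom TT TT"
    by (rule tensor_map_hom[OF TP TP h[OF assms(1)] h[OF assms(2)] mid])
  show "\<And>a b. a \<in> carrier A \<Longrightarrow> b \<in> carrier A \<Longrightarrow>
      tensor_map L MM MM (\<lambda>a. a \<otimes>\<^bsub>A\<^esub> x) (\<lambda>b. b \<otimes>\<^bsub>A\<^esub> y) (tt a b) = tt (a \<otimes>\<^bsub>A\<^esub> x) (b \<otimes>\<^bsub>A\<^esub> y)"
    by (rule tensor_map_tens[OF TP TP h[OF assms(1)] h[OF assms(2)] mid]) simp_all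
qed

abbreviation "right_tens_mult x y \<equiv> tensor_map L MM MM (\<lambda>a. a \<otimes>\<^bsub>A\<^esub> x) (\<lambda>b. b \<otimes>\<^bsub>A\<^esub> y)"

lemma right_tens_mult_D_cl:
  assumes b: "r \<in> carrier R" "r' \<in> carrier R" "p \<in> qpaths Q m" "q \<in> qpaths Q m" and xy: "x \<in> carrier A" "y \<in> carrier A"
  shows "right_tens_mult x y (D (cl r r' p q)) = left_term r r' p q x y"
  unfolding left_term_def qlength_eq[OF b(3)]
  by (rule finsum_comult_val[OF Tab right_mult_tens_hom(1)[OF xy] b]) (simp add: right_mult_tens_hom(2)[OF xy] comult_factors_in[OF b])

text \<open>The Takeuchi condition once more: it says that the componentwise product with \<open>\<Delta> a\<close> on the left is
  well defined on the tensor square.\<close>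

lemma right_tens_mult_D_balanced:
  assumes a: "a \<in> carrier A"
  shows "balanced L MM MM TT (\<lambda>x y. right_tens_mult x y (D a))"
proof -
  interpret T: abelian_group TT by (rule Tab)
  interpret A: k_algebra K A by (rule A_algebra)
  note rh = add_hom_compose[OF D_hom right_mult_tens_hom(1)]
  note lb = left_term_balanced[unfolded balanced_def, THEN conjunct1, THEN biadditiveD(4), simplified]
    left_term_balanced[unfolded balanced_def, THEN conjunct1, THEN biadditiveD(5), simplified]
  have lbm: "left_term r r' p q (t l \<otimes>\<^bsub>A\<^esub> x) y = left_term r r' p q x (s l \<otimes>\<^bsub>A\<^esub> y)"
    if "r \<in> carrier R" "r' \<in> carrier R" "p \<in> qpaths Q m" "q \<in> qpaths Q m" "x \<in> carrier A" "l \<in> carrier L" "y \<in> carrier A"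
    for r r' p q m x l y
    using left_term_balanced[OF that(1-4)] that(5-7) by (simp add: balanced_def)
  show ?thesis
  proof (rule balancedI; unfold MM_simps)
    fix x y assume "x \<in> carrier A" "y \<in> carrier A"
    thus "right_tens_mult x y (D a) \<in> carrier TT" using add_hom_closed[OF rh a] by simp
  next
    fix x x' y assume c: "x \<in> carrier A" "x' \<in> carrier A" "y \<in> carrier A"
    have xx: "x \<oplus>\<^bsub>A\<^esub> x' \<in> carrier A" using c by simp
    show "right_tens_mult (x \<oplus>\<^bsub>A\<^esub> x') y (D a) = right_tens_mult x y (D a) \<oplus>\<^bsub>TT\<^esub> right_tens_mult x' y (D a)"
      by (rule A_eq_on_span[OF Tab rh[OF xx c(3)] add_hom_plus[OF rh[OF c(1,3)] rh[OF c(2,3)] Aab Tab] _ a])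
         (simp add: right_tens_mult_D_cl xx c lb)
    show "right_tens_mult y (x \<oplus>\<^bsub>A\<^esub> x') (D a) = right_tens_mult y x (D a) \<oplus>\<^bsub>TT\<^esub> right_tens_mult y x' (D a)"
      by (rule A_eq_on_span[OF Tab rh[OF c(3) xx] add_hom_plus[OF rh[OF c(3,1)] rh[OF c(3,2)] Aab Tab] _ a])
         (simp add: right_tens_mult_D_cl xx c lb)
  next
    fix x l y assume c: "x \<in> carrier A" "l \<in> carrier L" "y \<in> carrier A"
    have tx: "t l \<otimes>\<^bsub>A\<^esub> x \<in> carrier A" "s l \<otimes>\<^bsub>A\<^esub> y \<in> carrier A" using c s_in t_in by auto
    show "right_tens_mult (t l \<otimes>\<^bsub>A\<^esub> x) y (D a) = right_tens_mult x (s l \<otimes>\<^bsub>A\<^esub> y) (D a)"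
      by (rule A_eq_on_span[OF Tab rh[OF tx(1) c(3)] rh[OF c(1) tx(2)] _ a])
         (simp add: right_tens_mult_D_cl tx c lbm)
  qed
qed

abbreviation "cmult \<equiv> componentwise_mult L A s t"

lemma cmult_eq: "cmult u v = tensor_lift TT (\<lambda>x y. right_tens_mult x y u) v"
  by (simp add: componentwise_mult_def Let_def MM_eq)

lemma cmult_hom: "a \<in> carrier A \<Longrightarrow> cmult (D a) \<in> add_hom TT TT"
  and cmult_tt: "a \<in> carrier A \<Longrightarrow> x \<in> carrier A \<Longrightarrow> y \<in> carrier A \<Longrightarrow> cmult (D a) (tt x y) = right_tens_mult x y (D a)"
  using tensor_pair.tensor_lift_hom[OF TP Tab right_tens_mult_D_balanced] tensor_pair.tensor_lift_tens[OF TP Tab right_tens_mult_D_balanced, of a x y]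
  by (simp_all add: cmult_eq[abs_def])

text \<open>For a class \<open>x\<close>, componentwise multiplication by \<open>\<Delta> x\<close> is the operator that served to construct
  \<open>\<Delta>\<close>, and its values on \<open>\<Delta> y\<close> are already known.\<close>

lemma D_mult:
  assumes "a \<in> carrier A" "b \<in> carrier A"
  shows "D (a \<otimes>\<^bsub>A\<^esub> b) = cmult (D a) (D b)"
proof -
  interpret T: abelian_group TT by (rule Tab)
  interpret A: k_algebra K A by (rule A_algebra)
  have bi1: "biadditive A A TT (\<lambda>a b. D (a \<otimes>\<^bsub>A\<^esub> b))"
    by (rule biadditiveI) (simp_all add: D_in A.l_distr A.r_distr add_hom_add[OF D_hom])
  have bi2: "biadditive A A TT (\<lambda>a b. cmult (D a) (D b))"
  proof (rule biadditiveI)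
    fix x y z assume c: "x \<in> carrier A" "y \<in> carrier A" "z \<in> carrier A"
    have xy: "x \<oplus>\<^bsub>A\<^esub> y \<in> carrier A" using c by simp
    show "cmult (D (x \<oplus>\<^bsub>A\<^esub> y)) (D z) = cmult (D x) (D z) \<oplus>\<^bsub>TT\<^esub> cmult (D y) (D z)"
      by (rule TT_eq[OF Tab cmult_hom[OF xy] add_hom_plus[OF cmult_hom[OF c(1)] cmult_hom[OF c(2)] Tab Tab] _ D_in[OF c(3)]])
         (simp add: cmult_tt xy c add_hom_add[OF add_hom_compose[OF D_hom right_mult_tens_hom(1)]])
    show "cmult (D x) (D (y \<oplus>\<^bsub>A\<^esub> z)) = cmult (D x) (D y) \<oplus>\<^bsub>TT\<^esub> cmult (D x) (D z)"
      by (rule add_hom_add[OF add_hom_compose[OF D_hom cmult_hom[OF c(1)]] c(2,3)])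
  next
    fix x y assume c: "x \<in> carrier A" "y \<in> carrier A"
    thus "cmult (D x) (D y) \<in> carrier TT" using add_hom_closed[OF cmult_hom D_in] by blast
  qed
  show ?thesis
  proof (rule biadditive_eq_on_span[OF bi1 bi2 Aab Aab Tab A_spans A_spans _ assms])
    fix x y assume "x \<in> Aspan" "y \<in> Aspan"
    then obtain r r' p q m r2 r2' p' q' n where x: "x = cl r r' p q" "r \<in> carrier R" "r' \<in> carrier R" "p \<in> qpaths Q m" "q \<in> qpaths Q m"
      and y: "y = cl r2 r2' p' q'" "r2 \<in> carrier R" "r2' \<in> carrier R" "p' \<in> qpaths Q n" "q' \<in> qpaths Q n" by auto
    have xi: "cl r r' p q \<in> carrier A" by (rule cl_in[OF x(2-5)])
    have "cmult (D x) (D y) = left_mult r r' p q (D y)"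
      unfolding x(1)
      by (rule TT_eq[OF Tab cmult_hom[OF xi] left_mult_hom[OF x(2-5)]])
         (simp_all add: cmult_tt[OF xi] left_mult_tt[OF x(2-5)] right_tens_mult_D_cl[OF x(2-5)] D_in y(1) cl_in[OF y(2-5)])
    also have "\<dots> = (if composable p q p' q' then comult_val (r \<otimes> r2) (r2' \<otimes> r') (qconcat p p') (qconcat q q') else \<zero>\<^bsub>TT\<^esub>)"
      unfolding y(1) D_cl[OF y(2-5)] by (rule left_mult_comult_val[OF x(2-5) y(2-5)])
    also have "\<dots> = D (x \<otimes>\<^bsub>A\<^esub> y)"
      unfolding x(1) y(1) cl_mult[OF x(2,3) y(2,3) x(4,5) y(4,5)]
      using add_hom_zero[OF D_hom Aab Tab] x y D_cl[of "r \<otimes> r2" "r2' \<otimes> r'" "qconcat p p'" "m + n" "qconcat q q'"]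
      by (simp add: qconcat_in_qpaths)
    finally show "D (x \<otimes>\<^bsub>A\<^esub> y) = cmult (D x) (D y)" by simp
  qed
qed

lemma D_takeuchi:
  assumes l: "l \<in> carrier L" and a: "a \<in> carrier A"
  shows "tensor_map L MM MM (\<lambda>x. x \<otimes>\<^bsub>A\<^esub> t l) id (D a) = tensor_map L MM MM id (\<lambda>y. y \<otimes>\<^bsub>A\<^esub> s l) (D a)"
proof -
  interpret T: abelian_group TT by (rule Tab)
  interpret A: k_algebra K A by (rule A_algebra)
  have h: "(\<lambda>a. a \<otimes>\<^bsub>A\<^esub> z) \<in> add_hom MM MM" if "z \<in> carrier A" for z
    using A_mult_hom(2)[OF that] unfolding add_hom_def MM_simps .
  have mid: "tt (ract MM x k \<otimes>\<^bsub>A\<^esub> t l) (id y) = tt (x \<otimes>\<^bsub>A\<^esub> t l) (id (lact MM k y))"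
    "tt (id (ract MM x k)) (y \<otimes>\<^bsub>A\<^esub> s l) = tt (id x) (lact MM k y \<otimes>\<^bsub>A\<^esub> s l)"
    if "x \<in> carrier MM" "k \<in> carrier L" "y \<in> carrier MM" for x k y
    using that l by (simp_all add: A.m_assoc s_in t_in tt_facts(4))
  have t1: "tensor_map L MM MM (\<lambda>x. x \<otimes>\<^bsub>A\<^esub> t l) (id) \<in> add_hom TT TT"
    "\<And>x y. x \<in> carrier MM \<Longrightarrow> y \<in> carrier MM \<Longrightarrow>
      tensor_map L MM MM (\<lambda>x. x \<otimes>\<^bsub>A\<^esub> t l) (id) (tt x y) = tt ((\<lambda>x. x \<otimes>\<^bsub>A\<^esub> t l) x) ((id) y)"
    by (rule tensor_map_hom[OF TP TP h[OF t_in[OF l]] id_add_hom(1)], erule (2) mid(1))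
       (rule tensor_map_tens[OF TP TP h[OF t_in[OF l]] id_add_hom(1)], erule (2) mid(1), assumption+)
  have t2: "tensor_map L MM MM (id) (\<lambda>y. y \<otimes>\<^bsub>A\<^esub> s l) \<in> add_hom TT TT"
    "\<And>x y. x \<in> carrier MM \<Longrightarrow> y \<in> carrier MM \<Longrightarrow>
      tensor_map L MM MM (id) (\<lambda>y. y \<otimes>\<^bsub>A\<^esub> s l) (tt x y) = tt ((id) x) ((\<lambda>y. y \<otimes>\<^bsub>A\<^esub> s l) y)"
    by (rule tensor_map_hom[OF TP TP id_add_hom(1) h[OF s_in[OF l]]], erule (2) mid(2))
       (rule tensor_map_tens[OF TP TP id_add_hom(1) h[OF s_in[OF l]]], erule (2) mid(2), assumption+)
  show ?thesis
  proof (rule A_eq_on_span[OF Tab add_hom_compose[OF D_hom t1(1)] add_hom_compose[OF D_hom t2(1)] _ a])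
    fix r r' p q m assume b: "r \<in> carrier R" "r' \<in> carrier R" "p \<in> qpaths Q m" "q \<in> qpaths Q m"
    have "tensor_map L MM MM (\<lambda>x. x \<otimes>\<^bsub>A\<^esub> t l) id (D (cl r r' p q)) = (\<Oplus>\<^bsub>TT\<^esub>u\<in>qpaths Q m. tt (cl r \<one> p u \<otimes>\<^bsub>A\<^esub> t l) (cl \<one> r' u q))"
      by (rule finsum_comult_val[OF Tab t1(1) b]) (simp add: t1(2) comult_factors_in[OF b])
    moreover have "tensor_map L MM MM id (\<lambda>y. y \<otimes>\<^bsub>A\<^esub> s l) (D (cl r r' p q)) = (\<Oplus>\<^bsub>TT\<^esub>u\<in>qpaths Q m. tt (cl r \<one> p u \<otimes>\<^bsub>A\<^esub> t l) (cl \<one> r' u q))"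
      by (rule finsum_comult_val[OF Tab t2(1) b])
         (simp add: t2(2) comult_factors_in[OF b] takeuchi_term(1)[OF b l _ A.one_closed A.one_closed])
    ultimately show "tensor_map L MM MM (\<lambda>x. x \<otimes>\<^bsub>A\<^esub> t l) id (D (cl r r' p q)) = tensor_map L MM MM id (\<lambda>y. y \<otimes>\<^bsub>A\<^esub> s l) (D (cl r r' p q))"
      by simp
  qed
qed

text \<open>Expanding both units gives the terms \<open>e\<^sup>l\<^sub>a \<otimes> e\<^sup>b\<^sub>\<mu>\<close>. Those with \<open>a \<noteq> b\<close> vanish, and the others
  make up \<open>\<Sum>\<^sub>l\<^sub>\<mu> \<Delta> (e\<^sup>l\<^sub>\<mu>)\<close>.\<close>

lemma D_one: "D \<one>\<^bsub>A\<^esub> = tt \<one>\<^bsub>A\<^esub> \<one>\<^bsub>A\<^esub>"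
proof -
  interpret T: abelian_group TT by (rule Tab)
  interpret A: k_algebra K A by (rule A_algebra)
  define c where "c l \<mu> = cl \<one> \<one> (Triv l) (Triv \<mu>)" for l \<mu>
  let ?V = "verts Q"
  have cin: "c l \<mu> \<in> carrier A" if "l \<in> ?V" "\<mu> \<in> ?V" for l \<mu>
    unfolding c_def using that by (intro cl_in[OF _ _ Triv_in Triv_in]) auto
  have c4: "tt (c l a) (c b \<mu>) \<in> carrier TT" if "l \<in> ?V" "a \<in> ?V" "b \<in> ?V" "\<mu> \<in> ?V" for l a b \<mu>
    using that by (intro tt_facts(1) cin)
  have one: "\<one>\<^bsub>A\<^esub> = (\<Oplus>\<^bsub>A\<^esub>l\<in>?V. \<Oplus>\<^bsub>A\<^esub>a\<in>?V. c l a)"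
    unfolding A_one c_def[symmetric] by (rule A.finsum_cartesian[OF finV finV cin])
  have one': "\<one>\<^bsub>A\<^esub> = (\<Oplus>\<^bsub>A\<^esub>i\<in>VV. c (fst i) (snd i))" unfolding A_one c_def ..
  have sin: "(\<Oplus>\<^bsub>A\<^esub>a\<in>?V. c l a) \<in> carrier A" if "l \<in> ?V" for l using that cin by (auto intro!: A.finsum_closed)
  have orth: "tt (c l a) (c b \<mu>) = \<zero>\<^bsub>TT\<^esub>" if V: "l \<in> ?V" "a \<in> ?V" "b \<in> ?V" "\<mu> \<in> ?V" and ne: "b \<noteq> a" for l a b \<mu>
  proof -
    \<comment> \<open>The indicator function of \<open>a\<close> acts as one on the left factor through \<open>t\<close> and as zero on the right one through \<open>s\<close>.\<close>
    define d where "d = (\<lambda>x\<in>?V. if x = a then \<one> else \<zero>)"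
    have d: "d \<in> carrier L" by (auto simp: d_def L_simps(1))
    have "t d \<otimes>\<^bsub>A\<^esub> c l a = c l a"
      unfolding c_def using t_left[OF d R.one_closed R.one_closed Triv_in[OF V(1)] Triv_in[OF V(2)]] V by (simp add: d_def)
    moreover have "s d \<otimes>\<^bsub>A\<^esub> c b \<mu> = \<zero>\<^bsub>A\<^esub>"
    proof -
      have "cl (\<zero>) \<one> (Triv b) (Triv \<mu>) = \<zero>\<^bsub>A\<^esub>"
        using add_hom_zero[of "\<lambda>r. cl r \<one> (Triv b) (Triv \<mu>)" R A] Rab Aab V
        by (simp add: add_hom_def cl_in[OF _ _ Triv_in Triv_in] cl_add(1)[OF _ _ _ Triv_in Triv_in])
      thus ?thesis
        unfolding c_def using s_left[OF d R.one_closed R.one_closed Triv_in[OF V(3)] Triv_in[OF V(4)]] V ne by (simp add: d_def)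
    qed
    ultimately show ?thesis using tt_facts(4)[OF cin[OF V(1,2)] d cin[OF V(3,4)]] tt_zero(1)[OF cin[OF V(1,2)]] by simp
  qed
  have tri: "(\<Oplus>\<^bsub>TT\<^esub>\<mu>\<in>?V. tt (c l a) (c a \<mu>)) \<in> carrier TT" if "l \<in> ?V" "a \<in> ?V" for l a
    using that c4 by (auto intro!: T.finsum_closed)
  have "tt \<one>\<^bsub>A\<^esub> \<one>\<^bsub>A\<^esub> = (\<Oplus>\<^bsub>TT\<^esub>i\<in>VV. tt (c (fst i) (snd i)) \<one>\<^bsub>A\<^esub>)"
    by (subst (1) one') (rule add_hom_finsum[OF tt_hom(2)[OF A.one_closed] Aab Tab], use cin in auto)
  also have "\<dots> = (\<Oplus>\<^bsub>TT\<^esub>l\<in>?V. \<Oplus>\<^bsub>TT\<^esub>a\<in>?V. tt (c l a) \<one>\<^bsub>A\<^esub>)"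
    by (rule T.finsum_cartesian[OF finV finV]) (simp add: tt_facts(1) cin)
  also have "\<dots> = (\<Oplus>\<^bsub>TT\<^esub>l\<in>?V. \<Oplus>\<^bsub>TT\<^esub>a\<in>?V. \<Oplus>\<^bsub>TT\<^esub>\<mu>\<in>?V. tt (c l a) (c a \<mu>))"
  proof (intro T.finsum_cong'[OF refl])
    fix l a assume la: "l \<in> ?V" "a \<in> ?V"
    have "tt (c l a) \<one>\<^bsub>A\<^esub> = (\<Oplus>\<^bsub>TT\<^esub>b\<in>?V. tt (c l a) (\<Oplus>\<^bsub>A\<^esub>\<mu>\<in>?V. c b \<mu>))"
      unfolding one by (rule add_hom_finsum[OF tt_hom(1)[OF cin[OF la]] Aab Tab sin])
    also have "\<dots> = (\<Oplus>\<^bsub>TT\<^esub>b\<in>?V. \<Oplus>\<^bsub>TT\<^esub>\<mu>\<in>?V. tt (c l a) (c b \<mu>))"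
    proof (rule T.finsum_cong'[OF refl])
      show "tt (c l a) (\<Oplus>\<^bsub>A\<^esub>\<mu>\<in>?V. c b \<mu>) = (\<Oplus>\<^bsub>TT\<^esub>\<mu>\<in>?V. tt (c l a) (c b \<mu>))" if "b \<in> ?V" for b
        by (rule add_hom_finsum[OF tt_hom(1)[OF cin[OF la]] Aab Tab cin[OF that]])
    qed (use la c4 in \<open>auto intro!: T.finsum_closed\<close>)
    also have "\<dots> = (\<Oplus>\<^bsub>TT\<^esub>\<mu>\<in>?V. tt (c l a) (c a \<mu>))"
    proof -
      have z: "(\<Oplus>\<^bsub>TT\<^esub>\<mu>\<in>?V. tt (c l a) (c b \<mu>)) = \<zero>\<^bsub>TT\<^esub>" if b: "b \<in> ?V" "b \<noteq> a" for b
      proof -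
        have "(\<Oplus>\<^bsub>TT\<^esub>\<mu>\<in>?V. tt (c l a) (c b \<mu>)) = (\<Oplus>\<^bsub>TT\<^esub>\<mu>\<in>?V. \<zero>\<^bsub>TT\<^esub>)"
          by (rule T.finsum_cong'[OF refl]) (use orth[OF la b(1) _ b(2)] in simp_all)
        thus ?thesis by (simp add: T.finsum_zero)
      qed
      show ?thesis by (rule T.finsum_single[OF finV]) (use la z tri[OF la] in simp_all)
    qed
    finally show "tt (c l a) \<one>\<^bsub>A\<^esub> = (\<Oplus>\<^bsub>TT\<^esub>\<mu>\<in>?V. tt (c l a) (c a \<mu>))" .
  qed (use tri in \<open>auto intro!: T.finsum_closed\<close>)
  also have "\<dots> = (\<Oplus>\<^bsub>TT\<^esub>l\<in>?V. \<Oplus>\<^bsub>TT\<^esub>\<mu>\<in>?V. \<Oplus>\<^bsub>TT\<^esub>a\<in>?V. tt (c l a) (c a \<mu>))"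
  proof (rule T.finsum_cong'[OF refl])
    show "(\<Oplus>\<^bsub>TT\<^esub>a\<in>?V. \<Oplus>\<^bsub>TT\<^esub>\<mu>\<in>?V. tt (c l a) (c a \<mu>)) = (\<Oplus>\<^bsub>TT\<^esub>\<mu>\<in>?V. \<Oplus>\<^bsub>TT\<^esub>a\<in>?V. tt (c l a) (c a \<mu>))" if "l \<in> ?V" for l
      by (rule T.finsum_swap[OF finV finV c4[OF that]])
  qed (use c4 in \<open>auto intro!: T.finsum_closed\<close>)
  also have "\<dots> = (\<Oplus>\<^bsub>TT\<^esub>l\<in>?V. \<Oplus>\<^bsub>TT\<^esub>\<mu>\<in>?V. D (c l \<mu>))"
  proof (intro T.finsum_cong'[OF refl])
    fix l \<mu> assume V: "l \<in> ?V" "\<mu> \<in> ?V"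
    have "D (c l \<mu>) = (\<Oplus>\<^bsub>TT\<^esub>u\<in>Triv ` ?V. comult_term \<one> \<one> (Triv l) (Triv \<mu>) u)"
      unfolding c_def D_cl[OF R.one_closed R.one_closed Triv_in[OF V(1)] Triv_in[OF V(2)]] comult_val_eq[OF Triv_in[OF V(1)]] qpaths_0 ..
    also have "\<dots> = (\<Oplus>\<^bsub>TT\<^esub>a\<in>?V. tt (c l a) (c a \<mu>))"
      unfolding c_def
      by (rule T.finsum_reindex) (use V in \<open>auto simp: inj_on_def intro!: comult_term_in[OF _ _ Triv_in Triv_in Triv_in]\<close>)
    finally show "(\<Oplus>\<^bsub>TT\<^esub>a\<in>?V. tt (c l a) (c a \<mu>)) = D (c l \<mu>)" by simp
  qed (use D_in cin in \<open>auto intro!: T.finsum_closed\<close>)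
  also have "\<dots> = (\<Oplus>\<^bsub>TT\<^esub>i\<in>VV. D (c (fst i) (snd i)))"
    by (rule T.finsum_cartesian[OF finV finV, symmetric]) (simp add: D_in cin)
  also have "\<dots> = D \<one>\<^bsub>A\<^esub>"
    unfolding one' by (rule add_hom_finsum[OF D_hom Aab Tab, symmetric]) (use cin in auto)
  finally show ?thesis by simp
qed

abbreviation "T2 \<equiv> bimodule_tensor L TT MM"
abbreviation "T3 \<equiv> bimodule_tensor L MM TT"

lemma TP2: "tensor_pair L TT MM" and TP3: "tensor_pair L MM TT"
proof -
  have "abelian_group MM" by (rule bimodule_abelian[OF MM_bimodule])
  thus "tensor_pair L TT MM" "tensor_pair L MM TT"
    using Tab add_hom_closed[OF act_TT_hom(1)] add_hom_closed[OF act_TT_hom(2)]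
    by (auto intro!: tensor_pair.intro simp: s_in t_in A_mult_in)
qed

lemma T3ab: "abelian_group T3" by (rule tensor_pair.abelian_T[OF TP3])
abbreviation "t2 \<equiv> tens L TT MM"
abbreviation "t3 \<equiv> tens L MM TT"

lemma t3_facts:
  "a \<in> carrier A \<Longrightarrow> u \<in> carrier TT \<Longrightarrow> t3 a u \<in> carrier T3"
  "a \<in> carrier A \<Longrightarrow> a' \<in> carrier A \<Longrightarrow> u \<in> carrier TT \<Longrightarrow> t3 (a \<oplus>\<^bsub>A\<^esub> a') u = t3 a u \<oplus>\<^bsub>T3\<^esub> t3 a' u"
  "a \<in> carrier A \<Longrightarrow> u \<in> carrier TT \<Longrightarrow> u' \<in> carrier TT \<Longrightarrow> t3 a (u \<oplus>\<^bsub>TT\<^esub> u') = t3 a u \<oplus>\<^bsub>T3\<^esub> t3 a u'"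
  "a \<in> carrier A \<Longrightarrow> l \<in> carrier L \<Longrightarrow> u \<in> carrier TT \<Longrightarrow> t3 (t l \<otimes>\<^bsub>A\<^esub> a) u = t3 a (lact TT l u)"
  using biadditiveD(3)[OF tensor_pair.tens_biadditive[OF TP3], of a u] biadditiveD(4)[OF tensor_pair.tens_biadditive[OF TP3], of a a' u]
   biadditiveD(5)[OF tensor_pair.tens_biadditive[OF TP3], of a u u'] tensor_pair.tens_middle[OF TP3, of a l u] by simp_all

lemma t2_facts:
  "a \<in> carrier A \<Longrightarrow> u \<in> carrier TT \<Longrightarrow> t2 u a \<in> carrier T2"
  "a \<in> carrier A \<Longrightarrow> a' \<in> carrier A \<Longrightarrow> u \<in> carrier TT \<Longrightarrow> t2 u (a \<oplus>\<^bsub>A\<^esub> a') = t2 u a \<oplus>\<^bsub>T2\<^esub> t2 u a'"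
  "a \<in> carrier A \<Longrightarrow> u \<in> carrier TT \<Longrightarrow> u' \<in> carrier TT \<Longrightarrow> t2 (u \<oplus>\<^bsub>TT\<^esub> u') a = t2 u a \<oplus>\<^bsub>T2\<^esub> t2 u' a"
  "a \<in> carrier A \<Longrightarrow> l \<in> carrier L \<Longrightarrow> u \<in> carrier TT \<Longrightarrow> t2 (ract TT u l) a = t2 u (s l \<otimes>\<^bsub>A\<^esub> a)"
  using biadditiveD(3)[OF tensor_pair.tens_biadditive[OF TP2], of u a] biadditiveD(5)[OF tensor_pair.tens_biadditive[OF TP2], of u a a']
   biadditiveD(4)[OF tensor_pair.tens_biadditive[OF TP2], of u u' a] tensor_pair.tens_middle[OF TP2, of u l a] by simp_all

text \<open>For fixed \<open>z\<close> the inner lift sends \<open>x \<otimes> y\<close> to \<open>x \<otimes> (y \<otimes> z)\<close>. That it is balanced against \<open>z\<close> is an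
  identity of additive maps in the first argument, checked on pure tensors.\<close>

lemma
  shows assoc_hom: "associator L MM MM MM \<in> add_hom T2 T3"
    and assoc_tens: "\<lbrakk>x \<in> carrier A; y \<in> carrier A; z \<in> carrier A\<rbrakk> \<Longrightarrow>
      associator L MM MM MM (t2 (tt x y) z) = t3 x (tt y z)"
proof -
  interpret A: k_algebra K A by (rule A_algebra)
  interpret T: abelian_group TT by (rule Tab)
  define g where "g z = tensor_lift T3 (\<lambda>x y. t3 x (tt y z))" for z
  have gb: "balanced L MM MM T3 (\<lambda>x y. t3 x (tt y z))" if z: "z \<in> carrier A" for z
    using z by (intro balancedI) (simp_all add: t3_facts tt_facts(1,2) tt_ops(2) s_in t_in)
  have gh: "g z \<in> add_hom TT T3" if "z \<in> carrier A" for z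
    unfolding g_def by (rule tensor_pair.tensor_lift_hom[OF TP T3ab gb[OF that]])
  have gt: "g z (tt x y) = t3 x (tt y z)" if "x \<in> carrier A" "y \<in> carrier A" "z \<in> carrier A" for x y z
    unfolding g_def using tensor_pair.tensor_lift_tens[OF TP T3ab gb[OF that(3)], of x y] that by simp
  have ob: "balanced L TT MM T3 (\<lambda>u z. g z u)"
  proof (rule balancedI; unfold MM_simps)
    fix u z assume "u \<in> carrier TT" "z \<in> carrier A"
    thus "g z u \<in> carrier T3" using add_hom_closed[OF gh] by blast
  next
    fix u u' z assume "u \<in> carrier TT" "u' \<in> carrier TT" "z \<in> carrier A"
    thus "g z (u \<oplus>\<^bsub>TT\<^esub> u') = g z u \<oplus>\<^bsub>T3\<^esub> g z u'" using add_hom_add[OF gh] by blast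
  next
    fix u z z' assume c: "u \<in> carrier TT" "z \<in> carrier A" "z' \<in> carrier A"
    have zz: "z \<oplus>\<^bsub>A\<^esub> z' \<in> carrier A" using c by simp
    show "g (z \<oplus>\<^bsub>A\<^esub> z') u = g z u \<oplus>\<^bsub>T3\<^esub> g z' u"
      by (rule TT_eq[OF T3ab gh[OF zz] add_hom_plus[OF gh[OF c(2)] gh[OF c(3)] Tab T3ab] _ c(1)])
         (use c in \<open>simp add: gt tt_facts(1,3) t3_facts\<close>)
  next
    fix u l z assume c: "u \<in> carrier TT" "l \<in> carrier L" "z \<in> carrier A"
    have sz: "s l \<otimes>\<^bsub>A\<^esub> z \<in> carrier A" using c s_in by simp
    show "g z (ract TT u l) = g (s l \<otimes>\<^bsub>A\<^esub> z) u"
      by (rule TT_eq[OF T3ab add_hom_compose[OF act_TT_hom(2)[OF c(2)] gh[OF c(3)]] gh[OF sz] _ c(1)])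
         (use c s_in t_in in \<open>simp add: gt tt_ops(3) tt_facts(4)\<close>)
  qed
  have a: "associator L MM MM MM = tensor_lift T3 (\<lambda>u z. g z u)"
    by (simp add: associator_def Let_def g_def)
  show "associator L MM MM MM \<in> add_hom T2 T3"
    unfolding a by (rule tensor_pair.tensor_lift_hom[OF TP2 T3ab ob])
  show "\<lbrakk>x \<in> carrier A; y \<in> carrier A; z \<in> carrier A\<rbrakk> \<Longrightarrow> associator L MM MM MM (t2 (tt x y) z) = t3 x (tt y z)"
    unfolding a using tensor_pair.tensor_lift_tens[OF TP2 T3ab ob, of "tt x y" z] by (simp add: tt_facts(1) gt)
qed

text \<open>Both sides are the sum of \<open>e\<^sup>p\<^sub>v \<otimes> (e\<^sup>v\<^sub>u \<otimes> e\<^sup>u\<^sub>q)\<close> over \<open>u\<close> and \<open>v\<close>, taken in opposite orders.\<close>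

lemma D_coassoc:
  assumes a: "a \<in> carrier A"
  shows "associator L MM MM MM (tensor_map L TT MM D id (D a)) = tensor_map L MM TT id D (D a)"
proof -
  interpret A: k_algebra K A by (rule A_algebra)
  interpret T: abelian_group TT by (rule Tab)
  interpret T3: abelian_group T3 by (rule T3ab)
  have DMM: "D \<in> add_hom MM TT" using D_hom by (simp add: add_hom_def)
  have mid1: "t2 (D (ract MM x l)) (id y) = t2 (D x) (id (lact MM l y))"
    if "x \<in> carrier MM" "l \<in> carrier L" "y \<in> carrier MM" for x l y
    using that by (simp add: D_ract t2_facts D_in)
  have mid2: "t3 (id (ract MM x l)) (D y) = t3 (id x) (D (lact MM l y))"
    if "x \<in> carrier MM" "l \<in> carrier L" "y \<in> carrier MM" for x l y
    using that by (simp add: D_lact t3_facts D_in)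
  have m1: "tensor_map L TT MM (D) (id) \<in> add_hom TT T2"
    "\<And>x y. x \<in> carrier MM \<Longrightarrow> y \<in> carrier MM \<Longrightarrow>
      tensor_map L TT MM (D) (id) (tt x y) = t2 ((D) x) ((id) y)"
    by (rule tensor_map_hom[OF TP TP2 DMM id_add_hom(1)], erule (2) mid1)
       (rule tensor_map_tens[OF TP TP2 DMM id_add_hom(1)], erule (2) mid1, assumption+)
  have m2: "tensor_map L MM TT (id) (D) \<in> add_hom TT T3"
    "\<And>x y. x \<in> carrier MM \<Longrightarrow> y \<in> carrier MM \<Longrightarrow>
      tensor_map L MM TT (id) (D) (tt x y) = t3 ((id) x) ((D) y)"
    by (rule tensor_map_hom[OF TP TP3 id_add_hom(1) DMM], erule (2) mid2)
       (rule tensor_map_tens[OF TP TP3 id_add_hom(1) DMM], erule (2) mid2, assumption+)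
  note lh = add_hom_compose[OF m1(1) assoc_hom]
  show ?thesis
  proof (rule A_eq_on_span[OF T3ab add_hom_compose[OF D_hom lh] add_hom_compose[OF D_hom m2(1)] _ a])
    fix r r' p q m assume b: "r \<in> carrier R" "r' \<in> carrier R" "p \<in> qpaths Q m" "q \<in> qpaths Q m"
    let ?f = "\<lambda>v u. t3 (cl r \<one> p v) (tt (cl \<one> \<one> v u) (cl \<one> r' u q))"
    have fin: "?f v u \<in> carrier T3" if "v \<in> qpaths Q m" "u \<in> qpaths Q m" for u v
      using that b by (intro t3_facts(1) tt_facts(1) cl_in) auto
    have 1: "associator L MM MM MM (tensor_map L TT MM D id (comult_term r r' p q u)) = (\<Oplus>\<^bsub>T3\<^esub>v\<in>qpaths Q m. ?f v u)"
      if u: "u \<in> qpaths Q m" for u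
    proof -
      have cu1: "cl r \<one> p u \<in> carrier A" "cl \<one> r' u q \<in> carrier A" using comult_factors_in[OF b u] .
      have h: "(\<lambda>y. associator L MM MM MM (t2 y (cl \<one> r' u q))) \<in> add_hom TT T3"
        using add_hom_compose[OF biadditiveD(2)[OF tensor_pair.tens_biadditive[OF TP2], of "cl \<one> r' u q"] assoc_hom] cu1 by simp
      have "associator L MM MM MM (tensor_map L TT MM D id (comult_term r r' p q u)) = associator L MM MM MM (t2 (D (cl r \<one> p u)) (cl \<one> r' u q))"
        using m1(2) cu1 by simp
      also have "\<dots> = (\<Oplus>\<^bsub>T3\<^esub>v\<in>qpaths Q m. ?f v u)"
      proof (rule finsum_comult_val[OF T3ab h b(1) R.one_closed b(3) u])
        fix v assume v: "v \<in> qpaths Q m"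
        show "associator L MM MM MM (t2 (comult_term r \<one> p u v) (cl \<one> r' u q)) = ?f v u"
          by (rule assoc_tens[OF comult_factors_in[OF b(1) R.one_closed b(3) u v] cu1(2)])
      qed
      finally show ?thesis .
    qed
    have 2: "tensor_map L MM TT id D (comult_term r r' p q v) = (\<Oplus>\<^bsub>T3\<^esub>u\<in>qpaths Q m. ?f v u)" if v: "v \<in> qpaths Q m" for v
    proof -
      have cu1: "cl r \<one> p v \<in> carrier A" "cl \<one> r' v q \<in> carrier A" using comult_factors_in[OF b v] .
      have h: "t3 (cl r \<one> p v) \<in> add_hom TT T3"
        using biadditiveD(1)[OF tensor_pair.tens_biadditive[OF TP3], of "cl r \<one> p v"] cu1 by simp
      have "tensor_map L MM TT id D (comult_term r r' p q v) = t3 (cl r \<one> p v) (D (cl \<one> r' v q))"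
        using m2(2) cu1 by simp
      also have "\<dots> = (\<Oplus>\<^bsub>T3\<^esub>u\<in>qpaths Q m. ?f v u)"
        by (rule finsum_comult_val[OF T3ab h R.one_closed b(2) v b(4)]) (rule refl)
      finally show ?thesis .
    qed
    have "associator L MM MM MM (tensor_map L TT MM D id (D (cl r r' p q))) = (\<Oplus>\<^bsub>T3\<^esub>u\<in>qpaths Q m. \<Oplus>\<^bsub>T3\<^esub>v\<in>qpaths Q m. ?f v u)"
      by (rule finsum_comult_val[OF T3ab lh b 1])
    also have "\<dots> = (\<Oplus>\<^bsub>T3\<^esub>v\<in>qpaths Q m. \<Oplus>\<^bsub>T3\<^esub>u\<in>qpaths Q m. ?f v u)"
      by (rule T3.finsum_swap[OF finq finq fin])
    also have "\<dots> = tensor_map L MM TT id D (D (cl r r' p q))"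
      by (rule finsum_comult_val[OF T3ab m2(1) b 2, symmetric])
    finally show "associator L MM MM MM (tensor_map L TT MM D id (D (cl r r' p q))) = tensor_map L MM TT id D (D (cl r r' p q))" .
  qed
qed

end

section \<open>The representation on the base algebra\<close>

locale central_weighted_quiver = weighted_quiver +
  assumes w_central: "\<And>a b c d. \<lbrakk>(a, b) \<in> arrow_pairs Q; (c, d) \<in> arrow_pairs Q\<rbrakk> \<Longrightarrow> w a b c d \<in> algebra_center R"
    and w_ends: "\<And>a b c d. \<lbrakk>(a, b) \<in> arrow_pairs Q; (c, d) \<in> arrow_pairs Q;
             tail Q a \<noteq> tail Q c \<or> head Q b \<noteq> head Q d\<rbrakk> \<Longrightarrow> w a b c d = \<zero>"
begin

lemma Lab: "abelian_group L" using L_algebra by (intro ring.is_abelian_group k_algebra.axioms)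

abbreviation "E \<equiv> end_algebra K L"

lemma E_simps:
  "carrier E = linear_hom K L L \<inter> extensional (carrier L)" "monoid.mult E = compose (carrier L)"
  "monoid.one E = (\<lambda>x\<in>carrier L. x)" "ring.zero E = (\<lambda>x\<in>carrier L. \<zero>\<^bsub>L\<^esub>)"
  "ring.add E = (\<lambda>\<phi> \<psi>. \<lambda>x\<in>carrier L. \<phi> x \<oplus>\<^bsub>L\<^esub> \<psi> x)" "smult E = (\<lambda>k \<phi>. \<lambda>x\<in>carrier L. k \<odot>\<^bsub>L\<^esub> \<phi> x)"
  by (simp_all add: end_algebra_def)

lemma E_eqI: "\<phi> \<in> carrier E \<Longrightarrow> \<psi> \<in> carrier E \<Longrightarrow> (\<And>f. f \<in> carrier L \<Longrightarrow> \<phi> f = \<psi> f) \<Longrightarrow> \<phi> = \<psi>"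
  by (rule extensionalityI[of _ "carrier L"]) (auto simp: E_simps)

lemma E_at:
  assumes "f \<in> carrier L"
  shows "(\<phi> \<otimes>\<^bsub>E\<^esub> \<psi>) f = \<phi> (\<psi> f)" "\<one>\<^bsub>E\<^esub> f = f" "\<zero>\<^bsub>E\<^esub> f = \<zero>\<^bsub>L\<^esub>" "(\<phi> \<oplus>\<^bsub>E\<^esub> \<psi>) f = \<phi> f \<oplus>\<^bsub>L\<^esub> \<psi> f"
    "(k \<odot>\<^bsub>E\<^esub> \<phi>) f = k \<odot>\<^bsub>L\<^esub> \<phi> f"
  using assms by (simp_all add: E_simps compose_def)

lemma E_lin:
  assumes "\<phi> \<in> carrier E"
  shows "f \<in> carrier L \<Longrightarrow> \<phi> f \<in> carrier L"
    "f \<in> carrier L \<Longrightarrow> g \<in> carrier L \<Longrightarrow> \<phi> (f \<oplus>\<^bsub>L\<^esub> g) = \<phi> f \<oplus>\<^bsub>L\<^esub> \<phi> g"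
    "k \<in> carrier K \<Longrightarrow> f \<in> carrier L \<Longrightarrow> \<phi> (k \<odot>\<^bsub>L\<^esub> f) = k \<odot>\<^bsub>L\<^esub> \<phi> f"
  using assms by (auto simp: E_simps linear_hom_def)

lemma E_inI:
  assumes "\<And>f. f \<in> carrier L \<Longrightarrow> \<phi> f \<in> carrier L"
    "\<And>f g. f \<in> carrier L \<Longrightarrow> g \<in> carrier L \<Longrightarrow> \<phi> (f \<oplus>\<^bsub>L\<^esub> g) = \<phi> f \<oplus>\<^bsub>L\<^esub> \<phi> g"
    "\<And>k f. k \<in> carrier K \<Longrightarrow> f \<in> carrier L \<Longrightarrow> \<phi> (k \<odot>\<^bsub>L\<^esub> f) = k \<odot>\<^bsub>L\<^esub> \<phi> f"
  shows "(\<lambda>f\<in>carrier L. \<phi> f) \<in> carrier E"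
proof -
  interpret Lm: k_algebra K L by (rule L_algebra)
  show ?thesis using assms by (simp add: E_simps linear_hom_def)
qed

lemma E_closed:
  "\<zero>\<^bsub>E\<^esub> \<in> carrier E" "\<one>\<^bsub>E\<^esub> \<in> carrier E"
  "\<phi> \<in> carrier E \<Longrightarrow> \<psi> \<in> carrier E \<Longrightarrow> \<phi> \<oplus>\<^bsub>E\<^esub> \<psi> \<in> carrier E"
  "\<phi> \<in> carrier E \<Longrightarrow> \<psi> \<in> carrier E \<Longrightarrow> \<phi> \<otimes>\<^bsub>E\<^esub> \<psi> \<in> carrier E"
  "k \<in> carrier K \<Longrightarrow> \<phi> \<in> carrier E \<Longrightarrow> k \<odot>\<^bsub>E\<^esub> \<phi> \<in> carrier E"
proof -
  interpret Lm: k_algebra K L by (rule L_algebra)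
  show "\<zero>\<^bsub>E\<^esub> \<in> carrier E" unfolding E_simps(4) by (rule E_inI) simp_all
  show "\<one>\<^bsub>E\<^esub> \<in> carrier E" unfolding E_simps(3) by (rule E_inI) simp_all
  show "\<phi> \<oplus>\<^bsub>E\<^esub> \<psi> \<in> carrier E" if "\<phi> \<in> carrier E" "\<psi> \<in> carrier E"
    unfolding E_simps(5) by (rule E_inI) (simp_all add: E_lin[OF that(1)] E_lin[OF that(2)] Lm.a_ac Lm.smult_r_distr)
  show "\<phi> \<otimes>\<^bsub>E\<^esub> \<psi> \<in> carrier E" if "\<phi> \<in> carrier E" "\<psi> \<in> carrier E"
    unfolding E_simps(2) compose_def by (rule E_inI) (simp_all add: E_lin[OF that(1)] E_lin[OF that(2)])
  show "k \<odot>\<^bsub>E\<^esub> \<phi> \<in> carrier E" if "k \<in> carrier K" "\<phi> \<in> carrier E"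
    unfolding E_simps(6)
    by (rule E_inI)
       (simp_all add: E_lin[OF that(2)] that(1) Lm.smult_r_distr Lm.smult_assoc1[symmetric] R.K.m_comm)
qed

lemma Eab: "abelian_group E"
proof (rule abelian_groupI)
  interpret Lm: k_algebra K L by (rule L_algebra)
  show "\<exists>\<psi>\<in>carrier E. \<psi> \<oplus>\<^bsub>E\<^esub> \<phi> = \<zero>\<^bsub>E\<^esub>" if p: "\<phi> \<in> carrier E" for \<phi>
  proof (rule bexI)
    show i: "(\<lambda>f\<in>carrier L. \<ominus>\<^bsub>L\<^esub> \<phi> f) \<in> carrier E"
      by (rule E_inI) (simp_all add: E_lin[OF p] Lm.minus_add Lm.smult_r_minus)
    show "(\<lambda>f\<in>carrier L. \<ominus>\<^bsub>L\<^esub> \<phi> f) \<oplus>\<^bsub>E\<^esub> \<phi> = \<zero>\<^bsub>E\<^esub>"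
      by (rule E_eqI[OF E_closed(3)[OF i p] E_closed(1)]) (simp add: E_at E_lin[OF p] Lm.l_neg)
  qed
  show "\<phi> \<oplus>\<^bsub>E\<^esub> \<psi> \<oplus>\<^bsub>E\<^esub> \<chi> = \<phi> \<oplus>\<^bsub>E\<^esub> (\<psi> \<oplus>\<^bsub>E\<^esub> \<chi>)" if "\<phi> \<in> carrier E" "\<psi> \<in> carrier E" "\<chi> \<in> carrier E" for \<phi> \<psi> \<chi>
    by (rule E_eqI) (use that in \<open>simp_all add: E_closed E_at E_lin Lm.a_assoc\<close>)
  show "\<phi> \<oplus>\<^bsub>E\<^esub> \<psi> = \<psi> \<oplus>\<^bsub>E\<^esub> \<phi>" if "\<phi> \<in> carrier E" "\<psi> \<in> carrier E" for \<phi> \<psi>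
    by (rule E_eqI) (use that in \<open>simp_all add: E_closed E_at E_lin Lm.a_comm\<close>)
  show "\<zero>\<^bsub>E\<^esub> \<oplus>\<^bsub>E\<^esub> \<phi> = \<phi>" if "\<phi> \<in> carrier E" for \<phi>
    by (rule E_eqI) (use that in \<open>simp_all add: E_closed E_at E_lin\<close>)
qed (simp_all add: E_closed)

lemma E_mult_hom: "\<phi> \<in> carrier E \<Longrightarrow> (\<lambda>\<psi>. \<phi> \<otimes>\<^bsub>E\<^esub> \<psi>) \<in> add_hom E E" "\<phi> \<in> carrier E \<Longrightarrow> (\<lambda>\<psi>. \<psi> \<otimes>\<^bsub>E\<^esub> \<phi>) \<in> add_hom E E"
proof -
  interpret Lm: k_algebra K L by (rule L_algebra)
  assume p: "\<phi> \<in> carrier E"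
  show "(\<lambda>\<psi>. \<phi> \<otimes>\<^bsub>E\<^esub> \<psi>) \<in> add_hom E E"
  proof (rule add_homI)
    fix x y assume "x \<in> carrier E" "y \<in> carrier E"
    thus "\<phi> \<otimes>\<^bsub>E\<^esub> (x \<oplus>\<^bsub>E\<^esub> y) = \<phi> \<otimes>\<^bsub>E\<^esub> x \<oplus>\<^bsub>E\<^esub> \<phi> \<otimes>\<^bsub>E\<^esub> y"
      using p by (intro E_eqI) (simp_all add: E_closed E_at E_lin)
  qed (simp add: E_closed p)
  show "(\<lambda>\<psi>. \<psi> \<otimes>\<^bsub>E\<^esub> \<phi>) \<in> add_hom E E"
  proof (rule add_homI)
    fix x y assume "x \<in> carrier E" "y \<in> carrier E"
    thus "(x \<oplus>\<^bsub>E\<^esub> y) \<otimes>\<^bsub>E\<^esub> \<phi> = x \<otimes>\<^bsub>E\<^esub> \<phi> \<oplus>\<^bsub>E\<^esub> y \<otimes>\<^bsub>E\<^esub> \<phi>"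
      using p by (intro E_eqI) (simp_all add: E_closed E_at E_lin)
  qed (simp add: E_closed p)
qed

text \<open>The function \<open>\<delta>\<^sub>p\<^sub>q (r f(\<tt>(q)) r') \<delta>\<^sub>\<ss>\<^sub>(\<^sub>q\<^sub>)\<close>, written out pointwise.\<close>

definition zeta_fun where
  "zeta_fun r r' p q f = (\<lambda>x\<in>verts Q. if p = q \<and> x = qsource Q q then r \<otimes> f (qtarget Q q) \<otimes> r' else \<zero>)"

definition zeta_op where "zeta_op r r' p q = (\<lambda>f\<in>carrier L. zeta_fun r r' p q f)"

lemma zeta_fun_at: "x \<in> verts Q \<Longrightarrow> zeta_fun r r' p q f x = (if p = q \<and> x = qsource Q q then r \<otimes> f (qtarget Q q) \<otimes> r' else \<zero>)"
  by (simp add: zeta_fun_def)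

lemma zeta_op_at: "f \<in> carrier L \<Longrightarrow> zeta_op r r' p q f = zeta_fun r r' p q f"
  by (simp add: zeta_op_def)

lemma zeta_fun_eq: "(if p = q then const_M Q (r \<otimes> f (qtarget Q q) \<otimes> r') \<otimes>\<^bsub>L\<^esub> delta_M R Q (qsource Q q) else \<zero>\<^bsub>L\<^esub>) = zeta_fun r r' p q f"
  if "r \<in> carrier R" "r' \<in> carrier R" "q \<in> qpaths Q m" "f \<in> carrier L"
  using L_vals(2)[OF that(4,3)] that(1,2)
  by (auto simp: L_simps zeta_fun_def const_M_def delta_M_def fun_eq_iff restrict_def)

context
  fixes r r' p q m
  assumes r: "r \<in> carrier R" "r' \<in> carrier R" and p: "p \<in> qpaths Q m" "q \<in> qpaths Q m"
begin

lemma zeta_fun_in: "f \<in> carrier L \<Longrightarrow> zeta_fun r r' p q f \<in> carrier L"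
  using L_vals(2)[OF _ p(2), of f] r by (auto simp: zeta_fun_def L_simps(1))

lemma zeta_op_in: "zeta_op r r' p q \<in> carrier E"
  unfolding zeta_op_def
proof (rule E_inI)
  interpret Lm: k_algebra K L by (rule L_algebra)
  fix f g k assume f: "f \<in> carrier L" "g \<in> carrier L"
  show "zeta_fun r r' p q (f \<oplus>\<^bsub>L\<^esub> g) = zeta_fun r r' p q f \<oplus>\<^bsub>L\<^esub> zeta_fun r r' p q g"
    by (rule L_eqI)
       (use f r L_vals(2)[OF f(1) p(2)] L_vals(2)[OF f(2) p(2)] in
         \<open>simp_all add: zeta_fun_in zeta_fun_at L_at(4) L_at(4)[OF qtarget_in[OF wfQ p(2)]] R.l_distr R.r_distr\<close>)
next
  interpret Lm: k_algebra K L by (rule L_algebra)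
  fix f k assume f: "k \<in> carrier K" "f \<in> carrier L"
  show "zeta_fun r r' p q (k \<odot>\<^bsub>L\<^esub> f) = k \<odot>\<^bsub>L\<^esub> zeta_fun r r' p q f"
    by (rule L_eqI)
       (use f r L_vals(2)[OF f(2) p(2)] in
         \<open>simp_all add: zeta_fun_in zeta_fun_at L_at(5) L_at(5)[OF qtarget_in[OF wfQ p(2)]] R.smult_mult_left R.smult_mult_right\<close>)
qed (rule zeta_fun_in)

lemma zeta_op_add:
  assumes x: "x \<in> carrier R" and that: "f \<in> carrier L"
  shows "zeta_op (r \<oplus> x) r' p q f = zeta_op r r' p q f \<oplus>\<^bsub>L\<^esub> zeta_op x r' p q f"
  using that x r L_vals(2)[OF that p(2)]
  by (simp add: zeta_op_at) (auto simp: zeta_fun_def L_simps(5) fun_eq_iff restrict_def R.l_distr)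

lemma zeta_op_add2:
  assumes x: "x \<in> carrier R" and that: "f \<in> carrier L"
  shows "zeta_op r (r' \<oplus> x) p q f = zeta_op r r' p q f \<oplus>\<^bsub>L\<^esub> zeta_op r x p q f"
  using that x r L_vals(2)[OF that p(2)]
  by (simp add: zeta_op_at) (auto simp: zeta_fun_def L_simps(5) fun_eq_iff restrict_def R.r_distr)

end

lemma zeta_op_props:
  "\<And>r s r' p q m. \<lbrakk>r \<in> carrier R; s \<in> carrier R; r' \<in> carrier R; p \<in> qpaths Q m; q \<in> qpaths Q m\<rbrakk> \<Longrightarrow>
       zeta_op (r \<oplus> s) r' p q = zeta_op r r' p q \<oplus>\<^bsub>E\<^esub> zeta_op s r' p q"
  "\<And>r s r' p q m. \<lbrakk>r \<in> carrier R; s \<in> carrier R; r' \<in> carrier R; p \<in> qpaths Q m; q \<in> qpaths Q m\<rbrakk> \<Longrightarrow>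
       zeta_op r (r' \<oplus> s) p q = zeta_op r r' p q \<oplus>\<^bsub>E\<^esub> zeta_op r s p q"
  "\<And>k r r' p q m. \<lbrakk>k \<in> carrier K; r \<in> carrier R; r' \<in> carrier R; p \<in> qpaths Q m; q \<in> qpaths Q m\<rbrakk> \<Longrightarrow>
       zeta_op (k \<odot> r) r' p q = zeta_op r (k \<odot> r') p q"
  "\<And>k r r' p q m. \<lbrakk>k \<in> carrier K; r \<in> carrier R; r' \<in> carrier R; p \<in> qpaths Q m; q \<in> qpaths Q m\<rbrakk> \<Longrightarrow>
       zeta_op (k \<odot> r) r' p q = k \<odot>\<^bsub>E\<^esub> zeta_op r r' p q"
proof -
  fix r x r' p q m assume a: "r \<in> carrier R" "x \<in> carrier R" "r' \<in> carrier R" "p \<in> qpaths Q m" "q \<in> qpaths Q m"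
  have rx: "r \<oplus> x \<in> carrier R" "r' \<oplus> x \<in> carrier R" using a by auto
  show "zeta_op (r \<oplus> x) r' p q = zeta_op r r' p q \<oplus>\<^bsub>E\<^esub> zeta_op x r' p q"
    by (rule E_eqI)
       (simp_all add: E_closed(3) E_at zeta_op_in[OF rx(1) a(3-5)] zeta_op_in[OF a(1,3-5)] zeta_op_in[OF a(2,3-5)] zeta_op_add[OF a(1,3-5,2)])
  show "zeta_op r (r' \<oplus> x) p q = zeta_op r r' p q \<oplus>\<^bsub>E\<^esub> zeta_op r x p q"
    by (rule E_eqI)
       (simp_all add: E_closed(3) E_at zeta_op_in[OF a(1) rx(2) a(4,5)] zeta_op_in[OF a(1,3-5)] zeta_op_in[OF a(1,2,4,5)] zeta_op_add2[OF a(1,3-5,2)])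
next
  fix k r r' p q m assume a: "k \<in> carrier K" "r \<in> carrier R" "r' \<in> carrier R" "p \<in> qpaths Q m" "q \<in> qpaths Q m"
  have kr: "k \<odot> r \<in> carrier R" "k \<odot> r' \<in> carrier R" using a by auto
  have "zeta_fun (k \<odot> r) r' p q f = zeta_fun r (k \<odot> r') p q f" "zeta_fun (k \<odot> r) r' p q f = k \<odot>\<^bsub>L\<^esub> zeta_fun r r' p q f" if "f \<in> carrier L" for f
    using L_vals(2)[OF that a(5)] a
    by (auto simp: zeta_fun_def L_simps(6) fun_eq_iff restrict_def R.smult_mult_left R.smult_mult_right)
  thus "zeta_op (k \<odot> r) r' p q = zeta_op r (k \<odot> r') p q" "zeta_op (k \<odot> r) r' p q = k \<odot>\<^bsub>E\<^esub> zeta_op r r' p q"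
    by (auto simp: zeta_op_def E_simps(6) fun_eq_iff restrict_def)
qed

text \<open>For composable pairs \<open>p p' = q q'\<close> forces \<open>p = q\<close> and \<open>p' = q'\<close>, since the lengths agree. If
  \<open>p = q\<close> and \<open>p' = q'\<close> are not composable, the delta function at \<open>\<ss>(q')\<close> vanishes at \<open>\<tt>(q)\<close>,
  where the outer operator evaluates it.\<close>

lemma zeta_op_mult:
  assumes r: "r \<in> carrier R" "r' \<in> carrier R" and p: "p \<in> qpaths Q m" "q \<in> qpaths Q m"
    and s: "x \<in> carrier R" "x' \<in> carrier R" and p': "p' \<in> qpaths Q n" "q' \<in> qpaths Q n"
  shows "zeta_op r r' p q \<otimes>\<^bsub>E\<^esub> zeta_op x x' p' q' =
     (if composable p q p' q' then zeta_op (r \<otimes> x) (x' \<otimes> r') (qconcat p p') (qconcat q q') else \<zero>\<^bsub>E\<^esub>)"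
proof (rule E_eqI)
  have rs: "r \<otimes> x \<in> carrier R" "x' \<otimes> r' \<in> carrier R" using r s by auto
  have pc: "composable p q p' q' \<Longrightarrow> qconcat p p' \<in> qpaths Q (m + n)" "composable p q p' q' \<Longrightarrow> qconcat q q' \<in> qpaths Q (m + n)"
    using p p' by (auto intro: qconcat_in_qpaths)
  have zin: "composable p q p' q' \<Longrightarrow> zeta_op (r \<otimes> x) (x' \<otimes> r') (qconcat p p') (qconcat q q') \<in> carrier E"
    by (rule zeta_op_in[OF rs pc])
  show "zeta_op r r' p q \<otimes>\<^bsub>E\<^esub> zeta_op x x' p' q' \<in> carrier E" by (rule E_closed(4)[OF zeta_op_in[OF r p] zeta_op_in[OF s p']])
  show "(if composable p q p' q' then zeta_op (r \<otimes> x) (x' \<otimes> r') (qconcat p p') (qconcat q q') else \<zero>\<^bsub>E\<^esub>) \<in> carrier E"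
    using zin E_closed(1) by auto
  fix f assume f: "f \<in> carrier L"
  note z' = zeta_fun_in[OF s p' f]
  note fv = L_vals(2)[OF f p'(2)]
  have tq: "qtarget Q q \<in> verts Q" by (rule qtarget_in[OF wfQ p(2)])
  have inj: "composable p q p' q' \<Longrightarrow> qconcat p p' = qconcat q q' \<longleftrightarrow> p = q \<and> p' = q'"
    using qconcat_inj[OF p p'] by blast
  have ends: "composable p q p' q' \<Longrightarrow> qsource Q (qconcat q q') = qsource Q q \<and> qtarget Q (qconcat q q') = qtarget Q q'"
    using p p' by (simp add: qsource_qconcat qtarget_qconcat)
  have "zeta_fun r r' p q (zeta_fun x x' p' q' f) y =
      (if composable p q p' q' then zeta_fun (r \<otimes> x) (x' \<otimes> r') (qconcat p p') (qconcat q q') f else \<zero>\<^bsub>L\<^esub>) y" if y: "y \<in> verts Q" for y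
  proof (cases "composable p q p' q'")
    case True
    thus ?thesis using r s fv tq by (simp add: zeta_fun_at[OF y] zeta_fun_at[OF tq] zeta_fun_at[OF qsource_in[OF wfQ p'(2)]] inj ends R.m_assoc)
  next
    case False
    hence "p = q \<Longrightarrow> p' = q' \<Longrightarrow> qtarget Q q \<noteq> qsource Q q'" by auto
    thus ?thesis using False r s fv tq y by (auto simp: zeta_fun_at[OF y] zeta_fun_at[OF tq] L_at(2))
  qed
  moreover have "(if composable p q p' q' then zeta_fun (r \<otimes> x) (x' \<otimes> r') (qconcat p p') (qconcat q q') f else \<zero>\<^bsub>L\<^esub>) \<in> carrier L"
    using zeta_fun_in[OF rs pc f] L_in(2) by auto
  ultimately have "zeta_fun r r' p q (zeta_fun x x' p' q' f) =
      (if composable p q p' q' then zeta_fun (r \<otimes> x) (x' \<otimes> r') (qconcat p p') (qconcat q q') f else \<zero>\<^bsub>L\<^esub>)"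
    by (intro L_eqI zeta_fun_in[OF r p z'])
  thus "(zeta_op r r' p q \<otimes>\<^bsub>E\<^esub> zeta_op x x' p' q') f =
     (if composable p q p' q' then zeta_op (r \<otimes> x) (x' \<otimes> r') (qconcat p p') (qconcat q q') else \<zero>\<^bsub>E\<^esub>) f"
    using f z' by (simp add: E_at zeta_op_at)
qed

lemma zeta_op_ne: "p \<noteq> q \<Longrightarrow> zeta_op r r' p q = \<zero>\<^bsub>E\<^esub>"
  by (auto simp: zeta_op_def zeta_fun_def E_simps(4) L_simps(4))

text \<open>An operator for \<open>p \<noteq> q\<close> is zero, so each sum reduces to its diagonal term. The two that remain are
  compared by the conditions on the ends and on centrality.\<close>

lemma zeta_op_relation:
  assumes ab: "(a, b) \<in> AP" and cd: "(c, d) \<in> AP"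
  shows "(\<Oplus>\<^bsub>E\<^esub>i\<in>AP. zeta_op (w (fst i) (snd i) a b) \<one> (AA i) (A2 c d)) =
      (\<Oplus>\<^bsub>E\<^esub>i\<in>AP. zeta_op \<one> (w c d (fst i) (snd i)) (A2 a b) (AA i))"
proof -
  interpret E: abelian_group E by (rule Eab)
  have wR: "w c d a b \<in> carrier R" by (rule w_in[OF cd ab])
  have 1: "(\<Oplus>\<^bsub>E\<^esub>i\<in>AP. zeta_op (w (fst i) (snd i) a b) \<one> (AA i) (A2 c d)) = zeta_op (w (fst (c, d)) (snd (c, d)) a b) \<one> (AA (c, d)) (A2 c d)"
  proof (rule E.finsum_single[OF finAP cd])
    show "zeta_op (w (fst i) (snd i) a b) \<one> (AA i) (A2 c d) = \<zero>\<^bsub>E\<^esub>" if "i \<noteq> (c, d)" for i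
      by (rule zeta_op_ne) (use that in \<open>auto simp: prod_eq_iff\<close>)
    show "zeta_op (w (fst (c, d)) (snd (c, d)) a b) \<one> (AA (c, d)) (A2 c d) \<in> carrier E"
      using zeta_op_in[OF wR R.one_closed A2_in[OF cd] A2_in[OF cd]] by simp
  qed
  have 2: "(\<Oplus>\<^bsub>E\<^esub>i\<in>AP. zeta_op \<one> (w c d (fst i) (snd i)) (A2 a b) (AA i)) = zeta_op \<one> (w c d (fst (a, b)) (snd (a, b))) (A2 a b) (AA (a, b))"
  proof (rule E.finsum_single[OF finAP ab])
    show "zeta_op \<one> (w c d (fst i) (snd i)) (A2 a b) (AA i) = \<zero>\<^bsub>E\<^esub>" if "i \<noteq> (a, b)" for i
      by (rule zeta_op_ne) (use that in \<open>auto simp: prod_eq_iff\<close>)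
    show "zeta_op \<one> (w c d (fst (a, b)) (snd (a, b))) (A2 a b) (AA (a, b)) \<in> carrier E"
      using zeta_op_in[OF R.one_closed wR A2_in[OF ab] A2_in[OF ab]] by simp
  qed
  have "zeta_fun (w c d a b) \<one> (A2 c d) (A2 c d) f = zeta_fun \<one> (w c d a b) (A2 a b) (A2 a b) f" if f: "f \<in> carrier L" for f
  proof -
    have fc: "f (head Q d) \<in> carrier R" "f (head Q b) \<in> carrier R"
      using L_vals(2)[OF f A2_in[OF cd]] L_vals(2)[OF f A2_in[OF ab]] by simp_all
    have cen: "w c d a b \<otimes> f (head Q b) = f (head Q b) \<otimes> w c d a b"
      using w_central[OF cd ab] fc by (simp add: algebra_center_def)
    have ends: "qsource Q (A2 c d) = tail Q c" "qtarget Q (A2 c d) = head Q d"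
      "qsource Q (A2 a b) = tail Q a" "qtarget Q (A2 a b) = head Q b" by simp_all
    have zc: "zeta_fun (w c d a b) \<one> (A2 c d) (A2 c d) f x =
        (if x = tail Q c then w c d a b \<otimes> f (head Q d) else \<zero>)" if "x \<in> verts Q" for x
      unfolding zeta_fun_at[OF that] ends using fc wR by simp
    have za: "zeta_fun \<one> (w c d a b) (A2 a b) (A2 a b) f x =
        (if x = tail Q a then w c d a b \<otimes> f (head Q b) else \<zero>)" if "x \<in> verts Q" for x
      unfolding zeta_fun_at[OF that] ends using fc wR cen by simp
    show ?thesis
    proof (rule L_eqI)
      show "zeta_fun (w c d a b) \<one> (A2 c d) (A2 c d) f \<in> carrier L"
        by (rule zeta_fun_in[OF wR R.one_closed A2_in[OF cd] A2_in[OF cd] f])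
      show "zeta_fun \<one> (w c d a b) (A2 a b) (A2 a b) f \<in> carrier L"
        by (rule zeta_fun_in[OF R.one_closed wR A2_in[OF ab] A2_in[OF ab] f])
      fix x assume x: "x \<in> verts Q"
      show "zeta_fun (w c d a b) \<one> (A2 c d) (A2 c d) f x = zeta_fun \<one> (w c d a b) (A2 a b) (A2 a b) f x"
      proof (cases "tail Q c \<noteq> tail Q a \<or> head Q d \<noteq> head Q b")
        case True
        hence "w c d a b = \<zero>" by (rule w_ends[OF cd ab])
        thus ?thesis unfolding zc[OF x] za[OF x] using fc by simp
      next
        case False
        thus ?thesis unfolding zc[OF x] za[OF x] by simp
      qed
    qed
  qed
  thus ?thesis unfolding 1 2 by (simp add: zeta_op_def cong: restrict_cong)
qed

lemma zeta_exists: "\<exists>F\<in>add_hom A E. \<forall>m. \<forall>r\<in>carrier R. \<forall>r'\<in>carrier R. \<forall>p\<in>qpaths Q m. \<forall>q\<in>qpaths Q m. F (cl r r' p q) = zeta_op r r' p q"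
proof (rule A_lift[OF Eab, where lm = "\<lambda>r r' p q \<psi>. zeta_op r r' p q \<otimes>\<^bsub>E\<^esub> \<psi>" and rm = "\<lambda>r r' p q \<psi>. \<psi> \<otimes>\<^bsub>E\<^esub> zeta_op r r' p q"])
  fix r r' p q m assume a: "r \<in> carrier R" "r' \<in> carrier R" "p \<in> qpaths Q m" "q \<in> qpaths Q m"
  show "(\<lambda>\<psi>. zeta_op r r' p q \<otimes>\<^bsub>E\<^esub> \<psi>) \<in> add_hom E E" "(\<lambda>\<psi>. \<psi> \<otimes>\<^bsub>E\<^esub> zeta_op r r' p q) \<in> add_hom E E"
    by (rule E_mult_hom[OF zeta_op_in[OF a]])+
qed (fact zeta_op_in zeta_op_props zeta_op_mult zeta_op_relation)+

text \<open>The following holds for every additive map with the prescribed values. It is used twice: to show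
  that the map given by the universal property is a homomorphism, and then for \<open>\<zeta>\<close> itself.\<close>

context
  fixes Z assumes Z: "Z \<in> add_hom A E"
    and Zcl: "\<And>m r r' p q. \<lbrakk>r \<in> carrier R; r' \<in> carrier R; p \<in> qpaths Q m; q \<in> qpaths Q m\<rbrakk> \<Longrightarrow> Z (cl r r' p q) = zeta_op r r' p q"
begin

lemma Z_in: "a \<in> carrier A \<Longrightarrow> Z a \<in> carrier E" by (rule add_hom_closed[OF Z])

lemma Z_mult:
  assumes "a \<in> carrier A" "b \<in> carrier A"
  shows "Z (a \<otimes>\<^bsub>A\<^esub> b) = Z a \<otimes>\<^bsub>E\<^esub> Z b"
proof -
  interpret A: k_algebra K A by (rule A_algebra)
  have bi1: "biadditive A A E (\<lambda>a b. Z (a \<otimes>\<^bsub>A\<^esub> b))"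
    by (rule biadditiveI) (simp_all add: Z_in A.l_distr A.r_distr add_hom_add[OF Z])
  have bi2: "biadditive A A E (\<lambda>a b. Z a \<otimes>\<^bsub>E\<^esub> Z b)"
    by (rule biadditiveI)
       (simp_all add: Z_in E_closed add_hom_add[OF Z] add_hom_add[OF E_mult_hom(1)] add_hom_add[OF E_mult_hom(2)])
  show ?thesis
  proof (rule biadditive_eq_on_span[OF bi1 bi2 Aab Aab Eab A_spans A_spans _ assms])
    fix x y assume "x \<in> Aspan" "y \<in> Aspan"
    then obtain r r' p q m r2 r2' p' q' n where x: "x = cl r r' p q" "r \<in> carrier R" "r' \<in> carrier R" "p \<in> qpaths Q m" "q \<in> qpaths Q m"
      and y: "y = cl r2 r2' p' q'" "r2 \<in> carrier R" "r2' \<in> carrier R" "p' \<in> qpaths Q n" "q' \<in> qpaths Q n" by auto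
    show "Z (x \<otimes>\<^bsub>A\<^esub> y) = Z x \<otimes>\<^bsub>E\<^esub> Z y"
      unfolding x(1) y(1) cl_mult[OF x(2,3) y(2,3) x(4,5) y(4,5)] Zcl[OF x(2-5)] Zcl[OF y(2-5)] zeta_op_mult[OF x(2-5) y(2-5)]
      using add_hom_zero[OF Z Aab Eab] x y Zcl[of "r \<otimes> r2" "r2' \<otimes> r'" "qconcat p p'" "m + n" "qconcat q q'"]
      by (simp add: qconcat_in_qpaths)
  qed
qed

lemma eval_hom: "f \<in> carrier L \<Longrightarrow> x \<in> verts Q \<Longrightarrow> (\<lambda>\<psi>. \<psi> f x) \<in> add_hom E R"
  by (rule add_homI) (simp_all add: L_val E_lin E_at L_at)

lemma Z_s: "g \<in> carrier L \<Longrightarrow> f \<in> carrier L \<Longrightarrow> Z (s g) f = g \<otimes>\<^bsub>L\<^esub> f"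
  and Z_t: "g \<in> carrier L \<Longrightarrow> f \<in> carrier L \<Longrightarrow> Z (t g) f = f \<otimes>\<^bsub>L\<^esub> g"
proof -
  assume g: "g \<in> carrier L" and f: "f \<in> carrier L"
  have sum: "Z (\<Oplus>\<^bsub>A\<^esub>i\<in>VV. h i) f x = (\<Oplus>i\<in>VV. Z (h i) f x)" if h: "\<And>i. i \<in> VV \<Longrightarrow> h i \<in> carrier A" and x: "x \<in> verts Q" for x h
    by (rule add_hom_finsum[OF add_hom_compose[OF Z eval_hom[OF f x]] Aab Rab h])
  have in1: "cl (g (fst i)) \<one> (Triv (fst i)) (Triv (snd i)) \<in> carrier A" "cl \<one> (g (fst i)) (Triv (snd i)) (Triv (fst i)) \<in> carrier A"
    if "i \<in> VV" for i
    using that by (auto intro!: cl_in[OF _ _ Triv_in Triv_in] L_val[OF g])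
  have z1: "Z (cl (g (fst i)) \<one> (Triv (fst i)) (Triv (snd i))) f x = (if i = (x, x) then g x \<otimes> f x else \<zero>)"
    if "i \<in> VV" "x \<in> verts Q" for i x
  proof -
    have "Z (cl (g (fst i)) \<one> (Triv (fst i)) (Triv (snd i))) = zeta_op (g (fst i)) \<one> (Triv (fst i)) (Triv (snd i))"
      by (rule Zcl[OF _ _ Triv_in Triv_in]) (use that L_val[OF g] in auto)
    thus ?thesis using that f L_val[OF g] L_val[OF f] by (auto simp: zeta_op_at zeta_fun_at prod_eq_iff)
  qed
  have z2: "Z (cl \<one> (g (fst i)) (Triv (snd i)) (Triv (fst i))) f x = (if i = (x, x) then f x \<otimes> g x else \<zero>)"
    if "i \<in> VV" "x \<in> verts Q" for i x
  proof -
    have "Z (cl \<one> (g (fst i)) (Triv (snd i)) (Triv (fst i))) = zeta_op \<one> (g (fst i)) (Triv (snd i)) (Triv (fst i))"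
      by (rule Zcl[OF _ _ Triv_in Triv_in]) (use that L_val[OF g] in auto)
    thus ?thesis using that f L_val[OF g] L_val[OF f] by (auto simp: zeta_op_at zeta_fun_at prod_eq_iff)
  qed
  show "Z (s g) f = g \<otimes>\<^bsub>L\<^esub> f"
  proof (rule L_eqI)
    show "Z (s g) f \<in> carrier L" "g \<otimes>\<^bsub>L\<^esub> f \<in> carrier L" using g f by (simp_all add: E_lin Z_in s_in L_in)
    fix x assume x: "x \<in> verts Q"
    have "Z (s g) f x = (\<Oplus>i\<in>VV. Z (cl (g (fst i)) \<one> (Triv (fst i)) (Triv (snd i))) f x)"
      unfolding s_eq[OF g] by (rule sum[OF in1(1) x])
    also have "\<dots> = Z (cl (g (fst (x, x))) \<one> (Triv (fst (x, x))) (Triv (snd (x, x)))) f x"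
      by (rule R.finsum_single[OF finVV]) (use x z1 L_val[OF g x] L_val[OF f x] in \<open>simp_all del: fst_conv snd_conv\<close>)
    also have "\<dots> = (g \<otimes>\<^bsub>L\<^esub> f) x" using z1[of "(x, x)" x] x by (simp add: L_at(3))
    finally show "Z (s g) f x = (g \<otimes>\<^bsub>L\<^esub> f) x" .
  qed
  show "Z (t g) f = f \<otimes>\<^bsub>L\<^esub> g"
  proof (rule L_eqI)
    show "Z (t g) f \<in> carrier L" "f \<otimes>\<^bsub>L\<^esub> g \<in> carrier L" using g f by (simp_all add: E_lin Z_in t_in L_in)
    fix x assume x: "x \<in> verts Q"
    have "Z (t g) f x = (\<Oplus>i\<in>VV. Z (cl \<one> (g (fst i)) (Triv (snd i)) (Triv (fst i))) f x)"
      unfolding t_eq[OF g] by (rule sum[OF in1(2) x])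
    also have "\<dots> = Z (cl \<one> (g (fst (x, x))) (Triv (snd (x, x))) (Triv (fst (x, x)))) f x"
      by (rule R.finsum_single[OF finVV]) (use x z2 L_val[OF g x] L_val[OF f x] in \<open>simp_all del: fst_conv snd_conv\<close>)
    also have "\<dots> = (f \<otimes>\<^bsub>L\<^esub> g) x" using z2[of "(x, x)" x] x by (simp add: L_at(3))
    finally show "Z (t g) f x = (f \<otimes>\<^bsub>L\<^esub> g) x" .
  qed
qed

lemma Z_one: "Z \<one>\<^bsub>A\<^esub> = \<one>\<^bsub>E\<^esub>"
proof -
  interpret A: k_algebra K A by (rule A_algebra)
  interpret Lm: k_algebra K L by (rule L_algebra)
  have "s \<one>\<^bsub>L\<^esub> = \<one>\<^bsub>A\<^esub>" using s_hom by (simp add: algebra_hom_def ring_hom_def)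
  thus ?thesis using Z_s[OF L_in(1)]
    by (intro E_eqI) (simp_all add: Z_in E_closed E_at)
qed

lemma Z_smult: "k \<in> carrier K \<Longrightarrow> a \<in> carrier A \<Longrightarrow> Z (k \<odot>\<^bsub>A\<^esub> a) = k \<odot>\<^bsub>E\<^esub> Z a"
proof -
  interpret Lm: k_algebra K L by (rule L_algebra)
  assume k: "k \<in> carrier K" and a: "a \<in> carrier A"
  have sE: "smult E k \<in> add_hom E E"
    by (rule add_homI, simp add: E_closed k)
       (rule E_eqI, simp_all add: E_closed k E_at E_lin Lm.smult_r_distr)
  show ?thesis
  proof (rule A_eq_on_span[OF Eab add_hom_compose[OF smult_A_hom[OF k] Z] add_hom_compose[OF Z sE] _ a])
    fix r r' p q m assume b: "r \<in> carrier R" "r' \<in> carrier R" "p \<in> qpaths Q m" "q \<in> qpaths Q m"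
    have kr: "k \<odot> r \<in> carrier R" using k b by simp
    show "Z (k \<odot>\<^bsub>A\<^esub> cl r r' p q) = k \<odot>\<^bsub>E\<^esub> Z (cl r r' p q)"
      unfolding cl_smult[OF k b] Zcl[OF kr b(2-4)] Zcl[OF b] by (rule zeta_op_props(4)[OF k b])
  qed
qed

end

abbreviation "isZ \<equiv> is_zeta K R Q w"

lemma isZ_eq: "isZ \<zeta> \<longleftrightarrow> \<zeta> \<in> algebra_hom K A E \<inter> extensional (carrier A) \<and>
    (\<forall>m. \<forall>p\<in>qpaths Q m. \<forall>q\<in>qpaths Q m. \<forall>r\<in>carrier R. \<forall>r'\<in>carrier R. \<forall>f\<in>carrier L.
        \<zeta> (cl r r' p q) f = zeta_fun r r' p q f)"
  unfolding is_zeta_def Let_def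
  by (intro conj_cong refl all_cong ball_cong) (simp add: zeta_fun_eq)

lemma isZ_D:
  assumes "isZ \<zeta>"
  shows "\<zeta> \<in> add_hom A E" "\<lbrakk>r \<in> carrier R; r' \<in> carrier R; p \<in> qpaths Q m; q \<in> qpaths Q m\<rbrakk> \<Longrightarrow> \<zeta> (cl r r' p q) = zeta_op r r' p q"
proof -
  show 1: "\<zeta> \<in> add_hom A E" using assms by (auto simp: isZ_eq algebra_hom_def linear_hom_def add_hom_def)
  assume b: "r \<in> carrier R" "r' \<in> carrier R" "p \<in> qpaths Q m" "q \<in> qpaths Q m"
  show "\<zeta> (cl r r' p q) = zeta_op r r' p q"
  proof (rule E_eqI[OF add_hom_closed[OF 1 cl_in[OF b]] zeta_op_in[OF b]])
    fix f assume "f \<in> carrier L"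
    thus "\<zeta> (cl r r' p q) f = zeta_op r r' p q f" using assms b by (simp add: isZ_eq zeta_op_at)
  qed
qed

lemma zeta_ex1: "\<exists>!\<zeta>. isZ \<zeta>"
proof -
  interpret A: k_algebra K A by (rule A_algebra)
  obtain Z0 where Z0: "Z0 \<in> add_hom A E" and
    c: "\<And>m r r' p q. \<lbrakk>r \<in> carrier R; r' \<in> carrier R; p \<in> qpaths Q m; q \<in> qpaths Q m\<rbrakk> \<Longrightarrow> Z0 (cl r r' p q) = zeta_op r r' p q"
    using zeta_exists by auto
  have "restrict Z0 (carrier A) \<in> algebra_hom K A E"
    using Z_mult[OF Z0 c] Z_one[OF Z0 c] Z_smult[OF Z0 c] add_hom_add[OF Z0] add_hom_closed[OF Z0]
    by (simp add: algebra_hom_def ring_hom_def linear_hom_def)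
  moreover have "restrict Z0 (carrier A) (cl r r' p q) f = zeta_fun r r' p q f"
    if b: "r \<in> carrier R" "r' \<in> carrier R" "p \<in> qpaths Q m" "q \<in> qpaths Q m" and f: "f \<in> carrier L" for r r' p q m f
    using cl_in[OF b] c[OF b] f by (simp add: zeta_op_at)
  ultimately have "isZ (restrict Z0 (carrier A))" unfolding isZ_eq by simp
  moreover have "\<zeta> = \<zeta>'" if z: "isZ \<zeta>" "isZ \<zeta>'" for \<zeta> \<zeta>'
  proof (rule extensionalityI[of _ "carrier A"])
    show "\<zeta> x = \<zeta>' x" if x: "x \<in> carrier A" for x
      by (rule A_eq_on_span[OF Eab isZ_D(1)[OF z(1)] isZ_D(1)[OF z(2)] _ x]) (simp add: isZ_D(2)[OF z(1)] isZ_D(2)[OF z(2)])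
  qed (use z in \<open>auto simp: isZ_eq\<close>)
  ultimately show ?thesis by blast
qed

abbreviation "\<zeta> \<equiv> zeta_map K R Q w"

lemma zeta_isZ: "isZ \<zeta>"
  unfolding zeta_map_def by (rule theI'[OF zeta_ex1])

lemmas zeta_hom = isZ_D(1)[OF zeta_isZ] and zeta_cl = isZ_D(2)[OF zeta_isZ]

lemma zeta_props:
  "a \<in> carrier A \<Longrightarrow> \<zeta> a \<in> carrier E"
  "a \<in> carrier A \<Longrightarrow> b \<in> carrier A \<Longrightarrow> \<zeta> (a \<otimes>\<^bsub>A\<^esub> b) = \<zeta> a \<otimes>\<^bsub>E\<^esub> \<zeta> b"
  "\<zeta> \<one>\<^bsub>A\<^esub> = \<one>\<^bsub>E\<^esub>"
  "k \<in> carrier K \<Longrightarrow> a \<in> carrier A \<Longrightarrow> \<zeta> (k \<odot>\<^bsub>A\<^esub> a) = k \<odot>\<^bsub>E\<^esub> \<zeta> a"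
  "g \<in> carrier L \<Longrightarrow> f \<in> carrier L \<Longrightarrow> \<zeta> (s g) f = g \<otimes>\<^bsub>L\<^esub> f"
  "g \<in> carrier L \<Longrightarrow> f \<in> carrier L \<Longrightarrow> \<zeta> (t g) f = f \<otimes>\<^bsub>L\<^esub> g"
  using Z_in[OF zeta_hom zeta_cl] Z_mult[OF zeta_hom zeta_cl] Z_one[OF zeta_hom zeta_cl] Z_smult[OF zeta_hom zeta_cl]
    Z_s[OF zeta_hom zeta_cl] Z_t[OF zeta_hom zeta_cl] by simp_all

section \<open>The counit\<close>

abbreviation "\<pi>' \<equiv> counit_map K R Q w"

lemma pi_eq: "\<pi>' a = \<zeta> a \<one>\<^bsub>L\<^esub>" by (simp add: counit_map_def)

lemma pi_in: "a \<in> carrier A \<Longrightarrow> \<pi>' a \<in> carrier L"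
  by (simp add: pi_eq E_lin(1)[OF zeta_props(1)] L_in)

lemma pi_hom: "\<pi>' \<in> add_hom A L"
  by (rule add_homI) (simp_all add: pi_in, simp add: pi_eq add_hom_add[OF zeta_hom] E_at L_in)

lemma pi_smult: "k \<in> carrier K \<Longrightarrow> a \<in> carrier A \<Longrightarrow> \<pi>' (k \<odot>\<^bsub>A\<^esub> a) = k \<odot>\<^bsub>L\<^esub> \<pi>' a"
  by (simp add: pi_eq zeta_props(4) E_at L_in)

lemma pi_cl: "\<lbrakk>r \<in> carrier R; r' \<in> carrier R; p \<in> qpaths Q m; q \<in> qpaths Q m\<rbrakk> \<Longrightarrow> \<pi>' (cl r r' p q) = zeta_fun r r' p q \<one>\<^bsub>L\<^esub>"
  by (simp add: pi_eq zeta_cl zeta_op_at L_in)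

lemma pi_mult: "a \<in> carrier A \<Longrightarrow> b \<in> carrier A \<Longrightarrow> \<pi>' (a \<otimes>\<^bsub>A\<^esub> b) = \<zeta> a (\<pi>' b)"
  by (simp add: pi_eq zeta_props(2) E_at L_in)

lemma pi_s: "l \<in> carrier L \<Longrightarrow> a \<in> carrier A \<Longrightarrow> \<pi>' (s l \<otimes>\<^bsub>A\<^esub> a) = l \<otimes>\<^bsub>L\<^esub> \<pi>' a"
  and pi_t: "l \<in> carrier L \<Longrightarrow> a \<in> carrier A \<Longrightarrow> \<pi>' (t l \<otimes>\<^bsub>A\<^esub> a) = \<pi>' a \<otimes>\<^bsub>L\<^esub> l"
  by (simp_all add: pi_mult s_in t_in pi_in zeta_props(5,6))

lemma pi_bimodule_hom: "\<pi>' \<in> bimodule_hom K L MM (regular_bimodule L)"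
  using pi_hom by (simp add: bimodule_hom_def linear_hom_def add_hom_def pi_smult pi_s pi_t)

lemma pi_one: "\<pi>' \<one>\<^bsub>A\<^esub> = \<one>\<^bsub>L\<^esub>"
  by (simp add: pi_eq zeta_props(3) E_at L_in)

text \<open>By \<open>pi_mult\<close> the value at a product depends on the second factor only through its image under \<open>\<pi>\<close>,
  and \<open>\<pi> (s f) = f = \<pi> (t f)\<close>.\<close>

lemma pi_counit:
  assumes "a \<in> carrier A" "b \<in> carrier A"
  shows "\<pi>' (a \<otimes>\<^bsub>A\<^esub> s (\<pi>' b)) = \<pi>' (a \<otimes>\<^bsub>A\<^esub> b)" "\<pi>' (a \<otimes>\<^bsub>A\<^esub> t (\<pi>' b)) = \<pi>' (a \<otimes>\<^bsub>A\<^esub> b)"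
proof -
  interpret Lm: k_algebra K L by (rule L_algebra)
  have "\<pi>' (s (\<pi>' b)) = \<pi>' b" "\<pi>' (t (\<pi>' b)) = \<pi>' b"
    using pi_in[OF assms(2)] zeta_props(5)[OF pi_in[OF assms(2)] L_in(1)] zeta_props(6)[OF pi_in[OF assms(2)] L_in(1)]
    by (simp_all add: pi_eq[of "s _"] pi_eq[of "t _"])
  thus "\<pi>' (a \<otimes>\<^bsub>A\<^esub> s (\<pi>' b)) = \<pi>' (a \<otimes>\<^bsub>A\<^esub> b)" "\<pi>' (a \<otimes>\<^bsub>A\<^esub> t (\<pi>' b)) = \<pi>' (a \<otimes>\<^bsub>A\<^esub> b)"
    using assms by (simp_all add: pi_mult s_in t_in pi_in)
qed

abbreviation "RB \<equiv> regular_bimodule L"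

lemma TPl: "tensor_pair L RB MM" and TPr: "tensor_pair L MM RB"
proof -
  interpret Lm: k_algebra K L by (rule L_algebra)
  have "abelian_group RB" by (rule abelian_group_cong[OF Lab]) simp_all
  thus "tensor_pair L RB MM" "tensor_pair L MM RB"
    using bimodule_abelian[OF MM_bimodule]
    by (auto intro!: tensor_pair.intro simp: s_in t_in A_mult_in)
qed

lemma MMab: "abelian_group MM" by (rule bimodule_abelian[OF MM_bimodule])

lemma
  shows lu_hom: "left_unitor MM \<in> add_hom (bimodule_tensor L RB MM) MM"
    and lu_tens: "l \<in> carrier L \<Longrightarrow> a \<in> carrier A \<Longrightarrow> left_unitor MM (tens L RB MM l a) = s l \<otimes>\<^bsub>A\<^esub> a"
    and ru_hom: "right_unitor MM \<in> add_hom (bimodule_tensor L MM RB) MM"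
    and ru_tens: "l \<in> carrier L \<Longrightarrow> a \<in> carrier A \<Longrightarrow> right_unitor MM (tens L MM RB a l) = t l \<otimes>\<^bsub>A\<^esub> a"
proof -
  interpret B: bimodule K L MM by (rule MM_bimodule)
  have b1: "balanced L RB MM MM (lact MM)"
    by (rule balancedI; unfold regular_bimodule_simps)
       (fact B.lact_closed B.lact_add_left B.lact_add_right | rule B.lact_lact, assumption+)+
  have b2: "balanced L MM RB MM (ract MM)"
    by (rule balancedI; unfold regular_bimodule_simps)
       (fact B.ract_closed B.ract_add_left B.ract_add_right | rule B.ract_ract[symmetric], assumption+)+
  show "left_unitor MM \<in> add_hom (bimodule_tensor L RB MM) MM"
    unfolding left_unitor_def by (rule tensor_pair.tensor_lift_hom[OF TPl MMab b1])
  show "l \<in> carrier L \<Longrightarrow> a \<in> carrier A \<Longrightarrow> left_unitor MM (tens L RB MM l a) = s l \<otimes>\<^bsub>A\<^esub> a"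
    unfolding left_unitor_def using tensor_pair.tensor_lift_tens[OF TPl MMab b1, of l a] by simp
  show "right_unitor MM \<in> add_hom (bimodule_tensor L MM RB) MM"
    unfolding right_unitor_def by (rule tensor_pair.tensor_lift_hom[OF TPr MMab b2])
  show "l \<in> carrier L \<Longrightarrow> a \<in> carrier A \<Longrightarrow> right_unitor MM (tens L MM RB a l) = t l \<otimes>\<^bsub>A\<^esub> a"
    unfolding right_unitor_def using tensor_pair.tensor_lift_tens[OF TPr MMab b2, of a l] by simp
qed

lemma zero_act:
  assumes "a \<in> carrier A" shows "s \<zero>\<^bsub>L\<^esub> \<otimes>\<^bsub>A\<^esub> a = \<zero>\<^bsub>A\<^esub>" "t \<zero>\<^bsub>L\<^esub> \<otimes>\<^bsub>A\<^esub> a = \<zero>\<^bsub>A\<^esub>"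
proof -
  interpret A: k_algebra K A by (rule A_algebra)
  have "s \<in> add_hom L A" "t \<in> add_hom L A"
    using s_hom t_hom by (simp_all add: algebra_hom_def linear_hom_def add_hom_def)
  thus "s \<zero>\<^bsub>L\<^esub> \<otimes>\<^bsub>A\<^esub> a = \<zero>\<^bsub>A\<^esub>" "t \<zero>\<^bsub>L\<^esub> \<otimes>\<^bsub>A\<^esub> a = \<zero>\<^bsub>A\<^esub>"
    using assms by (simp_all add: add_hom_zero[OF _ Lab Aab])
qed

lemma zeta_fun_ne: "p \<noteq> q \<Longrightarrow> zeta_fun r r' p q f = \<zero>\<^bsub>L\<^esub>"
  by (simp add: zeta_fun_def L_simps(4))

text \<open>As \<open>\<pi> (e\<^sup>p\<^sub>u)\<close> is zero for \<open>u \<noteq> p\<close>, one summand of \<open>\<Delta>\<close> is left; \<open>\<pi>\<close> takes the scalar off one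
  factor and \<open>s\<close> or \<open>t\<close> puts it on the other.\<close>

lemma
  assumes a: "a \<in> carrier A"
  shows D_counit_left: "left_unitor MM (tensor_map L RB MM \<pi>' id (D a)) = a"
    and D_counit_right: "right_unitor MM (tensor_map L MM RB id \<pi>' (D a)) = a"
proof -
  interpret A: k_algebra K A by (rule A_algebra)
  have pMM: "\<pi>' \<in> add_hom MM RB" using pi_hom by (simp add: add_hom_def)
  have mid1: "tens L RB MM (\<pi>' (ract MM x l)) (id y) = tens L RB MM (\<pi>' x) (id (lact MM l y))"
    if "x \<in> carrier MM" "l \<in> carrier L" "y \<in> carrier MM" for x l y
    using tensor_pair.tens_middle[OF TPl, of "\<pi>' x" l y] that by (simp add: pi_t pi_in)
  have mid2: "tens L MM RB (id (ract MM x l)) (\<pi>' y) = tens L MM RB (id x) (\<pi>' (lact MM l y))"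
    if "x \<in> carrier MM" "l \<in> carrier L" "y \<in> carrier MM" for x l y
    using tensor_pair.tens_middle[OF TPr, of x l "\<pi>' y"] that by (simp add: pi_s pi_in)
  have m1: "tensor_map L RB MM \<pi>' id \<in> add_hom TT (bimodule_tensor L RB MM)"
    "\<And>x y. x \<in> carrier MM \<Longrightarrow> y \<in> carrier MM \<Longrightarrow> tensor_map L RB MM \<pi>' id (tt x y) = tens L RB MM (\<pi>' x) (id y)"
    by (rule tensor_map_hom[OF TP TPl pMM id_add_hom(1)], erule (2) mid1)
       (rule tensor_map_tens[OF TP TPl pMM id_add_hom(1)], erule (2) mid1, assumption+)
  have m2: "tensor_map L MM RB id \<pi>' \<in> add_hom TT (bimodule_tensor L MM RB)"
    "\<And>x y. x \<in> carrier MM \<Longrightarrow> y \<in> carrier MM \<Longrightarrow> tensor_map L MM RB id \<pi>' (tt x y) = tens L MM RB (id x) (\<pi>' y)"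
    by (rule tensor_map_hom[OF TP TPr id_add_hom(1) pMM], erule (2) mid2)
       (rule tensor_map_tens[OF TP TPr id_add_hom(1) pMM], erule (2) mid2, assumption+)
  have hMA: "add_hom TT MM = add_hom TT A" by (rule add_hom_target_cong) simp_all
  note lh = add_hom_compose[OF m1(1) lu_hom, unfolded hMA]
  note rh = add_hom_compose[OF m2(1) ru_hom, unfolded hMA]
  show "left_unitor MM (tensor_map L RB MM \<pi>' id (D a)) = a"
  proof (rule A_eq_on_span[OF Aab add_hom_compose[OF D_hom lh] id_add_hom(2) _ a])
    fix r r' p q m assume b: "r \<in> carrier R" "r' \<in> carrier R" "p \<in> qpaths Q m" "q \<in> qpaths Q m"
    let ?g = "\<lambda>u. s (\<pi>' (cl r \<one> p u)) \<otimes>\<^bsub>A\<^esub> cl \<one> r' u q"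
    have g: "?g u = (if u = p then cl r r' p q else \<zero>\<^bsub>A\<^esub>)" if u: "u \<in> qpaths Q m" for u
    proof (cases "u = p")
      case True
      have z: "zeta_fun r \<one> p p \<one>\<^bsub>L\<^esub> (qsource Q p) = r"
        using b qsource_in[OF wfQ b(3)] qtarget_in[OF wfQ b(3)] by (simp add: zeta_fun_at L_at(1))
      show ?thesis
        using s_left[OF zeta_fun_in[OF b(1) R.one_closed b(3,3) L_in(1)] R.one_closed b(2-4)] z b True
        by (simp add: pi_cl[OF b(1) R.one_closed b(3,3)])
    next
      case False
      thus ?thesis using comult_factors_in(2)[OF b u] by (simp add: pi_cl[OF b(1) R.one_closed b(3) u] zeta_fun_ne zero_act)
    qed
    have "left_unitor MM (tensor_map L RB MM \<pi>' id (D (cl r r' p q))) = (\<Oplus>\<^bsub>A\<^esub>u\<in>qpaths Q m. ?g u)"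
      by (rule finsum_comult_val[OF Aab lh b]) (simp add: m1(2) comult_factors_in[OF b] lu_tens pi_in)
    also have "\<dots> = ?g p"
      by (rule A.finsum_single[OF finq b(3)]) (use g b cl_in[OF b] in simp_all)
    finally show "left_unitor MM (tensor_map L RB MM \<pi>' id (D (cl r r' p q))) = cl r r' p q" using g[OF b(3)] by simp
  qed
  show "right_unitor MM (tensor_map L MM RB id \<pi>' (D a)) = a"
  proof (rule A_eq_on_span[OF Aab add_hom_compose[OF D_hom rh] id_add_hom(2) _ a])
    fix r r' p q m assume b: "r \<in> carrier R" "r' \<in> carrier R" "p \<in> qpaths Q m" "q \<in> qpaths Q m"
    let ?g = "\<lambda>u. t (\<pi>' (cl \<one> r' u q)) \<otimes>\<^bsub>A\<^esub> cl r \<one> p u"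
    have g: "?g u = (if u = q then cl r r' p q else \<zero>\<^bsub>A\<^esub>)" if u: "u \<in> qpaths Q m" for u
    proof (cases "u = q")
      case True
      have z: "zeta_fun \<one> r' q q \<one>\<^bsub>L\<^esub> (qsource Q q) = r'"
        using b qsource_in[OF wfQ b(4)] qtarget_in[OF wfQ b(4)] by (simp add: zeta_fun_at L_at(1))
      show ?thesis
        using t_left[OF zeta_fun_in[OF R.one_closed b(2) b(4,4) L_in(1)] b(1) R.one_closed b(3,4)] z b True
        by (simp add: pi_cl[OF R.one_closed b(2) b(4,4)])
    next
      case False
      thus ?thesis using comult_factors_in(1)[OF b u] by (simp add: pi_cl[OF R.one_closed b(2) u b(4)] zeta_fun_ne zero_act)
    qed
    have "right_unitor MM (tensor_map L MM RB id \<pi>' (D (cl r r' p q))) = (\<Oplus>\<^bsub>A\<^esub>u\<in>qpaths Q m. ?g u)"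
      by (rule finsum_comult_val[OF Aab rh b]) (simp add: m2(2) comult_factors_in[OF b] ru_tens pi_in)
    also have "\<dots> = ?g q"
      by (rule A.finsum_single[OF finq b(4)]) (use g b cl_in[OF b] in simp_all)
    finally show "right_unitor MM (tensor_map L MM RB id \<pi>' (D (cl r r' p q))) = cl r r' p q" using g[OF b(4)] by simp
  qed
qed

section \<open>The left bialgebroid\<close>

lemma Aw_bialgebroid: "left_bialgebroid K A L s t D \<pi>'"
proof (rule left_bialgebroid.intro; (unfold MM_eq[symmetric])?)
  show "bimodule_comonoid K L MM D \<pi>'"
    by (intro bimodule_comonoid.intro MM_bimodule bimodule_comonoid_axioms.intro)
       (simp_all add: D_bimodule_hom pi_bimodule_hom D_coassoc D_counit_left D_counit_right)
qed (simp_all add: A_algebra L_algebra s_hom t_hom s_t_commute D_takeuchi D_one D_mult pi_one pi_counit)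

end

theorem theorem3p6:
  fixes K :: "'k ring" and R :: "('k, 'r) module" and Q :: "('l, 'q) pre_digraph"
    and w :: "'q \<Rightarrow> 'q \<Rightarrow> 'q \<Rightarrow> 'q \<Rightarrow> 'r"
  assumes "field K"
    and "k_algebra K R"
    and "fin_digraph Q" and "verts Q \<noteq> {}"
    and "\<And>a b c d. \<lbrakk>(a, b) \<in> arrow_pairs Q; (c, d) \<in> arrow_pairs Q\<rbrakk> \<Longrightarrow> w a b c d \<in> carrier R"
    and "\<And>a b c d. \<lbrakk>(a, b) \<in> arrow_pairs Q; (c, d) \<in> arrow_pairs Q\<rbrakk>
           \<Longrightarrow> w a b c d \<in> algebra_center R"
    and "\<And>a b c d. \<lbrakk>(a, b) \<in> arrow_pairs Q; (c, d) \<in> arrow_pairs Q;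
             tail Q a \<noteq> tail Q c \<or> head Q b \<noteq> head Q d\<rbrakk>
           \<Longrightarrow> w a b c d = \<zero>\<^bsub>R\<^esub>"
  shows "(\<exists>!\<Delta>. is_comult K R Q w \<Delta>) \<and>
    (\<exists>!\<zeta>. is_zeta K R Q w \<zeta>) \<and>
    left_bialgebroid K (Aw K R Q w) (M_alg R Q)
      (source_map K R Q w) (target_map K R Q w) (comult_map K R Q w) (counit_map K R Q w)"
proof -
  interpret central_weighted_quiver K R Q w
    by (intro central_weighted_quiver.intro weighted_quiver.intro central_weighted_quiver_axioms.intro assms)
  show ?thesis using comult_ex1 zeta_ex1 Aw_bialgebroid by blast
qed

end
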